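(* Let $M$ be a Hausdorff manifold and let $C$ be a coalgebra over $\mathcal{C}^{\infty}_{c}(M)$. The following conditions are equivalent: (i) The coalgebra $C$ is isomorphic to the sheaf coalgebra $\mathcal{C}^{\infty}_{c}(E)$ of a sheaf $E$ on $M$. (ii) The homomorphism of coalgebras $\Psi_{C}:\mathcal{C}^{\infty}_{c}(\mathcal{E}_{sp}(C))\to C$ is an isomorphism. (iii) The weakly grouplike elements of $C$ normally generate $C$ and are normally linearly independent. (iv) For any $x\in M$, the $(\mathcal{C}^{\infty}_{M})_{x}$-module $C_{x}$ is freely generated by the grouplike elements of $C_{x}$. Moreover, if the coalgebra $C$ is isomorphic to the sheaf coalgebra $\mathcal{C}^{\infty}_{c}(E)$ of a sheaf $E$ on $M$, then the sheaf $E$ is isomorphic to the spectral sheaf $\mathcal{E}_{sp}(C)$ of $C$.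
   Context: All manifolds and maps are smooth; $\mathbb{F}\in\{\mathbb{R},\mathbb{C}\}$ is fixed; $M$ is a Hausdorff manifold; $R=\mathcal{C}^{\infty}_{c}(M)$ is the ring of $\mathbb{F}$-valued smooth functions with compact support; "$f_{x}=1$" means that the germ of $f$ at $x$ is that of the constant $1$. Coalgebras. A left $R$-module $C$ is locally unitary if for all $c_{1},\dots,c_{k}\in C$ there is $r\in R$ with $rc_{i}=c_{i}$ for all $i$. A coalgebra over $R$ is a locally unitary $R$-module $C$ with $R$-linear maps $\Delta:C\to C\otimes_{R}C$ and $\epsilon:C\to R$ with $(\mathrm{id}\otimes\epsilon)\circ\Delta=\mathrm{id}=(\epsilon\otimes\mathrm{id})\circ\Delta$ (coassociativity and cocommutativity are not assumed). Homomorphisms are $R$-linear maps $\alpha$ with $(\alpha\otimes\alpha)\circ\Delta=\Delta\circ\alpha$, $\epsilon\circ\alpha=\epsilon$. An element $c$ is weakly grouplike if $\Delta(c)=c\otimes c'$ for some $c'\in C$. Sheaves. A sheaf on $M$ is a local diffeomorphism $\pi:E\to M$ with $E$ a manifold, not necessarily Hausdorff (no second countability required); morphisms are smooth maps over $M$. An open $U\subset E$ is $\pi$-elementary if $\pi|_{U}$ is injective. With $\mathcal{C}^{\infty}_{E}$ the sheaf of germs of smooth $\mathbb{F}$-valued functions, $\mathcal{C}^{\infty}_{c}(E)$ is the subspace of the space of all (not necessarily continuous) global sections of $\mathcal{C}^{\infty}_{E}$ spanned by the extensions by zero of functions in $\mathcal{C}^{\infty}_{c}(U)$, $U\subset E$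 Hausdorff open; it consists of sums of elements $f\circ\pi|_{U}$ (extended by zero), $U$ $\pi$-elementary, $f\in\mathcal{C}^{\infty}_{c}(\pi(U))$. Module structure: $p(f\circ\pi|_{U})=pf\circ\pi|_{U}$. Coalgebra structure: $\Delta(f\circ\pi|_{U})=(f\circ\pi|_{U})\otimes(\eta\circ\pi|_{U})$ for any $\eta\in\mathcal{C}^{\infty}_{c}(\pi(U))$ with $\eta f=f$, and $\epsilon(f\circ\pi|_{U})=f$. Spectral sheaf. For a coalgebra $C$ over $R$ and $x\in M$, put $N_{x}(C)=\{c\in C: fc=0$ for some $f\in\mathcal{C}^{\infty}_{c}(M)$ with $f_{x}=1\}$, $C_{x}=C/N_{x}(C)$, $c_{x}=c+N_{x}(C)$. With the induced maps $\Delta_{x},\epsilon_{x}$ (using $(C\otimes_{R}C)_{x}=C_{x}\otimes_{R_{x}}C_{x}$) $C_{x}$ is a coalgebra over the ring of germs $R_{x}=(\mathcal{C}^{\infty}_{M})_{x}$; its grouplike elements are $G(C_{x})=\{\zeta:\Delta_{x}(\zeta)=\zeta\otimes\zeta,\ \epsilon_{x}(\zeta)=1\}$. $c$ is normalized at $x$ if $\epsilon(c)_{x}=1$, and on $W\subset M$ if normalized at each point of $W$. $\mathcal{E}_{sp}(C)$ is the sheaf $\pi_{sp}(C):\mathcal{E}_{sp}(C)\to M$ with stalks $G(C_{x})$ and topology with basis the sets $c_{W}=\{c_{x}:x\in W\}$, $W\subset M$ open, $c$ weakly grouplike and normalized on $W$ (each projecting diffeomorphically to $W$). $\Psi_{C}$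 is the well-defined homomorphism with $\Psi_{C}(\sum_{i}f_{i}\circ\pi_{sp}(C)|_{(c_{i})_{W_{i}}})=\sum_{i}f_{i}c_{i}$ for $c_{i}$ weakly grouplike normalized on open $W_{i}$ and $f_{i}\in\mathcal{C}^{\infty}_{c}(W_{i})$. A subset $\Lambda\subset C$ normally generates $C$ if every $c\in C$ is a sum $\sum_{i=1}^{k}f_{i}c_{i}$ with $f_{i}\in\mathcal{C}^{\infty}_{c}(M)$, $c_{i}\in\Lambda$ and $c_{i}$ normalized on $\mathrm{supp}(f_{i})$. It is normally linearly independent if for every $x\in M$, all $c_{1},\dots,c_{k}\in\Lambda$ normalized at $x$ and all $f_{1},\dots,f_{k}\in\mathcal{C}^{\infty}_{c}(M)$ with $\sum_{i}f_{i}c_{i}=0$, either $(f_{i})_{x}=0$ for all $i$, or there are distinct $i,j$ and $f\in\mathcal{C}^{\infty}_{c}(M)$ with $f_{x}=1$ and $fc_{i}=fc_{j}$. *)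

theory Defs
  imports
    "HOL-Analysis.Abstract_Euclidean_Space"
    "HOL-Analysis.Derivative"
    "HOL-Algebra.Free_Abelian_Groups"
    "HOL-Algebra.AbelCoset"
    "HOL-Algebra.Module"
begin

section \<open>Smooth manifolds\<close>

text \<open>
  The dimension is a natural number, with \<open>0\<close> allowed, so the model space is
  \<^const>\<open>Euclidean_space\<close>, whose points are the sequences vanishing from index \<open>n\<close> on.
  A function is \<open>C\<^sup>k\<close> on an open set if its partial derivatives of order at most \<open>k\<close> exist and
  are continuous. As \<open>V\<close> is open, the partial derivatives at a point of \<open>V\<close> do not depend on the
  values outside \<open>V\<close>.
\<close>

fun Ck_on :: "nat \<Rightarrow> nat \<Rightarrow> (nat \<Rightarrow> real) set \<Rightarrow> ((nat \<Rightarrow> real) \<Rightarrow> 'f::real_normed_vector) \<Rightarrow> bool"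
  where
    "Ck_on 0 n V f \<longleftrightarrow> continuous_map (subtopology (Euclidean_space n) V) euclidean f"
  | "Ck_on (Suc k) n V f \<longleftrightarrow>
       continuous_map (subtopology (Euclidean_space n) V) euclidean f \<and>
       (\<forall>i<n. (\<forall>x\<in>V. (\<lambda>t. f (x(i := t))) differentiable at (x i)) \<and>
              Ck_on k n V (\<lambda>x. vector_derivative (\<lambda>t. f (x(i := t))) (at (x i))))"

definition smooth_Rn :: "nat \<Rightarrow> (nat \<Rightarrow> real) set \<Rightarrow> ((nat \<Rightarrow> real) \<Rightarrow> 'f::real_normed_vector) \<Rightarrow> bool"
  where "smooth_Rn n V f \<longleftrightarrow> openin (Euclidean_space n) V \<and> (\<forall>k. Ck_on k n V f)"

text \<open>
  A chart is a pair of an open domain and a coordinate map. The atlas need not be maximal. Neither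
  the Hausdorff property nor second countability is part of the notion of a manifold.
\<close>

record 'a manifold =
  mdim :: nat
  mtop :: "'a topology"
  atlas :: "('a set \<times> ('a \<Rightarrow> nat \<Rightarrow> real)) set"

definition is_manifold :: "'a manifold \<Rightarrow> bool" where
  "is_manifold X \<longleftrightarrow>
     (\<forall>(U, \<phi>) \<in> atlas X.
        openin (mtop X) U \<and> openin (Euclidean_space (mdim X)) (\<phi> ` U) \<and>
        homeomorphic_map (subtopology (mtop X) U)
          (subtopology (Euclidean_space (mdim X)) (\<phi> ` U)) \<phi>) \<and>
     (\<Union>(U, \<phi>) \<in> atlas X. U) = topspace (mtop X) \<and>
     (\<forall>(U, \<phi>) \<in> atlas X. \<forall>(V, \<psi>) \<in> atlas X. \<forall>i < mdim X.
        smooth_Rn (mdim X) (\<phi> ` (U \<inter> V)) (\<lambda>z. \<psi> (inv_into U \<phi> z) i))"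

definition smooth_on :: "'a manifold \<Rightarrow> 'a set \<Rightarrow> ('a \<Rightarrow> 'f::real_normed_field) \<Rightarrow> bool" where
  "smooth_on X U f \<longleftrightarrow> openin (mtop X) U \<and>
     (\<forall>(V, \<phi>) \<in> atlas X. smooth_Rn (mdim X) (\<phi> ` (U \<inter> V)) (\<lambda>z. f (inv_into V \<phi> z)))"

definition smooth_map_on :: "'a manifold \<Rightarrow> 'a set \<Rightarrow> 'b manifold \<Rightarrow> ('a \<Rightarrow> 'b) \<Rightarrow> bool" where
  "smooth_map_on X U Y g \<longleftrightarrow> openin (mtop X) U \<and>
     continuous_map (subtopology (mtop X) U) (mtop Y) g \<and>
     (\<forall>(V, \<phi>) \<in> atlas X. \<forall>(W, \<psi>) \<in> atlas Y. \<forall>i < mdim Y.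
        smooth_Rn (mdim X) (\<phi> ` (U \<inter> V \<inter> g -` W)) (\<lambda>z. \<psi> (g (inv_into V \<phi> z)) i))"

definition local_diffeo :: "'a manifold \<Rightarrow> 'b manifold \<Rightarrow> ('a \<Rightarrow> 'b) \<Rightarrow> bool" where
  "local_diffeo X Y g \<longleftrightarrow>
     smooth_map_on X (topspace (mtop X)) Y g \<and>
     (\<forall>x \<in> topspace (mtop X). \<exists>U. openin (mtop X) U \<and> x \<in> U \<and> openin (mtop Y) (g ` U) \<and>
        inj_on g U \<and> smooth_map_on Y (g ` U) X (inv_into U g))"

definition is_sheaf :: "'m manifold \<Rightarrow> 'e manifold \<Rightarrow> ('e \<Rightarrow> 'm) \<Rightarrow> bool" where
  "is_sheaf M E \<pi> \<longleftrightarrow> is_manifold E \<and> local_diffeo E M \<pi>"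

definition sheaf_morphism ::
  "'e manifold \<Rightarrow> ('e \<Rightarrow> 'm) \<Rightarrow> 'd manifold \<Rightarrow> ('d \<Rightarrow> 'm) \<Rightarrow> ('e \<Rightarrow> 'd) \<Rightarrow> bool" where
  "sheaf_morphism E \<pi> D \<rho> g \<longleftrightarrow> smooth_map_on E (topspace (mtop E)) D g \<and>
     (\<forall>e \<in> topspace (mtop E). \<rho> (g e) = \<pi> e)"

definition sheaf_isomorphic ::
  "'e manifold \<Rightarrow> ('e \<Rightarrow> 'm) \<Rightarrow> 'd manifold \<Rightarrow> ('d \<Rightarrow> 'm) \<Rightarrow> bool" where
  "sheaf_isomorphic E \<pi> D \<rho> \<longleftrightarrow>
     (\<exists>g h. sheaf_morphism E \<pi> D \<rho> g \<and> sheaf_morphism D \<rho> E \<pi> h \<and>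
        (\<forall>e \<in> topspace (mtop E). h (g e) = e) \<and> (\<forall>d \<in> topspace (mtop D). g (h d) = d))"

section \<open>Functions with compact support and germs\<close>

text \<open>
  The field of scalars is a type \<open>'f\<close> of class \<^class>\<open>real_normed_field\<close>; up to isomorphism the
  only instances are \<open>real\<close> and \<open>complex\<close> (Gelfand-Mazur).

  An element of \<open>C\<^sub>c\<^sup>\<infinity>(U)\<close> is represented by its extension by zero to the whole type. The closure in
  the support is relative to \<open>U\<close>, which matters if \<open>X\<close> is not Hausdorff.
\<close>

definition Cc :: "'a manifold \<Rightarrow> 'a set \<Rightarrow> ('a \<Rightarrow> 'f::real_normed_field) set" where
  "Cc X U = {f. smooth_on X U f \<and> (\<forall>x. x \<notin> U \<longrightarrow> f x = 0) \<and>
     compactin (mtop X) (subtopology (mtop X) U closure_of {x \<in> U. f x \<noteq> 0})}"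

definition supp :: "'a manifold \<Rightarrow> ('a \<Rightarrow> 'f::real_normed_field) \<Rightarrow> 'a set" where
  "supp X f = mtop X closure_of {x \<in> topspace (mtop X). f x \<noteq> 0}"

text \<open>
  The ring \<open>C\<^sub>c\<^sup>\<infinity>(M)\<close>. It has an identity only if \<open>M\<close> is compact; the field \<open>one\<close> of the record
  is not used otherwise, and need not lie in the carrier.
\<close>

definition Cc_ring :: "'a manifold \<Rightarrow> ('a \<Rightarrow> 'f::real_normed_field) ring" where
  "Cc_ring X = \<lparr>carrier = Cc X (topspace (mtop X)),
     monoid.mult = (\<lambda>f g x. f x * g x),
     one = (\<lambda>x. if x \<in> topspace (mtop X) then 1 else 0),
     zero = (\<lambda>x. 0), add = (\<lambda>f g x. f x + g x)\<rparr>"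

text \<open>
  The germ at \<open>x\<close> is the class of all functions agreeing with \<open>f\<close> near \<open>x\<close>; it is empty if \<open>x\<close> is
  not a point of the manifold.
\<close>

definition germ :: "'a manifold \<Rightarrow> 'a \<Rightarrow> ('a \<Rightarrow> 'f) \<Rightarrow> ('a \<Rightarrow> 'f) set" where
  "germ X x f = {g. \<exists>U. openin (mtop X) U \<and> x \<in> U \<and> (\<forall>y\<in>U. g y = f y)}"

definition germ_op ::
  "'a manifold \<Rightarrow> 'a \<Rightarrow> ('f \<Rightarrow> 'f \<Rightarrow> 'f) \<Rightarrow> ('a \<Rightarrow> 'f) set \<Rightarrow> ('a \<Rightarrow> 'f) set \<Rightarrow> ('a \<Rightarrow> 'f) set" where
  "germ_op X x h A B = (\<Union>f\<in>A. \<Union>g\<in>B. germ X x (\<lambda>y. h (f y) (g y)))"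

definition germ_ring :: "'a manifold \<Rightarrow> 'a \<Rightarrow> ('a \<Rightarrow> 'f::real_normed_field) set ring" where
  "germ_ring X x = \<lparr>carrier = {germ X x f | f U. x \<in> U \<and> smooth_on X U f},
     monoid.mult = germ_op X x (*), one = germ X x (\<lambda>_. 1),
     zero = germ X x (\<lambda>_. 0), add = germ_op X x (+)\<rparr>"

section \<open>Modules and tensor products over rings without identity\<close>

text \<open>
  The locale \<^locale>\<open>module\<close> requires the ring to have an identity, so only its record type is
  reused. The fields \<open>mult\<close> and \<open>one\<close> of a module play no role.
\<close>

definition rmodule :: "('r, 'z) ring_scheme \<Rightarrow> ('r, 'c, 'y) module_scheme \<Rightarrow> bool" where
  "rmodule R A \<longleftrightarrow> abelian_group A \<and>
     (\<forall>r \<in> carrier R. \<forall>a \<in> carrier A. r \<odot>\<^bsub>A\<^esub> a \<in> carrier A) \<and>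
     (\<forall>r \<in> carrier R. \<forall>s \<in> carrier R. \<forall>a \<in> carrier A.
        (r \<oplus>\<^bsub>R\<^esub> s) \<odot>\<^bsub>A\<^esub> a = r \<odot>\<^bsub>A\<^esub> a \<oplus>\<^bsub>A\<^esub> s \<odot>\<^bsub>A\<^esub> a) \<and>
     (\<forall>r \<in> carrier R. \<forall>a \<in> carrier A. \<forall>b \<in> carrier A.
        r \<odot>\<^bsub>A\<^esub> (a \<oplus>\<^bsub>A\<^esub> b) = r \<odot>\<^bsub>A\<^esub> a \<oplus>\<^bsub>A\<^esub> r \<odot>\<^bsub>A\<^esub> b) \<and>
     (\<forall>r \<in> carrier R. \<forall>s \<in> carrier R. \<forall>a \<in> carrier A.
        (r \<otimes>\<^bsub>R\<^esub> s) \<odot>\<^bsub>A\<^esub> a = r \<odot>\<^bsub>A\<^esub> (s \<odot>\<^bsub>A\<^esub> a))"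

definition locally_unitary :: "('r, 'z) ring_scheme \<Rightarrow> ('r, 'c, 'y) module_scheme \<Rightarrow> bool" where
  "locally_unitary R A \<longleftrightarrow>
     (\<forall>S. finite S \<and> S \<subseteq> carrier A \<longrightarrow> (\<exists>r \<in> carrier R. \<forall>a \<in> S. r \<odot>\<^bsub>A\<^esub> a = a))"

definition rlinear ::
  "('r, 'z) ring_scheme \<Rightarrow> ('r, 'a, 'x) module_scheme \<Rightarrow> ('r, 'b, 'y) module_scheme \<Rightarrow> ('a \<Rightarrow> 'b) \<Rightarrow> bool"
  where
  "rlinear R A B h \<longleftrightarrow> h \<in> carrier A \<rightarrow> carrier B \<and>
     (\<forall>a \<in> carrier A. \<forall>a' \<in> carrier A. h (a \<oplus>\<^bsub>A\<^esub> a') = h a \<oplus>\<^bsub>B\<^esub> h a') \<and>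
     (\<forall>r \<in> carrier R. \<forall>a \<in> carrier A. h (r \<odot>\<^bsub>A\<^esub> a) = r \<odot>\<^bsub>B\<^esub> h a)"

definition regular_module :: "('r, 'z) ring_scheme \<Rightarrow> ('r, 'r) module" where
  "regular_module R = \<lparr>carrier = carrier R, monoid.mult = monoid.mult R, one = one R,
     zero = zero R, add = add R, smult = monoid.mult R\<rparr>"

text \<open>
  The tensor product over \<open>R\<close> is the quotient of the free abelian group on pairs by the subgroup
  expressing biadditivity and \<open>R\<close>-balancedness; its elements are cosets.
\<close>

definition tensor_rels ::
  "('r, 'z) ring_scheme \<Rightarrow> ('r, 'a, 'x) module_scheme \<Rightarrow> ('r, 'b, 'y) module_scheme \<Rightarrow> ('a \<times> 'b \<Rightarrow>\<^sub>0 int) set"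
  where
  "tensor_rels R A B = generate (free_Abelian_group (carrier A \<times> carrier B))
     ({frag_of (a \<oplus>\<^bsub>A\<^esub> a', b) - frag_of (a, b) - frag_of (a', b) | a a' b.
         a \<in> carrier A \<and> a' \<in> carrier A \<and> b \<in> carrier B} \<union>
      {frag_of (a, b \<oplus>\<^bsub>B\<^esub> b') - frag_of (a, b) - frag_of (a, b') | a b b'.
         a \<in> carrier A \<and> b \<in> carrier B \<and> b' \<in> carrier B} \<union>
      {frag_of (r \<odot>\<^bsub>A\<^esub> a, b) - frag_of (a, r \<odot>\<^bsub>B\<^esub> b) | r a b.
         r \<in> carrier R \<and> a \<in> carrier A \<and> b \<in> carrier B})"

definition tensor_group ::
  "('r, 'z) ring_scheme \<Rightarrow> ('r, 'a, 'x) module_scheme \<Rightarrow> ('r, 'b, 'y) module_scheme \<Rightarrow> ('a \<times> 'b \<Rightarrow>\<^sub>0 int) set monoid"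
  where
  "tensor_group R A B = free_Abelian_group (carrier A \<times> carrier B) Mod tensor_rels R A B"

definition tens ::
  "('r, 'z) ring_scheme \<Rightarrow> ('r, 'a, 'x) module_scheme \<Rightarrow> ('r, 'b, 'y) module_scheme \<Rightarrow> 'a \<Rightarrow> 'b \<Rightarrow> ('a \<times> 'b \<Rightarrow>\<^sub>0 int) set"
  where
  "tens R A B a b =
     r_coset (free_Abelian_group (carrier A \<times> carrier B)) (tensor_rels R A B) (frag_of (a, b))"

text \<open>
  \<open>tensor_lift H h\<close> is the homomorphism from a tensor product to the abelian group \<open>H\<close> (written
  multiplicatively) that is induced by the balanced biadditive map \<open>h\<close>.
\<close>

definition tensor_lift ::
  "('g, 'z) monoid_scheme \<Rightarrow> ('a \<times> 'b \<Rightarrow> 'g) \<Rightarrow> ('a \<times> 'b \<Rightarrow>\<^sub>0 int) set \<Rightarrow> 'g" where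
  "tensor_lift H h T =
     the_elem ((\<lambda>t. finprod H (\<lambda>p. h p [^]\<^bsub>H\<^esub> Poly_Mapping.lookup t p) (Poly_Mapping.keys t)) ` T)"

definition tensor ::
  "('r, 'z) ring_scheme \<Rightarrow> ('r, 'a, 'x) module_scheme \<Rightarrow> ('r, 'b, 'y) module_scheme \<Rightarrow> ('r, ('a \<times> 'b \<Rightarrow>\<^sub>0 int) set) module"
  where
  "tensor R A B = \<lparr>carrier = carrier (tensor_group R A B),
     monoid.mult = undefined, one = undefined,
     zero = one (tensor_group R A B), add = monoid.mult (tensor_group R A B),
     smult = (\<lambda>r. tensor_lift (tensor_group R A B) (\<lambda>(a, b). tens R A B (r \<odot>\<^bsub>A\<^esub> a) b))\<rparr>"

section \<open>Coalgebras\<close>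

record ('r, 'c) coalgebra = "('r, 'c) module" +
  comult :: "'c \<Rightarrow> ('c \<times> 'c \<Rightarrow>\<^sub>0 int) set"
  counit :: "'c \<Rightarrow> 'r"

text \<open>
  In the counit axioms \<open>C \<otimes> R\<close> and \<open>R \<otimes> C\<close> are identified with \<open>C\<close> by the action, so that
  \<open>id \<otimes> \<epsilon>\<close> becomes \<open>a \<otimes> b \<mapsto> \<epsilon>(b) a\<close>.
\<close>

definition is_coalgebra :: "('r, 'z) ring_scheme \<Rightarrow> ('r, 'c, 'y) coalgebra_scheme \<Rightarrow> bool" where
  "is_coalgebra R C \<longleftrightarrow> rmodule R C \<and> locally_unitary R C \<and>
     rlinear R C (tensor R C C) (comult C) \<and>
     rlinear R C (regular_module R) (counit C) \<and>
     (\<forall>c \<in> carrier C.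
        tensor_lift (add_monoid C) (\<lambda>(a, b). counit C b \<odot>\<^bsub>C\<^esub> a) (comult C c) = c \<and>
        tensor_lift (add_monoid C) (\<lambda>(a, b). counit C a \<odot>\<^bsub>C\<^esub> b) (comult C c) = c)"

definition coalgebra_hom ::
  "('r, 'z) ring_scheme \<Rightarrow> ('r, 'c, 'x) coalgebra_scheme \<Rightarrow> ('r, 'd, 'y) coalgebra_scheme \<Rightarrow> ('c \<Rightarrow> 'd) \<Rightarrow> bool"
  where
  "coalgebra_hom R C D \<alpha> \<longleftrightarrow> rlinear R C D \<alpha> \<and>
     (\<forall>c \<in> carrier C.
        tensor_lift (tensor_group R D D) (\<lambda>(a, b). tens R D D (\<alpha> a) (\<alpha> b)) (comult C c)
          = comult D (\<alpha> c) \<and>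
        counit D (\<alpha> c) = counit C c)"

definition coalgebra_iso ::
  "('r, 'z) ring_scheme \<Rightarrow> ('r, 'c, 'x) coalgebra_scheme \<Rightarrow> ('r, 'd, 'y) coalgebra_scheme \<Rightarrow> ('c \<Rightarrow> 'd) \<Rightarrow> bool"
  where
  "coalgebra_iso R C D \<alpha> \<longleftrightarrow> coalgebra_hom R C D \<alpha> \<and>
     (\<exists>\<beta>. coalgebra_hom R D C \<beta> \<and>
        (\<forall>c \<in> carrier C. \<beta> (\<alpha> c) = c) \<and> (\<forall>d \<in> carrier D. \<alpha> (\<beta> d) = d))"

definition coalgebra_isomorphic ::
  "('r, 'z) ring_scheme \<Rightarrow> ('r, 'c, 'x) coalgebra_scheme \<Rightarrow> ('r, 'd, 'y) coalgebra_scheme \<Rightarrow> bool"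
  where
  "coalgebra_isomorphic R C D \<longleftrightarrow> (\<exists>\<alpha>. coalgebra_iso R C D \<alpha>)"

definition weakly_grouplike :: "('r, 'z) ring_scheme \<Rightarrow> ('r, 'c, 'y) coalgebra_scheme \<Rightarrow> 'c set" where
  "weakly_grouplike R C =
     {c \<in> carrier C. \<exists>c' \<in> carrier C. comult C c = tens R C C c c'}"

definition grouplike :: "('r, 'z) ring_scheme \<Rightarrow> ('r, 'c, 'y) coalgebra_scheme \<Rightarrow> 'c set" where
  "grouplike R C = {c \<in> carrier C. comult C c = tens R C C c c \<and> counit C c = \<one>\<^bsub>R\<^esub>}"

section \<open>The sheaf coalgebra\<close>

text \<open>
  Elements are sections of the sheaf of germs. Germs and not just values are needed because \<open>E\<close> may
  fail to be Hausdorff.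
\<close>

definition ext_zero :: "'e manifold \<Rightarrow> 'e set \<Rightarrow> ('e \<Rightarrow> 'f::real_normed_field) \<Rightarrow> 'e \<Rightarrow> ('e \<Rightarrow> 'f) set"
  where "ext_zero E U f = (\<lambda>e. if e \<in> U then germ E e f else germ E e (\<lambda>_. 0))"

definition sec_add ::
  "'e manifold \<Rightarrow> ('e \<Rightarrow> ('e \<Rightarrow> 'f::real_normed_field) set) \<Rightarrow> ('e \<Rightarrow> ('e \<Rightarrow> 'f) set) \<Rightarrow> 'e \<Rightarrow> ('e \<Rightarrow> 'f) set"
  where "sec_add E s t = (\<lambda>e. germ_op E e (+) (s e) (t e))"

definition sec_mult ::
  "'e manifold \<Rightarrow> ('e \<Rightarrow> 'f::real_normed_field) \<Rightarrow> ('e \<Rightarrow> ('e \<Rightarrow> 'f) set) \<Rightarrow> 'e \<Rightarrow> ('e \<Rightarrow> 'f) set"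
  where "sec_mult E p s = (\<lambda>e. germ_op E e (*) (germ E e p) (s e))"

inductive_set Cc_sections :: "'e manifold \<Rightarrow> ('e \<Rightarrow> ('e \<Rightarrow> 'f::real_normed_field) set) set"
  for E :: "'e manifold" where
    ext: "\<lbrakk>openin (mtop E) U; Hausdorff_space (subtopology (mtop E) U); f \<in> Cc E U\<rbrakk>
            \<Longrightarrow> ext_zero E U f \<in> Cc_sections E"
  | add: "\<lbrakk>s \<in> Cc_sections E; t \<in> Cc_sections E\<rbrakk> \<Longrightarrow> sec_add E s t \<in> Cc_sections E"
  | scale: "s \<in> Cc_sections E \<Longrightarrow> sec_mult E (\<lambda>_. a) s \<in> Cc_sections E"

text \<open>
  A function \<open>p\<close> acts as multiplication by the germs of \<open>p \<circ> \<pi>\<close>, so that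
  \<open>p (f \<circ> \<pi>|U) = (p f) \<circ> \<pi>|U\<close>.
\<close>

definition sheaf_module ::
  "'e manifold \<Rightarrow> ('e \<Rightarrow> 'm) \<Rightarrow> ('m \<Rightarrow> 'f::real_normed_field, 'e \<Rightarrow> ('e \<Rightarrow> 'f) set) module" where
  "sheaf_module E \<pi> = \<lparr>carrier = Cc_sections E, monoid.mult = undefined, one = undefined,
     zero = (\<lambda>e. germ E e (\<lambda>_. 0)), add = sec_add E, smult = (\<lambda>p. sec_mult E (p \<circ> \<pi>))\<rparr>"

definition elementary :: "'e manifold \<Rightarrow> ('e \<Rightarrow> 'm) \<Rightarrow> 'e set \<Rightarrow> bool" where
  "elementary E \<pi> U \<longleftrightarrow> openin (mtop E) U \<and> inj_on \<pi> U"

text \<open>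
  The comultiplication and counit are given on the generators \<open>f \<circ> \<pi>|U\<close> and extended additively:
  the value on \<open>s\<close> is the one computed from any presentation of \<open>s\<close> as a sum of generators.
\<close>

definition sheaf_comult ::
  "'m manifold \<Rightarrow> 'e manifold \<Rightarrow> ('e \<Rightarrow> 'm) \<Rightarrow> ('e \<Rightarrow> ('e \<Rightarrow> 'f::real_normed_field) set) \<Rightarrow>
     (('e \<Rightarrow> ('e \<Rightarrow> 'f) set) \<times> ('e \<Rightarrow> ('e \<Rightarrow> 'f) set) \<Rightarrow>\<^sub>0 int) set" where
  "sheaf_comult M E \<pi> s =
     (let R = Cc_ring M; A = sheaf_module E \<pi>
      in THE T. \<exists>(k::nat) U f \<eta>.
        (\<forall>i<k. elementary E \<pi> (U i) \<and> f i \<in> Cc M (\<pi> ` U i) \<and> \<eta> i \<in> Cc M (\<pi> ` U i) \<and>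
           \<eta> i \<otimes>\<^bsub>R\<^esub> f i = f i) \<and>
        s = finsum A (\<lambda>i. ext_zero E (U i) (f i \<circ> \<pi>)) {..<k} \<and>
        T = finsum (tensor R A A)
              (\<lambda>i. tens R A A (ext_zero E (U i) (f i \<circ> \<pi>)) (ext_zero E (U i) (\<eta> i \<circ> \<pi>))) {..<k})"

definition sheaf_counit ::
  "'m manifold \<Rightarrow> 'e manifold \<Rightarrow> ('e \<Rightarrow> 'm) \<Rightarrow> ('e \<Rightarrow> ('e \<Rightarrow> 'f::real_normed_field) set) \<Rightarrow> 'm \<Rightarrow> 'f" where
  "sheaf_counit M E \<pi> s =
     (THE r. \<exists>(k::nat) U f.
        (\<forall>i<k. elementary E \<pi> (U i) \<and> f i \<in> Cc M (\<pi> ` U i)) \<and>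
        s = finsum (sheaf_module E \<pi>) (\<lambda>i. ext_zero E (U i) (f i \<circ> \<pi>)) {..<k} \<and>
        r = finsum (Cc_ring M) f {..<k})"

definition sheaf_coalgebra ::
  "'m manifold \<Rightarrow> 'e manifold \<Rightarrow> ('e \<Rightarrow> 'm) \<Rightarrow> ('m \<Rightarrow> 'f::real_normed_field, 'e \<Rightarrow> ('e \<Rightarrow> 'f) set) coalgebra"
  where
  "sheaf_coalgebra M E \<pi> = module.extend (sheaf_module E \<pi>)
     (coalgebra.fields (sheaf_comult M E \<pi>) (sheaf_counit M E \<pi>))"

section \<open>Stalks of a coalgebra and the spectral sheaf\<close>

definition Nx :: "'m manifold \<Rightarrow> ('m \<Rightarrow> 'f::real_normed_field, 'c) coalgebra \<Rightarrow> 'm \<Rightarrow> 'c set" where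
  "Nx M C x = {c \<in> carrier C. \<exists>f \<in> carrier (Cc_ring M).
     germ M x f = germ M x (\<lambda>_. 1) \<and> f \<odot>\<^bsub>C\<^esub> c = \<zero>\<^bsub>C\<^esub>}"

abbreviation cls :: "'m manifold \<Rightarrow> ('m \<Rightarrow> 'f::real_normed_field, 'c) coalgebra \<Rightarrow> 'm \<Rightarrow> 'c \<Rightarrow> 'c set" where
  "cls M C x c \<equiv> a_r_coset C (Nx M C x) c"

definition stalk_module ::
  "'m manifold \<Rightarrow> ('m \<Rightarrow> 'f::real_normed_field, 'c) coalgebra \<Rightarrow> 'm \<Rightarrow> (('m \<Rightarrow> 'f) set, 'c set) module" where
  "stalk_module M C x = \<lparr>carrier = A_RCOSETS C (Nx M C x),
     monoid.mult = undefined, one = undefined, zero = Nx M C x, add = set_add C,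
     smult = (\<lambda>\<gamma> \<zeta>. the_elem {cls M C x (f \<odot>\<^bsub>C\<^esub> c) | f c.
        f \<in> carrier (Cc_ring M) \<and> f \<in> \<gamma> \<and> c \<in> \<zeta>})\<rparr>"

text \<open>
  The comultiplication on \<open>C\<^sub>x\<close> is induced by \<open>\<Delta>\<close> followed by the projection
  \<open>C \<otimes>\<^sub>R C \<rightarrow> C\<^sub>x \<otimes>\<^bsub>R\<^sub>x\<^esub> C\<^sub>x\<close>.
\<close>

definition stalk_comult ::
  "'m manifold \<Rightarrow> ('m \<Rightarrow> 'f::real_normed_field, 'c) coalgebra \<Rightarrow> 'm \<Rightarrow> 'c set \<Rightarrow> ('c set \<times> 'c set \<Rightarrow>\<^sub>0 int) set"
  where
  "stalk_comult M C x \<zeta> =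
     (let S = germ_ring M x; D = stalk_module M C x
      in the_elem ((\<lambda>c. tensor_lift (tensor_group S D D)
           (\<lambda>(a, b). tens S D D (cls M C x a) (cls M C x b)) (comult C c)) ` \<zeta>))"

definition stalk_coalgebra ::
  "'m manifold \<Rightarrow> ('m \<Rightarrow> 'f::real_normed_field, 'c) coalgebra \<Rightarrow> 'm \<Rightarrow> (('m \<Rightarrow> 'f) set, 'c set) coalgebra" where
  "stalk_coalgebra M C x = module.extend (stalk_module M C x)
     (coalgebra.fields (stalk_comult M C x) (\<lambda>\<zeta>. the_elem ((\<lambda>c. germ M x (counit C c)) ` \<zeta>)))"

definition stalk_grouplike ::
  "'m manifold \<Rightarrow> ('m \<Rightarrow> 'f::real_normed_field, 'c) coalgebra \<Rightarrow> 'm \<Rightarrow> 'c set set" where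
  "stalk_grouplike M C x = grouplike (germ_ring M x) (stalk_coalgebra M C x)"

definition normalized_at ::
  "'m manifold \<Rightarrow> ('m \<Rightarrow> 'f::real_normed_field, 'c) coalgebra \<Rightarrow> 'c \<Rightarrow> 'm \<Rightarrow> bool" where
  "normalized_at M C c x \<longleftrightarrow> germ M x (counit C c) = germ M x (\<lambda>_. 1)"

definition normalized_on ::
  "'m manifold \<Rightarrow> ('m \<Rightarrow> 'f::real_normed_field, 'c) coalgebra \<Rightarrow> 'c \<Rightarrow> 'm set \<Rightarrow> bool" where
  "normalized_on M C c W \<longleftrightarrow> (\<forall>x \<in> W. normalized_at M C c x)"

definition spectral_set ::
  "'m manifold \<Rightarrow> ('m \<Rightarrow> 'f::real_normed_field, 'c) coalgebra \<Rightarrow> 'c \<Rightarrow> 'm set \<Rightarrow> ('m \<times> 'c set) set" where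
  "spectral_set M C c W = (\<lambda>x. (x, cls M C x c)) ` W"

definition spectral_basis ::
  "'m manifold \<Rightarrow> ('m \<Rightarrow> 'f::real_normed_field, 'c) coalgebra \<Rightarrow> ('m \<times> 'c set) set set" where
  "spectral_basis M C = {spectral_set M C c W | c W.
     openin (mtop M) W \<and> c \<in> weakly_grouplike (Cc_ring M) C \<and> normalized_on M C c W}"

definition spectral_space ::
  "'m manifold \<Rightarrow> ('m \<Rightarrow> 'f::real_normed_field, 'c) coalgebra \<Rightarrow> ('m \<times> 'c set) set" where
  "spectral_space M C = (SIGMA x : topspace (mtop M). stalk_grouplike M C x)"

text \<open>
  The points are pairs \<open>(x, \<zeta>)\<close> with \<open>\<zeta> \<in> G(C\<^sub>x)\<close>, and the projection is \<^const>\<open>fst\<close>. The charts are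
  those of \<open>M\<close> transported along the projections \<open>c\<^sub>W \<rightarrow> W\<close>.
\<close>

definition spectral_sheaf ::
  "'m manifold \<Rightarrow> ('m \<Rightarrow> 'f::real_normed_field, 'c) coalgebra \<Rightarrow> ('m \<times> 'c set) manifold" where
  "spectral_sheaf M C = \<lparr>mdim = mdim M,
     mtop = topology (\<lambda>U. U \<subseteq> spectral_space M C \<and>
       (\<forall>p \<in> U. \<exists>B \<in> spectral_basis M C. p \<in> B \<and> B \<subseteq> U)),
     atlas = {(spectral_set M C c W, \<phi> \<circ> fst) | c W V \<phi>.
       (V, \<phi>) \<in> atlas M \<and> openin (mtop M) W \<and> W \<subseteq> V \<and>
       c \<in> weakly_grouplike (Cc_ring M) C \<and> normalized_on M C c W}\<rparr>"

definition Psi ::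
  "'m manifold \<Rightarrow> ('m \<Rightarrow> 'f::real_normed_field, 'c) coalgebra \<Rightarrow>
     ('m \<times> 'c set \<Rightarrow> ('m \<times> 'c set \<Rightarrow> 'f) set) \<Rightarrow> 'c" where
  "Psi M C s =
     (let E = spectral_sheaf M C
      in THE d. \<exists>(k::nat) c W f.
        (\<forall>i<k. c i \<in> weakly_grouplike (Cc_ring M) C \<and> openin (mtop M) (W i) \<and>
           normalized_on M C (c i) (W i) \<and> f i \<in> Cc M (W i)) \<and>
        s = finsum (sheaf_module E fst)
              (\<lambda>i. ext_zero E (spectral_set M C (c i) (W i)) (f i \<circ> fst)) {..<k} \<and>
        d = finsum C (\<lambda>i. f i \<odot>\<^bsub>C\<^esub> c i) {..<k})"

section \<open>Normal generation, normal independence, free generation\<close>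

definition normally_generates ::
  "'m manifold \<Rightarrow> ('m \<Rightarrow> 'f::real_normed_field, 'c) coalgebra \<Rightarrow> 'c set \<Rightarrow> bool" where
  "normally_generates M C L \<longleftrightarrow>
     (\<forall>d \<in> carrier C. \<exists>(k::nat) f c.
        (\<forall>i<k. f i \<in> carrier (Cc_ring M) \<and> c i \<in> L \<and> normalized_on M C (c i) (supp M (f i))) \<and>
        d = finsum C (\<lambda>i. f i \<odot>\<^bsub>C\<^esub> c i) {..<k})"

definition normally_lin_indep ::
  "'m manifold \<Rightarrow> ('m \<Rightarrow> 'f::real_normed_field, 'c) coalgebra \<Rightarrow> 'c set \<Rightarrow> bool" where
  "normally_lin_indep M C L \<longleftrightarrow>
     (\<forall>x \<in> topspace (mtop M). \<forall>(k::nat) c f.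
        (\<forall>i<k. c i \<in> L \<and> normalized_at M C (c i) x \<and> f i \<in> carrier (Cc_ring M)) \<and>
        finsum C (\<lambda>i. f i \<odot>\<^bsub>C\<^esub> c i) {..<k} = \<zero>\<^bsub>C\<^esub> \<longrightarrow>
        (\<forall>i<k. germ M x (f i) = germ M x (\<lambda>_. 0)) \<or>
        (\<exists>i<k. \<exists>j<k. i \<noteq> j \<and> (\<exists>g \<in> carrier (Cc_ring M).
           germ M x g = germ M x (\<lambda>_. 1) \<and> g \<odot>\<^bsub>C\<^esub> c i = g \<odot>\<^bsub>C\<^esub> c j)))"

definition freely_generated ::
  "('r, 'z) ring_scheme \<Rightarrow> ('r, 'c, 'y) module_scheme \<Rightarrow> 'c set \<Rightarrow> bool" where
  "freely_generated R A B \<longleftrightarrow> B \<subseteq> carrier A \<and>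
     (\<forall>a \<in> carrier A. \<exists>!r. r \<in> B \<rightarrow>\<^sub>E carrier R \<and> finite {b \<in> B. r b \<noteq> \<zero>\<^bsub>R\<^esub>} \<and>
        a = finsum A (\<lambda>b. r b \<odot>\<^bsub>A\<^esub> b) {b \<in> B. r b \<noteq> \<zero>\<^bsub>R\<^esub>})"

end

theory Submission
  imports Defs "HOL-Computational_Algebra.Polynomial"
begin

text \<open>
  Near a point \<open>x\<close> a section of \<open>E\<close> is the finite sum of its germs at the points of the fibre over \<open>x\<close>;
  these coordinates determine the section, and they allow one to define linear maps on
  \<open>C\<^sub>c\<^sup>\<infinity>(E)\<close> on the members of a cover of \<open>E\<close> by elementary sets. If a section is weakly grouplike and
  normalized at \<open>x\<close>, then its coordinates at \<open>x\<close> are orthogonal idempotent germs, hence all of them are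
  \<open>0\<close> except for one, which is \<open>1\<close>. The grouplike elements of the stalk at \<open>x\<close> are therefore the points of the
  fibre, which yields both (iii) and the isomorphism of \<open>E\<close> with the spectral sheaf. Conversely, normal
  generation makes \<open>\<Psi>\<close> surjective, and independence makes it injective, coordinate by coordinate.
  Condition (iv) is the germwise form of (iii); generation passes from germs to \<open>C\<close> by means of products
  \<open>1 - \<Prod>(1 - f\<^sub>i)\<close>, since no partitions of unity are available.
\<close>

text \<open>The comultiplication and counit of sections and the map \<open>Psi\<close> are
  prescribed on generators, but a section has many presentations by generators over overlapping
  elementary sets of a space that need not be Hausdorff. The additive closure of the prescribed
  graph is therefore studied as a relation: near each \<open>x\<close> every value that it assigns
  to a section equals a sum over the fibre that depends on the section alone, and elements of a
  locally unitary module that agree near every point are equal. This makes the relation a function.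
  The ring need not have an identity, so agreement near \<open>x\<close> is expressed by a
  multiplier: \<open>geq x a b\<close> says that some \<open>g\<close> with germ 1 at
  \<open>x\<close> satisfies \<open>g a = g b\<close>. This is equality in the stalk. It is
  respected by linear maps and by tensor products, so that most arguments about stalks take place in
  the module itself. The counit axiom ties weakly grouplike elements to grouplike ones: \<Delta>(c)
  = c \<otimes> c' forces \<epsilon>(c) c' = c, hence c' = c near every point at which c is
  normalized.\<close>

abbreviation germ0 :: "'a manifold => 'a => ('a => 'f::zero) set" where
  "germ0 X x \<equiv> germ X x (\<lambda>_. 0)"

abbreviation germ1 :: "'a manifold => 'a => ('a => 'f::one) set" where
  "germ1 X x \<equiv> germ X x (\<lambda>_. 1)"

section \<open>Calculus in Euclidean space\<close>

text \<open>The topology of \<open>Euclidean_space\<close> is induced from the product topology on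
  all sequences, so that abstract continuity becomes \<open>continuous_on\<close>.\<close>

lemma continuous_map_Euclidean_iff:
  assumes "V \<subseteq> topspace (Euclidean_space n)"
  shows "continuous_map (subtopology (Euclidean_space n) V) euclidean f \<longleftrightarrow> continuous_on V f"
proof -
  have "subtopology (Euclidean_space n) V = top_of_set V"
    using assms unfolding Euclidean_space_def euclidean_product_topology
    by (simp add: subtopology_subtopology topspace_Euclidean_space Int_absorb1)
  then show ?thesis by simp
qed

lemma openin_Euclidean_iff:
  "openin (Euclidean_space n) V \<longleftrightarrow> (\<exists>T. open T \<and> V = T \<inter> topspace (Euclidean_space n))"
  unfolding Euclidean_space_def euclidean_product_topology openin_subtopology by simp

text \<open>A basic open set of the product restricts each coordinate separately. Below index
  \<open>n\<close> the finitely many radii have a minimum; from \<open>n\<close> on the coordinates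
  of both points are 0, so nothing has to be required there.\<close>

lemma openin_Euclidean_box:
  assumes "openin (Euclidean_space n) V" "x \<in> V"
  shows "\<exists>\<delta>>0. \<forall>z \<in> topspace (Euclidean_space n). (\<forall>i<n. \<bar>z i - x i\<bar> < \<delta>) --> z \<in> V"
proof -
  obtain T where T: "open T" "V = T \<inter> topspace (Euclidean_space n)"
    using assms(1) openin_Euclidean_iff by auto
  have "openin (powertop_real UNIV) T" "x \<in> T"
    using T assms by (auto simp: euclidean_product_topology)
  then obtain U where U: "\<And>i. open (U i)" "x \<in> Pi\<^sub>E UNIV U" "Pi\<^sub>E UNIV U \<subseteq> T"
    unfolding openin_product_topology_alt by fastforce
  have "\<exists>d>0. \<forall>y. \<bar>y - x i\<bar> < d --> y \<in> U i" for i
  proof -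
    have "x i \<in> U i" using U(2) by auto
    then obtain d where "d > 0" "ball (x i) d \<subseteq> U i"
      using U(1) open_contains_ball by blast
    then show ?thesis
      by (intro exI[of _ d]) (auto simp: subset_iff dist_real_def abs_minus_commute)
  qed
  then obtain d where d: "\<And>i. d i > 0" "\<And>i y. \<bar>y - x i\<bar> < d i ==> y \<in> U i"
    by metis
  \<comment> \<open>The 1 keeps the set nonempty in dimension 0.\<close>
  define \<delta> where "\<delta> = Min (insert 1 (d ` {..<n}))"
  have pos: "\<delta> > 0" and le: "\<And>i. i < n ==> \<delta> \<le> d i"
    unfolding \<delta>_def using d(1) by auto
  show ?thesis
  proof (intro exI conjI ballI impI)
    show "\<delta> > 0" by (fact pos)
    fix z assume z: "z \<in> topspace (Euclidean_space n)" "\<forall>i<n. \<bar>z i - x i\<bar> < \<delta>"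
    have "z i \<in> U i" for i
    proof (cases "i < n")
      case True
      with z(2) le[OF True] d(2) show ?thesis by fastforce
    next
      case False
      have "x \<in> topspace (Euclidean_space n)" using T assms(2) by auto
      then have "z i = x i" using z(1) False by (auto simp: topspace_Euclidean_space)
      then show ?thesis using U(2) by auto
    qed
    then show "z \<in> V" using U(3) z(1) T(2) by auto
  qed
qed

lemma topspace_Euclidean_upd:
  assumes "x \<in> topspace (Euclidean_space n)" "i < n"
  shows "x(i := t) \<in> topspace (Euclidean_space n)"
  using assms by (auto simp: topspace_Euclidean_space)

text \<open>Partial derivatives are formed along whole coordinate lines; this is why they depend
  only on the values in the open set.\<close>

lemma openin_Euclidean_line:
  assumes "openin (Euclidean_space n) V" "x \<in> V" "i < n"
  shows "\<exists>S. open S \<and> x i \<in> S \<and> (\<forall>t\<in>S. x(i := t) \<in> V)"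
proof -
  obtain \<delta> where "\<delta> > 0"
    and \<delta>: "\<And>z. z \<in> topspace (Euclidean_space n) ==> \<forall>i<n. \<bar>z i - x i\<bar> < \<delta> ==> z \<in> V"
    using openin_Euclidean_box[OF assms(1,2)] by blast
  have x: "x \<in> topspace (Euclidean_space n)"
    using assms openin_subset by blast
  show ?thesis
  proof (intro exI conjI ballI)
    show "open (ball (x i) \<delta>)" "x i \<in> ball (x i) \<delta>" using \<open>\<delta> > 0\<close> by auto
    show "x(i := t) \<in> V" if "t \<in> ball (x i) \<delta>" for t
      using that \<open>\<delta> > 0\<close>
      by (intro \<delta> topspace_Euclidean_upd[OF x assms(3)]) (auto simp: dist_real_def abs_minus_commute)
  qed
qed

lemma partial_transform:
  assumes "openin (Euclidean_space n) V" "x \<in> V" "i < n" "\<forall>x\<in>V. f x = g x"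
  shows "((\<lambda>t. f (x(i := t))) has_vector_derivative D) (at (x i)) \<longleftrightarrow>
         ((\<lambda>t. g (x(i := t))) has_vector_derivative D) (at (x i))"
proof -
  obtain S where S: "open S" "x i \<in> S" "\<forall>t\<in>S. x(i := t) \<in> V"
    using openin_Euclidean_line[OF assms(1-3)] by blast
  then show ?thesis
    using assms(4) by (auto elim!: has_vector_derivative_transform_within_open[OF _ \<open>open S\<close> \<open>x i \<in> S\<close>])
qed

section \<open>Functions of class C^k on open subsets of Euclidean space\<close>

lemma Ck_on_cong:
  assumes "openin (Euclidean_space n) V" "\<forall>x\<in>V. f x = g x"
  shows "Ck_on k n V f \<longleftrightarrow> Ck_on k n V g"
  using assms(2)
proof (induction k arbitrary: f g)
  case 0
  have "V \<subseteq> topspace (Euclidean_space n)" using assms(1) openin_subset by blast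
  with 0 show ?case by (simp add: continuous_map_Euclidean_iff cong: continuous_on_cong)
next
  case (Suc k)
  have sub: "V \<subseteq> topspace (Euclidean_space n)" using assms(1) openin_subset by blast
  have v: "((\<lambda>t. f (x(i := t))) has_vector_derivative D) (at (x i)) \<longleftrightarrow>
         ((\<lambda>t. g (x(i := t))) has_vector_derivative D) (at (x i))" if "x \<in> V" "i < n" for x i D
    using partial_transform[OF assms(1) that Suc.prems] .
  have d: "(\<lambda>t. f (x(i := t))) differentiable at (x i) \<longleftrightarrow> (\<lambda>t. g (x(i := t))) differentiable at (x i)"
    if "x \<in> V" "i < n" for x i
    using v[OF that] by (blast dest: vector_derivative_works[THEN iffD1] intro: differentiableI_vector)
  have w: "vector_derivative (\<lambda>t. f (x(i := t))) (at (x i)) = vector_derivative (\<lambda>t. g (x(i := t))) (at (x i))"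
    if "x \<in> V" "i < n" for x i
    unfolding vector_derivative_def using v[OF that] by simp
  have "Ck_on k n V (\<lambda>x. vector_derivative (\<lambda>t. f (x(i := t))) (at (x i))) \<longleftrightarrow>
        Ck_on k n V (\<lambda>x. vector_derivative (\<lambda>t. g (x(i := t))) (at (x i)))" if "i < n" for i
    by (rule Suc.IH) (use w[OF _ that] in \<open>simp del: fun_upd_apply\<close>)
  then show ?case
    using Suc.prems d sub by (simp add: continuous_map_Euclidean_iff cong: continuous_on_cong)
qed

text \<open>In this form any function may serve as the partial derivative, so that closure
  properties are proved by exhibiting a witness instead of computing
  \<open>vector_derivative\<close>.\<close>

lemma Ck_on_Suc_iff:
  assumes "openin (Euclidean_space n) V"
  shows "Ck_on (Suc k) n V f \<longleftrightarrow> continuous_on V f \<and>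
    (\<forall>i<n. \<exists>g. (\<forall>x\<in>V. ((\<lambda>t. f (x(i := t))) has_vector_derivative g x) (at (x i))) \<and> Ck_on k n V g)"
    (is "_ \<longleftrightarrow> ?r")
proof
  have sub: "V \<subseteq> topspace (Euclidean_space n)" using assms(1) openin_subset by blast
  show ?r if "Ck_on (Suc k) n V f"
    using that sub by (auto simp: continuous_map_Euclidean_iff vector_derivative_works[symmetric]
      intro!: exI[of _ "\<lambda>x. vector_derivative (\<lambda>t. f (x(_ := t))) (at (x _))"])
  show "Ck_on (Suc k) n V f" if r: ?r
    unfolding Ck_on.simps
  proof (intro conjI allI impI ballI)
    show "continuous_map (subtopology (Euclidean_space n) V) euclidean f"
      using r sub by (simp add: continuous_map_Euclidean_iff)
    fix i assume i: "i < n"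
    then obtain g where g: "\<forall>x\<in>V. ((\<lambda>t. f (x(i := t))) has_vector_derivative g x) (at (x i))"
      "Ck_on k n V g" using r by blast
    show "(\<lambda>t. f (x(i := t))) differentiable at (x i)" if "x \<in> V" for x
      using g(1) that by (blast intro: differentiableI_vector)
    have "\<forall>x\<in>V. vector_derivative (\<lambda>t. f (x(i := t))) (at (x i)) = g x"
      by (rule ballI, rule vector_derivative_at, rule bspec[OF g(1)])
    then show "Ck_on k n V (\<lambda>x. vector_derivative (\<lambda>t. f (x(i := t))) (at (x i)))"
      by (rule iffD2[OF Ck_on_cong[OF assms] g(2)])
  qed
qed

lemma Ck_on_0_iff:
  assumes "openin (Euclidean_space n) V"
  shows "Ck_on 0 n V f \<longleftrightarrow> continuous_on V f"
  using openin_subset[OF assms] by (simp add: continuous_map_Euclidean_iff)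

lemma Ck_on_continuous:
  assumes "openin (Euclidean_space n) V" "Ck_on k n V f"
  shows "continuous_on V f"
  using assms by (cases k) (auto simp: Ck_on_0_iff Ck_on_Suc_iff simp del: Ck_on.simps)

lemma Ck_on_SucD:
  assumes "openin (Euclidean_space n) V" "Ck_on (Suc k) n V f"
  shows "Ck_on k n V f"
  using assms(2)
proof (induction k arbitrary: f)
  case 0
  then show ?case using assms(1) by (auto simp: Ck_on_0_iff Ck_on_Suc_iff simp del: Ck_on.simps)
next
  case (Suc k)
  show ?case unfolding Ck_on_Suc_iff[OF assms(1)]
  proof (intro conjI allI impI)
    show "continuous_on V f" using Ck_on_continuous[OF assms(1) Suc.prems] .
    fix i assume "i < n"
    then obtain g where "\<forall>x\<in>V. ((\<lambda>t. f (x(i := t))) has_vector_derivative g x) (at (x i))"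
      "Ck_on (Suc k) n V g"
      using iffD1[OF Ck_on_Suc_iff[OF assms(1)] Suc.prems] by blast
    then show "\<exists>g. (\<forall>x\<in>V. ((\<lambda>t. f (x(i := t))) has_vector_derivative g x) (at (x i))) \<and> Ck_on k n V g"
      using Suc.IH by blast
  qed
qed

lemma Ck_on_subset:
  assumes "openin (Euclidean_space n) V" "openin (Euclidean_space n) W" "W \<subseteq> V" "Ck_on k n V f"
  shows "Ck_on k n W f"
  using assms(4)
proof (induction k arbitrary: f)
  case 0
  then show ?case using assms by (auto simp: Ck_on_0_iff intro: continuous_on_subset simp del: Ck_on.simps)
next
  case (Suc k)
  show ?case unfolding Ck_on_Suc_iff[OF assms(2)]
  proof (intro conjI allI impI)
    show "continuous_on W f"
      using Ck_on_continuous[OF assms(1) Suc.prems] assms(3) continuous_on_subset by blast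
    fix i assume "i < n"
    then obtain g where "\<forall>x\<in>V. ((\<lambda>t. f (x(i := t))) has_vector_derivative g x) (at (x i))"
      "Ck_on k n V g"
      using iffD1[OF Ck_on_Suc_iff[OF assms(1)] Suc.prems] by blast
    then show "\<exists>g. (\<forall>x\<in>W. ((\<lambda>t. f (x(i := t))) has_vector_derivative g x) (at (x i))) \<and> Ck_on k n W g"
      using Suc.IH assms(3) by blast
  qed
qed

lemma continuous_on_Euclidean_local:
  assumes V: "openin (Euclidean_space n) V"
    and loc: "\<And>x. x \<in> V ==> \<exists>W. openin (Euclidean_space n) W \<and> x \<in> W \<and> W \<subseteq> V \<and> continuous_on W f"
  shows "continuous_on V f"
  unfolding continuous_on_def
proof
  fix x assume "x \<in> V"
  then obtain W where W: "openin (Euclidean_space n) W" "x \<in> W" "W \<subseteq> V" "continuous_on W f"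
    using loc by blast
  obtain T where T: "open T" "W = T \<inter> topspace (Euclidean_space n)"
    using W(1) openin_Euclidean_iff by auto
  have "V \<subseteq> topspace (Euclidean_space n)" using V openin_subset by blast
  then have "at x within V = at x within W"
    using T W by (intro at_within_nhd[of _ T]) auto
  then show "(f \<longlongrightarrow> f x) (at x within V)"
    using W(2,4) by (simp add: continuous_on_def)
qed

text \<open>The induction follows the definition rather than \<open>Ck_on_Suc_iff\<close>:
  \<open>vector_derivative\<close> is one function for all neighbourhoods, whereas witnesses on
  different neighbourhoods would have to be glued.\<close>

lemma Ck_on_local:
  assumes V: "openin (Euclidean_space n) V"
    and loc: "\<And>x. x \<in> V ==> \<exists>W. openin (Euclidean_space n) W \<and> x \<in> W \<and> W \<subseteq> V \<and> Ck_on k n W f"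
  shows "Ck_on k n V f"
  using loc
proof (induction k arbitrary: f)
  case 0
  show ?case unfolding Ck_on_0_iff[OF V]
    by (rule continuous_on_Euclidean_local[OF V], drule "0") (use Ck_on_continuous[of n _ 0 f] in blast)
next
  case (Suc k)
  have sub: "V \<subseteq> topspace (Euclidean_space n)" using V openin_subset by blast
  show ?case unfolding Ck_on.simps
  proof (intro conjI allI impI ballI)
    have "continuous_on V f"
      by (rule continuous_on_Euclidean_local[OF V], drule Suc.prems)
         (use Ck_on_continuous[of n _ "Suc k" f] in blast)
    then show "continuous_map (subtopology (Euclidean_space n) V) euclidean f"
      using sub by (simp add: continuous_map_Euclidean_iff)
    fix i assume i: "i < n"
    show "(\<lambda>t. f (x(i := t))) differentiable at (x i)" if x: "x \<in> V" for x
    proof -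
      obtain W where "x \<in> W" "Ck_on (Suc k) n W f" using Suc.prems[OF x] by blast
      then show ?thesis using i by simp
    qed
    show "Ck_on k n V (\<lambda>x. vector_derivative (\<lambda>t. f (x(i := t))) (at (x i)))"
    proof (rule Suc.IH)
      fix x assume "x \<in> V"
      then obtain W where "openin (Euclidean_space n) W" "x \<in> W" "W \<subseteq> V" "Ck_on (Suc k) n W f"
        using Suc.prems by blast
      then show "\<exists>W. openin (Euclidean_space n) W \<and> x \<in> W \<and> W \<subseteq> V \<and>
          Ck_on k n W (\<lambda>x. vector_derivative (\<lambda>t. f (x(i := t))) (at (x i)))"
        using i by (intro exI[of _ W]) simp
    qed
  qed
qed

lemma Ck_on_const [simp]:
  assumes "openin (Euclidean_space n) V"
  shows "Ck_on k n V (\<lambda>_. c)"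
proof (induction k arbitrary: c)
  case 0
  then show ?case using assms by (simp add: Ck_on_0_iff del: Ck_on.simps)
next
  case (Suc k)
  then show ?case using assms unfolding Ck_on_Suc_iff[OF assms]
    by (auto intro!: exI[of _ "\<lambda>_. 0"])
qed

lemma Ck_on_add:
  assumes "openin (Euclidean_space n) V" "Ck_on k n V f" "Ck_on k n V g"
  shows "Ck_on k n V (\<lambda>x. f x + g x)"
  using assms(2,3)
proof (induction k arbitrary: f g)
  case 0
  then show ?case using assms(1) by (auto simp: Ck_on_0_iff intro: continuous_intros simp del: Ck_on.simps)
next
  case (Suc k)
  show ?case unfolding Ck_on_Suc_iff[OF assms(1)]
  proof (intro conjI allI impI)
    show "continuous_on V (\<lambda>x. f x + g x)"
      using Suc.prems Ck_on_continuous[OF assms(1)] by (blast intro: continuous_on_add)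
    fix i assume i: "i < n"
    obtain f' where "\<forall>x\<in>V. ((\<lambda>t. f (x(i := t))) has_vector_derivative f' x) (at (x i))" "Ck_on k n V f'"
      using Suc.prems(1) i unfolding Ck_on_Suc_iff[OF assms(1)] by blast
    moreover obtain g' where "\<forall>x\<in>V. ((\<lambda>t. g (x(i := t))) has_vector_derivative g' x) (at (x i))" "Ck_on k n V g'"
      using Suc.prems(2) i unfolding Ck_on_Suc_iff[OF assms(1)] by blast
    ultimately show "\<exists>h. (\<forall>x\<in>V. ((\<lambda>t. f (x(i := t)) + g (x(i := t))) has_vector_derivative h x) (at (x i))) \<and> Ck_on k n V h"
      by (intro exI[of _ "\<lambda>x. f' x + g' x"]) (auto intro: has_vector_derivative_add Suc.IH)
  qed
qed

lemma Ck_on_sum: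
  assumes "openin (Euclidean_space n) V" "\<And>j. j \<in> J ==> Ck_on k n V (f j)"
  shows "Ck_on k n V (\<lambda>x. \<Sum>j\<in>J. f j x)"
  using assms(2)
  by (induction J rule: infinite_finite_induct) (auto simp: assms(1) Ck_on_add simp del: Ck_on.simps)

lemma Ck_on_bounded_linear:
  assumes "openin (Euclidean_space n) V" "bounded_linear L" "Ck_on k n V f"
  shows "Ck_on k n V (\<lambda>x. L (f x))"
  using assms(3)
proof (induction k arbitrary: f)
  case 0
  then show ?case using assms(1) bounded_linear.continuous_on[OF assms(2)]
    by (auto simp: Ck_on_0_iff simp del: Ck_on.simps)
next
  case (Suc k)
  show ?case unfolding Ck_on_Suc_iff[OF assms(1)]
  proof (intro conjI allI impI)
    show "continuous_on V (\<lambda>x. L (f x))"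
      using Suc.prems Ck_on_continuous[OF assms(1)] bounded_linear.continuous_on[OF assms(2)] by blast
    fix i assume i: "i < n"
    obtain f' where "\<forall>x\<in>V. ((\<lambda>t. f (x(i := t))) has_vector_derivative f' x) (at (x i))" "Ck_on k n V f'"
      using Suc.prems(1) i unfolding Ck_on_Suc_iff[OF assms(1)] by blast
    then show "\<exists>h. (\<forall>x\<in>V. ((\<lambda>t. L (f (x(i := t)))) has_vector_derivative h x) (at (x i))) \<and> Ck_on k n V h"
      by (intro exI[of _ "\<lambda>x. L (f' x)"])
         (auto intro: bounded_linear.has_vector_derivative[OF assms(2)] Suc.IH)
  qed
qed

text \<open>By the Leibniz rule the derivative is a sum of two terms of the same shape, to which the
  induction hypothesis applies once the order of \<open>f\<close> and \<open>g\<close> is lowered by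
  one. Multiplication and scaling are both instances.\<close>

lemma Ck_on_bilinear:
  assumes V: "openin (Euclidean_space n) V" and b: "bounded_bilinear b"
    and "Ck_on k n V f" "Ck_on k n V g"
  shows "Ck_on k n V (\<lambda>x. b (f x) (g x))"
  using assms(3,4)
proof (induction k arbitrary: f g)
  case 0
  then show ?case using V bounded_bilinear.continuous_on[OF b]
    by (auto simp: Ck_on_0_iff simp del: Ck_on.simps)
next
  case (Suc k)
  show ?case unfolding Ck_on_Suc_iff[OF V]
  proof (intro conjI allI impI)
    show "continuous_on V (\<lambda>x. b (f x) (g x))"
      by (rule bounded_bilinear.continuous_on[OF b Ck_on_continuous[OF V] Ck_on_continuous[OF V]]; fact Suc.prems)
    fix i assume i: "i < n"
    obtain f' where f': "\<forall>x\<in>V. ((\<lambda>t. f (x(i := t))) has_vector_derivative f' x) (at (x i))" "Ck_on k n V f'"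
      using Suc.prems(1) i unfolding Ck_on_Suc_iff[OF V] by blast
    obtain g' where g': "\<forall>x\<in>V. ((\<lambda>t. g (x(i := t))) has_vector_derivative g' x) (at (x i))" "Ck_on k n V g'"
      using Suc.prems(2) i unfolding Ck_on_Suc_iff[OF V] by blast
    show "\<exists>h. (\<forall>x\<in>V. ((\<lambda>t. b (f (x(i := t))) (g (x(i := t)))) has_vector_derivative h x) (at (x i))) \<and> Ck_on k n V h"
    proof (intro exI conjI ballI)
      show "((\<lambda>t. b (f (x(i := t))) (g (x(i := t)))) has_vector_derivative (b (f x) (g' x) + b (f' x) (g x))) (at (x i))"
        if "x \<in> V" for x
        using bounded_bilinear.has_vector_derivative[OF b, of "\<lambda>t. f (x(i := t))" "f' x" "x i" UNIV "\<lambda>t. g (x(i := t))" "g' x"]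
          f'(1) g'(1) that by simp
      show "Ck_on k n V (\<lambda>x. b (f x) (g' x) + b (f' x) (g x))"
        using f'(2) g'(2) Suc.prems by (intro Ck_on_add Suc.IH V) (auto intro: Ck_on_SucD[OF V])
    qed
  qed
qed

lemma Ck_on_proj:
  assumes V: "openin (Euclidean_space n) V"
  shows "Ck_on k n V (\<lambda>x. x j)"
proof (cases k)
  case 0
  then show ?thesis using V
    by (auto simp: Ck_on_0_iff simp del: Ck_on.simps intro: continuous_intros continuous_on_product_then_coordinatewise)
next
  case (Suc k)
  have "\<exists>g. (\<forall>x\<in>V. ((\<lambda>t. (x(i := t)) j) has_vector_derivative g x) (at (x i))) \<and> Ck_on k n V g" for i
    using V by (intro exI[of _ "\<lambda>_. if i = j then 1 else 0"]) auto
  then show ?thesis using V unfolding Suc Ck_on_Suc_iff[OF V]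
    by (auto intro: continuous_on_product_then_coordinatewise)
qed

subsection \<open>The chain rule\<close>

text \<open>Subtracting the linear function \<open>t *\<^sub>R v\<close> turns closeness of the
  derivative to \<open>v\<close> into a bound on a derivative, to which the mean value inequality
  applies.\<close>

lemma partial_increment_bound:
  fixes f :: "(nat => real) => 'f::real_normed_vector"
  assumes der: "\<And>t. t \<in> closed_segment a b ==>
      ((\<lambda>t. f (z(l := t))) has_vector_derivative f' (z(l := t))) (at t)"
    and bd: "\<And>t. t \<in> closed_segment a b ==> norm (f' (z(l := t)) - v) \<le> e"
  shows "norm (f (z(l := b)) - f (z(l := a)) - (b - a) *\<^sub>R v) \<le> e * \<bar>b - a\<bar>"
proof -
  define \<phi> where "\<phi> t = f (z(l := t)) - t *\<^sub>R v" for t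
  have "norm (\<phi> b - \<phi> a) \<le> e * norm (b - a)"
  proof (rule differentiable_bound[where S = "closed_segment a b" and f' = "\<lambda>t s. s *\<^sub>R (f' (z(l := t)) - v)"])
    show "(\<phi> has_derivative (\<lambda>s. s *\<^sub>R (f' (z(l := t)) - v))) (at t within closed_segment a b)"
      if "t \<in> closed_segment a b" for t
    proof -
      have "(\<phi> has_vector_derivative (f' (z(l := t)) - v)) (at t)"
        unfolding \<phi>_def using der[OF that]
        by (auto intro!: derivative_eq_intros)
      then show ?thesis
        unfolding has_vector_derivative_def using has_derivative_at_withinI by blast
    qed
    show "onorm (\<lambda>s. s *\<^sub>R (f' (z(l := t)) - v)) \<le> e" if "t \<in> closed_segment a b" for t
      using bd[OF that] onorm_scaleR_left[OF bounded_linear_ident, of "f' (z(l := t)) - v"]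
      by (simp add: onorm_id)
  qed auto
  then show ?thesis unfolding \<phi>_def by (simp add: algebra_simps)
qed

lemma has_vector_derivative_quotient_iff:
  "(F has_vector_derivative D) (at t0) \<longleftrightarrow>
   ((\<lambda>t. (1 / (t - t0)) *\<^sub>R (F t - F t0)) \<longlongrightarrow> D) (at t0)"
proof -
  have eq: "norm ((1 / (t - t0)) *\<^sub>R (F t - F t0) - D) = norm (F t - F t0 - (t - t0) *\<^sub>R D) / norm (t - t0)"
    if "t \<noteq> t0" for t
  proof -
    have "(1 / (t - t0)) *\<^sub>R (F t - F t0) - D = (1 / (t - t0)) *\<^sub>R (F t - F t0 - (t - t0) *\<^sub>R D)"
      using that by (simp add: scaleR_diff_right)
    then show ?thesis by (simp add: divide_inverse mult.commute)
  qed
  have "(F has_vector_derivative D) (at t0) \<longleftrightarrow>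
      ((\<lambda>t. norm (F t - F t0 - (t - t0) *\<^sub>R D) / norm (t - t0)) \<longlongrightarrow> 0) (at t0)"
    unfolding has_vector_derivative_def has_derivative_iff_norm
    by (simp add: bounded_linear_scaleR_left)
  also have "\<dots> \<longleftrightarrow> ((\<lambda>t. norm ((1 / (t - t0)) *\<^sub>R (F t - F t0) - D)) \<longlongrightarrow> 0) (at t0)"
    by (rule tendsto_cong) (auto simp: eventually_at_filter eq simp del: real_norm_def)
  also have "\<dots> \<longleftrightarrow> ((\<lambda>t. (1 / (t - t0)) *\<^sub>R (F t - F t0)) \<longlongrightarrow> D) (at t0)"
    by (simp add: tendsto_norm_zero_iff LIM_zero_iff)
  finally show ?thesis .
qed

text \<open>
  Along the curve \<open>f\<close> is expanded one coordinate at a time; the difference quotients \<open>q j\<close> in the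
  single coordinates converge to the partial derivatives by the mean value inequality.
\<close>

lemma curve_chain_rule:
  fixes f :: "(nat => real) => 'f::real_normed_vector"
  assumes V: "openin (Euclidean_space m) V"
    and der: "\<And>j x. j < m ==> x \<in> V ==> ((\<lambda>t. f (x(j := t))) has_vector_derivative f' j x) (at (x j))"
    and cont: "\<And>j. j < m ==> continuous_on V (f' j)"
    and \<gamma>V: "\<gamma> t0 \<in> V" "eventually (\<lambda>t. \<gamma> t \<in> V) (at t0)"
    and d: "\<And>j. j < m ==> ((\<lambda>t. \<gamma> t j) has_vector_derivative d j) (at t0)"
  shows "((\<lambda>t. f (\<gamma> t)) has_vector_derivative (\<Sum>j<m. d j *\<^sub>R f' j (\<gamma> t0))) (at t0)"
proof -
  define z0 where "z0 = \<gamma> t0"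
  define mix where "mix z l = (\<lambda>j. if j < l then z j else z0 j)" for z :: "nat => real" and l :: nat
  \<comment> \<open>Where the coordinate has not moved, the quotient is filled in with its expected
    limit. Thus the telescoping expansion holds for every \<open>z\<close> in \<open>V\<close>, and
    the limit is right even for curves that return to \<open>z0 j\<close>.\<close>
  define q where "q j z = (if z j = z0 j then f' j z0
      else (1 / (z j - z0 j)) *\<^sub>R (f (mix z (Suc j)) - f (mix z j)))" for j z
  have Vsub: "V \<subseteq> topspace (Euclidean_space m)" using V openin_subset by blast
  have z0: "z0 \<in> V" using \<gamma>V z0_def by simp
  have mix0: "mix z 0 = z0" for z by (auto simp: mix_def)
  have mixm: "mix z m = z" if "z \<in> V" for z
  proof
    fix j show "mix z m j = z j"
      using subsetD[OF Vsub that] subsetD[OF Vsub z0]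
      by (cases "j < m") (auto simp: mix_def topspace_Euclidean_space)
  qed
  have mixS: "mix z (Suc j) = (mix z j)(j := z j)" "mix z j = (mix z j)(j := z0 j)" for z j
    by (auto simp: mix_def fun_eq_iff less_Suc_eq)
  have exp: "f z - f z0 = (\<Sum>j<m. (z j - z0 j) *\<^sub>R q j z)" if "z \<in> V" for z
  proof -
    have "(z j - z0 j) *\<^sub>R q j z = f (mix z (Suc j)) - f (mix z j)" for j
    proof (cases "z j = z0 j")
      case True
      then have "mix z (Suc j) = mix z j" using mixS[of z j] by simp
      then show ?thesis using True by simp
    next
      case False
      then show ?thesis by (simp add: q_def)
    qed
    then have "(\<Sum>j<m. (z j - z0 j) *\<^sub>R q j z) = (\<Sum>j<m. f (mix z (Suc j)) - f (mix z j))" by simp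
    also have "\<dots> = f (mix z m) - f (mix z 0)" by (rule sum_lessThan_telescope)
    finally show ?thesis using mix0 mixm[OF that] by simp
  qed
  have cg: "((\<lambda>t. \<gamma> t j) \<longlongrightarrow> z0 j) (at t0)" if "j < m" for j
    using has_vector_derivative_continuous[OF d[OF that]] by (simp add: continuous_at z0_def isCont_def)
  have qlim: "((\<lambda>t. q j (\<gamma> t)) \<longlongrightarrow> f' j z0) (at t0)" if j: "j < m" for j
  proof (rule tendstoI)
    fix e :: real assume e: "e > 0"
    have "openin (top_of_set V) (V \<inter> f' j -` ball (f' j z0) (e/2))"
      using cont[OF j] by (simp add: continuous_openin_preimage_gen)
    moreover have "top_of_set V = subtopology (Euclidean_space m) V"
      using Vsub unfolding Euclidean_space_def euclidean_product_topology
      by (simp add: subtopology_subtopology topspace_Euclidean_space Int_absorb1)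
    ultimately have "openin (Euclidean_space m) (V \<inter> f' j -` ball (f' j z0) (e/2))"
      using openin_trans_full[OF _ V] by simp
    moreover have "z0 \<in> V \<inter> f' j -` ball (f' j z0) (e/2)" using z0 e by auto
    ultimately obtain \<delta> where \<delta>: "\<delta> > 0" and box: "\<And>z. z \<in> topspace (Euclidean_space m) ==>
        \<forall>i<m. \<bar>z i - z0 i\<bar> < \<delta> ==> z \<in> V \<inter> f' j -` ball (f' j z0) (e/2)"
      by (elim openin_Euclidean_box[THEN exE]) blast+
    have ev: "eventually (\<lambda>t. \<forall>i\<in>{..<m}. \<bar>\<gamma> t i - z0 i\<bar> < \<delta>) (at t0)"
    proof (rule eventually_ball_finite)
      show "\<forall>i\<in>{..<m}. \<forall>\<^sub>F t in at t0. \<bar>\<gamma> t i - z0 i\<bar> < \<delta>"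
        using tendstoD[OF cg \<delta>] by (auto simp: dist_real_def)
    qed auto
    show "eventually (\<lambda>t. dist (q j (\<gamma> t)) (f' j z0) < e) (at t0)"
      using ev \<gamma>V(2)
    proof eventually_elim
      case (elim t)
      define z where "z = \<gamma> t"
      show ?case
      proof (cases "z j = z0 j")
        case True
        then show ?thesis using e by (simp add: q_def z_def)
      next
        case False
        \<comment> \<open>Each coordinate of this intermediate point is that of \<open>z0\<close>,
          that of \<open>z\<close>, or lies between the two, so the point stays in the box.\<close>
        have inb: "(mix z j)(j := s) \<in> V \<inter> f' j -` ball (f' j z0) (e/2)" if s: "s \<in> closed_segment (z0 j) (z j)" for s
        proof (rule box)
          show "(mix z j)(j := s) \<in> topspace (Euclidean_space m)"
            using z0 Vsub j by (auto simp: mix_def topspace_Euclidean_space subset_iff)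
          have "\<bar>s - z0 j\<bar> \<le> \<bar>z j - z0 j\<bar>"
            using s by (auto simp: closed_segment_eq_real_ivl split: if_splits)
          then show "\<forall>i<m. \<bar>((mix z j)(j := s)) i - z0 i\<bar> < \<delta>"
            using elim(1) j \<delta> by (fastforce simp: mix_def z_def)
        qed
        have "norm (f ((mix z j)(j := z j)) - f ((mix z j)(j := z0 j)) - (z j - z0 j) *\<^sub>R f' j z0) \<le> e/2 * \<bar>z j - z0 j\<bar>"
        proof (rule partial_increment_bound[where f' = "f' j"])
          show "((\<lambda>t. f ((mix z j)(j := t))) has_vector_derivative f' j ((mix z j)(j := s))) (at s)"
            if "s \<in> closed_segment (z0 j) (z j)" for s
            using der[OF j, of "(mix z j)(j := s)"] inb[OF that] by simp
          show "norm (f' j ((mix z j)(j := s)) - f' j z0) \<le> e/2"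
            if "s \<in> closed_segment (z0 j) (z j)" for s
            using inb[OF that] by (auto simp: dist_norm norm_minus_commute)
        qed
        then have b: "norm (f (mix z (Suc j)) - f (mix z j) - (z j - z0 j) *\<^sub>R f' j z0) \<le> e/2 * \<bar>z j - z0 j\<bar>"
          using mixS[of z j] by simp
        have "q j z - f' j z0 = (1 / (z j - z0 j)) *\<^sub>R (f (mix z (Suc j)) - f (mix z j) - (z j - z0 j) *\<^sub>R f' j z0)"
          using False by (simp add: q_def scaleR_diff_right)
        then have "norm (q j z - f' j z0) = norm (f (mix z (Suc j)) - f (mix z j) - (z j - z0 j) *\<^sub>R f' j z0) / \<bar>z j - z0 j\<bar>"
          by simp
        also have "\<dots> \<le> e/2" using b False by (simp add: divide_le_eq)
        finally show ?thesis using e by (simp add: dist_norm z_def)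
      qed
    qed
  qed
  show ?thesis
    unfolding has_vector_derivative_quotient_iff
  proof (rule Lim_transform_eventually)
    show "((\<lambda>t. \<Sum>j<m. ((\<gamma> t j - z0 j) / (t - t0)) *\<^sub>R q j (\<gamma> t)) \<longlongrightarrow> (\<Sum>j<m. d j *\<^sub>R f' j (\<gamma> t0))) (at t0)"
    proof (intro tendsto_sum tendsto_scaleR)
      fix j assume "j \<in> {..<m}"
      then have j: "j < m" by simp
      show "((\<lambda>t. (\<gamma> t j - z0 j) / (t - t0)) \<longlongrightarrow> d j) (at t0)"
        using d[OF j] unfolding has_vector_derivative_quotient_iff z0_def by simp
      show "((\<lambda>t. q j (\<gamma> t)) \<longlongrightarrow> f' j (\<gamma> t0)) (at t0)"
        using qlim[OF j] by (simp add: z0_def)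
    qed
    show "\<forall>\<^sub>F t in at t0. (\<Sum>j<m. ((\<gamma> t j - z0 j) / (t - t0)) *\<^sub>R q j (\<gamma> t)) = (1 / (t - t0)) *\<^sub>R (f (\<gamma> t) - f (\<gamma> t0))"
      using \<gamma>V(2)
    proof eventually_elim
      case (elim t)
      show ?case
        using exp[OF elim] by (simp add: z0_def[symmetric] scaleR_sum_right)
    qed
  qed
qed

text \<open>\<open>curve_chain_rule\<close> gives the partial derivatives of the composite as sums
  of products of \<open>G' j\<close> with \<open>f' j\<close> composed with \<open>G\<close>, and
  the latter are of order \<open>k\<close> by induction. The coordinates of \<open>G\<close> from
  \<open>m\<close> on vanish, because \<open>V\<close> lies in the Euclidean space; this is needed
  for continuity in the product topology.\<close>

lemma Ck_on_compose:
  fixes f :: "(nat => real) => 'f::real_normed_vector"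
  assumes V: "openin (Euclidean_space m) V" and U: "openin (Euclidean_space n) U"
    and G: "\<And>z. z \<in> U ==> G z \<in> V"
    and sm: "\<And>j. j < m ==> Ck_on k n U (\<lambda>z. G z j)"
    and f: "Ck_on k m V f"
  shows "Ck_on k n U (\<lambda>z. f (G z))"
  using sm f
proof (induction k arbitrary: f)
  case (0 f)
  have cont: "continuous_on U (\<lambda>z. f (G z))" if "\<And>j. j < m ==> continuous_on U (\<lambda>z. G z j)" "continuous_on V f"
    for f :: "(nat => real) => 'f"
  proof -
    have "continuous_on U G"
    proof (rule continuous_on_coordinatewise_then_product)
      fix j
      show "continuous_on U (\<lambda>z. G z j)"
      proof (cases "j < m")
        case False
        then have "G z j = 0" if "z \<in> U" for z
          using G[OF that] openin_subset[OF V] by (auto simp: topspace_Euclidean_space subset_iff)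
        then show ?thesis by (simp cong: continuous_on_cong)
      qed (use that in auto)
    qed
    then show ?thesis
      using that(2) G by (intro continuous_on_compose2[of V f U G]) auto
  qed
  show ?case using 0 unfolding Ck_on_0_iff[OF U] Ck_on_0_iff[OF V] by (intro cont) auto
next
  case (Suc k f)
  have smk: "Ck_on k n U (\<lambda>z. G z j)" if "j < m" for j using Suc.prems(1)[OF that] Ck_on_SucD[OF U] by blast
  have "Ck_on k n U (\<lambda>z. f (G z))"
    using Suc.IH[OF smk] Suc.prems(2) Ck_on_SucD[OF V] by blast
  then have c: "continuous_on U (\<lambda>z. f (G z))" using Ck_on_continuous[OF U] by blast
  obtain f' where f': "\<And>j x. j < m ==> x \<in> V ==> ((\<lambda>t. f (x(j := t))) has_vector_derivative f' j x) (at (x j))"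
    "\<And>j. j < m ==> Ck_on k m V (f' j)"
    using Suc.prems(2) unfolding Ck_on_Suc_iff[OF V] by metis
  have "\<exists>h. (\<forall>x\<in>U. ((\<lambda>t. f (G (x(i := t)))) has_vector_derivative h x) (at (x i))) \<and> Ck_on k n U h"
    if i: "i < n" for i
  proof -
    have "\<exists>g. (\<forall>x\<in>U. ((\<lambda>t. G (x(i := t)) j) has_vector_derivative g x) (at (x i))) \<and> Ck_on k n U g" if "j < m" for j
      using Suc.prems(1)[OF that] i unfolding Ck_on_Suc_iff[OF U] by blast
    then obtain G' where G': "\<And>j x. j < m ==> x \<in> U ==> ((\<lambda>t. G (x(i := t)) j) has_vector_derivative G' j x) (at (x i))"
      "\<And>j. j < m ==> Ck_on k n U (G' j)"
      by metis
    show ?thesis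
    proof (intro exI conjI ballI)
      fix x assume x: "x \<in> U"
      obtain S where S: "open S" "x i \<in> S" "\<forall>t\<in>S. x(i := t) \<in> U"
        using openin_Euclidean_line[OF U x i] by blast
      have "eventually (\<lambda>t. G (x(i := t)) \<in> V) (at (x i))"
        using S G unfolding eventually_at_topological by blast
      then have "((\<lambda>t. f (G (x(i := t)))) has_vector_derivative
          (\<Sum>j<m. G' j x *\<^sub>R f' j (G (x(i := x i))))) (at (x i))"
        using G[OF x] x G'(1)
        by (intro curve_chain_rule[OF V f'(1)] Ck_on_continuous[OF V f'(2)]) (auto simp: fun_upd_triv)
      then show "((\<lambda>t. f (G (x(i := t)))) has_vector_derivative (\<Sum>j<m. G' j x *\<^sub>R f' j (G x))) (at (x i))"
        by simp
    next
      show "Ck_on k n U (\<lambda>x. \<Sum>j<m. G' j x *\<^sub>R f' j (G x))"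
        using G'(2) f'(2) smk
        by (intro Ck_on_sum[OF U] Ck_on_bilinear[OF U bounded_bilinear_scaleR] Suc.IH) auto
    qed
  qed
  then show ?case using c unfolding Ck_on_Suc_iff[OF U] by blast
qed

subsection \<open>Bump functions\<close>

text \<open>The classical functions p(1/t) exp(-1/t), extended by 0 to the left half-line. The
  polynomial is a parameter because the whole family is closed under differentiation.\<close>

definition flat :: "real poly => real => real" where
  "flat p t = (if t \<le> 0 then 0 else poly p (1 / t) * exp (- (1 / t)))"

text \<open>The first factor is X^2: the derivative of 1/t contributes 1/t^2, with sign + from the
  exponential and sign - from the polynomial.\<close>

definition flat_deriv :: "real poly => real poly" where
  "flat_deriv p = [:0, 0, 1:] * (p - pderiv p)"

lemma poly_exp_tendsto_0: "((\<lambda>u. poly p u * exp (- u)) \<longlongrightarrow> (0::real)) at_top"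
proof -
  have "((\<lambda>u. \<Sum>i\<le>degree p. coeff p i * (u ^ i / exp u)) \<longlongrightarrow> (\<Sum>i\<le>degree p. coeff p i * 0)) at_top"
    by (intro tendsto_intros tendsto_power_div_exp_0)
  then show ?thesis by (simp add: poly_altdef exp_minus sum_distrib_right divide_inverse mult.assoc)
qed

lemma flat_tendsto_0: "((\<lambda>t. poly p (1 / t) * exp (- (1 / t))) \<longlongrightarrow> (0::real)) (at_right 0)"
proof -
  have "LIM t at_right (0::real). 1 / t :> at_top"
    using filterlim_inverse_at_top_right by (simp add: inverse_eq_divide)
  from filterlim_compose[OF poly_exp_tendsto_0 this] show ?thesis .
qed

text \<open>At 0 the right-hand difference quotient \<open>flat p h / h\<close> is a function of the
  same form, for the polynomial X p, and hence tends to 0.\<close>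

lemma flat_has_derivative: "(flat p has_real_derivative flat (flat_deriv p) t) (at t)"
proof -
  consider "t < 0" | "t = 0" | "t > 0" by linarith
  then show ?thesis
  proof cases
    case 1
    have "((\<lambda>_. 0) has_real_derivative 0) (at t)" by simp
    moreover have "eventually (\<lambda>s. flat p s = 0) (nhds t)"
      using eventually_nhds_in_open[of "{..<0}" t] 1 by (auto elim: eventually_mono simp: flat_def)
    ultimately show ?thesis
      using DERIV_cong_ev[OF refl, of "flat p" "\<lambda>_. 0"] 1 by (simp add: flat_def)
  next
    case 3
    have d: "((\<lambda>t. 1 / t) has_real_derivative - (1 / t\<^sup>2)) (at t)"
      using 3 by (auto intro!: derivative_eq_intros simp: power2_eq_square)
    have "((\<lambda>t. poly p (1 / t) * exp (- (1 / t))) has_real_derivative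
        poly (pderiv p) (1 / t) * (- (1 / t\<^sup>2)) * exp (- (1 / t)) + exp (- (1 / t)) * (- (- (1 / t\<^sup>2))) * poly p (1 / t)) (at t)"
      by (intro DERIV_mult DERIV_chain2[OF poly_DERIV d] DERIV_chain2[OF DERIV_exp DERIV_minus[OF d]])
    also have "poly (pderiv p) (1 / t) * (- (1 / t\<^sup>2)) * exp (- (1 / t)) + exp (- (1 / t)) * (- (- (1 / t\<^sup>2))) * poly p (1 / t)
        = flat (flat_deriv p) t"
      using 3 by (simp add: flat_def flat_deriv_def power2_eq_square algebra_simps)
    finally have "((\<lambda>t. poly p (1 / t) * exp (- (1 / t))) has_real_derivative flat (flat_deriv p) t) (at t)" .
    moreover have "eventually (\<lambda>s. flat p s = poly p (1 / s) * exp (- (1 / s))) (nhds t)"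
      using eventually_nhds_in_open[of "{0<..}" t] 3 by (auto elim: eventually_mono simp: flat_def)
    ultimately show ?thesis
      using DERIV_cong_ev[OF refl, of "flat p" "\<lambda>t. poly p (1 / t) * exp (- (1 / t))"] by simp
  next
    case 2
    have r: "((\<lambda>h. flat p h / h) \<longlongrightarrow> 0) (at_right 0)"
    proof (rule Lim_transform_eventually[OF flat_tendsto_0[of "[:0, 1:] * p"]])
      show "\<forall>\<^sub>F h in at_right 0. poly ([:0, 1:] * p) (1 / h) * exp (- (1 / h)) = flat p h / h"
        by (auto simp: eventually_at_filter flat_def)
    qed
    have l: "((\<lambda>h. flat p h / h) \<longlongrightarrow> 0) (at_left 0)"
      by (rule tendsto_eventually) (auto simp: eventually_at_filter flat_def)
    have "((\<lambda>h. flat p h / h) \<longlongrightarrow> 0) (at 0)"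
      using l r by (simp add: filterlim_at_split)
    then show ?thesis using 2 by (simp add: DERIV_def flat_def)
  qed
qed

text \<open>The induction leaves \<open>p\<close> arbitrary, since differentiation replaces
  \<open>p\<close> by \<open>flat_deriv p\<close>.\<close>

lemma Ck_on_flat:
  assumes V: "openin (Euclidean_space n) V" and "Ck_on k n V q"
  shows "Ck_on k n V (\<lambda>x. flat p (q x))"
  using assms(2)
proof (induction k arbitrary: p)
  case 0
  have "continuous_on UNIV (flat p)"
    using flat_has_derivative by (meson DERIV_isCont continuous_at_imp_continuous_on)
  then show ?case using 0 continuous_on_compose2 unfolding Ck_on_0_iff[OF V] by blast
next
  case (Suc k)
  have IH: "Ck_on k n V (\<lambda>x. flat p (q x))" for p using Suc.IH Suc.prems Ck_on_SucD[OF V] by blast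
  have "\<exists>h. (\<forall>x\<in>V. ((\<lambda>t. flat p (q (x(i := t)))) has_vector_derivative h x) (at (x i))) \<and> Ck_on k n V h"
    if i: "i < n" for i
  proof -
    obtain q' where q': "\<forall>x\<in>V. ((\<lambda>t. q (x(i := t))) has_vector_derivative q' x) (at (x i))" "Ck_on k n V q'"
      using Suc.prems i unfolding Ck_on_Suc_iff[OF V] by blast
    show ?thesis
    proof (intro exI conjI ballI)
      show "((\<lambda>t. flat p (q (x(i := t)))) has_vector_derivative (flat (flat_deriv p) (q x) * q' x)) (at (x i))"
        if "x \<in> V" for x
        using q'(1) that DERIV_chain'[of "\<lambda>t. q (x(i := t))" "q' x" "x i" UNIV "flat p" "flat (flat_deriv p) (q x)"]
          flat_has_derivative
        by (simp add: has_real_derivative_iff_has_vector_derivative[symmetric] mult.commute)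
      show "Ck_on k n V (\<lambda>x. flat (flat_deriv p) (q x) * q' x)"
        by (rule Ck_on_bilinear[OF V bounded_bilinear_mult IH q'(2)])
    qed
  qed
  then show ?case using Ck_on_continuous[OF V IH] unfolding Ck_on_Suc_iff[OF V] by blast
qed

lemma Ck_on_inverse:
  fixes f :: "(nat => real) => real"
  assumes V: "openin (Euclidean_space n) V" and "Ck_on k n V f" and nz: "\<And>x. x \<in> V ==> f x \<noteq> 0"
  shows "Ck_on k n V (\<lambda>x. inverse (f x))"
  using assms(2)
proof (induction k)
  case 0
  then show ?case using nz unfolding Ck_on_0_iff[OF V] by (auto intro: continuous_on_inverse)
next
  case (Suc k)
  have IH: "Ck_on k n V (\<lambda>x. inverse (f x))" using Suc.IH Suc.prems Ck_on_SucD[OF V] by blast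
  have "\<exists>h. (\<forall>x\<in>V. ((\<lambda>t. inverse (f (x(i := t)))) has_vector_derivative h x) (at (x i))) \<and> Ck_on k n V h"
    if i: "i < n" for i
  proof -
    obtain f' where f': "\<forall>x\<in>V. ((\<lambda>t. f (x(i := t))) has_vector_derivative f' x) (at (x i))" "Ck_on k n V f'"
      using Suc.prems i unfolding Ck_on_Suc_iff[OF V] by blast
    show ?thesis
    proof (intro exI conjI ballI)
      show "((\<lambda>t. inverse (f (x(i := t)))) has_vector_derivative (- 1 * (inverse (f x) * f' x * inverse (f x)))) (at (x i))"
        if "x \<in> V" for x
        using f'(1) that nz[OF that] DERIV_inverse'[of "\<lambda>t. f (x(i := t))" "f' x" "x i" UNIV]
        by (simp add: has_real_derivative_iff_has_vector_derivative[symmetric])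
      show "Ck_on k n V (\<lambda>x. - 1 * (inverse (f x) * f' x * inverse (f x)))"
        by (intro Ck_on_bilinear[OF V bounded_bilinear_mult] IH f'(2) Ck_on_const[OF V])
    qed
  qed
  then show ?case using Ck_on_continuous[OF V IH] unfolding Ck_on_Suc_iff[OF V] by blast
qed

text \<open>With \<open>Q\<close> the squared distance from \<open>a\<close> in the first
  \<open>n\<close> coordinates, \<open>A\<close> is positive exactly for \<open>Q\<close> <
  \<delta>^2 and \<open>B\<close> exactly for \<open>Q\<close> > \<delta>^2/4. Hence
  \<open>A + B\<close> never vanishes, and A / (A + B) is 1 where \<open>Q\<close> \<le>
  \<delta>^2/4 and 0 where \<open>Q\<close> \<ge> \<delta>^2.\<close>

lemma Euclidean_bump:
  fixes a :: "nat => real"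
  assumes "\<delta> > 0"
  shows "\<exists>b r. (\<forall>k. Ck_on k n (topspace (Euclidean_space n)) b) \<and> r > 0 \<and>
    (\<forall>z. (\<forall>i<n. \<bar>z i - a i\<bar> < r) --> b z = (1::real)) \<and>
    (\<forall>z i. b z \<noteq> 0 --> i < n --> \<bar>z i - a i\<bar> < \<delta>)"
proof -
  let ?V = "topspace (Euclidean_space n)"
  have V: "openin (Euclidean_space n) ?V" by simp
  define Q where "Q z = (\<Sum>i<n. (z i + - a i) * (z i + - a i))" for z :: "nat => real"
  define A where "A z = flat 1 (\<delta>\<^sup>2 + - 1 * Q z)" for z
  define B where "B z = flat 1 (Q z + - (\<delta>\<^sup>2 / 4))" for z
  define b where "b z = A z * inverse (A z + B z)" for z
  have Q: "Ck_on k n ?V Q" for k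
    unfolding Q_def
    by (intro Ck_on_sum[OF V] Ck_on_bilinear[OF V bounded_bilinear_mult] Ck_on_add[OF V] Ck_on_proj[OF V] Ck_on_const[OF V])
  have flat_pos: "flat 1 t > 0 \<longleftrightarrow> t > 0" "flat 1 t \<ge> 0" for t by (auto simp: flat_def)
  have pos: "A z + B z > 0" for z
  proof (cases "Q z < \<delta>\<^sup>2")
    case True
    then show ?thesis unfolding A_def B_def using flat_pos by (simp add: add_pos_nonneg)
  next
    case False
    moreover have "\<delta>\<^sup>2 > 0" using assms by simp
    ultimately have "Q z > \<delta>\<^sup>2 / 4" by linarith
    then show ?thesis unfolding A_def B_def using flat_pos by (simp add: add_nonneg_pos)
  qed
  have A: "Ck_on k n ?V A" for k
    unfolding A_def
    by (intro Ck_on_flat[OF V] Ck_on_add[OF V] Ck_on_bilinear[OF V bounded_bilinear_mult] Q Ck_on_const[OF V])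
  have B: "Ck_on k n ?V B" for k
    unfolding B_def by (intro Ck_on_flat[OF V] Ck_on_add[OF V] Q Ck_on_const[OF V])
  have 1: "Ck_on k n ?V b" for k
    unfolding b_def
    by (intro Ck_on_bilinear[OF V bounded_bilinear_mult] Ck_on_inverse[OF V] Ck_on_add[OF V] A B) (simp add: pos[THEN less_imp_neq, symmetric])
  \<comment> \<open>A cube of this half-width lies in the ball of radius \<delta>/2, since n/(n+1)^2
    \<le> 1; the summand 1 in the denominator also covers n = 0.\<close>
  define r where "r = \<delta> / 2 / (real n + 1)"
  have 2: "r > 0" using assms by (simp add: r_def)
  have 3: "b z = 1" if "\<forall>i<n. \<bar>z i - a i\<bar> < r" for z
  proof -
    have "Q z \<le> (\<Sum>i<n. r\<^sup>2)"
      unfolding Q_def power2_eq_square[symmetric]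
      by (rule sum_mono) (use that in \<open>auto intro!: abs_le_square_iff[THEN iffD1] simp: less_imp_le 2\<close>)
    also have "\<dots> = (real n / (real n + 1)\<^sup>2) * (\<delta>\<^sup>2 / 4)"
    proof -
      have "r\<^sup>2 = (\<delta> / 2)\<^sup>2 / (real n + 1)\<^sup>2" by (simp only: r_def power_divide)
      then show ?thesis by (simp add: power_divide)
    qed
    also have "\<dots> \<le> 1 * (\<delta>\<^sup>2 / 4)"
      by (rule mult_right_mono) (auto simp: divide_le_eq power2_eq_square algebra_simps add_pos_nonneg)
    finally have "B z = 0" by (simp add: B_def flat_def)
    then show ?thesis using pos[of z] by (simp add: b_def)
  qed
  have 4: "\<bar>z i - a i\<bar> < \<delta>" if "b z \<noteq> 0" "i < n" for z i
  proof -
    have "A z > 0" using that(1) flat_pos[of "\<delta>\<^sup>2 + - 1 * Q z"] by (auto simp: b_def A_def order_less_le)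
    then have "Q z < \<delta>\<^sup>2" unfolding A_def using flat_pos by simp
    moreover have "(z i + - a i) * (z i + - a i) \<le> Q z"
      unfolding Q_def by (rule member_le_sum) (use that in auto)
    ultimately have "(z i - a i)\<^sup>2 < \<delta>\<^sup>2" by (simp add: power2_eq_square)
    then have "\<bar>z i - a i\<bar>\<^sup>2 < \<delta>\<^sup>2" by simp
    then show ?thesis using assms power2_less_imp_less by fastforce
  qed
  show ?thesis
    by (intro exI[of _ b] exI[of _ r] conjI allI impI 1 2) (use 3 4 in blast)+
qed

section \<open>Smooth functions on manifolds\<close>

subsection \<open>Smooth functions on open subsets of Euclidean space\<close>

lemma smooth_Rn_open: "smooth_Rn n V f ==> openin (Euclidean_space n) V"
  by (simp add: smooth_Rn_def)

lemma smooth_Rn_cong: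
  assumes "\<And>x. x \<in> V ==> f x = g x"
  shows "smooth_Rn n V f \<longleftrightarrow> smooth_Rn n V g"
proof (cases "openin (Euclidean_space n) V")
  case True
  then show ?thesis unfolding smooth_Rn_def using Ck_on_cong[OF True, of f g] assms by simp
qed (simp add: smooth_Rn_def)

lemma smooth_Rn_subset:
  "smooth_Rn n V f ==> openin (Euclidean_space n) W ==> W \<subseteq> V ==> smooth_Rn n W f"
  by (simp add: smooth_Rn_def Ck_on_subset[of n V W])

lemma smooth_Rn_local:
  assumes "\<And>x. x \<in> V ==> \<exists>W. x \<in> W \<and> W \<subseteq> V \<and> smooth_Rn n W f"
  shows "smooth_Rn n V f"
  unfolding smooth_Rn_def
proof (intro conjI allI)
  show V: "openin (Euclidean_space n) V"
  proof (subst openin_subopen, intro ballI)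
    fix x assume "x \<in> V"
    then obtain W where "x \<in> W" "W \<subseteq> V" "smooth_Rn n W f" using assms by blast
    then show "\<exists>T. openin (Euclidean_space n) T \<and> x \<in> T \<and> T \<subseteq> V"
      using smooth_Rn_open[of n W f] by blast
  qed
  show "Ck_on k n V f" for k
  proof (rule Ck_on_local[OF V])
    fix x assume "x \<in> V"
    then obtain W where "x \<in> W" "W \<subseteq> V" "smooth_Rn n W f" using assms by blast
    then show "\<exists>W. openin (Euclidean_space n) W \<and> x \<in> W \<and> W \<subseteq> V \<and> Ck_on k n W f"
      by (intro exI[of _ W]) (simp add: smooth_Rn_def)
  qed
qed

lemma smooth_Rn_const: "openin (Euclidean_space n) V ==> smooth_Rn n V (\<lambda>_. c)"
  by (simp add: smooth_Rn_def)

lemma smooth_Rn_add: "smooth_Rn n V f ==> smooth_Rn n V g ==> smooth_Rn n V (\<lambda>x. f x + g x)"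
  by (simp add: smooth_Rn_def Ck_on_add)

lemma smooth_Rn_mult:
  fixes f g :: "_ => 'f::real_normed_field"
  shows "smooth_Rn n V f ==> smooth_Rn n V g ==> smooth_Rn n V (\<lambda>x. f x * g x)"
  by (simp add: smooth_Rn_def Ck_on_bilinear[OF _ bounded_bilinear_mult])

lemma smooth_Rn_compose:
  assumes "openin (Euclidean_space n) U" "\<And>z. z \<in> U ==> G z \<in> V"
    "\<And>j. j < m ==> smooth_Rn n U (\<lambda>z. G z j)" "smooth_Rn m V f"
  shows "smooth_Rn n U (\<lambda>z. f (G z))"
  using assms unfolding smooth_Rn_def by (auto intro: Ck_on_compose[where V = V and m = m])

subsection \<open>Charts\<close>

context
  fixes X :: "'a manifold"
  assumes X: "is_manifold X"
begin

lemma chart_openin: "(V, \<phi>) \<in> atlas X ==> openin (mtop X) V"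
  using X unfolding is_manifold_def by fast

lemma chart_homeo: "(V, \<phi>) \<in> atlas X ==>
    homeomorphic_map (subtopology (mtop X) V) (subtopology (Euclidean_space (mdim X)) (\<phi> ` V)) \<phi>"
  using X unfolding is_manifold_def by fast

lemma chart_image_openin: "(V, \<phi>) \<in> atlas X ==> openin (Euclidean_space (mdim X)) (\<phi> ` V)"
  using X unfolding is_manifold_def by fast

lemma chart_cover: "x \<in> topspace (mtop X) ==> \<exists>V \<phi>. (V, \<phi>) \<in> atlas X \<and> x \<in> V"
  using X unfolding is_manifold_def by fast

lemma chart_transition: "(U, \<phi>) \<in> atlas X ==> (V, \<psi>) \<in> atlas X ==> i < mdim X ==>
    smooth_Rn (mdim X) (\<phi> ` (U \<inter> V)) (\<lambda>z. \<psi> (inv_into U \<phi> z) i)"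
  using X unfolding is_manifold_def by fast

lemma chart_inj: "(V, \<phi>) \<in> atlas X ==> inj_on \<phi> V"
  using homeomorphic_imp_injective_map[OF chart_homeo] openin_subset[OF chart_openin]
  by (fastforce simp: Int_absorb1)

lemma chart_open:
  assumes "(V, \<phi>) \<in> atlas X" "openin (mtop X) U"
  shows "openin (Euclidean_space (mdim X)) (\<phi> ` (U \<inter> V))"
proof -
  have "openin (subtopology (mtop X) V) (U \<inter> V)"
    using assms(2) by (auto simp: openin_subtopology)
  then have "openin (subtopology (Euclidean_space (mdim X)) (\<phi> ` V)) (\<phi> ` (U \<inter> V))"
    using homeomorphic_imp_open_map[OF chart_homeo[OF assms(1)]] by (simp add: open_map_def)
  then show ?thesis using openin_trans_full[OF _ chart_image_openin[OF assms(1)]] by simp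
qed

lemma chart_preimage_open:
  assumes "(V, \<phi>) \<in> atlas X" "openin (Euclidean_space (mdim X)) W"
  shows "openin (mtop X) {x \<in> V. \<phi> x \<in> W}"
proof -
  have "continuous_map (subtopology (mtop X) V) (subtopology (Euclidean_space (mdim X)) (\<phi> ` V)) \<phi>"
    by (rule homeomorphic_imp_continuous_map[OF chart_homeo[OF assms(1)]])
  then have "continuous_map (subtopology (mtop X) V) (Euclidean_space (mdim X)) \<phi>"
    by (simp add: continuous_map_in_subtopology)
  from openin_continuous_map_preimage[OF this assms(2)]
  have "openin (subtopology (mtop X) V) {x \<in> V. \<phi> x \<in> W}"
    using openin_subset[OF chart_openin[OF assms(1)]] by (simp add: Int_absorb1)
  then show ?thesis using openin_trans_full[OF _ chart_openin[OF assms(1)]] by simp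
qed

lemma chart_inv_continuous:
  assumes "(V, \<phi>) \<in> atlas X"
  shows "continuous_map (subtopology (Euclidean_space (mdim X)) (\<phi> ` V)) (mtop X) (inv_into V \<phi>)"
  unfolding continuous_map_def
proof (intro conjI allI impI)
  have top: "topspace (subtopology (Euclidean_space (mdim X)) (\<phi> ` V)) = \<phi> ` V"
    using openin_subset[OF chart_image_openin[OF assms]] by auto
  show "inv_into V \<phi> \<in> topspace (subtopology (Euclidean_space (mdim X)) (\<phi> ` V)) \<rightarrow> topspace (mtop X)"
    unfolding top using chart_openin[OF assms] openin_subset inv_into_into[of _ \<phi> V] by blast
  fix U assume U: "openin (mtop X) U"
  have "{x \<in> \<phi> ` V. inv_into V \<phi> x \<in> U} = \<phi> ` (U \<inter> V)"
    using inv_into_f_f[OF chart_inj[OF assms]] by auto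
  then show "openin (subtopology (Euclidean_space (mdim X)) (\<phi> ` V))
      {x \<in> topspace (subtopology (Euclidean_space (mdim X)) (\<phi> ` V)). inv_into V \<phi> x \<in> U}"
    unfolding top using chart_open[OF assms U]
    by (auto simp: openin_open_subtopology[OF chart_image_openin[OF assms]])
qed

subsection \<open>Operations on smooth functions\<close>

lemma smooth_on_open: "smooth_on X U f ==> openin (mtop X) U"
  by (simp add: smooth_on_def)

lemma smooth_on_cong:
  assumes "\<And>x. x \<in> U ==> f x = g x"
  shows "smooth_on X U f \<longleftrightarrow> smooth_on X U g"
proof -
  have "smooth_Rn (mdim X) (\<phi> ` (U \<inter> V)) (\<lambda>z. f (inv_into V \<phi> z)) \<longleftrightarrow>
        smooth_Rn (mdim X) (\<phi> ` (U \<inter> V)) (\<lambda>z. g (inv_into V \<phi> z))" if "(V, \<phi>) \<in> atlas X" for V \<phi>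
    by (rule smooth_Rn_cong) (use assms inv_into_f_f[OF chart_inj[OF that]] in auto)
  then show ?thesis unfolding smooth_on_def by fast
qed

lemma smooth_on_subset:
  assumes "smooth_on X U f" "openin (mtop X) W" "W \<subseteq> U"
  shows "smooth_on X W f"
  unfolding smooth_on_def
proof (intro conjI assms(2) ballI, clarify)
  fix V \<phi> assume c: "(V, \<phi>) \<in> atlas X"
  then have "smooth_Rn (mdim X) (\<phi> ` (U \<inter> V)) (\<lambda>z. f (inv_into V \<phi> z))"
    using assms(1) unfolding smooth_on_def by fast
  then show "smooth_Rn (mdim X) (\<phi> ` (W \<inter> V)) (\<lambda>z. f (inv_into V \<phi> z))"
    by (rule smooth_Rn_subset) (use chart_open[OF c assms(2)] assms(3) in auto)
qed

lemma smooth_on_local: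
  assumes "\<And>x. x \<in> U ==> \<exists>W. x \<in> W \<and> W \<subseteq> U \<and> smooth_on X W f"
  shows "smooth_on X U f"
  unfolding smooth_on_def
proof (intro conjI ballI, goal_cases)
  case 1
  show ?case
  proof (subst openin_subopen, intro ballI)
    fix x assume "x \<in> U"
    then obtain W where "x \<in> W" "W \<subseteq> U" "smooth_on X W f" using assms by blast
    then show "\<exists>T. openin (mtop X) T \<and> x \<in> T \<and> T \<subseteq> U"
      using smooth_on_open[of W f] by blast
  qed
next
  case (2 c)
  obtain V \<phi> where c: "c = (V, \<phi>)" by force
  have ch: "(V, \<phi>) \<in> atlas X" using 2 c by simp
  have "smooth_Rn (mdim X) (\<phi> ` (U \<inter> V)) (\<lambda>z. f (inv_into V \<phi> z))"
  proof (rule smooth_Rn_local)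
    fix z assume "z \<in> \<phi> ` (U \<inter> V)"
    then obtain x where x: "x \<in> U" "x \<in> V" "z = \<phi> x" by blast
    obtain W where W: "x \<in> W" "W \<subseteq> U" "smooth_on X W f" using assms[OF x(1)] by blast
    have "smooth_Rn (mdim X) (\<phi> ` (W \<inter> V)) (\<lambda>z. f (inv_into V \<phi> z))"
      using W(3) ch unfolding smooth_on_def by fast
    then show "\<exists>W. z \<in> W \<and> W \<subseteq> \<phi> ` (U \<inter> V) \<and> smooth_Rn (mdim X) W (\<lambda>z. f (inv_into V \<phi> z))"
      by (intro exI[of _ "\<phi> ` (W \<inter> V)"]) (use W x in auto)
  qed
  then show ?case using c by simp
qed

lemma smooth_on_const: "openin (mtop X) U ==> smooth_on X U (\<lambda>_. c)"
  unfolding smooth_on_def using chart_open smooth_Rn_const by fast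

lemma smooth_on_add: "smooth_on X U f ==> smooth_on X U g ==> smooth_on X U (\<lambda>x. f x + g x)"
  unfolding smooth_on_def by (auto intro: smooth_Rn_add)

lemma smooth_on_mult: "smooth_on X U f ==> smooth_on X U g ==> smooth_on X U (\<lambda>x. f x * g x)"
  unfolding smooth_on_def by (auto intro: smooth_Rn_mult)

text \<open>Continuity of smooth functions, in the form in which it separates the values 0 and 1 of
  an idempotent germ in \<open>germ_idempotent\<close>.\<close>

lemma smooth_on_continuous_preimage:
  assumes f: "smooth_on X U f" and "open S"
  shows "openin (mtop X) {x \<in> U. f x \<in> S}"
proof (subst openin_subopen, intro ballI)
  fix x assume "x \<in> {x \<in> U. f x \<in> S}"
  then have x: "x \<in> U" "f x \<in> S" by auto
  have "x \<in> topspace (mtop X)" using smooth_on_open[OF f] x openin_subset by blast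
  then obtain V \<phi> where c: "(V, \<phi>) \<in> atlas X" "x \<in> V" using chart_cover by blast
  let ?E = "Euclidean_space (mdim X)" and ?A = "\<phi> ` (U \<inter> V)" and ?g = "\<lambda>z. f (inv_into V \<phi> z)"
  have "smooth_Rn (mdim X) ?A ?g" using f c unfolding smooth_on_def by fast
  then have A: "openin ?E ?A" and "continuous_on ?A ?g"
    by (auto simp: smooth_Rn_def intro: Ck_on_continuous)
  then have "continuous_map (subtopology ?E ?A) euclidean ?g"
    using continuous_map_Euclidean_iff openin_subset by blast
  then have "openin (subtopology ?E ?A) {z \<in> topspace (subtopology ?E ?A). ?g z \<in> S}"
    by (rule openin_continuous_map_preimage) (use assms(2) in simp)
  then have "openin ?E {z \<in> ?A. ?g z \<in> S}"
    using openin_trans_full[OF _ A] openin_subset[OF A] by (simp add: Int_absorb1)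
  from chart_preimage_open[OF c(1) this]
  have "openin (mtop X) {y \<in> V. \<phi> y \<in> {z \<in> ?A. ?g z \<in> S}}" .
  moreover have "{y \<in> V. \<phi> y \<in> {z \<in> ?A. ?g z \<in> S}} \<subseteq> {x \<in> U. f x \<in> S}"
    using inv_into_f_f[OF chart_inj[OF c(1)]] inj_onD[OF chart_inj[OF c(1)]] by fastforce
  moreover have "x \<in> {y \<in> V. \<phi> y \<in> {z \<in> ?A. ?g z \<in> S}}"
    using x c inv_into_f_f[OF chart_inj[OF c(1)]] by auto
  ultimately show "\<exists>T. openin (mtop X) T \<and> x \<in> T \<and> T \<subseteq> {x \<in> U. f x \<in> S}" by blast
qed

text \<open>In another chart the function is \<open>b\<close> composed with a transition map. This
  carries bump functions from Euclidean space to the manifold.\<close>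

lemma smooth_on_chart_compose:
  assumes c: "(V, \<phi>) \<in> atlas X" and b: "smooth_Rn (mdim X) W b" and W: "openin (mtop X) U" "U \<subseteq> V" "\<phi> ` U \<subseteq> W"
  shows "smooth_on X U (\<lambda>x. b (\<phi> x))"
  unfolding smooth_on_def
proof (intro conjI W(1) ballI, clarify)
  fix V' \<psi> assume c': "(V', \<psi>) \<in> atlas X"
  have o: "openin (Euclidean_space (mdim X)) (\<psi> ` (U \<inter> V'))" by (rule chart_open[OF c' W(1)])
  show "smooth_Rn (mdim X) (\<psi> ` (U \<inter> V')) (\<lambda>z. b (\<phi> (inv_into V' \<psi> z)))"
  proof (rule smooth_Rn_compose[OF o _ _ b])
    show "\<phi> (inv_into V' \<psi> z) \<in> W" if "z \<in> \<psi> ` (U \<inter> V')" for z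
      using that W(3) inv_into_f_f[OF chart_inj[OF c']] by auto
    show "smooth_Rn (mdim X) (\<psi> ` (U \<inter> V')) (\<lambda>z. \<phi> (inv_into V' \<psi> z) j)" if "j < mdim X" for j
      by (rule smooth_Rn_subset[OF chart_transition[OF c' c that] o]) (use W(2) in auto)
  qed
qed

end

lemma smooth_map_on_preimage_open:
  assumes g: "smooth_map_on X U Y g" and W: "openin (mtop Y) W"
  shows "openin (mtop X) {x \<in> U. g x \<in> W}"
proof -
  have U: "openin (mtop X) U" and c: "continuous_map (subtopology (mtop X) U) (mtop Y) g"
    using g by (auto simp: smooth_map_on_def)
  have "openin (subtopology (mtop X) U) {x \<in> topspace (subtopology (mtop X) U). g x \<in> W}"
    by (rule openin_continuous_map_preimage[OF c W])
  then show ?thesis using openin_trans_full[OF _ U] openin_subset[OF U] by (simp add: Int_absorb1)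
qed

text \<open>Locally a chart of \<open>Y\<close> around \<open>g x\<close> is inserted between
  \<open>g\<close> and \<open>f\<close>; the two coordinate expressions then compose by the chain
  rule.\<close>

lemma smooth_on_pullback:
  assumes X: "is_manifold X" and Y: "is_manifold Y"
    and g: "smooth_map_on X U Y g" and f: "smooth_on Y W f"
  shows "smooth_on X {x \<in> U. g x \<in> W} (\<lambda>x. f (g x))"
  unfolding smooth_on_def
proof (intro conjI ballI, goal_cases)
  case 1
  show ?case by (rule smooth_map_on_preimage_open[OF g smooth_on_open[OF Y f]])
next
  case (2 c)
  obtain V \<phi> where cc: "c = (V, \<phi>)" by force
  have c: "(V, \<phi>) \<in> atlas X" using 2 cc by simp
  have "smooth_Rn (mdim X) (\<phi> ` ({x \<in> U. g x \<in> W} \<inter> V)) (\<lambda>z. f (g (inv_into V \<phi> z)))"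
  proof (rule smooth_Rn_local)
    fix z assume "z \<in> \<phi> ` ({x \<in> U. g x \<in> W} \<inter> V)"
    then obtain x where x: "x \<in> U" "g x \<in> W" "x \<in> V" "z = \<phi> x" by blast
    have "g x \<in> topspace (mtop Y)" using smooth_on_open[OF Y f] x openin_subset by blast
    then obtain V' \<psi> where c': "(V', \<psi>) \<in> atlas Y" "g x \<in> V'" using chart_cover[OF Y] by blast
    let ?A = "\<phi> ` ({x \<in> U. g x \<in> W \<inter> V'} \<inter> V)"
    have oA: "openin (Euclidean_space (mdim X)) ?A"
      by (intro chart_open[OF X c] smooth_map_on_preimage_open[OF g] openin_Int
          smooth_on_open[OF Y f] chart_openin[OF Y c'(1)])
    have fY: "smooth_Rn (mdim Y) (\<psi> ` (W \<inter> V')) (\<lambda>z. f (inv_into V' \<psi> z))"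
      using f c'(1) unfolding smooth_on_def by fast
    have "smooth_Rn (mdim X) ?A (\<lambda>z. f (inv_into V' \<psi> (\<psi> (g (inv_into V \<phi> z)))))"
    proof (rule smooth_Rn_compose[OF oA _ _ fY])
      show "\<psi> (g (inv_into V \<phi> z)) \<in> \<psi> ` (W \<inter> V')" if "z \<in> ?A" for z
        using that inv_into_f_f[OF chart_inj[OF X c]] by auto
      show "smooth_Rn (mdim X) ?A (\<lambda>z. \<psi> (g (inv_into V \<phi> z)) j)" if "j < mdim Y" for j
      proof (rule smooth_Rn_subset[OF _ oA])
        show "smooth_Rn (mdim X) (\<phi> ` (U \<inter> V \<inter> g -` V')) (\<lambda>z. \<psi> (g (inv_into V \<phi> z)) j)"
          using g c c'(1) that unfolding smooth_map_on_def by fast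
      qed auto
    qed
    also have "smooth_Rn (mdim X) ?A (\<lambda>z. f (inv_into V' \<psi> (\<psi> (g (inv_into V \<phi> z))))) \<longleftrightarrow>
        smooth_Rn (mdim X) ?A (\<lambda>z. f (g (inv_into V \<phi> z)))"
      by (rule smooth_Rn_cong)
         (use inv_into_f_f[OF chart_inj[OF X c]] inv_into_f_f[OF chart_inj[OF Y c'(1)]] in auto)
    finally show "\<exists>A. z \<in> A \<and> A \<subseteq> \<phi> ` ({x \<in> U. g x \<in> W} \<inter> V) \<and>
        smooth_Rn (mdim X) A (\<lambda>z. f (g (inv_into V \<phi> z)))"
      by (intro exI[of _ ?A]) (use x c' in auto)
  qed
  then show ?case using cc by simp
qed

subsection \<open>Germs\<close>

lemma germ_eq_iff:
  assumes "x \<in> topspace (mtop X)"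
  shows "germ X x f = germ X x g \<longleftrightarrow> (\<exists>U. openin (mtop X) U \<and> x \<in> U \<and> (\<forall>y\<in>U. f y = g y))"
    (is "?l \<longleftrightarrow> ?r")
proof
  assume ?l
  moreover have "f \<in> germ X x f" using assms by (auto simp: germ_def)
  ultimately show ?r by (auto simp: germ_def)
next
  have *: "germ X x f \<subseteq> germ X x g" if r: "\<exists>U. openin (mtop X) U \<and> x \<in> U \<and> (\<forall>y\<in>U. f y = g y)" for f g :: "'a => 'b"
  proof
    fix h assume "h \<in> germ X x f"
    then obtain V where V: "openin (mtop X) V" "x \<in> V" "\<forall>y\<in>V. h y = f y" by (auto simp: germ_def)
    obtain U where U: "openin (mtop X) U" "x \<in> U" "\<forall>y\<in>U. f y = g y" using r by blast
    have "openin (mtop X) (U \<inter> V)" using U V by blast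
    then show "h \<in> germ X x g" unfolding germ_def using U V by auto
  qed
  assume ?r
  then have "\<exists>U. openin (mtop X) U \<and> x \<in> U \<and> (\<forall>y\<in>U. g y = f y)" by metis
  with \<open>?r\<close> * show ?l by blast
qed

lemma germ_eqI:
  assumes "openin (mtop X) U" "x \<in> U" "\<And>y. y \<in> U ==> f y = g y"
  shows "germ X x f = germ X x g"
proof -
  have "x \<in> topspace (mtop X)" using assms openin_subset by blast
  then show ?thesis using assms by (auto simp: germ_eq_iff)
qed

lemma germ_outside: "x \<notin> topspace (mtop X) ==> germ X x f = {}"
  using openin_subset by (fastforce simp: germ_def)

lemma germ_mem: "x \<in> topspace (mtop X) ==> f \<in> germ X x f"
  by (auto simp: germ_def)

lemma germ_mem_eq: "g \<in> germ X x f ==> germ X x g = germ X x f"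
  by (auto simp: germ_def intro: germ_eqI)

lemma germ_value: "x \<in> topspace (mtop X) ==> germ X x f = germ X x g ==> f x = g x"
  by (auto simp: germ_eq_iff)

lemma germ_op_germ: "germ_op X x h (germ X x f) (germ X x g) = germ X x (\<lambda>y. h (f y) (g y))"
proof (cases "x \<in> topspace (mtop X)")
  case True
  have "germ X x (\<lambda>y. h (f' y) (g' y)) = germ X x (\<lambda>y. h (f y) (g y))"
    if "f' \<in> germ X x f" "g' \<in> germ X x g" for f' g'
  proof -
    obtain U where U: "openin (mtop X) U" "x \<in> U" "\<forall>y\<in>U. f' y = f y" using \<open>f' \<in> _\<close> by (auto simp: germ_def)
    obtain V where V: "openin (mtop X) V" "x \<in> V" "\<forall>y\<in>V. g' y = g y" using \<open>g' \<in> _\<close> by (auto simp: germ_def)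
    show ?thesis by (rule germ_eqI[where U = "U \<inter> V"]) (use U V in auto)
  qed
  then show ?thesis unfolding germ_op_def using germ_mem[OF True, of f] germ_mem[OF True, of g] by blast
qed (simp add: germ_op_def germ_outside)

lemma germ_cong2:
  fixes h :: "'b => 'b => 'b"
  assumes "germ X x f = germ X x f'" "germ X x g = germ X x g'"
  shows "germ X x (\<lambda>y. h (f y) (g y)) = germ X x (\<lambda>y. h (f' y) (g' y))"
  using assms germ_op_germ[of X x h f g] germ_op_germ[of X x h f' g'] by simp

subsection \<open>Functions with compact support\<close>

text \<open>Compact subsets of a Hausdorff \<open>U\<close> are closed in \<open>U\<close>. Hence
  compactness of the closed support amounts to the existence of some compact subset of
  \<open>U\<close> off which \<open>f\<close> vanishes, a condition that is easily combined for
  several functions.\<close>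

lemma Cc_iff:
  assumes U: "openin (mtop X) U" and H: "Hausdorff_space (subtopology (mtop X) U)"
  shows "f \<in> Cc X U \<longleftrightarrow> smooth_on X U f \<and> (\<exists>K. compactin (mtop X) K \<and> K \<subseteq> U \<and> (\<forall>x. x \<notin> K --> f x = 0))"
    (is "?l \<longleftrightarrow> ?r")
proof
  let ?K = "subtopology (mtop X) U closure_of {x \<in> U. f x \<noteq> 0}"
  have top: "topspace (subtopology (mtop X) U) = U" using openin_subset[OF U] by auto
  assume ?l
  then have "smooth_on X U f" "compactin (mtop X) ?K" "\<forall>x. x \<notin> U --> f x = 0" by (auto simp: Cc_def)
  moreover have "?K \<subseteq> U" using closure_of_subset_topspace[of "subtopology (mtop X) U"] top by auto
  moreover have "{x \<in> U. f x \<noteq> 0} \<subseteq> ?K" by (rule closure_of_subset) (use openin_subset[OF U] in auto)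
  ultimately show ?r by (intro conjI exI[of _ ?K]) auto
next
  assume ?r
  then obtain K where f: "smooth_on X U f" and K: "compactin (mtop X) K" "K \<subseteq> U" "\<forall>x. x \<notin> K --> f x = 0" by blast
  let ?K = "subtopology (mtop X) U closure_of {x \<in> U. f x \<noteq> 0}"
  have cK: "compactin (subtopology (mtop X) U) K" using K by (simp add: compactin_subtopology)
  have "?K \<subseteq> K"
    by (rule closure_of_minimal) (use K compactin_imp_closedin[OF H cK] in auto)
  then have "compactin (subtopology (mtop X) U) ?K"
    using closed_compactin[OF cK] by simp
  then show ?l using f K by (auto simp: Cc_def compactin_subtopology)
qed

lemma carrier_Cc_ring [simp]: "carrier (Cc_ring X) = Cc X (topspace (mtop X))"
  and mult_Cc_ring [simp]: "f \<otimes>\<^bsub>Cc_ring X\<^esub> g = (\<lambda>x. f x * g x)"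
  and add_Cc_ring [simp]: "f \<oplus>\<^bsub>Cc_ring X\<^esub> g = (\<lambda>x. f x + g x)"
  and zero_Cc_ring [simp]: "\<zero>\<^bsub>Cc_ring X\<^esub> = (\<lambda>x. 0)"
  by (simp_all add: Cc_ring_def)

section \<open>Compactly supported functions and bump functions on a Hausdorff manifold\<close>

locale Hausdorff_manifold =
  fixes M :: "'m manifold"
  assumes mfd: "is_manifold M" and Hausd: "Hausdorff_space (mtop M)"
begin

abbreviation "TM \<equiv> topspace (mtop M)"
abbreviation "RM \<equiv> Cc_ring M"

lemma Cc_open_iff:
  assumes U: "openin (mtop M) U"
  shows "f \<in> Cc M U \<longleftrightarrow> smooth_on M U f \<and> (\<exists>K. compactin (mtop M) K \<and> K \<subseteq> U \<and> (\<forall>x. x \<notin> K --> f x = 0))"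
  by (rule Cc_iff[OF U Hausdorff_space_subtopology[OF Hausd]])

lemma Cc_imp_open: "f \<in> Cc M U ==> openin (mtop M) U"
  using smooth_on_open[OF mfd] by (auto simp: Cc_def)

text \<open>As \<open>M\<close> is Hausdorff, the complement of the compact set \<open>K\<close> is
  open; \<open>f\<close> vanishes there, and this complement together with \<open>U\<close> covers
  the manifold.\<close>

lemma Cc_smooth_on_top:
  fixes f :: "'m => 'f::real_normed_field"
  assumes "f \<in> Cc M U"
  shows "smooth_on M TM f"
proof -
  have U: "openin (mtop M) U" by (rule Cc_imp_open[OF assms])
  obtain K where f: "smooth_on M U f" and K: "compactin (mtop M) K" "K \<subseteq> U" "\<forall>x. x \<notin> K --> f x = 0"
    using assms Cc_open_iff[OF U] by blast
  have cl: "openin (mtop M) (TM - K)"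
    using compactin_imp_closedin[OF Hausd K(1)] by (simp add: openin_diff)
  have "smooth_on M (TM - K) f \<longleftrightarrow> smooth_on M (TM - K) (\<lambda>_. 0::'f)"
    by (rule smooth_on_cong[OF mfd]) (use K in auto)
  then have z: "smooth_on M (TM - K) f" using smooth_on_const[OF mfd cl] by blast
  show ?thesis
  proof (rule smooth_on_local[OF mfd])
    fix x assume "x \<in> TM"
    show "\<exists>W. x \<in> W \<and> W \<subseteq> TM \<and> smooth_on M W f"
    proof (cases "x \<in> K")
      case True
      then show ?thesis using f K(2) openin_subset[OF U] by (intro exI[of _ U]) auto
    next
      case False
      then show ?thesis using z \<open>x \<in> TM\<close> by (intro exI[of _ "TM - K"]) auto
    qed
  qed
qed

lemma Cc_iff_support:
  assumes U: "openin (mtop M) U"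
  shows "f \<in> Cc M U \<longleftrightarrow> smooth_on M TM f \<and> (\<exists>K. compactin (mtop M) K \<and> K \<subseteq> U \<and> (\<forall>x. x \<notin> K --> f x = 0))"
proof
  assume "f \<in> Cc M U"
  then show "smooth_on M TM f \<and> (\<exists>K. compactin (mtop M) K \<and> K \<subseteq> U \<and> (\<forall>x. x \<notin> K --> f x = 0))"
    using Cc_open_iff[OF U, of f] Cc_smooth_on_top[of f U] by simp
next
  assume "smooth_on M TM f \<and> (\<exists>K. compactin (mtop M) K \<and> K \<subseteq> U \<and> (\<forall>x. x \<notin> K --> f x = 0))"
  then show "f \<in> Cc M U"
    using Cc_open_iff[OF U, of f] smooth_on_subset[OF mfd _ U openin_subset[OF U], of f] by simp
qed

lemma Cc_mono:
  assumes f: "f \<in> Cc M U" and W: "openin (mtop M) W" "U \<subseteq> W"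
  shows "f \<in> Cc M W"
proof -
  obtain K where "smooth_on M TM f" "compactin (mtop M) K" "K \<subseteq> U" "\<forall>x. x \<notin> K --> f x = 0"
    using f unfolding Cc_iff_support[OF Cc_imp_open[OF f]] by blast
  then show ?thesis unfolding Cc_iff_support[OF W(1)] using W(2) by (intro conjI exI[of _ K]) auto
qed

lemma Cc_in_ring: "f \<in> Cc M U ==> f \<in> Cc M TM"
  by (rule Cc_mono[OF _ openin_topspace openin_subset[OF Cc_imp_open]])

lemma Cc_outside: "f \<in> Cc M U ==> x \<notin> U ==> f x = 0"
  by (simp add: Cc_def)

lemma Cc_add:
  assumes "f \<in> Cc M U" "g \<in> Cc M U"
  shows "(\<lambda>x. f x + g x) \<in> Cc M U"
proof -
  have U: "openin (mtop M) U" by (rule Cc_imp_open[OF assms(1)])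
  obtain K where "smooth_on M TM f" "compactin (mtop M) K" "K \<subseteq> U" "\<forall>x. x \<notin> K --> f x = 0"
    using assms(1) unfolding Cc_iff_support[OF U] by blast
  moreover obtain L where "smooth_on M TM g" "compactin (mtop M) L" "L \<subseteq> U" "\<forall>x. x \<notin> L --> g x = 0"
    using assms(2) unfolding Cc_iff_support[OF U] by blast
  ultimately show ?thesis unfolding Cc_iff_support[OF U]
    by (intro conjI smooth_on_add[OF mfd] exI[of _ "K \<union> L"] compactin_Un) auto
qed

lemma Cc_smooth_mult:
  assumes "smooth_on M TM p" "f \<in> Cc M U"
  shows "(\<lambda>x. p x * f x) \<in> Cc M U"
proof -
  have U: "openin (mtop M) U" by (rule Cc_imp_open[OF assms(2)])
  obtain K where "smooth_on M TM f" "compactin (mtop M) K" "K \<subseteq> U" "\<forall>x. x \<notin> K --> f x = 0"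
    using assms(2) unfolding Cc_iff_support[OF U] by blast
  then show ?thesis unfolding Cc_iff_support[OF U]
    by (intro conjI smooth_on_mult[OF mfd] assms(1) exI[of _ K]) auto
qed

lemma Cc_mult: "p \<in> Cc M W ==> f \<in> Cc M U ==> (\<lambda>x. p x * f x) \<in> Cc M U"
  by (rule Cc_smooth_mult[OF Cc_smooth_on_top])

lemma Cc_mult_right: "f \<in> Cc M U ==> p \<in> Cc M W ==> (\<lambda>x. f x * p x) \<in> Cc M U"
  using Cc_mult[of p W f U] by (simp add: mult.commute)

lemma Cc_scale: "f \<in> Cc M U ==> (\<lambda>x. a * f x) \<in> Cc M U"
  by (rule Cc_smooth_mult[OF smooth_on_const[OF mfd openin_topspace]])

lemma Cc_uminus: "f \<in> Cc M U ==> (\<lambda>x. - f x) \<in> Cc M U"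
  using Cc_scale[of f U "- 1"] by simp

lemma Cc_diff: "f \<in> Cc M U ==> g \<in> Cc M U ==> (\<lambda>x. f x - g x) \<in> Cc M U"
  using Cc_add[OF _ Cc_uminus, of f U g] by simp

lemma Cc_zero: "openin (mtop M) U ==> (\<lambda>_. 0) \<in> Cc M U"
  unfolding Cc_iff_support by (intro conjI smooth_on_const[OF mfd openin_topspace] exI[of _ "{}"]) auto

lemma Cc_germ_zero:
  assumes f: "f \<in> Cc M U" and x: "x \<in> TM" "x \<notin> U"
  shows "germ M x f = germ0 M x"
proof -
  obtain K where K: "compactin (mtop M) K" "K \<subseteq> U" "\<forall>x. x \<notin> K --> f x = 0"
    using f unfolding Cc_iff_support[OF Cc_imp_open[OF f]] by blast
  have "openin (mtop M) (TM - K)"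
    using compactin_imp_closedin[OF Hausd K(1)] by (simp add: openin_diff)
  then show ?thesis by (rule germ_eqI) (use K x in auto)
qed

text \<open>A Euclidean bump function of radius d/2 is pulled back along a chart and extended by
  zero. The closed cube of half-width d/2 lies in the image of \<open>U \<inter> V\<close>, and its
  preimage is a compact set off which the result vanishes.\<close>

lemma bump:
  assumes U: "openin (mtop M) U" and x: "x \<in> U"
  obtains h :: "'m => 'f::real_normed_field" where "h \<in> Cc M U" "germ M x h = germ1 M x"
proof -
  define n where "n = mdim M"
  have "x \<in> TM" using U x openin_subset by blast
  then obtain V \<phi> where c: "(V, \<phi>) \<in> atlas M" "x \<in> V" using chart_cover[OF mfd] by blast
  have A: "openin (Euclidean_space n) (\<phi> ` (U \<inter> V))"
    unfolding n_def by (rule chart_open[OF mfd c(1) U])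
  have "\<phi> x \<in> \<phi> ` (U \<inter> V)" using x c by blast
  from openin_Euclidean_box[OF A this] obtain d where d: "d > 0" and
    box: "\<And>z. z \<in> topspace (Euclidean_space n) ==> \<forall>i<n. \<bar>z i - \<phi> x i\<bar> < d ==> z \<in> \<phi> ` (U \<inter> V)"
    by blast
  have d2: "d / 2 > 0" using d by simp
  obtain b r where b': "(\<forall>k. Ck_on k n (topspace (Euclidean_space n)) b) \<and> r > 0 \<and>
    (\<forall>z. (\<forall>i<n. \<bar>z i - \<phi> x i\<bar> < r) --> b z = (1::real)) \<and>
    (\<forall>z i. b z \<noteq> 0 --> i < n --> \<bar>z i - \<phi> x i\<bar> < d / 2)"
    using Euclidean_bump[OF d2, of n "\<phi> x"] by (elim exE) (rule that)
  note b = conjunct1[OF b', THEN spec] conjunct1[OF conjunct2[OF b']]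
    conjunct1[OF conjunct2[OF conjunct2[OF b']], THEN spec, THEN mp]
    conjunct2[OF conjunct2[OF conjunct2[OF b']], THEN spec, THEN spec, THEN mp, THEN mp]
  \<comment> \<open>The factors {0} from \<open>n\<close> on place this product of compact intervals
    inside the Euclidean space; its compactness is Tychonoff's theorem.\<close>
  define K0 where "K0 = Pi\<^sub>E UNIV (\<lambda>i. if i < n then {\<phi> x i - d/2 .. \<phi> x i + d/2} else {0})"
  have K0_iff: "z \<in> K0 \<longleftrightarrow> (\<forall>i. z i \<in> (if i < n then {\<phi> x i - d/2 .. \<phi> x i + d/2} else {0}))" for z
    by (simp only: K0_def PiE_def Pi_def extensional_def Int_iff mem_Collect_eq) blast
  have K0t: "z \<in> topspace (Euclidean_space n)" if "z \<in> K0" for z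
  proof -
    have "z i = 0" if "i \<ge> n" for i
      using spec[OF iffD1[OF K0_iff \<open>z \<in> K0\<close>], of i] that by simp
    then show ?thesis by (simp add: topspace_Euclidean_space)
  qed
  have "compactin (powertop_real UNIV) K0"
    unfolding K0_def compactin_PiE by simp
  then have K0c: "compactin (Euclidean_space n) K0"
    using K0t unfolding Euclidean_space_def by (auto simp: compactin_subtopology)
  have K0sub: "K0 \<subseteq> \<phi> ` (U \<inter> V)"
  proof
    fix z assume z: "z \<in> K0"
    have "\<bar>z i - \<phi> x i\<bar> < d" if "i < n" for i
    proof -
      have "z i \<in> {\<phi> x i - d/2 .. \<phi> x i + d/2}"
        using spec[OF iffD1[OF K0_iff z], of i] that by simp
      then show ?thesis using d by (auto simp: abs_if)
    qed
    then show "z \<in> \<phi> ` (U \<inter> V)" using box z K0t by blast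
  qed
  define K where "K = inv_into V \<phi> ` K0"
  have "compactin (subtopology (Euclidean_space n) (\<phi> ` V)) K0"
    using K0c K0sub by (auto simp: compactin_subtopology)
  then have Kc: "compactin (mtop M) K"
    unfolding K_def n_def by (rule image_compactin[OF _ chart_inv_continuous[OF mfd c(1)]])
  have KUV: "K \<subseteq> U \<inter> V"
    unfolding K_def using K0sub inv_into_f_f[OF chart_inj[OF mfd c(1)]] by auto
  define h where "h y = (if y \<in> U \<inter> V then of_real (b (\<phi> y)) else (0::'f))" for y
  have oUV: "openin (mtop M) (U \<inter> V)" using U chart_openin[OF mfd c(1)] by blast
  have hK: "h y = 0" if "y \<notin> K" for y
  proof (rule ccontr)
    assume "h y \<noteq> 0"
    then have y: "y \<in> U \<inter> V" "b (\<phi> y) \<noteq> 0" by (auto simp: h_def split: if_splits)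
    have "\<phi> y \<in> K0"
    proof -
      have t: "\<phi> y \<in> topspace (Euclidean_space n)" using y A openin_subset by blast
      have "\<phi> y i \<in> {\<phi> x i - d/2 .. \<phi> x i + d/2}" if "i < n" for i
      proof -
        have "\<bar>\<phi> y i - \<phi> x i\<bar> < d / 2" using b(4)[OF y(2) that] .
        then show ?thesis unfolding atLeastAtMost_iff abs_less_iff by linarith
      qed
      then show ?thesis using t unfolding K0_iff topspace_Euclidean_space by simp
    qed
    then have "y \<in> K" unfolding K_def using inv_into_f_f[OF chart_inj[OF mfd c(1)]] y by force
    with that show False by simp
  qed
  have "smooth_Rn n (topspace (Euclidean_space n)) (\<lambda>z. of_real (b z) :: 'f)"
    unfolding smooth_Rn_def using b(1) Ck_on_bounded_linear[OF _ bounded_linear_of_real] by blast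
  then have "smooth_on M (U \<inter> V) (\<lambda>y. of_real (b (\<phi> y)) :: 'f)"
    unfolding n_def
    by (rule smooth_on_chart_compose[OF mfd c(1) _ oUV]) (use A openin_subset n_def in auto)
  also have "smooth_on M (U \<inter> V) (\<lambda>y. of_real (b (\<phi> y)) :: 'f) \<longleftrightarrow> smooth_on M (U \<inter> V) h"
    by (rule smooth_on_cong[OF mfd]) (simp add: h_def)
  finally have "h \<in> Cc M (U \<inter> V)"
    unfolding Cc_open_iff[OF oUV] using Kc KUV hK by blast
  then have h: "h \<in> Cc M U" using Cc_mono[OF _ U] by blast
  define B where "B = {z \<in> topspace (Euclidean_space n). \<forall>i<n. z i \<in> {\<phi> x i - r <..< \<phi> x i + r}}"
  have "open (Pi\<^sub>E UNIV (\<lambda>i. if i < n then {\<phi> x i - r <..< \<phi> x i + r} else UNIV))"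
    by (rule open_PiE) auto
  moreover have PE: "z \<in> Pi\<^sub>E UNIV (\<lambda>i. if i < n then {\<phi> x i - r <..< \<phi> x i + r} else UNIV) \<longleftrightarrow>
      (\<forall>i<n. z i \<in> {\<phi> x i - r <..< \<phi> x i + r})" for z
    unfolding PiE_def Pi_def extensional_def
    by (simp only: Int_iff mem_Collect_eq) (metis UNIV_I)
  have "B = Pi\<^sub>E UNIV (\<lambda>i. if i < n then {\<phi> x i - r <..< \<phi> x i + r} else UNIV) \<inter> topspace (Euclidean_space n)"
    unfolding B_def set_eq_iff Int_iff PE by (simp add: conj_commute)
  ultimately have oB: "openin (Euclidean_space n) B" unfolding openin_Euclidean_iff by metis
  have "openin (mtop M) (U \<inter> {y \<in> V. \<phi> y \<in> B})"
    using U chart_preimage_open[OF mfd c(1)] oB unfolding n_def by blast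
  then have "germ M x h = germ1 M x"
  proof (rule germ_eqI)
    show "x \<in> U \<inter> {y \<in> V. \<phi> y \<in> B}"
      using x c b(2) A openin_subset by (fastforce simp: B_def)
    fix y assume y: "y \<in> U \<inter> {y \<in> V. \<phi> y \<in> B}"
    have "\<bar>\<phi> y i - \<phi> x i\<bar> < r" if "i < n" for i
      using y that by (auto simp: B_def abs_less_iff)
    then have "b (\<phi> y) = 1" using b(3) by blast
    then show "h y = 1" using y by (simp add: h_def)
  qed
  with h show ?thesis by (rule that)
qed

text \<open>
  Functions \<open>h\<^sub>i\<close> equal to \<open>1\<close> near the points of a compact set combine to \<open>1 - \<Prod>(1 - h\<^sub>i)\<close>.
\<close>

lemma compact_bump:
  assumes U: "openin (mtop M) U" and K: "compactin (mtop M) K" "K \<subseteq> U"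
  obtains h :: "'m => 'f::real_normed_field" where "h \<in> Cc M U" "\<And>x. x \<in> K ==> germ M x h = germ1 M x"
proof -
  have "\<exists>W h. openin (mtop M) W \<and> x \<in> W \<and> h \<in> Cc M U \<and> (\<forall>y\<in>W. (h y :: 'f) = 1)" if "x \<in> K" for x
  proof -
    have x: "x \<in> U" "x \<in> TM" using that K U openin_subset by blast+
    obtain h :: "'m => 'f" where "h \<in> Cc M U" "germ M x h = germ1 M x"
      using bump[OF U x(1)] by blast
    then show ?thesis using x(2) by (auto simp: germ_eq_iff)
  qed
  then obtain W h where W: "\<And>x. x \<in> K ==> openin (mtop M) (W x)" "\<And>x. x \<in> K ==> x \<in> W x"
    "\<And>x. x \<in> K ==> h x \<in> Cc M U" "\<And>x y. x \<in> K ==> y \<in> W x ==> (h x y :: 'f) = 1"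
    by metis
  have "\<exists>\<F>. finite \<F> \<and> \<F> \<subseteq> W ` K \<and> K \<subseteq> \<Union>\<F>"
    by (rule compactinD[OF K(1)]) (use W in auto)
  then obtain S where S: "finite S" "S \<subseteq> K" "K \<subseteq> (\<Union>x\<in>S. W x)"
    by (metis finite_subset_image)
  have "\<exists>g. g \<in> Cc M U \<and> (\<forall>y\<in>(\<Union>x\<in>S. W x). (g y :: 'f) = 1)"
    using S(1,2)
  proof (induction S rule: finite_induct)
    case empty
    then show ?case using Cc_zero[OF U] by auto
  next
    case (insert x S)
    then obtain g where g: "g \<in> Cc M U" "\<forall>y\<in>(\<Union>x\<in>S. W x). (g y :: 'f) = 1" by auto
    have hx: "h x \<in> Cc M U" using W insert by auto
    have "(\<lambda>y. (g y + h x y) - g y * h x y) \<in> Cc M U"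
      by (intro Cc_diff Cc_add Cc_mult[OF g(1)] g(1) hx)
    moreover have "\<forall>y\<in>(\<Union>x\<in>insert x S. W x). (g y + h x y) - g y * h x y = 1"
      using g(2) W(4)[of x] insert.prems by auto
    ultimately show ?case by blast
  qed
  then obtain g where g: "g \<in> Cc M U" "\<forall>y\<in>(\<Union>x\<in>S. W x). (g y :: 'f) = 1" by blast
  show ?thesis
  proof (rule that[OF g(1)])
    fix x assume "x \<in> K"
    then obtain z where "z \<in> S" "x \<in> W z" using S by blast
    then show "germ M x g = germ1 M x"
      using S W by (intro germ_eqI[where U = "W z"]) (use g in auto)
  qed
qed

text \<open>Later \<open>h\<close> serves as the unit \<eta> in the formula for the
  comultiplication, and it yields weakly grouplike elements that are normalized on a prescribed
  support.\<close>

lemma Cc_support_bump: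
  assumes "f \<in> Cc M U"
  obtains h :: "'m => 'f::real_normed_field" where "h \<in> Cc M U"
    "\<And>x. x \<in> supp M f ==> germ M x h = germ1 M x" "\<And>x. f x \<noteq> 0 ==> h x = 1"
proof -
  have U: "openin (mtop M) U" by (rule Cc_imp_open[OF assms])
  obtain K where K: "compactin (mtop M) K" "K \<subseteq> U" "\<forall>x. x \<notin> K --> f x = 0"
    using assms unfolding Cc_iff_support[OF U] by blast
  obtain h :: "'m => 'f" where h: "h \<in> Cc M U" "\<And>x. x \<in> K ==> germ M x h = germ1 M x"
    using compact_bump[OF U K(1,2)] by blast
  have sK: "supp M f \<subseteq> K"
    unfolding supp_def by (rule closure_of_minimal) (use K compactin_imp_closedin[OF Hausd K(1)] in auto)
  show ?thesis
  proof (rule that[OF h(1)])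
    show "h x = 1" if "f x \<noteq> 0" for x
    proof -
      have "x \<in> K" using that K by blast
      moreover have "x \<in> TM" using \<open>x \<in> K\<close> K U openin_subset by blast
      ultimately show ?thesis using germ_value[OF _ h(2)] by simp
    qed
    show "germ M x h = germ1 M x" if "x \<in> supp M f" for x
      by (rule h(2)[OF subsetD[OF sK that]])
  qed
qed

lemma supp_subset_Cc:
  assumes f: "f \<in> Cc M TM" and U: "openin (mtop M) U" "supp M f \<subseteq> U"
  shows "f \<in> Cc M U"
proof -
  have s: "smooth_on M TM f" by (rule Cc_smooth_on_top[OF f])
  obtain K where K: "compactin (mtop M) K" "\<forall>x. x \<notin> K --> f x = 0"
    using f unfolding Cc_iff_support[OF openin_topspace] by blast
  have sK: "supp M f \<subseteq> K"
    unfolding supp_def by (rule closure_of_minimal) (use K compactin_imp_closedin[OF Hausd K(1)] in auto)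
  have "compactin (mtop M) (supp M f)"
    by (rule closed_compactin[OF K(1) sK]) (simp add: supp_def)
  moreover have "f x = 0" if "x \<notin> supp M f" for x
  proof (rule ccontr)
    assume "f x \<noteq> 0"
    then have "x \<in> {x \<in> TM. f x \<noteq> 0}" using Cc_outside[OF f] by blast
    then show False using that closure_of_subset[of "{x \<in> TM. f x \<noteq> 0}" "mtop M"]
      unfolding supp_def by blast
  qed
  ultimately show ?thesis unfolding Cc_iff_support[OF U(1)] using U(2) s by blast
qed

lemma germ_zero_off_supp:
  assumes "x \<in> TM" "x \<notin> supp M f"
  shows "germ M x f = germ0 M x"
proof (rule germ_eqI)
  show "openin (mtop M) (TM - supp M f)" by (simp add: supp_def openin_diff)
  show "x \<in> TM - supp M f" using assms by simp
  fix y assume y: "y \<in> TM - supp M f"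
  show "f y = 0"
  proof (rule ccontr)
    assume "f y \<noteq> 0"
    then show False using y closure_of_subset[of "{x \<in> TM. f x \<noteq> 0}" "mtop M"]
      unfolding supp_def by blast
  qed
qed

text \<open>Multiplication by a bump function does not change the germ. Thus every germ of a smooth
  function is the germ of a ring element, even of one supported in a given neighbourhood.\<close>

lemma germ_localize:
  assumes f: "smooth_on M U f" and x: "x \<in> U"
  obtains g where "g \<in> Cc M U" "germ M x g = germ M x f"
proof -
  have U: "openin (mtop M) U" by (rule smooth_on_open[OF mfd f])
  have xT: "x \<in> TM" using U x openin_subset by blast
  obtain h :: "'m => 'a" where h: "h \<in> Cc M U" "germ M x h = germ1 M x" using bump[OF U x] by blast
  obtain K where K: "compactin (mtop M) K" "K \<subseteq> U" "\<forall>x. x \<notin> K --> h x = 0"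
    using h(1) unfolding Cc_iff_support[OF U] by blast
  have "smooth_on M U h" using h(1) by (simp add: Cc_def)
  then have "(\<lambda>y. h y * f y) \<in> Cc M U"
    unfolding Cc_open_iff[OF U] using K by (intro conjI smooth_on_mult[OF mfd] f exI[of _ K]) auto
  moreover have "germ M x (\<lambda>y. h y * f y) = germ M x (\<lambda>y. 1 * f y)"
    by (rule germ_cong2[OF h(2) refl])
  ultimately show ?thesis using that[of "\<lambda>y. h y * f y"] by simp
qed

lemma Cc_germ_in_ring: "x \<in> TM ==> f \<in> Cc M U ==> germ M x f \<in> carrier (germ_ring M x)"
  unfolding germ_ring_def using Cc_smooth_on_top by fastforce

lemma germ_ring_representative:
  assumes "\<gamma> \<in> carrier (germ_ring M x)" "x \<in> W" "openin (mtop M) W"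
  obtains f where "f \<in> Cc M W" "\<gamma> = germ M x f"
proof -
  obtain f U where f: "\<gamma> = germ M x f" "x \<in> U" "smooth_on M U f"
    using assms(1) by (auto simp: germ_ring_def)
  have "openin (mtop M) (U \<inter> W)" using smooth_on_open[OF mfd f(3)] assms(3) by blast
  then have s: "smooth_on M (U \<inter> W) f" using smooth_on_subset[OF mfd f(3)] by blast
  obtain g where g: "g \<in> Cc M (U \<inter> W)" "germ M x g = germ M x f"
    using germ_localize[OF s] f(2) assms(2) by blast
  then have "g \<in> Cc M W" using Cc_mono[OF _ assms(3)] by blast
  then show ?thesis using that g f by simp
qed

end

section \<open>Modules and tensor products over rings without identity\<close>

subsection \<open>Modules and linear maps\<close>

locale rmod =
  fixes R :: "('r, 'z) ring_scheme" and A :: "('r, 'a, 'x) module_scheme" (structure)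
  assumes rmodule: "rmodule R A"

sublocale rmod \<subseteq> abelian_group A
  using rmodule by (simp add: rmodule_def)

context rmod
begin

lemma smult_closed [simp, intro]: "r \<in> carrier R ==> a \<in> carrier A ==> r \<odot> a \<in> carrier A"
  using rmodule by (simp add: rmodule_def)

lemma smult_l_distr: "r \<in> carrier R ==> s \<in> carrier R ==> a \<in> carrier A ==>
    (r \<oplus>\<^bsub>R\<^esub> s) \<odot> a = r \<odot> a \<oplus> s \<odot> a"
  using rmodule by (simp add: rmodule_def)

lemma smult_r_distr: "r \<in> carrier R ==> a \<in> carrier A ==> b \<in> carrier A ==>
    r \<odot> (a \<oplus> b) = r \<odot> a \<oplus> r \<odot> b"
  using rmodule by (simp add: rmodule_def)

lemma smult_assoc: "r \<in> carrier R ==> s \<in> carrier R ==> a \<in> carrier A ==>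
    (r \<otimes>\<^bsub>R\<^esub> s) \<odot> a = r \<odot> (s \<odot> a)"
  using rmodule by (simp add: rmodule_def)

lemma smult_zero_right [simp]:
  assumes "r \<in> carrier R" shows "r \<odot> \<zero> = \<zero>"
proof -
  have "r \<odot> \<zero> \<oplus> r \<odot> \<zero> = r \<odot> \<zero> \<oplus> \<zero>"
    using smult_r_distr[OF assms zero_closed zero_closed] assms by simp
  then show ?thesis using assms by simp
qed

lemma smult_minus:
  assumes "r \<in> carrier R" "a \<in> carrier A"
  shows "r \<odot> (\<ominus> a) = \<ominus> (r \<odot> a)"
proof -
  have "r \<odot> (\<ominus> a) \<oplus> r \<odot> a = \<zero>"
    using smult_r_distr[of r "\<ominus> a" a] assms by (simp add: l_neg)
  then show ?thesis using assms by (simp add: minus_equality)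
qed

lemma smult_finsum:
  assumes "r \<in> carrier R" "\<And>i. i \<in> I ==> f i \<in> carrier A"
  shows "r \<odot> finsum A f I = finsum A (\<lambda>i. r \<odot> f i) I"
  using assms(2)
proof (induction I rule: infinite_finite_induct)
  case (insert i I)
  then have "f i \<in> carrier A" "f \<in> I \<rightarrow> carrier A" "(\<lambda>i. r \<odot> f i) \<in> I \<rightarrow> carrier A" "r \<odot> f i \<in> carrier A"
    using assms(1) by auto
  then show ?case using insert assms(1) by (simp add: finsum_insert smult_r_distr)
qed (use assms(1) in \<open>auto simp: finsum_infinite\<close>)

end

lemma rlinear_closed: "rlinear R A B h ==> a \<in> carrier A ==> h a \<in> carrier B"
  and rlinear_add: "rlinear R A B h ==> a \<in> carrier A ==> b \<in> carrier A ==> h (a \<oplus>\<^bsub>A\<^esub> b) = h a \<oplus>\<^bsub>B\<^esub> h b"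
  and rlinear_smult: "rlinear R A B h ==> r \<in> carrier R ==> a \<in> carrier A ==> h (r \<odot>\<^bsub>A\<^esub> a) = r \<odot>\<^bsub>B\<^esub> h a"
  by (auto simp: rlinear_def)

lemma rlinear_zero:
  assumes "abelian_group A" "abelian_group B" "rlinear R A B h"
  shows "h \<zero>\<^bsub>A\<^esub> = \<zero>\<^bsub>B\<^esub>"
proof -
  interpret A: abelian_group A by fact
  interpret B: abelian_group B by fact
  have c: "h \<zero>\<^bsub>A\<^esub> \<in> carrier B" by (rule rlinear_closed[OF assms(3)]) simp
  have "h \<zero>\<^bsub>A\<^esub> \<oplus>\<^bsub>B\<^esub> h \<zero>\<^bsub>A\<^esub> = h \<zero>\<^bsub>A\<^esub> \<oplus>\<^bsub>B\<^esub> \<zero>\<^bsub>B\<^esub>"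
    using rlinear_add[OF assms(3), of "\<zero>\<^bsub>A\<^esub>" "\<zero>\<^bsub>A\<^esub>"] c by simp
  then show ?thesis using c by simp
qed

lemma rlinear_finsum:
  assumes A: "abelian_group A" and B: "abelian_group B" and h: "rlinear R A B h"
    and "\<And>i. i \<in> I ==> f i \<in> carrier A"
  shows "h (finsum A f I) = finsum B (\<lambda>i. h (f i)) I"
proof -
  interpret A: abelian_group A by fact
  interpret B: abelian_group B by fact
  show ?thesis using assms(4)
  proof (induction I rule: infinite_finite_induct)
    case (insert i I)
    then have "f i \<in> carrier A" "f \<in> I \<rightarrow> carrier A" "(\<lambda>i. h (f i)) \<in> I \<rightarrow> carrier B" "h (f i) \<in> carrier B"
      using rlinear_closed[OF h] by auto
    then show ?case using insert by (simp add: A.finsum_insert B.finsum_insert rlinear_add[OF h])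
  qed (use rlinear_zero[OF A B h] in \<open>auto simp: A.finsum_infinite B.finsum_infinite\<close>)
qed

text \<open>
  Finite families indexed by \<open>{..<k}\<close>, as they occur in the definitions, are replaced by the
  additive closure, over which one can do induction.
\<close>

inductive_set addspan :: "('a, 'y) ring_scheme => 'a set => 'a set" for A X where
  zero: "\<zero>\<^bsub>A\<^esub> \<in> addspan A X"
| add: "x \<in> X ==> s \<in> addspan A X ==> x \<oplus>\<^bsub>A\<^esub> s \<in> addspan A X"

context abelian_group
begin

lemma addspan_closed:
  assumes X: "X \<subseteq> carrier G" and s: "s \<in> addspan G X"
  shows "s \<in> carrier G"
  using s by (induction rule: addspan.induct) (use X in auto)

lemma addspan_incl: "X \<subseteq> carrier G ==> x \<in> X ==> x \<in> addspan G X"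
  using addspan.add[OF _ addspan.zero, of x X G] by auto

lemma addspan_plus:
  assumes X: "X \<subseteq> carrier G" and s: "s \<in> addspan G X" and t: "t \<in> addspan G X"
  shows "s \<oplus> t \<in> addspan G X"
  using s
proof (induction rule: addspan.induct)
  case zero
  then show ?case using t addspan_closed[OF X] by simp
next
  case (add x s)
  then have "x \<oplus> (s \<oplus> t) \<in> addspan G X" using addspan.add[OF add.hyps(1) add.IH] by simp
  then show ?case using add X t addspan_closed[OF X] by (simp add: a_assoc subset_iff)
qed

lemma addspan_iff:
  assumes "\<And>y. P y ==> \<phi> y \<in> carrier G"
  shows "d \<in> addspan G {\<phi> y |y. P y} \<longleftrightarrow>
    (\<exists>(k::nat) y. (\<forall>i<k. P (y i)) \<and> d = finsum G (\<lambda>i. \<phi> (y i)) {..<k})"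
proof
  assume "d \<in> addspan G {\<phi> y |y. P y}"
  then show "\<exists>(k::nat) y. (\<forall>i<k. P (y i)) \<and> d = finsum G (\<lambda>i. \<phi> (y i)) {..<k}"
  proof (induction rule: addspan.induct)
    case zero
    show ?case by (intro exI[of _ 0]) simp
  next
    case (add x s)
    then obtain k :: nat and y where y: "\<forall>i<k. P (y i)" "s = finsum G (\<lambda>i. \<phi> (y i)) {..<k}" by blast
    obtain z where z: "P z" "x = \<phi> z" using add by blast
    have "finsum G (\<lambda>i. \<phi> ((y(k := z)) i)) {..<Suc k} = \<phi> z \<oplus> finsum G (\<lambda>i. \<phi> ((y(k := z)) i)) {..<k}"
      using y z assms by (simp add: lessThan_Suc finsum_insert Pi_iff)
    also have "finsum G (\<lambda>i. \<phi> ((y(k := z)) i)) {..<k} = finsum G (\<lambda>i. \<phi> (y i)) {..<k}"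
      using y assms by (intro finsum_cong') (auto simp: Pi_iff)
    finally show ?case using y z by (intro exI[of _ "Suc k"] exI[of _ "y(k := z)"]) (auto simp: less_Suc_eq)
  qed
next
  have "(\<forall>i<k. P (y i)) ==> finsum G (\<lambda>i. \<phi> (y i)) {..<k} \<in> addspan G {\<phi> y |y. P y}" for k :: nat and y
  proof (induction k)
    case 0
    then show ?case by (simp add: addspan.zero)
  next
    case (Suc k)
    have "finsum G (\<lambda>i. \<phi> (y i)) {..<Suc k} = \<phi> (y k) \<oplus> finsum G (\<lambda>i. \<phi> (y i)) {..<k}"
      using Suc.prems assms by (simp add: lessThan_Suc finsum_insert Pi_iff)
    then show ?case using Suc by (auto intro!: addspan.add)
  qed
  then show "\<exists>(k::nat) y. (\<forall>i<k. P (y i)) \<and> d = finsum G (\<lambda>i. \<phi> (y i)) {..<k} ==> d \<in> addspan G {\<phi> y |y. P y}"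
    by blast
qed

end

subsection \<open>The universal property of the tensor product\<close>

text \<open>The target is only an abelian group, written multiplicatively as for
  \<open>tensor_lift\<close>; the scalars enter through the last clause alone.\<close>

definition balanced ::
  "('r, 'z) ring_scheme => ('r, 'a, 'x) module_scheme => ('r, 'b, 'y) module_scheme =>
    ('g, 'w) monoid_scheme => ('a \<times> 'b => 'g) => bool" where
  "balanced R A B H h \<longleftrightarrow>
    (\<forall>a\<in>carrier A. \<forall>b\<in>carrier B. h (a, b) \<in> carrier H) \<and>
    (\<forall>a\<in>carrier A. \<forall>a'\<in>carrier A. \<forall>b\<in>carrier B. h (a \<oplus>\<^bsub>A\<^esub> a', b) = h (a, b) \<otimes>\<^bsub>H\<^esub> h (a', b)) \<and>
    (\<forall>a\<in>carrier A. \<forall>b\<in>carrier B. \<forall>b'\<in>carrier B. h (a, b \<oplus>\<^bsub>B\<^esub> b') = h (a, b) \<otimes>\<^bsub>H\<^esub> h (a, b')) \<and>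
    (\<forall>r\<in>carrier R. \<forall>a\<in>carrier A. \<forall>b\<in>carrier B. h (r \<odot>\<^bsub>A\<^esub> a, b) = h (a, r \<odot>\<^bsub>B\<^esub> b))"

locale tensor_pair = A: rmod R A + B: rmod R B
  for R :: "('r, 'z) ring_scheme" and A :: "('r, 'a, 'x) module_scheme" and B :: "('r, 'b, 'y) module_scheme"
begin

abbreviation "FAB \<equiv> free_Abelian_group (carrier A \<times> carrier B)"
abbreviation "TAB \<equiv> tensor_group R A B"
abbreviation "NAB \<equiv> tensor_rels R A B"

definition "relators =
     ({frag_of (a \<oplus>\<^bsub>A\<^esub> a', b) - frag_of (a, b) - frag_of (a', b) | a a' b.
         a \<in> carrier A \<and> a' \<in> carrier A \<and> b \<in> carrier B} \<union>
      {frag_of (a, b \<oplus>\<^bsub>B\<^esub> b') - frag_of (a, b) - frag_of (a, b') | a b b'.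
         a \<in> carrier A \<and> b \<in> carrier B \<and> b' \<in> carrier B} \<union>
      {frag_of (r \<odot>\<^bsub>A\<^esub> a, b) - frag_of (a, r \<odot>\<^bsub>B\<^esub> b) | r a b.
         r \<in> carrier R \<and> a \<in> carrier A \<and> b \<in> carrier B})"

lemma NAB_def: "NAB = generate FAB relators"
  by (simp add: tensor_rels_def relators_def)

lemma diff_closed_FAB: "t \<in> carrier FAB ==> u \<in> carrier FAB ==> t - u \<in> carrier FAB"
  by (auto dest: subsetD[OF keys_diff])

lemma relators_carrier: "relators \<subseteq> carrier FAB"
  unfolding relators_def by (auto intro!: diff_closed_FAB simp del: carrier_free_Abelian_group_iff)

lemma NAB_subgroup: "subgroup NAB FAB"
  unfolding NAB_def by (rule group.generate_is_subgroup[OF group_free_Abelian_group relators_carrier])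

lemma TAB_comm_group: "comm_group TAB"
  unfolding tensor_group_def
  by (rule comm_group.abelian_FactGroup[OF abelian_free_Abelian_group NAB_subgroup])

lemma coset_eq:
  assumes "t \<in> carrier FAB" "u \<in> carrier FAB" "t - u \<in> NAB"
  shows "NAB #>\<^bsub>FAB\<^esub> t = NAB #>\<^bsub>FAB\<^esub> u"
proof -
  have "t \<in> NAB #>\<^bsub>FAB\<^esub> u" using assms(3) by (auto simp: r_coset_def intro!: bexI[of _ "t - u"])
  then show ?thesis
    using group.repr_independence[OF group_free_Abelian_group _ assms(2) NAB_subgroup] by metis
qed

lemma coset_plus:
  assumes "t \<in> carrier FAB" "u \<in> carrier FAB"
  shows "(NAB #>\<^bsub>FAB\<^esub> t) \<otimes>\<^bsub>TAB\<^esub> (NAB #>\<^bsub>FAB\<^esub> u) = NAB #>\<^bsub>FAB\<^esub> (t + u)"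
proof -
  have "NAB \<lhd> FAB"
    by (rule comm_group.subgroup_imp_normal[OF abelian_free_Abelian_group NAB_subgroup])
  from normal.rcos_sum[OF this assms] show ?thesis
    by (simp add: tensor_group_def FactGroup_def)
qed

lemma carrier_TAB: "carrier TAB = (\<lambda>t. NAB #>\<^bsub>FAB\<^esub> t) ` carrier FAB"
  by (auto simp: tensor_group_def FactGroup_def RCOSETS_def)

lemma one_TAB: "\<one>\<^bsub>TAB\<^esub> = NAB #>\<^bsub>FAB\<^esub> 0"
proof -
  have "NAB #>\<^bsub>FAB\<^esub> \<one>\<^bsub>FAB\<^esub> = NAB"
    by (rule group.coset_mult_one[OF group_free_Abelian_group subgroup.subset[OF NAB_subgroup]])
  then show ?thesis by (simp add: tensor_group_def FactGroup_def)
qed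

lemma frag_FAB: "a \<in> carrier A ==> b \<in> carrier B ==> frag_of (a, b) \<in> carrier FAB"
  by simp

lemma tens_closed [simp]: "a \<in> carrier A ==> b \<in> carrier B ==> tens R A B a b \<in> carrier TAB"
  unfolding carrier_TAB tens_def by (intro imageI frag_FAB)

lemma tens_add_left:
  assumes "a \<in> carrier A" "a' \<in> carrier A" "b \<in> carrier B"
  shows "tens R A B (a \<oplus>\<^bsub>A\<^esub> a') b = tens R A B a b \<otimes>\<^bsub>TAB\<^esub> tens R A B a' b"
proof -
  have "frag_of (a \<oplus>\<^bsub>A\<^esub> a', b) - frag_of (a, b) - frag_of (a', b) \<in> relators"
    unfolding relators_def using assms by blast
  then have "frag_of (a \<oplus>\<^bsub>A\<^esub> a', b) - (frag_of (a, b) + frag_of (a', b)) \<in> NAB"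
    unfolding NAB_def by (auto intro: generate.incl simp: diff_diff_eq)
  moreover have "frag_of (a, b) + frag_of (a', b) \<in> carrier FAB"
    using assms by (auto dest: subsetD[OF keys_add])
  ultimately show ?thesis
    unfolding tens_def using assms by (simp add: coset_plus coset_eq del: carrier_free_Abelian_group_iff)
qed

lemma tens_add_right:
  assumes "a \<in> carrier A" "b \<in> carrier B" "b' \<in> carrier B"
  shows "tens R A B a (b \<oplus>\<^bsub>B\<^esub> b') = tens R A B a b \<otimes>\<^bsub>TAB\<^esub> tens R A B a b'"
proof -
  have "frag_of (a, b \<oplus>\<^bsub>B\<^esub> b') - frag_of (a, b) - frag_of (a, b') \<in> relators"
    unfolding relators_def using assms by blast
  then have "frag_of (a, b \<oplus>\<^bsub>B\<^esub> b') - (frag_of (a, b) + frag_of (a, b')) \<in> NAB"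
    unfolding NAB_def by (auto intro: generate.incl simp: diff_diff_eq)
  moreover have "frag_of (a, b) + frag_of (a, b') \<in> carrier FAB"
    using assms by (auto dest: subsetD[OF keys_add])
  ultimately show ?thesis
    unfolding tens_def using assms by (simp add: coset_plus coset_eq del: carrier_free_Abelian_group_iff)
qed

lemma tens_smult:
  assumes "r \<in> carrier R" "a \<in> carrier A" "b \<in> carrier B"
  shows "tens R A B (r \<odot>\<^bsub>A\<^esub> a) b = tens R A B a (r \<odot>\<^bsub>B\<^esub> b)"
proof -
  have "frag_of (r \<odot>\<^bsub>A\<^esub> a, b) - frag_of (a, r \<odot>\<^bsub>B\<^esub> b) \<in> relators"
    unfolding relators_def using assms by blast
  then have "frag_of (r \<odot>\<^bsub>A\<^esub> a, b) - frag_of (a, r \<odot>\<^bsub>B\<^esub> b) \<in> NAB"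
    unfolding NAB_def by (rule generate.incl)
  then show ?thesis
    unfolding tens_def using assms by (intro coset_eq frag_FAB) auto
qed

text \<open>Inherited from the induction on free abelian groups, which explains why the step is a
  difference instead of a sum.\<close>

lemma tensor_induct [consumes 1, case_names one tens diff]:
  assumes T: "T \<in> carrier TAB"
    and one: "P \<one>\<^bsub>TAB\<^esub>"
    and tens: "\<And>a b. a \<in> carrier A ==> b \<in> carrier B ==> P (tens R A B a b)"
    and diff: "\<And>T U. T \<in> carrier TAB ==> U \<in> carrier TAB ==> P T ==> P U ==> P (T \<otimes>\<^bsub>TAB\<^esub> inv\<^bsub>TAB\<^esub> U)"
  shows "P T"
proof -
  interpret T: comm_group TAB by (rule TAB_comm_group)
  obtain t where t: "T = NAB #>\<^bsub>FAB\<^esub> t" "Poly_Mapping.keys t \<subseteq> carrier A \<times> carrier B"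
    using T by (auto simp: carrier_TAB)
  have "P (NAB #>\<^bsub>FAB\<^esub> t)"
  proof (rule free_Abelian_group_induct[OF t(2)], goal_cases)
    case 1
    then show ?case using one by (simp add: one_TAB)
  next
    case (2 x y)
    then have c: "NAB #>\<^bsub>FAB\<^esub> x \<in> carrier TAB" "NAB #>\<^bsub>FAB\<^esub> y \<in> carrier TAB" by (auto simp: carrier_TAB)
    have "(NAB #>\<^bsub>FAB\<^esub> (x - y)) \<otimes>\<^bsub>TAB\<^esub> (NAB #>\<^bsub>FAB\<^esub> y) = NAB #>\<^bsub>FAB\<^esub> x"
      using 2(1,2) coset_plus[OF diff_closed_FAB, of x y y] by simp
    moreover have "NAB #>\<^bsub>FAB\<^esub> (x - y) \<in> carrier TAB"
      unfolding carrier_TAB by (intro imageI diff_closed_FAB) (use 2 in auto)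
    ultimately have "NAB #>\<^bsub>FAB\<^esub> (x - y) = (NAB #>\<^bsub>FAB\<^esub> x) \<otimes>\<^bsub>TAB\<^esub> inv\<^bsub>TAB\<^esub> (NAB #>\<^bsub>FAB\<^esub> y)"
      using c T.inv_solve_right by metis
    then show ?case using diff[OF c 2(3,4)] by simp
  next
    case (3 p)
    then show ?case using tens[of "fst p" "snd p"] by (auto simp: tens_def)
  qed
  then show ?thesis using t by simp
qed

lemma tensor_hom_eq:
  assumes f: "f \<in> hom TAB H" and g: "g \<in> hom TAB H" and H: "group H"
    and eq: "\<And>a b. a \<in> carrier A ==> b \<in> carrier B ==> f (tens R A B a b) = g (tens R A B a b)"
    and T: "T \<in> carrier TAB"
  shows "f T = g T"
proof -
  interpret f: group_hom TAB H f
    using f H TAB_comm_group by (simp add: group_hom_def group_hom_axioms_def comm_group.axioms)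
  interpret g: group_hom TAB H g
    using g H TAB_comm_group by (simp add: group_hom_def group_hom_axioms_def comm_group.axioms)
  show ?thesis using T by (induction T rule: tensor_induct) (auto simp: eq)
qed

text \<open>On fragments supported in \<open>carrier A \<times> carrier B\<close> the explicit
  formula of \<open>tensor_lift\<close> agrees with the homomorphism \<open>k\<close> from the
  universal property of the free abelian group. Since \<open>k\<close> kills the relators, the
  formula is constant on cosets, and \<open>the_elem\<close> returns its value.\<close>

lemma tensor_lift:
  assumes H: "comm_group H" and h: "balanced R A B H h"
  shows "tensor_lift H h \<in> hom TAB H"
    and "\<And>a b. a \<in> carrier A ==> b \<in> carrier B ==> tensor_lift H h (tens R A B a b) = h (a, b)"
proof -
  interpret H: comm_group H by (rule H)
  let ?S = "carrier A \<times> carrier B"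
  have hc: "h p \<in> carrier H" if "p \<in> ?S" for p using that h by (auto simp: balanced_def)
  obtain k where k: "k \<in> hom FAB H" "\<And>p. p \<in> ?S ==> k (frag_of p) = h p"
    using H.free_Abelian_group_universal[of h ?S] hc by blast
  interpret k: group_hom FAB H k
    using k(1) by (simp add: group_hom_def group_hom_axioms_def)
  define e where "e t = finprod H (\<lambda>p. h p [^]\<^bsub>H\<^esub> Poly_Mapping.lookup t p) (Poly_Mapping.keys t)"
    for t :: "'a \<times> 'b \<Rightarrow>\<^sub>0 int"
  have ek: "e t = k t" if "Poly_Mapping.keys t \<subseteq> ?S" for t
  proof -
    have "Poly_Mapping.keys (\<Sum>p\<in>I. frag_cmul (c p) (frag_of p)) \<subseteq> ?S \<and>
        k (\<Sum>p\<in>I. frag_cmul (c p) (frag_of p)) = finprod H (\<lambda>p. h p [^]\<^bsub>H\<^esub> c p) I"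
      if "finite I" "I \<subseteq> ?S" for I c
      using that
    proof (induction I rule: finite_induct)
      case empty
      then show ?case using k.hom_one by simp
    next
      case (insert p I)
      let ?s = "\<Sum>p\<in>I. frag_cmul (c p) (frag_of p)"
      have s: "?s \<in> carrier FAB" using insert by auto
      have p: "frag_of p \<in> carrier FAB" using insert by auto
      have cm: "frag_cmul (c p) (frag_of p) = frag_of p [^]\<^bsub>FAB\<^esub> c p" using insert by simp
      have cmc: "frag_cmul (c p) (frag_of p) \<in> carrier FAB"
        unfolding cm by (rule group.int_pow_closed[OF group_free_Abelian_group p])
      have "k (frag_cmul (c p) (frag_of p) \<otimes>\<^bsub>FAB\<^esub> ?s) = h p [^]\<^bsub>H\<^esub> c p \<otimes>\<^bsub>H\<^esub> k ?s"
        unfolding k.hom_mult[OF cmc s] unfolding cm using k.hom_int_pow[OF p] k(2) insert by simp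
      moreover have "frag_cmul (c p) (frag_of p) + ?s \<in> carrier FAB"
        using s cmc by (auto dest: subsetD[OF keys_add])
      moreover have "(\<Sum>p\<in>insert p I. frag_cmul (c p) (frag_of p)) = frag_cmul (c p) (frag_of p) + ?s"
        using insert(1,2) by (rule sum.insert)
      moreover have "finprod H (\<lambda>p. h p [^]\<^bsub>H\<^esub> c p) (insert p I) = h p [^]\<^bsub>H\<^esub> c p \<otimes>\<^bsub>H\<^esub> finprod H (\<lambda>p. h p [^]\<^bsub>H\<^esub> c p) I"
        by (rule H.finprod_insert) (use insert(1,2,4) hc in \<open>auto simp: Pi_iff\<close>)
      moreover have "k ?s = finprod H (\<lambda>p. h p [^]\<^bsub>H\<^esub> c p) I" using insert by auto
      ultimately show ?case by (simp only: carrier_free_Abelian_group_iff mult_free_Abelian_group simp_thms)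
    qed
    from this[of "Poly_Mapping.keys t" "Poly_Mapping.lookup t"]
    have "e t = k (\<Sum>p\<in>Poly_Mapping.keys t. frag_cmul (Poly_Mapping.lookup t p) (frag_of p))"
      using that by (simp add: e_def)
    also have "(\<Sum>p\<in>Poly_Mapping.keys t. frag_cmul (Poly_Mapping.lookup t p) (frag_of p)) = t"
      using frag_expansion[of t, symmetric] unfolding frag_extend_def .
    finally show ?thesis .
  qed
  have kd: "k (t - u) = k t \<otimes>\<^bsub>H\<^esub> inv\<^bsub>H\<^esub> (k u)" if "t \<in> carrier FAB" "u \<in> carrier FAB" for t u
  proof -
    have "t - u = t \<otimes>\<^bsub>FAB\<^esub> inv\<^bsub>FAB\<^esub> u" using that by simp
    then show ?thesis
      using k.hom_mult[OF that(1) group.inv_closed[OF group_free_Abelian_group that(2)]] k.hom_inv[OF that(2)]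
      by (simp only:)
  qed
  have rel: "k t = \<one>\<^bsub>H\<^esub>" if "t \<in> relators" for t
  proof -
    have fin: "x \<otimes>\<^bsub>H\<^esub> inv\<^bsub>H\<^esub> y \<otimes>\<^bsub>H\<^esub> inv\<^bsub>H\<^esub> z = \<one>\<^bsub>H\<^esub>"
      if y: "y \<in> carrier H" and z: "z \<in> carrier H" and x: "x = y \<otimes>\<^bsub>H\<^esub> z" for x y z
    proof -
      have "x \<otimes>\<^bsub>H\<^esub> inv\<^bsub>H\<^esub> y = z \<otimes>\<^bsub>H\<^esub> y \<otimes>\<^bsub>H\<^esub> inv\<^bsub>H\<^esub> y"
        unfolding x using H.m_comm[OF y z] by simp
      also have "\<dots> = z" using y z by (simp only: H.m_assoc[OF z y H.inv_closed[OF y]] H.r_inv H.r_one)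
      finally show ?thesis using z by simp
    qed
    have c3: "frag_of p - frag_of q \<in> carrier FAB" if "p \<in> ?S" "q \<in> ?S" for p q
      by (rule diff_closed_FAB) (use that in simp_all)
    from that show ?thesis
      unfolding relators_def
    proof (elim UnE CollectE exE conjE, goal_cases)
      case (1 a a' b)
      then have "k t = h (a \<oplus>\<^bsub>A\<^esub> a', b) \<otimes>\<^bsub>H\<^esub> inv\<^bsub>H\<^esub> h (a, b) \<otimes>\<^bsub>H\<^esub> inv\<^bsub>H\<^esub> h (a', b)"
        using kd[OF c3 frag_FAB] kd[OF frag_FAB frag_FAB] k(2) by simp
      also have "\<dots> = \<one>\<^bsub>H\<^esub>"
        by (rule fin) (use 1 h hc in \<open>auto simp: balanced_def\<close>)
      finally show ?thesis .
    next
      case (2 a b b')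
      then have "k t = h (a, b \<oplus>\<^bsub>B\<^esub> b') \<otimes>\<^bsub>H\<^esub> inv\<^bsub>H\<^esub> h (a, b) \<otimes>\<^bsub>H\<^esub> inv\<^bsub>H\<^esub> h (a, b')"
        using kd[OF c3 frag_FAB] kd[OF frag_FAB frag_FAB] k(2) by simp
      also have "\<dots> = \<one>\<^bsub>H\<^esub>"
        by (rule fin) (use 2 h hc in \<open>auto simp: balanced_def\<close>)
      finally show ?thesis .
    next
      case (3 r a b)
      then have "k t = h (r \<odot>\<^bsub>A\<^esub> a, b) \<otimes>\<^bsub>H\<^esub> inv\<^bsub>H\<^esub> h (a, r \<odot>\<^bsub>B\<^esub> b)"
        using kd[OF frag_FAB frag_FAB] k(2) by simp
      also have "h (r \<odot>\<^bsub>A\<^esub> a, b) = h (a, r \<odot>\<^bsub>B\<^esub> b)" using h 3 by (simp add: balanced_def)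
      finally show ?thesis using 3 hc by simp
    qed
  qed
  have N1: "k t = \<one>\<^bsub>H\<^esub>" if "t \<in> NAB" for t
  proof -
    have "NAB \<subseteq> kernel FAB H k"
      unfolding NAB_def
      by (rule group.generate_subgroup_incl[OF group_free_Abelian_group _ k.subgroup_kernel])
         (use rel subsetD[OF relators_carrier] in \<open>simp add: kernel_def subset_iff del: carrier_free_Abelian_group_iff\<close>)
    then show ?thesis using that by (auto simp: kernel_def)
  qed
  have val: "tensor_lift H h (NAB #>\<^bsub>FAB\<^esub> t) = k t" if t: "t \<in> carrier FAB" for t
  proof -
    have "e u = k t" if u: "u \<in> NAB #>\<^bsub>FAB\<^esub> t" for u
    proof -
      obtain v where v: "v \<in> NAB" "u = v + t" using u by (auto simp: r_coset_def)
      have vc: "v \<in> carrier FAB" using v subgroup.mem_carrier[OF NAB_subgroup] by blast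
      have "k u = k v \<otimes>\<^bsub>H\<^esub> k t" using v k.hom_mult[OF vc t] by simp
      moreover have "Poly_Mapping.keys u \<subseteq> ?S" using v vc t by (auto dest: subsetD[OF keys_add])
      ultimately show ?thesis using N1[OF v(1)] ek k.hom_closed[OF t] by simp
    qed
    moreover have "t \<in> NAB #>\<^bsub>FAB\<^esub> t"
      by (rule group.rcos_self[OF group_free_Abelian_group t NAB_subgroup])
    ultimately have "e ` (NAB #>\<^bsub>FAB\<^esub> t) = {k t}" by (auto simp: image_iff)
    then show ?thesis unfolding tensor_lift_def e_def by simp
  qed
  show "tensor_lift H h \<in> hom TAB H"
  proof (rule homI)
    fix T U assume T: "T \<in> carrier TAB"
    then obtain t where t: "t \<in> carrier FAB" "T = NAB #>\<^bsub>FAB\<^esub> t" by (auto simp: carrier_TAB)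
    show "tensor_lift H h T \<in> carrier H" using t val k.hom_closed by simp
    assume U: "U \<in> carrier TAB"
    then obtain u where u: "u \<in> carrier FAB" "U = NAB #>\<^bsub>FAB\<^esub> u" by (auto simp: carrier_TAB)
    have "t + u \<in> carrier FAB" using t u by (auto dest: subsetD[OF keys_add])
    then show "tensor_lift H h (T \<otimes>\<^bsub>TAB\<^esub> U) = tensor_lift H h T \<otimes>\<^bsub>H\<^esub> tensor_lift H h U"
      using t u val coset_plus k.hom_mult[OF t(1) u(1)] by simp
  qed
  show "\<And>a b. a \<in> carrier A ==> b \<in> carrier B ==> tensor_lift H h (tens R A B a b) = h (a, b)"
    unfolding tens_def using val k(2) by simp
qed

lemma tensor_simps [simp]: "carrier (tensor R A B) = carrier TAB" "\<zero>\<^bsub>tensor R A B\<^esub> = \<one>\<^bsub>TAB\<^esub>"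
  "T \<oplus>\<^bsub>tensor R A B\<^esub> U = T \<otimes>\<^bsub>TAB\<^esub> U"
  by (simp_all add: tensor_def)

lemma tensor_abelian_group: "abelian_group (tensor R A B)"
proof -
  interpret T: comm_group TAB by (rule TAB_comm_group)
  show ?thesis
  proof (rule abelian_groupI, goal_cases)
    case 3
    then show ?case by (simp add: T.m_assoc)
  next
    case 4
    then show ?case by (simp add: T.m_comm)
  next
    case (6 x)
    then show ?case using T.l_inv_ex[of x] by simp
  qed simp_all
qed

lemma a_inv_tensor: "\<ominus>\<^bsub>tensor R A B\<^esub> T = inv\<^bsub>TAB\<^esub> T"
  by (simp add: a_inv_def m_inv_def)

text \<open>The action of \<open>r\<close> is the lift of a \<otimes> b \<mapsto> ra \<otimes> b,
  which is balanced because multiplication in \<open>R\<close> commutes. The module axioms become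
  equalities of homomorphisms and are checked on pure tensors.\<close>

lemma tensor_rmodule:
  assumes comm: "\<And>r s. r \<in> carrier R ==> s \<in> carrier R ==> r \<otimes>\<^bsub>R\<^esub> s = s \<otimes>\<^bsub>R\<^esub> r"
    and cl: "\<And>r s. r \<in> carrier R ==> s \<in> carrier R ==> r \<otimes>\<^bsub>R\<^esub> s \<in> carrier R"
      "\<And>r s. r \<in> carrier R ==> s \<in> carrier R ==> r \<oplus>\<^bsub>R\<^esub> s \<in> carrier R"
  shows "rmodule R (tensor R A B)"
    and "\<And>r a b. r \<in> carrier R ==> a \<in> carrier A ==> b \<in> carrier B ==>
      r \<odot>\<^bsub>tensor R A B\<^esub> tens R A B a b = tens R A B (r \<odot>\<^bsub>A\<^esub> a) b"
proof -
  interpret T: comm_group TAB by (rule TAB_comm_group)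
  define m where "m r = (\<lambda>(a, b). tens R A B (r \<odot>\<^bsub>A\<^esub> a) b)" for r
  have sm: "module.smult (tensor R A B) r = tensor_lift TAB (m r)" for r by (simp add: tensor_def m_def)
  have bal: "balanced R A B TAB (m r)" if r: "r \<in> carrier R" for r
    unfolding balanced_def m_def
  proof (intro conjI ballI; clarsimp)
    fix s a b assume s: "s \<in> carrier R" and ab: "a \<in> carrier A" "b \<in> carrier B"
    have "r \<odot>\<^bsub>A\<^esub> (s \<odot>\<^bsub>A\<^esub> a) = s \<odot>\<^bsub>A\<^esub> (r \<odot>\<^bsub>A\<^esub> a)"
      using A.smult_assoc[OF r s ab(1)] A.smult_assoc[OF s r ab(1)] comm[OF r s] by simp
    then show "tens R A B (r \<odot>\<^bsub>A\<^esub> (s \<odot>\<^bsub>A\<^esub> a)) b = tens R A B (r \<odot>\<^bsub>A\<^esub> a) (s \<odot>\<^bsub>B\<^esub> b)"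
      using r s ab by (simp add: tens_smult)
  qed (use r in \<open>auto simp: A.smult_r_distr tens_add_left tens_add_right\<close>)
  note hom = tensor_lift(1)[OF TAB_comm_group bal]
  have val: "tensor_lift TAB (m r) (tens R A B a b) = tens R A B (r \<odot>\<^bsub>A\<^esub> a) b"
    if "r \<in> carrier R" "a \<in> carrier A" "b \<in> carrier B" for r a b
    using tensor_lift(2)[OF TAB_comm_group bal that(2,3)] that by (simp add: m_def)
  show "\<And>r a b. r \<in> carrier R ==> a \<in> carrier A ==> b \<in> carrier B ==>
      r \<odot>\<^bsub>tensor R A B\<^esub> tens R A B a b = tens R A B (r \<odot>\<^bsub>A\<^esub> a) b"
    unfolding sm by (rule val)
  have hc: "tensor_lift TAB (m r) T \<in> carrier TAB" if "r \<in> carrier R" "T \<in> carrier TAB" for r T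
    using hom[OF that(1)] that(2) by (auto simp: hom_def)
  have hm: "tensor_lift TAB (m r) (T \<otimes>\<^bsub>TAB\<^esub> U) = tensor_lift TAB (m r) T \<otimes>\<^bsub>TAB\<^esub> tensor_lift TAB (m r) U"
    if "r \<in> carrier R" "T \<in> carrier TAB" "U \<in> carrier TAB" for r T U
    using hom[OF that(1)] that by (auto simp: hom_def)
  show "rmodule R (tensor R A B)"
    unfolding rmodule_def
  proof (intro conjI ballI tensor_abelian_group; simp add: sm; (elim conjE)?)
    fix r s T assume r: "r \<in> carrier R" and s: "s \<in> carrier R" and T: "T \<in> carrier TAB"
    show "tensor_lift TAB (m (r \<oplus>\<^bsub>R\<^esub> s)) T = tensor_lift TAB (m r) T \<otimes>\<^bsub>TAB\<^esub> tensor_lift TAB (m s) T"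
    proof (rule tensor_hom_eq[OF hom _ T.is_group _ T])
      show "(\<lambda>T. tensor_lift TAB (m r) T \<otimes>\<^bsub>TAB\<^esub> tensor_lift TAB (m s) T) \<in> hom TAB TAB"
        by (rule homI) (use r s in \<open>simp_all add: hc hm T.m_ac\<close>)
    qed (use r s cl in \<open>simp_all add: val A.smult_l_distr tens_add_left\<close>)
    show "tensor_lift TAB (m (r \<otimes>\<^bsub>R\<^esub> s)) T = tensor_lift TAB (m r) (tensor_lift TAB (m s) T)"
    proof (rule tensor_hom_eq[OF hom _ T.is_group _ T])
      show "(\<lambda>T. tensor_lift TAB (m r) (tensor_lift TAB (m s) T)) \<in> hom TAB TAB"
        by (rule homI) (use r s in \<open>simp_all add: hc hm\<close>)
    qed (use r s cl in \<open>simp_all add: val A.smult_assoc\<close>)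
  qed (use hc hm in auto)
qed

end

subsection \<open>Germs of elements of locally unitary modules\<close>

locale lmod = Hausdorff_manifold M + rmod "Cc_ring M" A
  for M :: "'m manifold" and A :: "('m => 'f::real_normed_field, 'a, 'x) module_scheme" (structure) +
  assumes locally_unitary: "locally_unitary RM A"
begin

lemmas smult_closed' [simp, intro] = smult_closed[simplified]
lemmas smult_add_left = smult_l_distr[simplified]
lemmas smult_add_right = smult_r_distr[simplified]
lemmas smult_smult = smult_assoc[simplified]
lemmas smult_zero' [simp] = smult_zero_right[simplified]

lemma zero_in_Cc [simp]: "(\<lambda>_. 0) \<in> Cc M TM"
  by (rule Cc_zero) simp

lemma smult_zero_left [simp]:
  assumes "a \<in> carrier A" shows "(\<lambda>_. 0) \<odot> a = \<zero>"
proof -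
  have c: "(\<lambda>_. 0) \<odot> a \<in> carrier A" using assms by simp
  have "(\<lambda>_. 0) \<odot> a \<oplus> (\<lambda>_. 0) \<odot> a = (\<lambda>_. 0) \<odot> a \<oplus> \<zero>"
    using smult_add_left[OF zero_in_Cc zero_in_Cc assms] c by simp
  then show ?thesis using c by simp
qed

lemma unit_of: "finite S ==> S \<subseteq> carrier A ==> \<exists>r\<in>Cc M TM. \<forall>a\<in>S. r \<odot> a = a"
  using locally_unitary by (simp add: locally_unitary_def)

lemma smult_commute:
  assumes "r \<in> Cc M TM" "s \<in> Cc M TM" "a \<in> carrier A"
  shows "r \<odot> (s \<odot> a) = s \<odot> (r \<odot> a)"
  using smult_smult[OF assms] smult_smult[OF assms(2,1,3)] by (simp add: mult.commute)

text \<open>Equality of \<open>a\<close> and \<open>b\<close> in the stalk at \<open>x\<close>,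
  expressed without the quotient. For \<open>b\<close> zero it says that \<open>a\<close> belongs to
  the submodule N_x.\<close>

definition geq :: "'m => 'a => 'a => bool" where
  "geq x a b \<longleftrightarrow> (\<exists>g\<in>Cc M TM. germ M x g = germ1 M x \<and> g \<odot> a = g \<odot> b)"

lemma geqI: "g \<in> Cc M TM ==> germ M x g = germ1 M x ==> g \<odot> a = g \<odot> b ==> geq x a b"
  unfolding geq_def by (rule bexI[of _ g]) simp_all

lemma geqE:
  assumes "geq x a b"
  obtains g where "g \<in> Cc M TM" "germ M x g = germ1 M x" "g \<odot> a = g \<odot> b"
  using assms unfolding geq_def by (elim bexE conjE) (rule that)

lemma geq_refl [simp]:
  assumes "x \<in> TM" shows "geq x a a"
proof -
  obtain g :: "'m => 'f" where "g \<in> Cc M TM" "germ M x g = germ1 M x"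
    by (rule bump[OF openin_topspace assms])
  then show ?thesis by (rule geqI) simp
qed

lemma geq_sym: "geq x a b ==> geq x b a"
  by (elim geqE) (rule geqI, assumption, assumption, simp)

lemma germ_one_mult:
  fixes g h :: "'m => 'f"
  assumes "germ M x g = germ1 M x"
  shows "germ M x (\<lambda>y. g y * h y) = germ M x h"
  using germ_cong2[OF assms refl, of "(*)" h] by simp

text \<open>The product of two multipliers with germ 1 again has germ 1 and inherits both equations.
  The congruence rules below rest on such a common multiplier.\<close>

lemma geqE2:
  assumes "geq x a b" "geq x c d" "a \<in> carrier A" "b \<in> carrier A" "c \<in> carrier A" "d \<in> carrier A"
  obtains g where "g \<in> Cc M TM" "germ M x g = germ1 M x" "g \<odot> a = g \<odot> b" "g \<odot> c = g \<odot> d"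
proof -
  obtain g where g: "g \<in> Cc M TM" "germ M x g = germ1 M x" "g \<odot> a = g \<odot> b"
    using assms(1) by (rule geqE)
  obtain h where h: "h \<in> Cc M TM" "germ M x h = germ1 M x" "h \<odot> c = h \<odot> d"
    using assms(2) by (rule geqE)
  show ?thesis
  proof (rule that)
    show "(\<lambda>y. g y * h y) \<in> Cc M TM" by (rule Cc_mult[OF g(1) h(1)])
    show "germ M x (\<lambda>y. g y * h y) = germ1 M x" using germ_one_mult[OF g(2)] h(2) by simp
    show "(\<lambda>y. g y * h y) \<odot> a = (\<lambda>y. g y * h y) \<odot> b"
      by (simp only: smult_smult[OF g(1) h(1) assms(3)] smult_smult[OF g(1) h(1) assms(4)]
          smult_commute[OF g(1) h(1) assms(3)] smult_commute[OF g(1) h(1) assms(4)] g(3))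
    show "(\<lambda>y. g y * h y) \<odot> c = (\<lambda>y. g y * h y) \<odot> d"
      by (simp only: smult_smult[OF g(1) h(1) assms(5)] smult_smult[OF g(1) h(1) assms(6)] h(3))
  qed
qed

lemma geq_trans:
  assumes "geq x a b" "geq x b c" "a \<in> carrier A" "b \<in> carrier A" "c \<in> carrier A"
  shows "geq x a c"
  by (rule geqE2[OF assms(1,2) assms(3-4) assms(4-5)]) (rule geqI, assumption, assumption, simp)

lemma geq_add:
  assumes "geq x a b" "geq x c d" "a \<in> carrier A" "b \<in> carrier A" "c \<in> carrier A" "d \<in> carrier A"
  shows "geq x (a \<oplus> c) (b \<oplus> d)"
  by (rule geqE2[OF assms]) (rule geqI, assumption, assumption, simp add: assms(3-) smult_add_right)

lemma geq_smult:
  assumes "geq x a b" "p \<in> Cc M TM" "a \<in> carrier A" "b \<in> carrier A"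
  shows "geq x (p \<odot> a) (p \<odot> b)"
  using assms(1)
proof (rule geqE)
  fix g assume g: "g \<in> Cc M TM" "germ M x g = germ1 M x" "g \<odot> a = g \<odot> b"
  then show ?thesis
    by (intro geqI[OF g(1,2)]) (simp only: smult_commute[OF g(1) assms(2,3)] smult_commute[OF g(1) assms(2,4)] g(3))
qed

lemma geq_minus:
  assumes "geq x a b" "a \<in> carrier A" "b \<in> carrier A"
  shows "geq x (\<ominus> a) (\<ominus> b)"
  using assms(1)
proof (rule geqE)
  fix g assume g: "g \<in> Cc M TM" "germ M x g = germ1 M x" "g \<odot> a = g \<odot> b"
  then show ?thesis
    by (intro geqI[OF g(1,2)]) (simp add: smult_minus assms(2,3))
qed

lemma geq_diff_iff:
  assumes "a \<in> carrier A" "b \<in> carrier A" "x \<in> TM"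
  shows "geq x a b \<longleftrightarrow> geq x (a \<oplus> \<ominus> b) \<zero>"
proof
  assume "geq x a b"
  then have "geq x (a \<oplus> \<ominus> b) (b \<oplus> \<ominus> b)" by (rule geq_add) (use assms in auto)
  then show "geq x (a \<oplus> \<ominus> b) \<zero>" using assms by (simp add: r_neg)
next
  assume "geq x (a \<oplus> \<ominus> b) \<zero>"
  then have "geq x (a \<oplus> \<ominus> b \<oplus> b) (\<zero> \<oplus> b)" by (rule geq_add) (use assms in auto)
  then show "geq x a b" using assms by (simp add: a_assoc l_neg)
qed

lemma geq_finsum:
  assumes "\<And>i. i \<in> I ==> geq x (f i) (g i)" "\<And>i. i \<in> I ==> f i \<in> carrier A" "\<And>i. i \<in> I ==> g i \<in> carrier A"
    and x: "x \<in> TM"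
  shows "geq x (finsum A f I) (finsum A g I)"
  using assms(1-3)
proof (induction I rule: infinite_finite_induct)
  case (insert i I)
  have "f \<in> I \<rightarrow> carrier A" "g \<in> I \<rightarrow> carrier A" using insert by auto
  then show ?case using insert x by (auto simp: finsum_insert intro!: geq_add)
qed (use x in \<open>auto simp: finsum_infinite\<close>)

text \<open>The multiplier is a bump function supported where \<open>p\<close> and \<open>q\<close>
  coincide, so that its products with \<open>p\<close> and \<open>q\<close> are the same ring
  element.\<close>

lemma geq_germ:
  assumes "germ M x p = germ M x q" "p \<in> Cc M TM" "q \<in> Cc M TM" "a \<in> carrier A" "x \<in> TM"
  shows "geq x (p \<odot> a) (q \<odot> a)"
proof -
  obtain U where U: "openin (mtop M) U" "x \<in> U" "\<forall>y\<in>U. p y = q y"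
    using assms(1,5) by (auto simp: germ_eq_iff)
  obtain g :: "'m => 'f" where g: "g \<in> Cc M U" "germ M x g = germ1 M x" using bump[OF U(1,2)] by blast
  have "(\<lambda>y. g y * p y) = (\<lambda>y. g y * q y)"
  proof
    show "g y * p y = g y * q y" for y using U(3) Cc_outside[OF g(1), of y] by (cases "y \<in> U") simp_all
  qed
  then have "g \<odot> (p \<odot> a) = g \<odot> (q \<odot> a)"
    by (simp only: smult_smult[OF Cc_in_ring[OF g(1)] assms(2,4), symmetric]
        smult_smult[OF Cc_in_ring[OF g(1)] assms(3,4), symmetric])
  then show ?thesis by (rule geqI[OF Cc_in_ring[OF g(1)] g(2)])
qed

text \<open>The constant 1 need not be a ring element with which \<open>p\<close> could be compared;
  a local unit \<open>r\<close> of \<open>a\<close> takes its place, as \<open>p r\<close> and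
  \<open>r\<close> have the same germ at \<open>x\<close>.\<close>

lemma geq_one:
  assumes "germ M x p = germ1 M x" "p \<in> Cc M TM" "a \<in> carrier A" "x \<in> TM"
  shows "geq x (p \<odot> a) a"
proof -
  obtain r where r: "r \<in> Cc M TM" "r \<odot> a = a" using unit_of[of "{a}"] assms by auto
  have "geq x ((\<lambda>y. p y * r y) \<odot> a) (r \<odot> a)"
    using germ_one_mult[OF assms(1)] r assms by (intro geq_germ Cc_mult) auto
  then show ?thesis using r assms by (simp add: smult_smult)
qed

lemma geq_germ_zero:
  assumes "germ M x p = germ0 M x" "p \<in> Cc M TM" "a \<in> carrier A" "x \<in> TM"
  shows "geq x (p \<odot> a) \<zero>"
  using geq_germ[OF assms(1,2) zero_in_Cc assms(3,4)] assms by simp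

text \<open>
  With \<open>f\<^sub>i = 1\<close> on an open cover of the support of \<open>r\<close> one has \<open>r \<Prod>(1 - f\<^sub>i) = 0\<close>, so that
  \<open>c = r c\<close> is a combination of the \<open>f\<^sub>i c\<close>.
\<close>

lemma local_submodule:
  assumes S: "\<zero> \<in> S" "\<And>s t. s \<in> S ==> t \<in> S ==> s \<oplus> t \<in> S" "S \<subseteq> carrier A"
    "\<And>r s. r \<in> Cc M TM ==> s \<in> S ==> r \<odot> s \<in> S"
    and c: "c \<in> carrier A"
    and loc: "\<And>x. x \<in> TM ==> \<exists>f\<in>Cc M TM. germ M x f = germ1 M x \<and> f \<odot> c \<in> S"
  shows "c \<in> S"
proof -
  obtain r where r: "r \<in> Cc M TM" "r \<odot> c = c" using unit_of[of "{c}"] c by auto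
  obtain K where K: "compactin (mtop M) K" "K \<subseteq> TM" "\<forall>x. x \<notin> K --> r x = 0"
    using r(1) unfolding Cc_iff_support[OF openin_topspace] by blast
  have "\<exists>f W. f \<in> Cc M TM \<and> f \<odot> c \<in> S \<and> openin (mtop M) W \<and> x \<in> W \<and> (\<forall>y\<in>W. f y = 1)" if "x \<in> K" for x
  proof -
    have x: "x \<in> TM" using that K(2) by blast
    obtain f where f: "f \<in> Cc M TM" "germ M x f = germ1 M x" "f \<odot> c \<in> S" using loc[OF x] by blast
    obtain W where "openin (mtop M) W" "x \<in> W" "\<forall>y\<in>W. f y = 1"
      using f(2) unfolding germ_eq_iff[OF x] by blast
    then show ?thesis using f by (intro exI[of _ f] exI[of _ W]) simp
  qed
  then obtain f W where f: "\<And>x. x \<in> K ==> f x \<in> Cc M TM" "\<And>x. x \<in> K ==> f x \<odot> c \<in> S"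
    "\<And>x. x \<in> K ==> openin (mtop M) (W x)" "\<And>x. x \<in> K ==> x \<in> W x" "\<And>x y. x \<in> K ==> y \<in> W x ==> f x y = 1"
    by metis
  have "\<exists>\<F>. finite \<F> \<and> \<F> \<subseteq> W ` K \<and> K \<subseteq> \<Union>\<F>"
    by (rule compactinD[OF K(1)]) (use f in auto)
  then obtain X where X: "finite X" "X \<subseteq> K" "K \<subseteq> (\<Union>x\<in>X. W x)"
    by (metis finite_subset_image)
  have "\<exists>r'\<in>Cc M TM. (\<forall>y. r y = 0 --> r' y = 0) \<and> (\<forall>x\<in>X. \<forall>y\<in>W x. r' y = 0) \<and>
      (\<exists>s\<in>S. r \<odot> c = s \<oplus> r' \<odot> c)"
    using X(1,2)
  proof (induction X rule: finite_induct)
    case empty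
    show ?case by (rule bexI[OF _ r(1)]) (use S(1) r c in \<open>auto intro!: bexI[of _ \<zero>]\<close>)
  next
    case (insert x X)
    then obtain r' s where r': "r' \<in> Cc M TM" "\<forall>y. r y = 0 --> r' y = 0" "\<forall>x\<in>X. \<forall>y\<in>W x. r' y = 0"
      "s \<in> S" "r \<odot> c = s \<oplus> r' \<odot> c" by auto
    have x: "x \<in> K" using insert by simp
    define r1 where "r1 y = r' y * f x y" for y
    define r2 where "r2 y = r' y - r1 y" for y
    have r1: "r1 \<in> Cc M TM" unfolding r1_def using Cc_mult[OF r'(1) f(1)[OF x]] .
    have r2: "r2 \<in> Cc M TM" unfolding r2_def using Cc_diff[OF r'(1) r1] .
    have "r' = (\<lambda>y. r1 y + r2 y)" by (simp add: r2_def)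
    then have "r' \<odot> c = r1 \<odot> c \<oplus> r2 \<odot> c" using smult_add_left[OF r1 r2 c] by simp
    moreover have "r1 \<odot> c \<in> S"
      unfolding r1_def using smult_smult[OF r'(1) f(1)[OF x] c] S(4)[OF r'(1) f(2)[OF x]] by simp
    ultimately have "s \<oplus> r1 \<odot> c \<in> S" "r \<odot> c = (s \<oplus> r1 \<odot> c) \<oplus> r2 \<odot> c"
      using r' S r1 r2 c by (auto simp: a_assoc subset_iff)
    moreover have "\<forall>y. r y = 0 --> r2 y = 0" "\<forall>x\<in>insert x X. \<forall>y\<in>W x. r2 y = 0"
      using r'(2,3) f(5)[OF x] by (auto simp: r2_def r1_def)
    ultimately show ?case
      by (intro bexI[OF _ r2] conjI bexI[of _ "s \<oplus> r1 \<odot> c"])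
  qed
  then obtain r' s where r': "\<forall>y. r y = 0 --> r' y = 0" "\<forall>x\<in>X. \<forall>y\<in>W x. r' y = 0" "s \<in> S" "r \<odot> c = s \<oplus> r' \<odot> c"
    by blast
  have "r' y = 0" for y
    using r'(1,2) K(3) X(3) by (cases "y \<in> K") auto
  then have "r' = (\<lambda>_. 0)" by auto
  then show ?thesis using r' r c S(3) by auto
qed

text \<open>\<open>local_submodule\<close> for the submodule {0}, applied to the difference. It is
  the passage from stalks back to the module, on which the well-definedness of all glued maps
  depends.\<close>

lemma geq_everywhere:
  assumes "\<And>x. x \<in> TM ==> geq x a b" "a \<in> carrier A" "b \<in> carrier A"
  shows "a = b"
proof -
  have "a \<oplus> \<ominus> b \<in> {\<zero>}"
  proof (rule local_submodule)
    fix x assume x: "x \<in> TM"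
    then have "geq x (a \<oplus> \<ominus> b) \<zero>" using assms geq_diff_iff by blast
    then show "\<exists>f\<in>Cc M TM. germ M x f = germ1 M x \<and> f \<odot> (a \<oplus> \<ominus> b) \<in> {\<zero>}"
    proof (rule geqE)
      fix g assume "g \<in> Cc M TM" "germ M x g = germ1 M x" "g \<odot> (a \<oplus> \<ominus> b) = g \<odot> \<zero>"
      then show ?thesis by (intro bexI[of _ g]) simp_all
    qed
  qed (use assms in auto)
  then have "a \<oplus> \<ominus> b = \<zero>" by simp
  then show ?thesis using assms(2,3) by (metis a_inv_closed minus_equality minus_minus)
qed

section \<open>The tensor square of a locally unitary module\<close>

sublocale AA: tensor_pair "Cc_ring M" A A
  by unfold_locales

abbreviation "AxA \<equiv> tensor RM A A"

lemma AxA_rmodule: "rmodule RM AxA"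
  and AxA_smult_tens: "\<And>r a b. r \<in> Cc M TM ==> a \<in> carrier A ==> b \<in> carrier A ==>
      r \<odot>\<^bsub>AxA\<^esub> tens RM A A a b = tens RM A A (r \<odot> a) b"
  using AA.tensor_rmodule by (simp_all add: mult.commute Cc_mult Cc_add)

text \<open>A tensor involves finitely many left factors, and an \<open>r\<close> that fixes them
  fixes the tensor. Hence \<open>geq\<close> and its rules become available for the tensor square as
  well.\<close>

lemma AxA_locally_unitary: "locally_unitary RM AxA"
proof -
  interpret T: rmod "Cc_ring M" AxA by unfold_locales (rule AxA_rmodule)
  have one: "\<exists>S. finite S \<and> S \<subseteq> carrier A \<and> (\<forall>r\<in>Cc M TM. (\<forall>a\<in>S. r \<odot> a = a) --> r \<odot>\<^bsub>AxA\<^esub> T = T)"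
    if "T \<in> carrier AA.TAB" for T
    using that
  proof (induction T rule: AA.tensor_induct)
    case one
    show ?case using T.smult_zero_right by (intro exI[of _ "{}"]) simp
  next
    case (tens a b)
    then show ?case by (intro exI[of _ "{a}"]) (simp add: AxA_smult_tens)
  next
    case (diff T U)
    then obtain S S' where S: "finite S" "S \<subseteq> carrier A" "\<forall>r\<in>Cc M TM. (\<forall>a\<in>S. r \<odot> a = a) --> r \<odot>\<^bsub>AxA\<^esub> T = T"
      "finite S'" "S' \<subseteq> carrier A" "\<forall>r\<in>Cc M TM. (\<forall>a\<in>S'. r \<odot> a = a) --> r \<odot>\<^bsub>AxA\<^esub> U = U" by blast
    have "r \<odot>\<^bsub>AxA\<^esub> (T \<oplus>\<^bsub>AxA\<^esub> \<ominus>\<^bsub>AxA\<^esub> U) = T \<oplus>\<^bsub>AxA\<^esub> \<ominus>\<^bsub>AxA\<^esub> U"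
      if "r \<in> Cc M TM" "\<forall>a\<in>S \<union> S'. r \<odot> a = a" for r
    proof -
      have "r \<odot>\<^bsub>AxA\<^esub> T = T" "r \<odot>\<^bsub>AxA\<^esub> U = U" using S that by blast+
      then show ?thesis
        using T.smult_r_distr[of r T "\<ominus>\<^bsub>AxA\<^esub> U"] T.smult_minus[of r U] T.a_inv_closed[of U] that diff(1,2)
        by simp
    qed
    then show ?case using S(1,2,4,5)
      by (intro exI[of _ "S \<union> S'"]) (simp add: AA.a_inv_tensor)
  qed
  show ?thesis
    unfolding locally_unitary_def
  proof (intro allI impI, elim conjE)
    fix Ts assume Ts: "finite Ts" "Ts \<subseteq> carrier AxA"
    have "\<forall>T\<in>Ts. \<exists>S. finite S \<and> S \<subseteq> carrier A \<and> (\<forall>r\<in>Cc M TM. (\<forall>a\<in>S. r \<odot> a = a) --> r \<odot>\<^bsub>AxA\<^esub> T = T)"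
      using one Ts(2) by auto
    then obtain S where S: "\<forall>T\<in>Ts. finite (S T) \<and> S T \<subseteq> carrier A \<and> (\<forall>r\<in>Cc M TM. (\<forall>a\<in>S T. r \<odot> a = a) --> r \<odot>\<^bsub>AxA\<^esub> T = T)"
      by metis
    obtain r where r: "r \<in> Cc M TM" "\<forall>a\<in>(\<Union>T\<in>Ts. S T). r \<odot> a = a"
      using unit_of[of "\<Union>T\<in>Ts. S T"] Ts(1) S by (auto simp: UN_subset_iff)
    then show "\<exists>r\<in>carrier RM. \<forall>T\<in>Ts. r \<odot>\<^bsub>AxA\<^esub> T = T"
      using S by (intro bexI[of _ r]) auto
  qed
qed

lemma AxA_lmod: "lmod M AxA"
  by (intro lmod.intro Hausdorff_manifold_axioms rmod.intro lmod_axioms.intro AxA_rmodule AxA_locally_unitary)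

end

section \<open>Stalks of a coalgebra\<close>

subsection \<open>The quotient by the elements vanishing near a point\<close>

context lmod
begin

text \<open>The submodule \<open>Nx\<close> for an arbitrary locally unitary module, so that it can
  be applied to the tensor square too.\<close>

definition Nz :: "'m => 'a set" where "Nz x = {a \<in> carrier A. geq x a \<zero>}"

lemma Nz_subgroup:
  assumes x: "x \<in> TM"
  shows "abelian_subgroup (Nz x) A"
proof (rule abelian_subgroupI3[OF additive_subgroup.intro abelian_group_axioms])
  show "subgroup (Nz x) (add_monoid A)"
  proof (rule subgroup.intro)
    fix a b assume "a \<in> Nz x" "b \<in> Nz x"
    then show "a \<otimes>\<^bsub>add_monoid A\<^esub> b \<in> Nz x"
      using geq_add[of x a \<zero> b \<zero>] by (simp add: Nz_def)
  next
    fix a assume a: "a \<in> Nz x"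
    then have "geq x (\<ominus> a) (\<ominus> \<zero>)" by (intro geq_minus) (auto simp: Nz_def)
    moreover have "\<ominus> \<zero> = \<zero>" by (rule minus_equality) simp_all
    ultimately have "\<ominus> a \<in> Nz x" using a by (simp add: Nz_def)
    then show "inv\<^bsub>add_monoid A\<^esub> a \<in> Nz x" by (simp add: a_inv_def)
  qed (use x in \<open>auto simp: Nz_def\<close>)
qed

lemma Nz_coset:
  assumes x: "x \<in> TM" and a: "a \<in> carrier A"
  shows "Nz x +> a = {b \<in> carrier A. geq x b a}"
proof (intro equalityI subsetI)
  fix b assume "b \<in> Nz x +> a"
  then obtain h where h: "h \<in> carrier A" "geq x h \<zero>" "b = h \<oplus> a"
    by (auto simp: a_r_coset_def' Nz_def)
  have "geq x (h \<oplus> a) (\<zero> \<oplus> a)" using h a x by (intro geq_add) auto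
  then show "b \<in> {b \<in> carrier A. geq x b a}" using h a by simp
next
  fix b assume b: "b \<in> {b \<in> carrier A. geq x b a}"
  then have "b \<oplus> \<ominus> a \<in> Nz x" using a x geq_diff_iff[of b a x] by (simp add: Nz_def)
  moreover have "b = (b \<oplus> \<ominus> a) \<oplus> a" using a b by (simp add: a_assoc l_neg)
  ultimately show "b \<in> Nz x +> a" unfolding a_r_coset_def' by blast
qed

lemma Nz_coset_eq_iff:
  assumes x: "x \<in> TM" and a: "a \<in> carrier A" "b \<in> carrier A"
  shows "Nz x +> a = Nz x +> b \<longleftrightarrow> geq x a b"
proof
  assume "Nz x +> a = Nz x +> b"
  moreover have "a \<in> Nz x +> a" using Nz_coset[OF x a(1)] a x by simp
  ultimately show "geq x a b" using Nz_coset[OF x a(2)] by simp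
next
  assume g: "geq x a b"
  show "Nz x +> a = Nz x +> b"
    unfolding Nz_coset[OF x a(1)] Nz_coset[OF x a(2)]
  proof (intro equalityI subsetI CollectI conjI)
    fix c assume "c \<in> {c \<in> carrier A. geq x c a}"
    then show "c \<in> carrier A" "geq x c b" using geq_trans[OF _ g _ a, of c] by simp_all
  next
    fix c assume "c \<in> {c \<in> carrier A. geq x c b}"
    then show "c \<in> carrier A" "geq x c a" using geq_trans[OF _ geq_sym[OF g] _ a(2,1), of c] by simp_all
  qed
qed

lemma Nz_coset_add:
  "x \<in> TM ==> a \<in> carrier A ==> b \<in> carrier A ==> (Nz x +> a) <+> (Nz x +> b) = Nz x +> (a \<oplus> b)"
  by (rule abelian_subgroup.a_rcos_sum[OF Nz_subgroup])

lemma Nz_cosets: "a_rcosets (Nz x) = {Nz x +> a |a. a \<in> carrier A}"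
  by (auto simp: A_RCOSETS_def')

lemma geq_finsum_zero_off:
  assumes "finite I" "J \<subseteq> I" "\<And>i. i \<in> I ==> f i \<in> carrier A" "\<And>i. i \<in> I - J ==> geq x (f i) \<zero>" "x \<in> TM"
  shows "geq x (finsum A f I) (finsum A f J)"
proof -
  have "geq x (finsum A f I) (finsum A (\<lambda>i. if i \<in> J then f i else \<zero>) I)"
    using assms by (intro geq_finsum) auto
  also have "finsum A (\<lambda>i. if i \<in> J then f i else \<zero>) I = finsum A f J"
    using assms by (intro add.finprod_mono_neutral_cong_right) auto
  finally show ?thesis .
qed

text \<open>A common multiplier \<open>g\<close> may act on either factor of a tensor, so the two
  factors are exchanged one after the other.\<close>

lemma geq_tens:
  assumes "geq x a a'" "geq x b b'" "a \<in> carrier A" "a' \<in> carrier A" "b \<in> carrier A" "b' \<in> carrier A"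
  shows "lmod.geq M AxA x (tens RM A A a b) (tens RM A A a' b')"
proof -
  interpret T: lmod M AxA by (rule AxA_lmod)
  let ?t = "tens RM A A"
  obtain g where g: "g \<in> Cc M TM" "germ M x g = germ1 M x" "g \<odot> a = g \<odot> a'" "g \<odot> b = g \<odot> b'"
    using geqE2[OF assms] .
  have m: "g \<odot>\<^bsub>AxA\<^esub> ?t p q = ?t p (g \<odot> q)" if "p \<in> carrier A" "q \<in> carrier A" for p q
    using that g(1) AxA_smult_tens[OF g(1) that] AA.tens_smult[of g p q] by simp
  have "T.geq x (?t a b) (?t a' b)"
    using g AxA_smult_tens assms by (intro T.geqI[OF g(1,2)]) simp
  moreover have "T.geq x (?t a' b) (?t a' b')"
    using g m assms by (intro T.geqI[OF g(1,2)]) simp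
  ultimately show ?thesis using T.geq_trans assms by simp
qed

end

text \<open>A tensor product sees only the carriers, additions and scalar actions. This identifies
  the tensor products of a coalgebra record with those of its underlying module.\<close>

lemma tensor_cong:
  assumes "carrier A = carrier A'" "add A = add A'" "module.smult A = module.smult A'"
    "carrier B = carrier B'" "add B = add B'" "module.smult B = module.smult B'"
  shows "tensor_rels R A B = tensor_rels R A' B'" "tensor_group R A B = tensor_group R A' B'"
    "tens R A B = tens R A' B'" "tensor R A B = tensor R A' B'"
proof -
  show 1: "tensor_rels R A B = tensor_rels R A' B'" by (simp only: tensor_rels_def assms)
  show 2: "tensor_group R A B = tensor_group R A' B'" by (simp only: tensor_group_def assms 1)
  show 3: "tens R A B = tens R A' B'" by (simp only: fun_eq_iff tens_def assms 1) simp
  show "tensor R A B = tensor R A' B'" by (simp only: tensor_def assms 2 3)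
qed

lemma openin_germ_eq: "openin (mtop M) {y \<in> topspace (mtop M). germ M y f = germ M y g}"
proof (subst openin_subopen, intro ballI)
  fix x assume "x \<in> {y \<in> topspace (mtop M). germ M y f = germ M y g}"
  then have "x \<in> topspace (mtop M)" "germ M x f = germ M x g" by auto
  then obtain U where U: "openin (mtop M) U" "x \<in> U" "\<forall>y\<in>U. f y = g y" by (auto simp: germ_eq_iff)
  moreover have "U \<subseteq> {y \<in> topspace (mtop M). germ M y f = germ M y g}"
  proof
    fix y assume y: "y \<in> U"
    then have "germ M y f = germ M y g" using U by (intro germ_eqI[where U = U]) auto
    then show "y \<in> {y \<in> topspace (mtop M). germ M y f = germ M y g}" using y U openin_subset by blast
  qed
  ultimately show "\<exists>T. openin (mtop M) T \<and> x \<in> T \<and> T \<subseteq> {y \<in> topspace (mtop M). germ M y f = germ M y g}"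
    by (intro exI[of _ U]) simp
qed

lemma germ_ring_simps [simp]: "germ X x f \<otimes>\<^bsub>germ_ring X x\<^esub> germ X x g = germ X x (\<lambda>y. f y * g y)"
  "germ X x f \<oplus>\<^bsub>germ_ring X x\<^esub> germ X x g = germ X x (\<lambda>y. f y + g y)"
  "\<one>\<^bsub>germ_ring X x\<^esub> = germ1 X x" "\<zero>\<^bsub>germ_ring X x\<^esub> = germ0 X x"
  by (simp_all add: germ_ring_def germ_op_germ)

subsection \<open>Coalgebras and their weakly grouplike elements\<close>

locale coalg = Hausdorff_manifold M
  for M :: "'m manifold" +
  fixes C :: "('m => 'f::real_normed_field, 'c) coalgebra" (structure)
  assumes coalgebra: "is_coalgebra RM C"

sublocale coalg \<subseteq> lmod M C
  by (intro lmod.intro Hausdorff_manifold_axioms rmod.intro lmod_axioms.intro)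
    (use coalgebra in \<open>simp_all add: is_coalgebra_def\<close>)

context coalg
begin

abbreviation "tn \<equiv> tens RM C C"
abbreviation "WG \<equiv> weakly_grouplike RM C"

lemma comult_linear: "rlinear RM C AxA (comult C)"
  and counit_linear: "rlinear RM C (regular_module RM) (counit C)"
  using coalgebra by (simp_all add: is_coalgebra_def)

lemma comult_closed: "c \<in> carrier C ==> comult C c \<in> carrier AA.TAB"
  using rlinear_closed[OF comult_linear] by simp

lemma comult_add: "c \<in> carrier C ==> d \<in> carrier C ==> comult C (c \<oplus> d) = comult C c \<otimes>\<^bsub>AA.TAB\<^esub> comult C d"
  using rlinear_add[OF comult_linear] by simp

lemma comult_smult: "f \<in> Cc M TM ==> c \<in> carrier C ==> comult C (f \<odot> c) = f \<odot>\<^bsub>AxA\<^esub> comult C c"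
  using rlinear_smult[OF comult_linear] by simp

lemma counit_closed: "c \<in> carrier C ==> counit C c \<in> Cc M TM"
  using rlinear_closed[OF counit_linear] by (simp add: regular_module_def)

lemma counit_add: "c \<in> carrier C ==> d \<in> carrier C ==> counit C (c \<oplus> d) = (\<lambda>x. counit C c x + counit C d x)"
  using rlinear_add[OF counit_linear] by (simp add: regular_module_def)

lemma counit_smult: "f \<in> Cc M TM ==> c \<in> carrier C ==> counit C (f \<odot> c) = (\<lambda>x. f x * counit C c x)"
  using rlinear_smult[OF counit_linear] by (simp add: regular_module_def)

lemma add_monoid_comm_group: "comm_group (add_monoid C)"
  by (rule a_comm_group)

text \<open>The counit axioms evaluated on a pure tensor. The maps a \<otimes> b \<mapsto>
  \<epsilon>(b) a and a \<otimes> b \<mapsto> \<epsilon>(a) b are balanced, so their lifts can be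
  computed.\<close>

lemma counit_comult_tens:
  assumes "c \<in> carrier C" "c' \<in> carrier C" "d \<in> carrier C" "comult C d = tn c c'"
  shows "counit C c' \<odot> c = d" "counit C c \<odot> c' = d"
proof -
  have "balanced RM C C (add_monoid C) (\<lambda>(a, b). counit C b \<odot> a)"
    unfolding balanced_def
    by (simp add: counit_closed counit_add smult_add_left smult_add_right counit_smult
        smult_smult smult_commute)
  then have "tensor_lift (add_monoid C) (\<lambda>(a, b). counit C b \<odot> a) (tn c c') = counit C c' \<odot> c"
    using AA.tensor_lift(2)[OF add_monoid_comm_group] assms by simp
  moreover have "tensor_lift (add_monoid C) (\<lambda>(a, b). counit C b \<odot> a) (comult C d) = d"
    using coalgebra assms(3) by (simp add: is_coalgebra_def)
  ultimately show "counit C c' \<odot> c = d" using assms(4) by simp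
  have "balanced RM C C (add_monoid C) (\<lambda>(a, b). counit C a \<odot> b)"
    unfolding balanced_def
    by (simp add: counit_closed counit_add smult_add_left smult_add_right counit_smult
        smult_smult smult_commute)
  then have "tensor_lift (add_monoid C) (\<lambda>(a, b). counit C a \<odot> b) (tn c c') = counit C c \<odot> c'"
    using AA.tensor_lift(2)[OF add_monoid_comm_group] assms by simp
  moreover have "tensor_lift (add_monoid C) (\<lambda>(a, b). counit C a \<odot> b) (comult C d) = d"
    using coalgebra assms(3) by (simp add: is_coalgebra_def)
  ultimately show "counit C c \<odot> c' = d" using assms(4) by simp
qed

lemma WG_carrier: "c \<in> WG ==> c \<in> carrier C"
  by (simp add: weakly_grouplike_def)

text \<open>The last equation is the essential one: wherever the counit of \<open>c\<close> is 1, it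
  turns the unknown factor \<open>c'\<close> into \<open>c\<close>, so that a weakly grouplike
  element is grouplike where it is normalized.\<close>

lemma WG_comult:
  assumes "c \<in> WG"
  obtains c' where "c' \<in> carrier C" "comult C c = tn c c'" "counit C c \<odot> c' = c"
  using assms counit_comult_tens(2)[of c _ c] by (auto simp: weakly_grouplike_def)

lemma normalized_mult:
  assumes "normalized_on M C c W" "f \<in> Cc M W"
  shows "(\<lambda>y. f y * counit C c y) = f"
proof
  fix y
  show "f y * counit C c y = f y"
  proof (cases "y \<in> W")
    case True
    then have "y \<in> TM" using Cc_imp_open[OF assms(2)] openin_subset by blast
    then have "counit C c y = 1"
      using assms(1) True germ_value[of y M "counit C c" "\<lambda>_. 1"] by (simp add: normalized_on_def normalized_at_def)
    then show ?thesis by simp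
  qed (simp add: Cc_outside[OF assms(2)])
qed

text \<open>As \<open>f\<close> is supported where \<epsilon>(c) = 1, it absorbs \<epsilon>(c);
  hence f c' = f \<epsilon>(c) c' = f c. Moving \<open>f\<close> across the tensor sign and back
  replaces \<open>c'\<close> by \<open>c\<close>.\<close>

lemma WG_comult_smult:
  assumes c: "c \<in> WG" and n: "normalized_on M C c W" and f: "f \<in> Cc M W"
  shows "comult C (f \<odot> c) = tn (f \<odot> c) c"
proof -
  obtain c' where c': "c' \<in> carrier C" "comult C c = tn c c'" "counit C c \<odot> c' = c" using WG_comult[OF c] .
  have cc: "c \<in> carrier C" by (rule WG_carrier[OF c])
  have fR: "f \<in> Cc M TM" by (rule Cc_in_ring[OF f])
  have "f \<odot> c' = (\<lambda>y. f y * counit C c y) \<odot> c'" by (simp only: normalized_mult[OF n f])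
  also have "\<dots> = f \<odot> c" using smult_smult[OF fR counit_closed[OF cc] c'(1)] c'(3) by simp
  finally have e: "f \<odot> c' = f \<odot> c" .
  have "comult C (f \<odot> c) = tn (f \<odot> c) c'" using comult_smult[OF fR cc] c'(2) AxA_smult_tens[OF fR cc c'(1)] by simp
  also have "\<dots> = tn c (f \<odot> c')" using AA.tens_smult[of f c c'] fR cc c' by simp
  also have "\<dots> = tn (f \<odot> c) c" using AA.tens_smult[of f c c] fR cc e by simp
  finally show ?thesis .
qed

lemma WG_germ:
  assumes c: "c \<in> WG" and n: "normalized_at M C c x" and x: "x \<in> TM"
  obtains c' where "c' \<in> carrier C" "comult C c = tn c c'" "geq x c c'"
proof -
  obtain c' where c': "c' \<in> carrier C" "comult C c = tn c c'" "counit C c \<odot> c' = c" using WG_comult[OF c] .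
  have "geq x (counit C c \<odot> c') c'"
    by (rule geq_one) (use n x c' counit_closed WG_carrier[OF c] in \<open>auto simp: normalized_at_def\<close>)
  then show ?thesis using that c' by simp
qed

lemma openin_normalized: "openin (mtop M) {y \<in> TM. normalized_at M C c y}"
  unfolding normalized_at_def by (rule openin_germ_eq)

subsection \<open>The stalk as a module over the ring of germs\<close>

lemma Nx_eq: "Nx M C x = Nz x"
  by (auto simp: Nx_def Nz_def geq_def)

lemma cls_eq_iff: "x \<in> TM ==> a \<in> carrier C ==> b \<in> carrier C ==> cls M C x a = cls M C x b \<longleftrightarrow> geq x a b"
  unfolding Nx_eq by (rule Nz_coset_eq_iff)

lemma cls_mem_iff: "x \<in> TM ==> a \<in> carrier C ==> b \<in> cls M C x a \<longleftrightarrow> b \<in> carrier C \<and> geq x b a"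
  unfolding Nx_eq by (simp add: Nz_coset)

abbreviation "Cx x \<equiv> stalk_module M C x"

lemma carrier_stalk: "carrier (Cx x) = {cls M C x a |a. a \<in> carrier C}"
  by (simp add: stalk_module_def Nx_eq Nz_cosets)

lemma cls_closed [simp]: "a \<in> carrier C ==> cls M C x a \<in> carrier (Cx x)"
  by (auto simp: carrier_stalk)

lemma stalk_add: "x \<in> TM ==> a \<in> carrier C ==> b \<in> carrier C ==>
    cls M C x a \<oplus>\<^bsub>Cx x\<^esub> cls M C x b = cls M C x (a \<oplus> b)"
  by (simp add: stalk_module_def Nx_eq Nz_coset_add)

lemma stalk_zero:
  assumes "x \<in> TM" shows "\<zero>\<^bsub>Cx x\<^esub> = cls M C x \<zero>"
proof -
  have "Nz x = {b \<in> carrier C. geq x b \<zero>}" by (simp add: Nz_def)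
  then show ?thesis using Nz_coset[OF assms zero_closed] by (simp add: stalk_module_def Nx_eq)
qed

text \<open>The definition takes the only element of a set of candidates. They all coincide, since
  another representative of the germ or of the class changes the product only away from
  \<open>x\<close>.\<close>

lemma stalk_smult:
  assumes x: "x \<in> TM" and f: "f \<in> Cc M TM" and c: "c \<in> carrier C"
  shows "germ M x f \<odot>\<^bsub>Cx x\<^esub> cls M C x c = cls M C x (f \<odot> c)"
proof -
  have all: "cls M C x (f' \<odot> c') = cls M C x (f \<odot> c)"
    if f': "f' \<in> Cc M TM" "f' \<in> germ M x f" and c': "c' \<in> cls M C x c" for f' c'
  proof -
    have c'': "c' \<in> carrier C" "geq x c' c" using c' cls_mem_iff[OF x c] by auto
    have "geq x (f' \<odot> c') (f \<odot> c')" by (rule geq_germ[OF germ_mem_eq[OF f'(2)] f'(1) f c''(1) x])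
    moreover have "geq x (f \<odot> c') (f \<odot> c)" by (rule geq_smult[OF c''(2) f c''(1) c])
    ultimately have "geq x (f' \<odot> c') (f \<odot> c)" by (rule geq_trans) (use f f' c c'' in simp_all)
    then show ?thesis using cls_eq_iff[OF x] f f' c c'' by simp
  qed
  have "{cls M C x (f' \<odot> c') |f' c'. f' \<in> carrier RM \<and> f' \<in> germ M x f \<and> c' \<in> cls M C x c} = {cls M C x (f \<odot> c)}"
    (is "?S = _")
  proof (intro equalityI subsetI)
    fix \<zeta> assume "\<zeta> \<in> ?S"
    then show "\<zeta> \<in> {cls M C x (f \<odot> c)}"
      unfolding mem_Collect_eq by (elim exE conjE) (simp only: singleton_iff carrier_Cc_ring all)
  next
    fix \<zeta> assume "\<zeta> \<in> {cls M C x (f \<odot> c)}"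
    then show "\<zeta> \<in> ?S"
      using f germ_mem[OF x, of f] cls_mem_iff[OF x c, of c] c x
      by (intro CollectI exI[of _ f] exI[of _ c]) simp
  qed
  then show ?thesis unfolding stalk_module_def by simp
qed

lemma germ_ring_cases:
  assumes "\<gamma> \<in> carrier (germ_ring M x)" "x \<in> TM"
  obtains f where "f \<in> Cc M TM" "\<gamma> = germ M x f"
  using germ_ring_representative[OF assms openin_topspace] .

lemma stalk_cases:
  assumes "\<zeta> \<in> carrier (Cx x)"
  obtains c where "c \<in> carrier C" "\<zeta> = cls M C x c"
  using assms by (auto simp: carrier_stalk)

lemma stalk_abelian_group:
  assumes x: "x \<in> TM"
  shows "abelian_group (Cx x)"
proof (rule abelian_groupI, goal_cases)
  case (1 \<zeta> \<xi>)
  then show ?case by (elim stalk_cases) (simp add: stalk_add[OF x])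
next
  case 2
  then show ?case by (simp add: stalk_zero[OF x])
next
  case (3 \<zeta> \<xi> \<theta>)
  then show ?case by (elim stalk_cases) (simp add: stalk_add[OF x] a_assoc)
next
  case (4 \<zeta> \<xi>)
  then show ?case by (elim stalk_cases) (simp add: stalk_add[OF x] a_comm)
next
  case (5 \<zeta>)
  then show ?case by (elim stalk_cases) (simp add: stalk_zero[OF x] stalk_add[OF x])
next
  case (6 \<zeta>)
  then obtain c where c: "c \<in> carrier C" "\<zeta> = cls M C x c" by (rule stalk_cases)
  then show ?case
    by (intro bexI[of _ "cls M C x (\<ominus> c)"]) (simp_all add: stalk_zero[OF x] stalk_add[OF x] l_neg)
qed

lemma stalk_rmodule:
  assumes x: "x \<in> TM"
  shows "rmodule (germ_ring M x) (Cx x)"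
  unfolding rmodule_def
proof (intro conjI ballI stalk_abelian_group[OF x], goal_cases)
  case (1 r a)
  then show ?case by (elim stalk_cases germ_ring_cases[OF _ x]) (simp add: stalk_smult[OF x])
next
  case (2 r s a)
  then show ?case
    by (elim stalk_cases germ_ring_cases[OF _ x])
      (simp add: stalk_smult[OF x] Cc_add stalk_add[OF x] smult_add_left)
next
  case (3 r a b)
  then show ?case
    by (elim stalk_cases germ_ring_cases[OF _ x])
      (simp add: stalk_smult[OF x] stalk_add[OF x] smult_add_right)
next
  case (4 r s a)
  then show ?case
    by (elim stalk_cases germ_ring_cases[OF _ x])
      (simp add: stalk_smult[OF x] Cc_mult smult_smult)
qed

lemma cls_finsum:
  assumes x: "x \<in> TM" and "\<And>i. i \<in> I ==> f i \<in> carrier C"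
  shows "finsum (Cx x) (\<lambda>i. cls M C x (f i)) I = cls M C x (finsum C f I)"
  using assms(2)
proof (induction I rule: infinite_finite_induct)
  case (infinite I)
  then show ?case
    by (simp add: finsum_infinite abelian_monoid.finsum_infinite[OF abelian_group.axioms(1)[OF stalk_abelian_group[OF x]]] stalk_zero[OF x])
next
  case empty
  then show ?case
    by (simp add: abelian_monoid.finsum_empty[OF abelian_group.axioms(1)[OF stalk_abelian_group[OF x]]] stalk_zero[OF x])
next
  case (insert i I)
  have m: "abelian_monoid (Cx x)" using stalk_abelian_group[OF x] by (rule abelian_group.axioms)
  have "finsum (Cx x) (\<lambda>i. cls M C x (f i)) (insert i I) = cls M C x (f i) \<oplus>\<^bsub>Cx x\<^esub> finsum (Cx x) (\<lambda>i. cls M C x (f i)) I"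
    by (rule abelian_monoid.finsum_insert[OF m]) (use insert in auto)
  moreover have "finsum C f (insert i I) = f i \<oplus> finsum C f I" by (rule finsum_insert) (use insert in auto)
  moreover have "finsum C f I \<in> carrier C" using insert by auto
  ultimately show ?case using insert by (simp add: stalk_add[OF x])
qed

subsection \<open>Grouplike elements of the stalk\<close>

text \<open>
  The map \<open>C \<otimes> C \<rightarrow> C\<^sub>x \<otimes> C\<^sub>x\<close> has as kernel the elements vanishing near \<open>x\<close>: an inverse of the
  induced map \<open>(C \<otimes> C)\<^sub>x \<rightarrow> C\<^sub>x \<otimes> C\<^sub>x\<close> sends \<open>a\<^sub>x \<otimes> b\<^sub>x\<close> to \<open>(a \<otimes> b)\<^sub>x\<close>.
\<close>

abbreviation "Tx x \<equiv> tensor_group (germ_ring M x) (Cx x) (Cx x)"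
abbreviation "tx x \<equiv> tens (germ_ring M x) (Cx x) (Cx x)"

definition germ_tensor :: "'m => ('c \<times> 'c \<Rightarrow>\<^sub>0 int) set => ('c set \<times> 'c set \<Rightarrow>\<^sub>0 int) set" where
  "germ_tensor x = tensor_lift (Tx x) (\<lambda>(a, b). tx x (cls M C x a) (cls M C x b))"

context
  fixes x assumes x: "x \<in> TM"
begin

interpretation Sx: tensor_pair "germ_ring M x" "Cx x" "Cx x"
  by (intro tensor_pair.intro rmod.intro stalk_rmodule x)

lemma germ_tensor_balanced: "balanced RM C C (Tx x) (\<lambda>(a, b). tx x (cls M C x a) (cls M C x b))"
  unfolding balanced_def
proof (intro conjI ballI; simp)
  fix a b c assume "a \<in> carrier C" "b \<in> carrier C" "c \<in> carrier C"
  then show "tx x (cls M C x (a \<oplus> b)) (cls M C x c) =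
      tx x (cls M C x a) (cls M C x c) \<otimes>\<^bsub>Tx x\<^esub> tx x (cls M C x b) (cls M C x c)"
    by (simp add: stalk_add[OF x, symmetric] Sx.tens_add_left)
next
  fix a b c assume "a \<in> carrier C" "b \<in> carrier C" "c \<in> carrier C"
  then show "tx x (cls M C x a) (cls M C x (b \<oplus> c)) =
      tx x (cls M C x a) (cls M C x b) \<otimes>\<^bsub>Tx x\<^esub> tx x (cls M C x a) (cls M C x c)"
    by (simp add: stalk_add[OF x, symmetric] Sx.tens_add_right)
next
  fix r :: "'m => 'f" and a b assume "r \<in> Cc M TM" "a \<in> carrier C" "b \<in> carrier C"
  then show "tx x (cls M C x (r \<odot> a)) (cls M C x b) = tx x (cls M C x a) (cls M C x (r \<odot> b))"
    by (simp add: stalk_smult[OF x, symmetric] Sx.tens_smult Cc_germ_in_ring[OF x])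
qed

lemma germ_tensor_hom: "germ_tensor x \<in> hom AA.TAB (Tx x)"
  and germ_tensor_tens: "a \<in> carrier C ==> b \<in> carrier C ==>
    germ_tensor x (tn a b) = tx x (cls M C x a) (cls M C x b)"
  unfolding germ_tensor_def
  using AA.tensor_lift[OF Sx.TAB_comm_group germ_tensor_balanced] by auto

interpretation T: lmod M AxA by (rule AxA_lmod)

text \<open>Both sides are homomorphisms in the tensor, and on a pure tensor \<open>g a\<close> and
  \<open>a\<close> have the same class. Thus \<open>germ_tensor\<close> depends only on the germ of
  a tensor.\<close>

lemma germ_tensor_smult_one:
  assumes g: "g \<in> Cc M TM" "germ M x g = germ1 M x" and T: "T \<in> carrier AA.TAB"
  shows "germ_tensor x (g \<odot>\<^bsub>AxA\<^esub> T) = germ_tensor x T"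
proof (rule AA.tensor_hom_eq[where f = "\<lambda>T. germ_tensor x (g \<odot>\<^bsub>AxA\<^esub> T)" and H = "Tx x", OF _ germ_tensor_hom _ _ T])
  have h: "germ_tensor x T \<in> carrier (Tx x)" if "T \<in> carrier AA.TAB" for T
    using germ_tensor_hom that by (auto simp: hom_def)
  have m: "germ_tensor x (T \<otimes>\<^bsub>AA.TAB\<^esub> U) = germ_tensor x T \<otimes>\<^bsub>Tx x\<^esub> germ_tensor x U"
    if "T \<in> carrier AA.TAB" "U \<in> carrier AA.TAB" for T U
    using germ_tensor_hom that by (auto simp: hom_def)
  have s: "g \<odot>\<^bsub>AxA\<^esub> T \<in> carrier AA.TAB" if "T \<in> carrier AA.TAB" for T
    using T.smult_closed'[of g T] g that by simp
  show "(\<lambda>T. germ_tensor x (g \<odot>\<^bsub>AxA\<^esub> T)) \<in> hom AA.TAB (Tx x)"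
  proof (rule homI)
    fix T U assume TU: "T \<in> carrier AA.TAB" "U \<in> carrier AA.TAB"
    show "germ_tensor x (g \<odot>\<^bsub>AxA\<^esub> T) \<in> carrier (Tx x)" using TU h s by simp
    show "germ_tensor x (g \<odot>\<^bsub>AxA\<^esub> (T \<otimes>\<^bsub>AA.TAB\<^esub> U)) = germ_tensor x (g \<odot>\<^bsub>AxA\<^esub> T) \<otimes>\<^bsub>Tx x\<^esub> germ_tensor x (g \<odot>\<^bsub>AxA\<^esub> U)"
      using T.smult_add_right[of g T U] g(1) TU m s by simp
  qed
  show "group (Tx x)" using Sx.TAB_comm_group by (rule comm_group.axioms)
  show "germ_tensor x (g \<odot>\<^bsub>AxA\<^esub> tn a b) = germ_tensor x (tn a b)" if "a \<in> carrier C" "b \<in> carrier C" for a b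
    using that g geq_one[OF g(2,1) that(1) x] cls_eq_iff[OF x, of "g \<odot> a" a]
    by (simp add: AxA_smult_tens germ_tensor_tens)
qed

lemma germ_tensor_geq:
  assumes "T.geq x T U" "T \<in> carrier AA.TAB" "U \<in> carrier AA.TAB"
  shows "germ_tensor x T = germ_tensor x U"
  using assms(1)
proof (rule T.geqE)
  fix g :: "'m => 'f" assume g: "g \<in> Cc M TM" "germ M x g = germ1 M x" "g \<odot>\<^bsub>AxA\<^esub> T = g \<odot>\<^bsub>AxA\<^esub> U"
  have "germ_tensor x T = germ_tensor x (g \<odot>\<^bsub>AxA\<^esub> T)" using germ_tensor_smult_one[OF g(1,2) assms(2)] by simp
  also have "\<dots> = germ_tensor x U" unfolding g(3) by (rule germ_tensor_smult_one[OF g(1,2) assms(3)])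
  finally show ?thesis .
qed

lemma germ_tensor_inj:
  assumes eq: "germ_tensor x T = germ_tensor x U" and T: "T \<in> carrier AA.TAB" "U \<in> carrier AA.TAB"
  shows "T.geq x T U"
proof -
  define H where "H = AxA A_Mod (T.Nz x)"
  have N: "abelian_subgroup (T.Nz x) AxA" by (rule T.Nz_subgroup[OF x])
  have H: "comm_group H" unfolding H_def by (rule abelian_subgroup.a_factorgroup_is_comm_group[OF N])
  define q where "q T = a_r_coset AxA (T.Nz x) T" for T
  have qc: "q T \<in> carrier H" if "T \<in> carrier AA.TAB" for T
    using that T.Nz_cosets[of x] by (auto simp: H_def q_def A_FactGroup_def')
  have qa: "q (T \<otimes>\<^bsub>AA.TAB\<^esub> U) = q T \<otimes>\<^bsub>H\<^esub> q U" if "T \<in> carrier AA.TAB" "U \<in> carrier AA.TAB" for T U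
    using T.Nz_coset_add[OF x, of T U] that by (simp add: H_def q_def A_FactGroup_def')
  have qe: "q T = q U \<longleftrightarrow> T.geq x T U" if "T \<in> carrier AA.TAB" "U \<in> carrier AA.TAB" for T U
    unfolding q_def using T.Nz_coset_eq_iff[OF x, of T U] that by simp
  \<comment> \<open>Any choice of representatives will do: by \<open>geq_tens\<close> the class of
    \<open>tn a b\<close> in \<open>H\<close> depends only on the classes of \<open>a\<close> and
    \<open>b\<close>.\<close>
  define rep where "rep \<zeta> = (SOME a. a \<in> carrier C \<and> \<zeta> = cls M C x a)" for \<zeta>
  have rep: "rep (cls M C x a) \<in> carrier C" "geq x (rep (cls M C x a)) a" if a: "a \<in> carrier C" for a
  proof -
    have "rep (cls M C x a) \<in> carrier C \<and> cls M C x a = cls M C x (rep (cls M C x a))"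
      unfolding rep_def by (rule someI[of _ a]) (simp add: a)
    then show "rep (cls M C x a) \<in> carrier C" "geq x (rep (cls M C x a)) a"
      using cls_eq_iff[OF x a] geq_sym by auto
  qed
  define h where "h = (\<lambda>(\<zeta>, \<xi>). q (tn (rep \<zeta>) (rep \<xi>)))"
  have hv: "h (cls M C x a, cls M C x b) = q (tn a b)" if "a \<in> carrier C" "b \<in> carrier C" for a b
    using that rep geq_tens[of x "rep (cls M C x a)" a "rep (cls M C x b)" b] by (simp add: h_def qe)
  have "balanced (germ_ring M x) (Cx x) (Cx x) H h"
    unfolding balanced_def
  proof (intro conjI ballI, goal_cases)
    case (1 a b)
    then show ?case by (elim stalk_cases) (simp add: hv qc)
  next
    case (2 a a' b)
    then show ?case by (elim stalk_cases) (simp add: stalk_add[OF x] hv qa[symmetric] AA.tens_add_left)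
  next
    case (3 a b b')
    then show ?case by (elim stalk_cases) (simp add: stalk_add[OF x] hv qa[symmetric] AA.tens_add_right)
  next
    case (4 r a b)
    then show ?case
      by (elim stalk_cases germ_ring_cases[OF _ x]) (simp add: stalk_smult[OF x] hv AA.tens_smult)
  qed
  note L = Sx.tensor_lift[OF H this]
  have "tensor_lift H h (germ_tensor x T) = q T" if T: "T \<in> carrier AA.TAB" for T
  proof (rule AA.tensor_hom_eq[where f = "\<lambda>T. tensor_lift H h (germ_tensor x T)" and H = H, OF _ _ _ _ T])
    show "(\<lambda>T. tensor_lift H h (germ_tensor x T)) \<in> hom AA.TAB H"
      using hom_compose[OF germ_tensor_hom L(1)] by (simp add: comp_def)
    show "q \<in> hom AA.TAB H" by (rule homI) (simp_all add: qc qa)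
    show "group H" using H by (rule comm_group.axioms)
    show "tensor_lift H h (germ_tensor x (tn a b)) = q (tn a b)" if "a \<in> carrier C" "b \<in> carrier C" for a b
      using that L(2) by (simp add: germ_tensor_tens hv)
  qed
  then have "q T = q U" using eq T by metis
  then show ?thesis using qe T by simp
qed

lemma stalk_coalgebra_simps:
  "carrier (stalk_coalgebra M C x) = carrier (Cx x)"
  "add (stalk_coalgebra M C x) = add (Cx x)"
  "zero (stalk_coalgebra M C x) = zero (Cx x)"
  "module.smult (stalk_coalgebra M C x) = module.smult (Cx x)"
  "comult (stalk_coalgebra M C x) = stalk_comult M C x"
  "counit (stalk_coalgebra M C x) = (\<lambda>\<zeta>. the_elem ((\<lambda>c. germ M x (counit C c)) ` \<zeta>))"
  by (simp_all add: stalk_coalgebra_def module.extend_def coalgebra.fields_def)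

text \<open>Independence of the representative: a multiplier that equates \<open>d\<close> and
  \<open>c\<close> also equates their comultiplications, and \<open>germ_tensor\<close> ignores
  it.\<close>

lemma stalk_comult_cls:
  assumes c: "c \<in> carrier C"
  shows "stalk_comult M C x (cls M C x c) = germ_tensor x (comult C c)"
proof -
  have all: "germ_tensor x (comult C d) = germ_tensor x (comult C c)" if "d \<in> cls M C x c" for d
  proof -
    have d: "d \<in> carrier C" "geq x d c" using that cls_mem_iff[OF x c] by auto
    have "T.geq x (comult C d) (comult C c)"
      using d(2)
    proof (rule geqE)
      fix g assume g: "g \<in> Cc M TM" "germ M x g = germ1 M x" "g \<odot> d = g \<odot> c"
      show ?thesis
        by (rule T.geqI[OF g(1,2)]) (simp only: comult_smult[OF g(1) d(1), symmetric] comult_smult[OF g(1) c, symmetric] g(3))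
    qed
    then show ?thesis by (rule germ_tensor_geq) (use d c comult_closed in auto)
  qed
  have "c \<in> cls M C x c" using cls_mem_iff[OF x c] c x by simp
  have "(\<lambda>c. germ_tensor x (comult C c)) ` cls M C x c = {germ_tensor x (comult C c)}"
  proof (intro equalityI subsetI)
    fix y assume "y \<in> (\<lambda>c. germ_tensor x (comult C c)) ` cls M C x c"
    then show "y \<in> {germ_tensor x (comult C c)}" by (elim imageE) (simp only: singleton_iff all)
  next
    fix y assume "y \<in> {germ_tensor x (comult C c)}"
    then show "y \<in> (\<lambda>c. germ_tensor x (comult C c)) ` cls M C x c"
      using \<open>c \<in> cls M C x c\<close> by (simp only: singleton_iff) (rule imageI)
  qed
  then show ?thesis unfolding stalk_comult_def germ_tensor_def Let_def by simp
qed

lemma stalk_counit_cls: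
  assumes c: "c \<in> carrier C"
  shows "the_elem ((\<lambda>c. germ M x (counit C c)) ` cls M C x c) = germ M x (counit C c)"
proof -
  have all: "germ M x (counit C d) = germ M x (counit C c)" if "d \<in> cls M C x c" for d
  proof -
    have d: "d \<in> carrier C" "geq x d c" using that cls_mem_iff[OF x c] by auto
    show ?thesis
      using d(2)
    proof (rule geqE)
      fix g assume g: "g \<in> Cc M TM" "germ M x g = germ1 M x" "g \<odot> d = g \<odot> c"
      have "germ M x (counit C d) = germ M x (counit C (g \<odot> d))"
        using germ_one_mult[OF g(2)] counit_smult[OF g(1) d(1)] by simp
      also have "\<dots> = germ M x (counit C c)"
        unfolding g(3) using germ_one_mult[OF g(2)] counit_smult[OF g(1) c] by simp
      finally show ?thesis .
    qed
  qed
  have "c \<in> cls M C x c" using cls_mem_iff[OF x c] c x by simp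
  have "(\<lambda>c. germ M x (counit C c)) ` cls M C x c = {germ M x (counit C c)}"
  proof (intro equalityI subsetI)
    fix y assume "y \<in> (\<lambda>c. germ M x (counit C c)) ` cls M C x c"
    then show "y \<in> {germ M x (counit C c)}" by (elim imageE) (simp only: singleton_iff all)
  next
    fix y assume "y \<in> {germ M x (counit C c)}"
    then show "y \<in> (\<lambda>c. germ M x (counit C c)) ` cls M C x c"
      using \<open>c \<in> cls M C x c\<close> by (simp only: singleton_iff) (rule imageI)
  qed
  then show ?thesis by simp
qed

text \<open>The injectivity of \<open>germ_tensor\<close> on germs moves the grouplike condition
  from the tensor product of the stalks to the tensor square of \<open>C\<close> near
  \<open>x\<close>.\<close>

lemma stalk_grouplike_cls_iff:
  assumes c: "c \<in> carrier C"
  shows "cls M C x c \<in> stalk_grouplike M C x \<longleftrightarrow> T.geq x (comult C c) (tn c c) \<and> normalized_at M C c x"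
proof -
  have t: "tens (germ_ring M x) (stalk_coalgebra M C x) (stalk_coalgebra M C x) = tx x"
    by (rule tensor_cong) (simp_all add: stalk_coalgebra_simps)
  have "cls M C x c \<in> stalk_grouplike M C x \<longleftrightarrow>
      germ_tensor x (comult C c) = germ_tensor x (tn c c) \<and> germ M x (counit C c) = germ1 M x"
    unfolding stalk_grouplike_def grouplike_def t
    using c by (simp add: stalk_coalgebra_simps stalk_comult_cls stalk_counit_cls germ_tensor_tens)
  moreover have "germ_tensor x (comult C c) = germ_tensor x (tn c c) \<longleftrightarrow> T.geq x (comult C c) (tn c c)"
    using germ_tensor_geq[OF _ comult_closed[OF c] AA.tens_closed[OF c c]]
      germ_tensor_inj[OF _ comult_closed[OF c] AA.tens_closed[OF c c]] by (rule iffI[rotated])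
  ultimately show ?thesis by (simp add: normalized_at_def)
qed

lemma WG_stalk_grouplike:
  assumes c: "c \<in> WG" and n: "normalized_at M C c x"
  shows "cls M C x c \<in> stalk_grouplike M C x"
proof -
  obtain c' where c': "c' \<in> carrier C" "comult C c = tn c c'" "geq x c c'" using WG_germ[OF c n x] .
  have cc: "c \<in> carrier C" by (rule WG_carrier[OF c])
  have "T.geq x (tn c c') (tn c c)"
    using geq_tens[of x c c c' c] c' cc x geq_sym by simp
  then show ?thesis using stalk_grouplike_cls_iff[OF cc] c' n by simp
qed

text \<open>If \<open>g\<close> realizes \<Delta>(c) = c \<otimes> c near \<open>x\<close>, then
  \<Delta>(gc) = gc \<otimes> c holds globally. So \<open>g \<odot> c\<close> is weakly grouplike,
  and it has the class of \<open>c\<close> at \<open>x\<close>.\<close>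

lemma stalk_grouplike_WG:
  assumes z: "\<zeta> \<in> stalk_grouplike M C x"
  obtains c where "c \<in> WG" "normalized_at M C c x" "\<zeta> = cls M C x c"
proof -
  have "\<zeta> \<in> carrier (Cx x)"
    using z by (simp add: stalk_grouplike_def grouplike_def stalk_coalgebra_simps)
  then obtain c where c: "c \<in> carrier C" "\<zeta> = cls M C x c" by (rule stalk_cases)
  then have "T.geq x (comult C c) (tn c c)" and n: "normalized_at M C c x"
    using z stalk_grouplike_cls_iff by auto
  from this(1) show ?thesis
  proof (rule T.geqE)
    fix g :: "'m => 'f" assume g: "g \<in> Cc M TM" "germ M x g = germ1 M x"
      "g \<odot>\<^bsub>AxA\<^esub> comult C c = g \<odot>\<^bsub>AxA\<^esub> tn c c"
    have gc: "g \<odot> c \<in> carrier C" using g c by simp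
    have "comult C (g \<odot> c) = tn (g \<odot> c) c"
      using comult_smult[OF g(1) c(1)] g(3) AxA_smult_tens[OF g(1) c(1) c(1)] by simp
    then have w: "g \<odot> c \<in> WG" using gc c by (auto simp: weakly_grouplike_def)
    have "germ M x (counit C (g \<odot> c)) = germ1 M x"
      using counit_smult[OF g(1) c(1)] germ_one_mult[OF g(2)] n by (simp add: normalized_at_def)
    moreover have "\<zeta> = cls M C x (g \<odot> c)"
      using cls_eq_iff[OF x gc c(1)] geq_one[OF g(2,1) c(1) x] c(2) by simp
    ultimately show ?thesis using that[OF w] by (simp add: normalized_at_def)
  qed
qed

lemma stalk_grouplike_carrier: "stalk_grouplike M C x \<subseteq> carrier (Cx x)"
  by (auto simp: stalk_grouplike_def grouplike_def stalk_coalgebra_simps)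

end

end

section \<open>The sheaf coalgebra\<close>

subsection \<open>Elementary open sets\<close>

locale sheaf = Hausdorff_manifold M
  for M :: "'m manifold" +
  fixes E :: "'e manifold" and \<pi> :: "'e => 'm"
  assumes sheaf: "is_sheaf M E \<pi>"
begin

abbreviation "TE \<equiv> topspace (mtop E)"
abbreviation "CS \<equiv> Cc_sections E"

lemma E_mfd: "is_manifold E"
  using sheaf by (simp add: is_sheaf_def)

lemma proj_smooth: "smooth_map_on E TE M \<pi>"
  using sheaf by (simp add: is_sheaf_def local_diffeo_def)

lemma proj_in: "e \<in> TE ==> \<pi> e \<in> TM"
  using proj_smooth by (auto simp: smooth_map_on_def continuous_map_def)

lemma proj_continuous: "continuous_map (mtop E) (mtop M) \<pi>"
  using proj_smooth by (simp add: smooth_map_on_def)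

lemma proj_preimage_open: "openin (mtop M) W ==> openin (mtop E) {e \<in> TE. \<pi> e \<in> W}"
  by (rule smooth_map_on_preimage_open[OF proj_smooth])

lemma local_section:
  assumes "e \<in> TE"
  obtains U where "openin (mtop E) U" "e \<in> U" "openin (mtop M) (\<pi> ` U)" "inj_on \<pi> U"
    "smooth_map_on M (\<pi> ` U) E (inv_into U \<pi>)"
  using sheaf assms unfolding is_sheaf_def local_diffeo_def by blast

text \<open>Near each point the image of \<open>Q\<close> contains the preimage of \<open>Q\<close>
  under a local inverse, which is open because the local inverse is continuous.\<close>

lemma proj_open:
  assumes Q: "openin (mtop E) Q"
  shows "openin (mtop M) (\<pi> ` Q)"
proof (subst openin_subopen, intro ballI)
  fix y assume "y \<in> \<pi> ` Q"
  then obtain e where e: "e \<in> Q" "y = \<pi> e" by blast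
  then have "e \<in> TE" using Q openin_subset by blast
  then obtain U where U: "openin (mtop E) U" "e \<in> U" "openin (mtop M) (\<pi> ` U)" "inj_on \<pi> U"
    "smooth_map_on M (\<pi> ` U) E (inv_into U \<pi>)" by (rule local_section)
  show "\<exists>T. openin (mtop M) T \<and> y \<in> T \<and> T \<subseteq> \<pi> ` Q"
  proof (intro exI conjI)
    show "openin (mtop M) {y \<in> \<pi> ` U. inv_into U \<pi> y \<in> Q}"
      by (rule smooth_map_on_preimage_open[OF U(5) Q])
    show "y \<in> {y \<in> \<pi> ` U. inv_into U \<pi> y \<in> Q}" using e U inv_into_f_f[OF U(4,2)] by auto
    show "{y \<in> \<pi> ` U. inv_into U \<pi> y \<in> Q} \<subseteq> \<pi> ` Q"
    proof
      fix z assume z: "z \<in> {y \<in> \<pi> ` U. inv_into U \<pi> y \<in> Q}"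
      then have "\<pi> (inv_into U \<pi> z) = z" by (intro f_inv_into_f) simp
      then show "z \<in> \<pi> ` Q" using z by (metis (mono_tags, lifting) image_eqI mem_Collect_eq)
    qed
  qed
qed

abbreviation "el \<equiv> elementary E \<pi>"

lemma el_open: "el U ==> openin (mtop E) U" and el_inj: "el U ==> inj_on \<pi> U"
  by (simp_all add: elementary_def)

lemma el_sub: "el U ==> U \<subseteq> TE"
  using el_open openin_subset by blast

lemma el_image_open: "el U ==> openin (mtop M) (\<pi> ` U)"
  by (rule proj_open[OF el_open])

lemma el_subset: "el U ==> openin (mtop E) V ==> V \<subseteq> U ==> el V"
  by (auto simp: elementary_def intro: inj_on_subset)

lemma el_Int: "el U ==> openin (mtop E) V ==> el (U \<inter> V)"
  by (rule el_subset) (auto dest: el_open)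

lemma el_exists: "e \<in> TE ==> \<exists>U. el U \<and> e \<in> U"
  by (erule local_section) (auto simp: elementary_def)

lemma el_inv [simp]: "el U ==> e \<in> U ==> inv_into U \<pi> (\<pi> e) = e"
  by (rule inv_into_f_f[OF el_inj])

lemma el_inv_preimage:
  assumes U: "el U"
  shows "{y \<in> \<pi> ` U. inv_into U \<pi> y \<in> Q} = \<pi> ` (U \<inter> Q)"
proof (intro equalityI subsetI)
  fix y assume "y \<in> {y \<in> \<pi> ` U. inv_into U \<pi> y \<in> Q}"
  then obtain e where "e \<in> U" "y = \<pi> e" "inv_into U \<pi> y \<in> Q" by blast
  then show "y \<in> \<pi> ` (U \<inter> Q)" using U by auto
next
  fix y assume "y \<in> \<pi> ` (U \<inter> Q)"
  then obtain e where "e \<in> U" "e \<in> Q" "y = \<pi> e" by blast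
  then show "y \<in> {y \<in> \<pi> ` U. inv_into U \<pi> y \<in> Q}" using U by auto
qed

lemma el_inv_continuous:
  assumes U: "el U"
  shows "continuous_map (subtopology (mtop M) (\<pi> ` U)) (mtop E) (inv_into U \<pi>)"
  unfolding continuous_map_def
proof (intro conjI allI impI)
  have top: "topspace (subtopology (mtop M) (\<pi> ` U)) = \<pi> ` U"
    using openin_subset[OF el_image_open[OF U]] by auto
  show "inv_into U \<pi> \<in> topspace (subtopology (mtop M) (\<pi> ` U)) \<rightarrow> TE"
    unfolding top using el_sub[OF U] U by auto
  fix Q assume Q: "openin (mtop E) Q"
  have "openin (mtop M) (\<pi> ` (U \<inter> Q))" using proj_open el_open[OF U] Q by blast
  then show "openin (subtopology (mtop M) (\<pi> ` U))
      {y \<in> topspace (subtopology (mtop M) (\<pi> ` U)). inv_into U \<pi> y \<in> Q}"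
    unfolding top el_inv_preimage[OF U] by (auto simp: openin_open_subtopology[OF el_image_open[OF U]])
qed

text \<open>The definition of a sheaf provides smooth local inverses only on some small sets
  \<open>D\<close>. Around a given point the inverse on \<open>U\<close> coincides with such a one
  on the image of \<open>U \<inter> D \<inter> W\<close>, and smoothness is local.\<close>

lemma el_inv_smooth:
  assumes U: "el U"
  shows "smooth_map_on M (\<pi> ` U) E (inv_into U \<pi>)"
  unfolding smooth_map_on_def
proof (intro conjI ballI el_image_open[OF U] el_inv_continuous[OF U], clarify)
  fix V \<phi> W \<psi> i assume c: "(V, \<phi>) \<in> atlas M" "(W, \<psi>) \<in> atlas E" and i: "i < mdim E"
  let ?s = "inv_into U \<pi>"
  show "smooth_Rn (mdim M) (\<phi> ` (\<pi> ` U \<inter> V \<inter> ?s -` W)) (\<lambda>z. \<psi> (?s (inv_into V \<phi> z)) i)"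
  proof (rule smooth_Rn_local)
    fix z assume "z \<in> \<phi> ` (\<pi> ` U \<inter> V \<inter> ?s -` W)"
    then obtain e where e: "e \<in> U" "\<pi> e \<in> V" "e \<in> W" "z = \<phi> (\<pi> e)" using U by auto
    then have "e \<in> TE" using el_sub[OF U] by blast
    then obtain D where D: "openin (mtop E) D" "e \<in> D" "openin (mtop M) (\<pi> ` D)" "inj_on \<pi> D"
      "smooth_map_on M (\<pi> ` D) E (inv_into D \<pi>)" by (rule local_section)
    let ?P = "\<pi> ` (U \<inter> D \<inter> W)"
    have P: "openin (mtop M) ?P"
      by (intro proj_open openin_Int el_open[OF U] D(1) chart_openin[OF E_mfd c(2)])
    have oA: "openin (Euclidean_space (mdim M)) (\<phi> ` (?P \<inter> V))" by (rule chart_open[OF mfd c(1) P])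
    have inv: "inv_into D \<pi> y = ?s y" "?s y \<in> W" if y: "y \<in> ?P" for y
    proof -
      obtain d where "d \<in> U" "d \<in> D" "d \<in> W" "y = \<pi> d" using y by blast
      then show "inv_into D \<pi> y = ?s y" "?s y \<in> W" using U inv_into_f_f[OF D(4)] by auto
    qed
    have "smooth_Rn (mdim M) (\<phi> ` (\<pi> ` D \<inter> V \<inter> inv_into D \<pi> -` W)) (\<lambda>z. \<psi> (inv_into D \<pi> (inv_into V \<phi> z)) i)"
      using D(5) c i unfolding smooth_map_on_def by fast
    then have "smooth_Rn (mdim M) (\<phi> ` (?P \<inter> V)) (\<lambda>z. \<psi> (inv_into D \<pi> (inv_into V \<phi> z)) i)"
      by (rule smooth_Rn_subset[OF _ oA]) (use inv in auto)
    also have "smooth_Rn (mdim M) (\<phi> ` (?P \<inter> V)) (\<lambda>z. \<psi> (inv_into D \<pi> (inv_into V \<phi> z)) i) \<longleftrightarrow>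
        smooth_Rn (mdim M) (\<phi> ` (?P \<inter> V)) (\<lambda>z. \<psi> (?s (inv_into V \<phi> z)) i)"
    proof (rule smooth_Rn_cong)
      fix z assume "z \<in> \<phi> ` (?P \<inter> V)"
      then obtain y where y: "y \<in> ?P" "y \<in> V" "z = \<phi> y" by blast
      then have "inv_into V \<phi> z = y" using inv_into_f_f[OF chart_inj[OF mfd c(1)]] by simp
      then show "\<psi> (inv_into D \<pi> (inv_into V \<phi> z)) i = \<psi> (?s (inv_into V \<phi> z)) i" using inv(1)[OF y(1)] by simp
    qed
    finally show "\<exists>A. z \<in> A \<and> A \<subseteq> \<phi> ` (\<pi> ` U \<inter> V \<inter> ?s -` W) \<and>
        smooth_Rn (mdim M) A (\<lambda>z. \<psi> (?s (inv_into V \<phi> z)) i)"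
      by (intro exI[of _ "\<phi> ` (?P \<inter> V)"]) (use e D inv in auto)
  qed
qed

text \<open>\<open>U\<close> maps injectively and continuously to the Hausdorff space of
  \<open>M\<close>, although \<open>E\<close> itself need not be Hausdorff.\<close>

lemma el_Hausdorff:
  assumes U: "el U"
  shows "Hausdorff_space (subtopology (mtop E) U)"
proof (rule Hausdorff_space_injective_preimage[OF Hausd])
  show "continuous_map (subtopology (mtop E) U) (mtop M) \<pi>"
    by (rule continuous_map_from_subtopology[OF proj_continuous])
  show "inj_on \<pi> (topspace (subtopology (mtop E) U))"
    using el_inj[OF U] el_sub[OF U] by (simp add: Int_absorb1)
qed

subsection \<open>Extension by zero\<close>

text \<open>The compact set \<open>K\<close> is closed in the Hausdorff \<open>U\<close>, though
  perhaps not in \<open>E\<close>. So \<open>f\<close> is smooth on all of \<open>U\<close>, and its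
  germ vanishes at the points of \<open>U - V\<close>.\<close>

lemma Cc_extend:
  fixes f :: "'e => 'f::real_normed_field"
  assumes f: "f \<in> Cc E V" and VU: "V \<subseteq> U" and V: "openin (mtop E) V" and U: "openin (mtop E) U"
    and H: "Hausdorff_space (subtopology (mtop E) U)"
  shows "f \<in> Cc E U" and "ext_zero E V f = ext_zero E U f"
proof -
  have HV: "Hausdorff_space (subtopology (mtop E) V)"
    using Hausdorff_space_subtopology[OF H, of V] VU by (simp add: subtopology_subtopology Int_absorb1)
  obtain K where s: "smooth_on E V f" and K: "compactin (mtop E) K" "K \<subseteq> V" "\<forall>x. x \<notin> K --> f x = 0"
    using f unfolding Cc_iff[OF V HV] by blast
  have "closedin (subtopology (mtop E) U) K"
    by (rule compactin_imp_closedin[OF H]) (use K VU in \<open>simp add: compactin_subtopology\<close>)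
  then have "openin (subtopology (mtop E) U) (topspace (subtopology (mtop E) U) - K)" by (rule openin_diff[OF openin_topspace])
  moreover have "topspace (subtopology (mtop E) U) = U" using openin_subset[OF U] by auto
  ultimately have oK: "openin (mtop E) (U - K)" using openin_trans_full[OF _ U] by simp
  have "smooth_on E (U - K) f \<longleftrightarrow> smooth_on E (U - K) (\<lambda>_. 0 :: 'f)"
    by (rule smooth_on_cong[OF E_mfd]) (use K in auto)
  then have z: "smooth_on E (U - K) f" using smooth_on_const[OF E_mfd oK] by blast
  have "smooth_on E U f"
  proof (rule smooth_on_local[OF E_mfd])
    fix x assume "x \<in> U"
    then show "\<exists>W. x \<in> W \<and> W \<subseteq> U \<and> smooth_on E W f"
    proof (cases "x \<in> K")
      case True
      then show ?thesis using s K(2) VU by (intro exI[of _ V]) auto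
    next
      case False
      then show ?thesis using z \<open>x \<in> U\<close> by (intro exI[of _ "U - K"]) auto
    qed
  qed
  then show "f \<in> Cc E U"
    unfolding Cc_iff[OF U H] using K VU by (intro conjI exI[of _ K]) auto
  show "ext_zero E V f = ext_zero E U f"
  proof
    fix e show "ext_zero E V f e = ext_zero E U f e"
    proof (cases "e \<in> U - V")
      case True
      have "germ E e f = germ0 E e"
        by (rule germ_eqI[OF oK]) (use True K in auto)
      then show ?thesis using True by (simp add: ext_zero_def)
    qed (use VU in \<open>auto simp: ext_zero_def\<close>)
  qed
qed

text \<open>The cut-off outside \<open>U\<close> is what membership in \<open>Cc E U\<close>
  demands. On \<open>U\<close> the germs are those of \<open>f \<circ> \<pi>\<close>, which is why
  \<open>ez\<close> can do without it.\<close>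

definition pb :: "'e set => ('m => 'f::real_normed_field) => 'e => 'f" where
  "pb U f = (\<lambda>e. if e \<in> U then f (\<pi> e) else 0)"

definition ez :: "'e set => ('m => 'f::real_normed_field) => 'e => ('e => 'f) set" where
  "ez U f = ext_zero E U (f \<circ> \<pi>)"

definition smul :: "('m => 'f::real_normed_field) => ('e => ('e => 'f) set) => 'e => ('e => 'f) set" where
  "smul p s = sec_mult E (p \<circ> \<pi>) s"

lemma ext_zero_cong:
  assumes "openin (mtop E) U" "\<And>e. e \<in> U ==> f e = g e"
  shows "ext_zero E U f = ext_zero E U g"
proof
  fix e show "ext_zero E U f e = ext_zero E U g e"
    unfolding ext_zero_def using germ_eqI[OF assms(1) _ assms(2), of e] by auto
qed

lemma ez_pb: "el U ==> ext_zero E U (pb U f) = ez U f"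
  unfolding ez_def by (rule ext_zero_cong[OF el_open]) (auto simp: pb_def)

lemma pullback_smooth: "smooth_on M TM p ==> smooth_on E TE (p \<circ> \<pi>)"
  using smooth_on_pullback[OF E_mfd mfd proj_smooth, of TM p] proj_in
  by (simp add: comp_def Collect_conj_eq Int_absorb2 subset_iff cong: conj_cong)

lemma pb_Cc:
  assumes U: "el U" and f: "f \<in> Cc M (\<pi> ` U)"
  shows "pb U f \<in> Cc E U"
proof -
  obtain K where K: "compactin (mtop M) K" "K \<subseteq> \<pi> ` U" "\<forall>x. x \<notin> K --> f x = 0"
    using f unfolding Cc_iff_support[OF el_image_open[OF U]] by blast
  have "smooth_on E TE (f \<circ> \<pi>)" by (rule pullback_smooth[OF Cc_smooth_on_top[OF f]])
  then have "smooth_on E U (f \<circ> \<pi>)" by (rule smooth_on_subset[OF E_mfd _ el_open[OF U] el_sub[OF U]])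
  also have "smooth_on E U (f \<circ> \<pi>) \<longleftrightarrow> smooth_on E U (pb U f)"
    by (rule smooth_on_cong[OF E_mfd]) (simp add: pb_def)
  finally have s: "smooth_on E U (pb U f)" .
  have "compactin (mtop E) (inv_into U \<pi> ` K)"
    by (rule image_compactin[OF _ el_inv_continuous[OF U]]) (use K in \<open>simp add: compactin_subtopology\<close>)
  moreover have "inv_into U \<pi> ` K \<subseteq> U" using K(2) U by auto
  moreover have "pb U f e = 0" if "e \<notin> inv_into U \<pi> ` K" for e
  proof (cases "e \<in> U")
    case True
    have "\<pi> e \<notin> K"
    proof
      assume "\<pi> e \<in> K"
      then have "inv_into U \<pi> (\<pi> e) \<in> inv_into U \<pi> ` K" by (rule imageI)
      then show False using that U True by simp
    qed
    then show ?thesis using K(3) by (simp add: pb_def)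
  qed (simp add: pb_def)
  ultimately show ?thesis unfolding Cc_iff[OF el_open[OF U] el_Hausdorff[OF U]] using s by blast
qed

text \<open>The converse of \<open>pb_Cc\<close>: compactly supported functions on an elementary set
  are exactly the pullbacks of those on its image.\<close>

lemma push_Cc:
  assumes U: "el U" and h: "h \<in> Cc E U"
  obtains f where "f \<in> Cc M (\<pi> ` U)" "ext_zero E U h = ez U f"
proof -
  obtain K where s: "smooth_on E U h" and K: "compactin (mtop E) K" "K \<subseteq> U" "\<forall>x. x \<notin> K --> h x = 0"
    using h unfolding Cc_iff[OF el_open[OF U] el_Hausdorff[OF U]] by blast
  define f where "f y = (if y \<in> \<pi> ` U then h (inv_into U \<pi> y) else 0)" for y
  have e: "{y \<in> \<pi> ` U. inv_into U \<pi> y \<in> U} = \<pi> ` U" using el_inv_preimage[OF U, of U] by simp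
  have "smooth_on M (\<pi> ` U) (\<lambda>y. h (inv_into U \<pi> y))"
    using smooth_on_pullback[OF mfd E_mfd el_inv_smooth[OF U] s] unfolding e .
  also have "smooth_on M (\<pi> ` U) (\<lambda>y. h (inv_into U \<pi> y)) \<longleftrightarrow> smooth_on M (\<pi> ` U) f"
    by (rule smooth_on_cong[OF mfd]) (simp add: f_def)
  finally have "smooth_on M (\<pi> ` U) f" .
  moreover have "compactin (mtop M) (\<pi> ` K)" by (rule image_compactin[OF K(1) proj_continuous])
  moreover have "\<pi> ` K \<subseteq> \<pi> ` U" using K(2) by blast
  moreover have "f y = 0" if "y \<notin> \<pi> ` K" for y
  proof (cases "y \<in> \<pi> ` U")
    case True
    then obtain e where e: "e \<in> U" "y = \<pi> e" by blast
    then have "e \<notin> K" using that by blast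
    then show ?thesis using K(3) e U by (simp add: f_def)
  qed (simp add: f_def)
  ultimately have "f \<in> Cc M (\<pi> ` U)"
    unfolding Cc_open_iff[OF el_image_open[OF U]] by blast
  moreover have "ext_zero E U h = ez U f"
    unfolding ez_def by (rule ext_zero_cong[OF el_open[OF U]]) (use U in \<open>simp add: f_def\<close>)
  ultimately show ?thesis by (rule that)
qed

lemma ez_section: "el U ==> f \<in> Cc M (\<pi> ` U) ==> ez U f \<in> CS"
  using Cc_sections.ext[OF el_open el_Hausdorff pb_Cc] by (simp add: ez_pb)

text \<open>At a point of \<open>U - V\<close> the pullback is zero, since \<pi> is injective on
  \<open>U\<close> and \<open>f\<close> vanishes off the image of \<open>V\<close>;
  \<open>Cc_extend\<close> then compares the two extensions by zero.\<close>

lemma ez_mono: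
  assumes U: "el U" and V: "openin (mtop E) V" "V \<subseteq> U" and f: "f \<in> Cc M (\<pi> ` V)"
  shows "ez V f = ez U f"
proof -
  have elV: "el V" by (rule el_subset[OF U V])
  have "ez V f = ext_zero E V (pb V f)" by (rule ez_pb[OF elV, symmetric])
  also have "\<dots> = ext_zero E U (pb V f)"
    by (rule Cc_extend(2)[OF pb_Cc[OF elV f] V(2,1) el_open[OF U] el_Hausdorff[OF U]])
  also have "\<dots> = ez U f"
    unfolding ez_def
  proof (rule ext_zero_cong[OF el_open[OF U]])
    fix e assume e: "e \<in> U"
    show "pb V f e = (f \<circ> \<pi>) e"
    proof (cases "e \<in> V")
      case False
      have "\<pi> e \<notin> \<pi> ` V" using inj_onD[OF el_inj[OF U]] e False V(2) by blast
      then show ?thesis using Cc_outside[OF f] False by (simp add: pb_def)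
    qed (simp add: pb_def)
  qed
  finally show ?thesis .
qed

subsection \<open>The module of sections\<close>

lemma sec_add_ext_zero: "sec_add E (ext_zero E U f) (ext_zero E U g) = ext_zero E U (\<lambda>e. f e + g e)"
  by (rule HOL.ext) (simp add: sec_add_def ext_zero_def germ_op_germ)

lemma sec_mult_ext_zero: "sec_mult E p (ext_zero E U f) = ext_zero E U (\<lambda>e. p e * f e)"
  by (rule HOL.ext) (simp add: sec_mult_def ext_zero_def germ_op_germ)

lemma section_germ:
  assumes "s \<in> CS" shows "\<exists>F. s e = germ E e F"
  using assms
proof induction
  case (ext U f)
  then show ?case by (auto simp: ext_zero_def)
next
  case (add s t)
  then show ?case by (auto simp: sec_add_def germ_op_germ)
next
  case (scale s a)
  then show ?case by (auto simp: sec_mult_def germ_op_germ)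
qed

text \<open>With representatives chosen at all points at once, the module axioms for sections reduce
  to identities between functions.\<close>

lemma section_germs:
  assumes "s \<in> CS"
  obtains F where "s = (\<lambda>e. germ E e (F e))"
proof -
  have "\<forall>e. \<exists>F. s e = germ E e F" using section_germ[OF assms] by blast
  then obtain F where "\<forall>e. s e = germ E e (F e)" by metis
  then show ?thesis by (intro that[of F] HOL.ext) simp
qed

lemma sec_add_germs: "sec_add E (\<lambda>e. germ E e (F e)) (\<lambda>e. germ E e (G e)) = (\<lambda>e. germ E e (\<lambda>y. F e y + G e y))"
  and sec_mult_germs: "sec_mult E p (\<lambda>e. germ E e (F e)) = (\<lambda>e. germ E e (\<lambda>y. p y * F e y))"
  by (simp_all add: sec_add_def sec_mult_def germ_op_germ)

lemma zero_section: "(\<lambda>e. germ0 E e) \<in> CS"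
proof -
  have "ext_zero E {} (\<lambda>_. 0) \<in> CS"
    by (rule Cc_sections.ext) (auto simp: Cc_def smooth_on_const[OF E_mfd])
  then show ?thesis by (simp add: ext_zero_def)
qed

lemma sec_mult_closed:
  fixes p :: "'m => 'f::real_normed_field"
  assumes p: "smooth_on M TM p" and s: "s \<in> CS"
  shows "smul p s \<in> CS"
  using s
proof induction
  case (ext U f)
  obtain K where s: "smooth_on E U f" and K: "compactin (mtop E) K" "K \<subseteq> U" "\<forall>x. x \<notin> K --> f x = 0"
    using ext(3) unfolding Cc_iff[OF ext(1,2)] by blast
  have pU: "smooth_on E U (p \<circ> \<pi>)"
    by (rule smooth_on_subset[OF E_mfd pullback_smooth[OF p] ext(1) openin_subset[OF ext(1)]])
  have "(\<lambda>e. (p \<circ> \<pi>) e * f e) \<in> Cc E U"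
    unfolding Cc_iff[OF ext(1,2)] using K by (intro conjI smooth_on_mult[OF E_mfd pU s] exI[of _ K]) auto
  then show ?case unfolding smul_def sec_mult_ext_zero by (rule Cc_sections.ext[OF ext(1,2)])
next
  case (add s t)
  obtain F where F: "s = (\<lambda>e. germ E e (F e))" using section_germs[OF add.hyps(1)] .
  obtain G where G: "t = (\<lambda>e. germ E e (G e))" using section_germs[OF add.hyps(2)] .
  have "smul p (sec_add E s t) = sec_add E (smul p s) (smul p t)"
    unfolding F G smul_def sec_add_germs sec_mult_germs by (simp add: algebra_simps)
  then show ?case using Cc_sections.add[OF add.IH] by simp
next
  case (scale s a)
  obtain F where F: "s = (\<lambda>e. germ E e (F e))" using section_germs[OF scale.hyps(1)] .
  have "smul p (sec_mult E (\<lambda>_. a) s) = sec_mult E (\<lambda>_. a) (smul p s)"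
    unfolding F smul_def sec_mult_germs by (simp add: algebra_simps)
  then show ?case using Cc_sections.scale[OF scale.IH] by simp
qed

abbreviation Sec :: "('m => 'f::real_normed_field, 'e => ('e => 'f) set) module" where
  "Sec \<equiv> sheaf_module E \<pi>"

lemma Sec_simps [simp]: "carrier Sec = CS" "s \<oplus>\<^bsub>Sec\<^esub> t = sec_add E s t"
  "p \<odot>\<^bsub>Sec\<^esub> s = smul p s" "\<zero>\<^bsub>Sec\<^esub> = (\<lambda>e. germ0 E e)"
  by (simp_all add: sheaf_module_def smul_def)

lemma section_germs':
  assumes "s \<in> carrier Sec"
  obtains F where "s = (\<lambda>e. germ E e (F e))"
  by (rule section_germs[of s]) (use assms in simp, rule that)

lemma Sec_abelian_group: "abelian_group Sec"
proof (rule abelian_groupI, goal_cases)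
  case (1 s t)
  then show ?case by (simp add: Cc_sections.add)
next
  case 2
  then show ?case by (simp add: zero_section)
next
  case (3 s t u)
  then show ?case by (elim section_germs') (simp add: sec_add_germs algebra_simps)
next
  case (4 s t)
  then show ?case by (elim section_germs') (simp add: sec_add_germs algebra_simps)
next
  case (5 s)
  then show ?case by (elim section_germs') (simp add: sec_add_germs)
next
  case (6 s)
  have "sec_mult E (\<lambda>_. - 1) s \<in> CS" using 6 by (simp add: Cc_sections.scale)
  then show ?case using 6
    by (intro bexI[of _ "sec_mult E (\<lambda>_. - 1) s"]; elim section_germs')
      (simp_all add: sec_add_germs sec_mult_germs)
qed

lemma Sec_rmodule: "rmodule RM Sec"
  unfolding rmodule_def
proof (intro conjI ballI Sec_abelian_group, goal_cases)
  case (1 r a)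
  then show ?case by (simp add: sec_mult_closed[OF Cc_smooth_on_top])
next
  case (2 r s a)
  then show ?case by (elim section_germs')
      (simp add: smul_def sec_add_germs sec_mult_germs algebra_simps)
next
  case (3 r a b)
  then show ?case by (elim section_germs')
      (simp add: smul_def sec_add_germs sec_mult_germs algebra_simps)
next
  case (4 r s a)
  then show ?case by (elim section_germs')
      (simp add: smul_def sec_mult_germs algebra_simps)
qed

lemma ez_add: "sec_add E (ez U f) (ez U g) = ez U (\<lambda>y. f y + g y)"
  by (simp add: ez_def sec_add_ext_zero comp_def)

lemma ez_smult: "smul p (ez U f) = ez U (\<lambda>y. p y * f y)"
  by (simp add: ez_def smul_def sec_mult_ext_zero comp_def)

text \<open>
  Every section with compact support in a Hausdorff open set decomposes into sections supported
  in elementary sets; again the functions \<open>1 - \<Prod>(1 - h\<^sub>i)\<close> replace a partition of unity.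
\<close>

lemma section_span:
  fixes U :: "'i => 'e set" and s :: "'e => ('e => 'f::real_normed_field) set"
  assumes U: "\<And>i. i \<in> I ==> el (U i)" and cover: "TE \<subseteq> (\<Union>i\<in>I. U i)" and s: "s \<in> CS"
  shows "s \<in> addspan Sec {ez (U i) f |i f. i \<in> I \<and> f \<in> Cc M (\<pi> ` U i)}"
  using s
proof induction
  interpret A: rmod "Cc_ring M" "Sec :: ('m => 'f, 'e => ('e => 'f) set) module"
    by unfold_locales (rule Sec_rmodule)
  let ?X = "{ez (U i) f |i f. i \<in> I \<and> (f :: 'm => 'f) \<in> Cc M (\<pi> ` U i)}"
  have X: "?X \<subseteq> carrier Sec" using ez_section U by auto
  note plus = A.addspan_plus[OF X, simplified Sec_simps]
  {
    case (add s t)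
    then show ?case using plus by simp
  next
    case (scale s a)
    from scale.IH show ?case
    proof (induction rule: addspan.induct)
      case zero
      then show ?case using addspan.zero[of Sec ?X] by (simp add: sec_mult_germs)
    next
      case (add x s)
      obtain i f where x: "i \<in> I" "f \<in> Cc M (\<pi> ` U i)" "x = ez (U i) f" using add.hyps(1) by blast
      have c: "x \<in> CS" "s \<in> CS"
        using subsetD[OF X add.hyps(1)] A.addspan_closed[OF X add.hyps(2)] by simp_all
      obtain F G where F: "x = (\<lambda>e. germ E e (F e))" and G: "s = (\<lambda>e. germ E e (G e))"
        by (rule section_germs[OF c(1)], rule section_germs[OF c(2)], rule that)
      have "sec_mult E (\<lambda>_. a) (sec_add E x s) = sec_add E (sec_mult E (\<lambda>_. a) x) (sec_mult E (\<lambda>_. a) s)"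
        unfolding F G sec_add_germs sec_mult_germs by (simp add: algebra_simps)
      moreover have "sec_mult E (\<lambda>_. a) x = ez (U i) (\<lambda>y. a * f y)"
        unfolding x(3) ez_def sec_mult_ext_zero by (simp add: comp_def)
      moreover have "ez (U i) (\<lambda>y. a * f y) \<in> ?X" using x Cc_scale[OF x(2)] by blast
      ultimately show ?case using addspan.add[of _ ?X _ Sec] add.IH by simp
    qed
  next
    case (ext Q f)
    note Q = ext(1,2)
    obtain K where K: "compactin (mtop E) K" "K \<subseteq> Q" "\<forall>x. x \<notin> K --> f x = 0"
      using ext(3) unfolding Cc_iff[OF Q] by blast
    have loc: "\<exists>i V h W. i \<in> I \<and> V = U i \<inter> Q \<and> (h :: 'm => 'f) \<in> Cc M (\<pi> ` V) \<and> openin (mtop E) W \<and> e \<in> W \<and>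
        (\<forall>d\<in>W. pb V h d = 1)" if "e \<in> K" for e
    proof -
      have eT: "e \<in> TE" using that K(2) Q(1) openin_subset by blast
      then obtain i where i: "i \<in> I" "e \<in> U i" using cover by blast
      let ?V = "U i \<inter> Q"
      have V: "el ?V" by (rule el_Int[OF U[OF i(1)] Q(1)])
      have eV: "e \<in> ?V" using that i K by blast
      obtain h :: "'m => 'f" where h: "h \<in> Cc M (\<pi> ` ?V)" "germ M (\<pi> e) h = germ1 M (\<pi> e)"
        by (rule bump[OF el_image_open[OF V] imageI[OF eV]])
      obtain P where P: "openin (mtop M) P" "\<pi> e \<in> P" "\<forall>y\<in>P. h y = 1"
        using h(2) unfolding germ_eq_iff[OF proj_in[OF eT]] by blast
      show ?thesis
      proof (intro exI conjI)
        show "openin (mtop E) (?V \<inter> {e \<in> TE. \<pi> e \<in> P})"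
          by (intro openin_Int[OF el_open[OF V]] proj_preimage_open P(1))
        show "\<forall>d\<in>?V \<inter> {e \<in> TE. \<pi> e \<in> P}. pb ?V h d = 1" using P(3) by (simp add: pb_def)
      qed (use i h P eV eT in simp_all)
    qed
    have "\<forall>e\<in>K. \<exists>i h W. i \<in> I \<and> (h :: 'm => 'f) \<in> Cc M (\<pi> ` (U i \<inter> Q)) \<and> openin (mtop E) W \<and> e \<in> W \<and>
        (\<forall>d\<in>W. pb (U i \<inter> Q) h d = 1)"
      using loc by blast
    from bchoice[OF this] obtain i where "\<forall>e\<in>K. \<exists>h W. i e \<in> I \<and> (h :: 'm => 'f) \<in> Cc M (\<pi> ` (U (i e) \<inter> Q)) \<and> openin (mtop E) W \<and> e \<in> W \<and>
        (\<forall>d\<in>W. pb (U (i e) \<inter> Q) h d = 1)" by blast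
    from bchoice[OF this] obtain h where "\<forall>e\<in>K. \<exists>W. i e \<in> I \<and> (h e :: 'm => 'f) \<in> Cc M (\<pi> ` (U (i e) \<inter> Q)) \<and> openin (mtop E) W \<and> e \<in> W \<and>
        (\<forall>d\<in>W. pb (U (i e) \<inter> Q) (h e) d = 1)" by blast
    from bchoice[OF this] obtain W where W: "\<forall>e\<in>K. i e \<in> I \<and> (h e :: 'm => 'f) \<in> Cc M (\<pi> ` (U (i e) \<inter> Q)) \<and> openin (mtop E) (W e) \<and> e \<in> W e \<and>
        (\<forall>d\<in>W e. pb (U (i e) \<inter> Q) (h e) d = 1)" by blast
    have "\<exists>\<F>. finite \<F> \<and> \<F> \<subseteq> W ` K \<and> K \<subseteq> \<Union>\<F>"
      by (rule compactinD[OF K(1)]) (use W in auto)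
    then obtain Y where Y: "finite Y" "Y \<subseteq> K" "K \<subseteq> (\<Union>e\<in>Y. W e)"
      by (metis finite_subset_image)
    \<comment> \<open>The remainder \<open>f'\<close> is built as \<open>f\<close> times the factors
      1 - \<open>pb (U (i e) \<inter> Q) (h e)\<close> for \<open>e\<close> in \<open>Y\<close>.
      Only its vanishing, where \<open>f\<close> vanishes and on the sets \<open>W e\<close>, is
      recorded; for the full \<open>Y\<close> it forces \<open>f'\<close> to be 0.\<close>
    have "\<exists>f'\<in>Cc E Q. (\<forall>d. f d = 0 --> f' d = 0) \<and> (\<forall>e\<in>Y. \<forall>d\<in>W e. f' d = 0) \<and>
        (\<exists>\<sigma>\<in>addspan Sec ?X. ext_zero E Q f = sec_add E \<sigma> (ext_zero E Q f'))"
      using Y(1,2)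
    proof (induction Y rule: finite_induct)
      case empty
      have "ext_zero E Q f \<in> carrier Sec" using Cc_sections.ext[OF ext] by simp
      then have "ext_zero E Q f = sec_add E \<zero>\<^bsub>Sec\<^esub> (ext_zero E Q f)" using A.l_zero[of "ext_zero E Q f"] by simp
      then show ?case using ext(3) addspan.zero[of Sec ?X] by (intro bexI[OF _ ext(3)] conjI bexI) auto
    next
      case (insert e Y)
      then obtain f' \<sigma> where f': "f' \<in> Cc E Q" "\<forall>d. f d = 0 --> f' d = 0" "\<forall>e\<in>Y. \<forall>d\<in>W e. f' d = 0"
        "\<sigma> \<in> addspan Sec ?X" "ext_zero E Q f = sec_add E \<sigma> (ext_zero E Q f')" by auto
      have e: "e \<in> K" using insert by simp
      let ?V = "U (i e) \<inter> Q"
      have iI: "i e \<in> I" and hV: "h e \<in> Cc M (\<pi> ` ?V)" and one: "\<forall>d\<in>W e. pb ?V (h e) d = 1" using W e by auto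
      have V: "el ?V" by (rule el_Int[OF U[OF iI] Q(1)])
      have HV: "pb ?V (h e) \<in> Cc E ?V" by (rule pb_Cc[OF V hV])
      obtain L where L: "smooth_on E ?V (pb ?V (h e))" "compactin (mtop E) L" "L \<subseteq> ?V" "\<forall>x. x \<notin> L --> pb ?V (h e) x = 0"
        using HV unfolding Cc_iff[OF el_open[OF V] el_Hausdorff[OF V]] by blast
      have f's: "smooth_on E Q f'" using f'(1) by (simp add: Cc_def)
      define f1 where "f1 d = f' d * pb ?V (h e) d" for d
      define f2 where "f2 d = f' d + (- 1) * f1 d" for d
      have f1V: "f1 \<in> Cc E ?V"
        unfolding Cc_iff[OF el_open[OF V] el_Hausdorff[OF V]] f1_def
        using L smooth_on_subset[OF E_mfd f's el_open[OF V]]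
        by (intro conjI smooth_on_mult[OF E_mfd] exI[of _ L]) auto
      note f1Q = Cc_extend[OF f1V _ el_open[OF V] Q, of, OF Int_lower2]
      obtain K' where K': "compactin (mtop E) K'" "K' \<subseteq> Q" "\<forall>x. x \<notin> K' --> f' x = 0"
        using f'(1) unfolding Cc_iff[OF Q] by blast
      have f1s: "smooth_on E Q f1" using f1Q(1) by (simp add: Cc_def)
      have f2s: "smooth_on E Q f2"
        unfolding f2_def
        by (intro smooth_on_add[OF E_mfd] smooth_on_mult[OF E_mfd] smooth_on_const[OF E_mfd Q(1)] f's f1s)
      have f2Q: "f2 \<in> Cc E Q"
        unfolding Cc_iff[OF Q]
      proof (intro conjI exI[of _ K'] f2s K'(1,2) allI impI)
        fix d assume "d \<notin> K'"
        then show "f2 d = 0" using K'(3) by (simp add: f2_def f1_def)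
      qed
      obtain g where g: "g \<in> Cc M (\<pi> ` ?V)" "ext_zero E ?V f1 = ez ?V g" by (rule push_Cc[OF V f1V])
      have "ez ?V g = ez (U (i e)) g"
        by (rule ez_mono[OF U[OF iI] el_open[OF V] Int_lower1 g(1)])
      then have x: "ext_zero E Q f1 = ez (U (i e)) g" using g(2) f1Q(2) by simp
      have "g \<in> Cc M (\<pi> ` U (i e))" by (rule Cc_mono[OF g(1) el_image_open[OF U[OF iI]]]) blast
      then have xX: "ext_zero E Q f1 \<in> ?X" using x iI by blast
      have "ext_zero E Q f' = sec_add E (ext_zero E Q f1) (ext_zero E Q f2)"
        unfolding sec_add_ext_zero by (rule ext_zero_cong[OF Q(1)]) (simp add: f2_def)
      moreover have "ext_zero E Q f1 \<in> carrier Sec" "ext_zero E Q f2 \<in> carrier Sec" "\<sigma> \<in> carrier Sec"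
        using X xX Cc_sections.ext[OF Q f2Q] A.addspan_closed[OF X f'(4)] by auto
      ultimately have "ext_zero E Q f = sec_add E (sec_add E \<sigma> (ext_zero E Q f1)) (ext_zero E Q f2)"
        using f'(5) A.a_assoc[of \<sigma> "ext_zero E Q f1" "ext_zero E Q f2"] by simp
      moreover have "sec_add E \<sigma> (ext_zero E Q f1) \<in> addspan Sec ?X"
        by (rule plus[OF f'(4) A.addspan_incl[OF X xX]])
      moreover have "\<forall>d. f d = 0 --> f2 d = 0" "\<forall>e\<in>insert e Y. \<forall>d\<in>W e. f2 d = 0"
        using f'(2,3) one by (auto simp: f2_def f1_def)
      ultimately show ?case by (intro bexI[OF _ f2Q] conjI bexI)
    qed
    then obtain f' \<sigma> where f': "\<forall>d. f d = 0 --> f' d = 0" "\<forall>e\<in>Y. \<forall>d\<in>W e. f' d = 0"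
      "\<sigma> \<in> addspan Sec ?X" "ext_zero E Q f = sec_add E \<sigma> (ext_zero E Q f')" by auto
    have "f' = (\<lambda>_. 0)"
    proof
      fix d show "f' d = 0" using f'(1,2) K(3) Y(3) by (cases "d \<in> K") auto
    qed
    then have "ext_zero E Q f' = \<zero>\<^bsub>Sec\<^esub>" by (simp add: ext_zero_def)
    then have "ext_zero E Q f = \<sigma>"
      using f'(4) A.r_zero[of \<sigma>] A.addspan_closed[OF X f'(3)] by simp
    then show ?case using f'(3) by simp
  }
qed

end

section \<open>Common local units, and the ring as a module over itself\<close>

context Hausdorff_manifold
begin

lemma compact_unit:
  assumes "compactin (mtop M) K"
  obtains r :: "'m => 'f::real_normed_field" where "r \<in> Cc M TM" "\<forall>y\<in>K. r y = 1"
proof -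
  have KT: "K \<subseteq> TM" by (rule compactin_subset_topspace[OF assms])
  obtain r :: "'m => 'f" where r: "r \<in> Cc M TM" "\<And>y. y \<in> K ==> germ M y r = germ1 M y"
    by (rule compact_bump[OF openin_topspace assms KT]) (rule that, assumption, simp)
  show ?thesis
  proof (rule that[OF r(1)], rule ballI)
    fix y assume y: "y \<in> K"
    show "r y = 1" using germ_value[OF _ r(2)[OF y]] y KT by auto
  qed
qed

abbreviation Reg :: "('m => 'f::real_normed_field, 'm => 'f) module" where
  "Reg \<equiv> regular_module RM"

lemma Reg_simps [simp]: "carrier Reg = Cc M TM" "f \<oplus>\<^bsub>Reg\<^esub> g = (\<lambda>y. f y + g y)"
  "f \<odot>\<^bsub>Reg\<^esub> g = (\<lambda>y. f y * g y)" "\<zero>\<^bsub>Reg\<^esub> = (\<lambda>_. 0)"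
  by (simp_all add: regular_module_def)

lemma Reg_lmod: "lmod M (Reg :: ('m => 'f::real_normed_field, 'm => 'f) module)"
proof (intro lmod.intro Hausdorff_manifold_axioms rmod.intro lmod_axioms.intro)
  have "abelian_group (Reg :: ('m => 'f, 'm => 'f) module)"
  proof (rule abelian_groupI, goal_cases)
    case (6 f)
    then show ?case by (intro bexI[of _ "\<lambda>y. - f y"]) (simp_all add: Cc_uminus)
  qed (simp_all add: Cc_add Cc_zero algebra_simps)
  then show "rmodule RM (Reg :: ('m => 'f, 'm => 'f) module)"
    unfolding rmodule_def by (simp add: Cc_mult algebra_simps)
  show "locally_unitary RM (Reg :: ('m => 'f, 'm => 'f) module)"
    unfolding locally_unitary_def
  proof (intro allI impI, elim conjE)
    fix S :: "('m => 'f) set" assume S: "finite S" "S \<subseteq> carrier Reg"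
    have "\<exists>K. compactin (mtop M) K \<and> (\<forall>y. y \<notin> K --> a y = 0)" if "a \<in> S" for a
    proof -
      have "a \<in> Cc M TM" using that S by auto
      then show ?thesis unfolding Cc_iff_support[OF openin_topspace] by blast
    qed
    then have "\<forall>a\<in>S. \<exists>K. compactin (mtop M) K \<and> (\<forall>y. y \<notin> K --> a y = 0)" by blast
    from bchoice[OF this] obtain K where K: "\<forall>a\<in>S. compactin (mtop M) (K a) \<and> (\<forall>y. y \<notin> K a --> a y = 0)" by blast
    have "compactin (mtop M) (\<Union>(K ` S))" by (rule compactin_Union) (use S K in auto)
    then obtain r :: "'m => 'f" where r: "r \<in> Cc M TM" "\<forall>y\<in>\<Union>(K ` S). r y = 1"
      by (rule compact_unit)
    have "(\<lambda>y. r y * a y) = a" if a: "a \<in> S" for a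
    proof
      fix y show "r y * a y = a y" using K a bspec[OF r(2), of y] by (cases "y \<in> K a") auto
    qed
    then show "\<exists>r\<in>carrier RM. \<forall>a\<in>S. r \<odot>\<^bsub>Reg\<^esub> a = a"
      using r(1) by (intro bexI[of _ r]) simp_all
  qed
qed

end

context sheaf
begin

subsection \<open>Coordinates of sections\<close>

text \<open>
  The germ of a section at \<open>e\<close>, transported to \<open>M\<close> along the local inverse of the projection.
\<close>

definition el_of :: "'e => 'e set" where "el_of e = (SOME U. el U \<and> e \<in> U)"

definition loc :: "'e => ('e => ('e => 'f::real_normed_field) set) => ('m => 'f) set" where
  "loc e s = germ M (\<pi> e) (\<lambda>y. (SOME F. F \<in> s e) (inv_into (el_of e) \<pi> y))"

text \<open>The elementary set and the representative chosen in \<open>loc\<close> do not matter: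
  different choices give the same function on the image of a small neighbourhood of
  \<open>e\<close>.\<close>

lemma loc_germ:
  assumes e: "e \<in> TE" "el U" "e \<in> U" and s: "s e = germ E e F"
  shows "loc e s = germ M (\<pi> e) (\<lambda>y. F (inv_into U \<pi> y))"
proof -
  have D: "el (el_of e)" "e \<in> el_of e"
    using someI_ex[OF el_exists[OF e(1)]] by (simp_all add: el_of_def)
  define G where "G = (SOME F. F \<in> s e)"
  have "F \<in> s e" using s germ_mem[OF e(1)] by simp
  then have "G \<in> s e" unfolding G_def by (rule someI[of "\<lambda>F. F \<in> s e"])
  then obtain Q where Q: "openin (mtop E) Q" "e \<in> Q" "\<forall>y\<in>Q. G y = F y"
    unfolding s germ_def by blast
  have "germ M (\<pi> e) (\<lambda>y. G (inv_into (el_of e) \<pi> y)) = germ M (\<pi> e) (\<lambda>y. F (inv_into U \<pi> y))"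
  proof (rule germ_eqI)
    show "openin (mtop M) (\<pi> ` (U \<inter> el_of e \<inter> Q))"
      by (intro proj_open openin_Int el_open e(2) D(1) Q(1))
    show "\<pi> e \<in> \<pi> ` (U \<inter> el_of e \<inter> Q)" using e D Q by blast
    fix y assume "y \<in> \<pi> ` (U \<inter> el_of e \<inter> Q)"
    then obtain d where "d \<in> U" "d \<in> el_of e" "d \<in> Q" "y = \<pi> d" by blast
    then show "G (inv_into (el_of e) \<pi> y) = F (inv_into U \<pi> y)" using e(2) D(1) Q(3) by simp
  qed
  then show ?thesis by (simp add: loc_def G_def)
qed

lemma loc_cases:
  assumes "e \<in> TE" "s \<in> CS"
  obtains U F where "el U" "e \<in> U" "s e = germ E e F" "loc e s = germ M (\<pi> e) (\<lambda>y. F (inv_into U \<pi> y))"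
proof -
  obtain U where U: "el U" "e \<in> U" using el_exists[OF assms(1)] by blast
  obtain F where F: "s e = germ E e F" using section_germ[OF assms(2)] by blast
  show ?thesis by (rule that[OF U F loc_germ[of e U s F, OF assms(1) U F]])
qed

lemma loc_add:
  assumes e: "e \<in> TE" and s: "s \<in> CS" and t: "t \<in> CS"
  shows "loc e (sec_add E s t) = loc e s \<oplus>\<^bsub>germ_ring M (\<pi> e)\<^esub> loc e t"
proof -
  obtain U where U: "el U" "e \<in> U" using el_exists[OF e] by blast
  obtain F where F: "s e = germ E e F" using section_germ[OF s] by blast
  obtain G where G: "t e = germ E e G" using section_germ[OF t] by blast
  have "sec_add E s t e = germ E e (\<lambda>y. F y + G y)" by (simp add: sec_add_def F G germ_op_germ)
  then have "loc e (sec_add E s t) = germ M (\<pi> e) (\<lambda>y. F (inv_into U \<pi> y) + G (inv_into U \<pi> y))"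
    using loc_germ[of e U "sec_add E s t" "\<lambda>y. F y + G y", OF e U] by simp
  then show ?thesis using loc_germ[of e U s F, OF e U F] loc_germ[of e U t G, OF e U G] by simp
qed

lemma loc_smul:
  assumes e: "e \<in> TE" and s: "s \<in> CS"
  shows "loc e (smul p s) = germ M (\<pi> e) p \<otimes>\<^bsub>germ_ring M (\<pi> e)\<^esub> loc e s"
proof -
  obtain U where U: "el U" "e \<in> U" using el_exists[OF e] by blast
  obtain F where F: "s e = germ E e F" using section_germ[OF s] by blast
  have "smul p s e = germ E e (\<lambda>y. p (\<pi> y) * F y)"
    by (simp add: smul_def sec_mult_def F germ_op_germ)
  then have "loc e (smul p s) = germ M (\<pi> e) (\<lambda>y. p (\<pi> (inv_into U \<pi> y)) * F (inv_into U \<pi> y))"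
    by (rule loc_germ[of e U "smul p s" "\<lambda>y. p (\<pi> y) * F y", OF e U])
  also have "\<dots> = germ M (\<pi> e) (\<lambda>y. p y * F (inv_into U \<pi> y))"
    by (rule germ_eqI[OF el_image_open[OF U(1)]]) (use U in \<open>auto simp: f_inv_into_f\<close>)
  finally show ?thesis using loc_germ[of e U s F, OF e U F] by simp
qed

lemma loc_zero: "e \<in> TE ==> loc e (\<lambda>e. germ0 E e) = germ0 M (\<pi> e)"
  using el_exists loc_germ[of e _ "\<lambda>e. germ0 E e" "\<lambda>_. 0"] by blast

lemma loc_ez:
  assumes e: "e \<in> TE" and U: "el U" and f: "f \<in> Cc M (\<pi> ` U)"
  shows "loc e (ez U f) = (if e \<in> U then germ M (\<pi> e) f else germ0 M (\<pi> e))"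
proof (cases "e \<in> U")
  case True
  have "ez U f e = germ E e (f \<circ> \<pi>)" using True by (simp add: ez_def ext_zero_def)
  then have "loc e (ez U f) = germ M (\<pi> e) (\<lambda>y. (f \<circ> \<pi>) (inv_into U \<pi> y))"
    by (rule loc_germ[of e U "ez U f" "f \<circ> \<pi>", OF e U True])
  also have "\<dots> = germ M (\<pi> e) f"
    by (rule germ_eqI[OF el_image_open[OF U]]) (use True in \<open>auto simp: f_inv_into_f\<close>)
  finally show ?thesis using True by simp
next
  case False
  obtain D where D: "el D" "e \<in> D" using el_exists[OF e] by blast
  have "ez U f e = germ0 E e" using False by (simp add: ez_def ext_zero_def)
  then show ?thesis using loc_germ[of e D "ez U f" "\<lambda>_. 0", OF e D] False by simp
qed

text \<open>The representative chosen in \<open>loc\<close> need not be smooth near the point; a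
  smooth one is found by writing the section as a sum of generators.\<close>

lemma loc_closed:
  fixes s :: "'e => ('e => 'f::real_normed_field) set"
  assumes e: "e \<in> TE" and s: "s \<in> CS"
  shows "loc e s \<in> carrier (germ_ring M (\<pi> e))"
proof -
  let ?X = "{ez U f |U (f :: 'm => 'f). U \<in> Collect el \<and> f \<in> Cc M (\<pi> ` U)}"
  have "s \<in> addspan Sec ?X"
    by (rule section_span[OF _ _ s, of "Collect el" "\<lambda>U. U"]) (use el_exists in auto)
  then have "\<exists>f\<in>Cc M TM. loc e s = germ M (\<pi> e) f"
  proof (induction rule: addspan.induct)
    case zero
    then show ?case using loc_zero[OF e] Cc_zero[OF openin_topspace] by auto
  next
    case (add u s)
    obtain U f where u: "el U" "f \<in> Cc M (\<pi> ` U)" "u = ez U f" using add.hyps(1) by blast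
    have uf: "\<exists>g\<in>Cc M TM. loc e u = germ M (\<pi> e) g"
      unfolding u(3) loc_ez[OF e u(1,2)]
      using Cc_in_ring[OF u(2)] Cc_zero[OF openin_topspace] by (cases "e \<in> U") auto
    have uc: "u \<in> CS" unfolding u(3) by (rule ez_section[OF u(1,2)])
    have sc: "s \<in> carrier Sec"
    proof (rule abelian_group.addspan_closed[OF Sec_abelian_group _ add.hyps(2)])
      show "?X \<subseteq> carrier Sec" using ez_section by auto
    qed
    obtain g where g: "g \<in> Cc M TM" "loc e u = germ M (\<pi> e) g" using uf by blast
    obtain f where f: "f \<in> Cc M TM" "loc e s = germ M (\<pi> e) f" using add.IH by blast
    have "loc e (u \<oplus>\<^bsub>Sec\<^esub> s) = germ M (\<pi> e) (\<lambda>y. g y + f y)"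
      using loc_add[OF e uc] sc g f by simp
    then show ?case using Cc_add[OF g(1) f(1)] by blast
  qed
  then show ?thesis using Cc_germ_in_ring[OF proj_in[OF e]] by auto
qed

lemma loc_inj:
  assumes s: "s \<in> CS" and z: "\<And>e. e \<in> TE ==> loc e s = germ0 M (\<pi> e)"
  shows "s = (\<lambda>e. germ0 E e)"
proof
  fix e show "s e = germ0 E e"
  proof (cases "e \<in> TE")
    case e: True
    obtain U F where U: "el U" "e \<in> U" "s e = germ E e F" "loc e s = germ M (\<pi> e) (\<lambda>y. F (inv_into U \<pi> y))"
      by (rule loc_cases[OF e s])
    have "germ M (\<pi> e) (\<lambda>y. F (inv_into U \<pi> y)) = germ0 M (\<pi> e)" using U(4) z[OF e] by simp
    then obtain W where W: "openin (mtop M) W" "\<pi> e \<in> W" "\<forall>y\<in>W. F (inv_into U \<pi> y) = 0"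
      unfolding germ_eq_iff[OF proj_in[OF e]] by blast
    have "germ E e F = germ0 E e"
    proof (rule germ_eqI)
      show "openin (mtop E) (U \<inter> {e \<in> TE. \<pi> e \<in> W})"
        by (intro openin_Int el_open[OF U(1)] proj_preimage_open W(1))
      show "e \<in> U \<inter> {e \<in> TE. \<pi> e \<in> W}" using U W e by blast
      fix d assume d: "d \<in> U \<inter> {e \<in> TE. \<pi> e \<in> W}"
      then have "F (inv_into U \<pi> (\<pi> d)) = 0" using W(3) by blast
      then show "F d = 0" using d U(1) by simp
    qed
    then show ?thesis using U(3) by simp
  next
    case False
    then show ?thesis using section_germ[OF s, of e] germ_outside[OF False] by auto
  qed
qed

text \<open>Finitely many sections involve finitely many generators; a function equal to 1 on
  compact sets supporting all their coefficient functions fixes every one of the sections.\<close>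

lemma Sec_lmod: "lmod M (Sec :: ('m => 'f::real_normed_field, 'e => ('e => 'f) set) module)"
proof (intro lmod.intro Hausdorff_manifold_axioms rmod.intro lmod_axioms.intro Sec_rmodule)
  interpret A: rmod "Cc_ring M" "Sec :: ('m => 'f, 'e => ('e => 'f) set) module"
    by unfold_locales (rule Sec_rmodule)
  let ?X = "{ez U f |U (f :: 'm => 'f). U \<in> Collect el \<and> f \<in> Cc M (\<pi> ` U)}"
  have X: "?X \<subseteq> carrier Sec" using ez_section by auto
  have one: "\<exists>K. compactin (mtop M) K \<and> (\<forall>r\<in>Cc M TM. (\<forall>y\<in>K. r y = (1 :: 'f)) --> smul r s = s)"
    if "s \<in> CS" for s
  proof -
    have "s \<in> addspan Sec ?X"
      by (rule section_span[OF _ _ that, of "Collect el" "\<lambda>U. U"]) (use el_exists in auto)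
    then show ?thesis
    proof (induction rule: addspan.induct)
      case zero
      show ?case by (intro exI[of _ "{}"]) (simp add: smul_def sec_mult_germs)
    next
      case (add u s)
      obtain U f where u: "el U" "f \<in> Cc M (\<pi> ` U)" "u = ez U f" using add.hyps(1) by blast
      obtain K where K: "compactin (mtop M) K" "\<forall>r\<in>Cc M TM. (\<forall>y\<in>K. r y = (1 :: 'f)) --> smul r s = s"
        using add.IH by blast
      obtain L where L: "compactin (mtop M) L" "\<forall>y. y \<notin> L --> f y = 0"
        using u(2) unfolding Cc_iff_support[OF el_image_open[OF u(1)]] by blast
      have "smul r (u \<oplus>\<^bsub>Sec\<^esub> s) = u \<oplus>\<^bsub>Sec\<^esub> s"
        if r: "r \<in> Cc M TM" "\<forall>y\<in>K \<union> L. r y = 1" for r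
      proof -
        have "(\<lambda>y. r y * f y) = f"
        proof
          fix y show "r y * f y = f y" using r(2) L(2) by (cases "y \<in> L") auto
        qed
        then have "smul r u = u" by (simp add: u(3) ez_smult)
        moreover have "smul r s = s" using K(2) r by blast
        moreover have "u \<in> carrier Sec" "s \<in> carrier Sec"
          using subsetD[OF X add.hyps(1)] A.addspan_closed[OF X add.hyps(2)] by simp_all
        ultimately show ?thesis using A.smult_r_distr[of r u s] r(1) by simp
      qed
      then show ?case using compactin_Un[OF K(1) L(1)] by blast
    qed
  qed
  show "locally_unitary RM (Sec :: ('m => 'f, 'e => ('e => 'f) set) module)"
    unfolding locally_unitary_def
  proof (intro allI impI, elim conjE)
    fix S :: "('e => ('e => 'f) set) set" assume S: "finite S" "S \<subseteq> carrier Sec"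
    have "\<forall>s\<in>S. \<exists>K. compactin (mtop M) K \<and> (\<forall>r\<in>Cc M TM. (\<forall>y\<in>K. r y = (1 :: 'f)) --> smul r s = s)"
      using one S(2) by auto
    from bchoice[OF this] obtain K where
      K: "\<forall>s\<in>S. compactin (mtop M) (K s) \<and> (\<forall>r\<in>Cc M TM. (\<forall>y\<in>K s. r y = (1 :: 'f)) --> smul r s = s)" by blast
    have "compactin (mtop M) (\<Union>(K ` S))" by (rule compactin_Union) (use S K in auto)
    then obtain r :: "'m => 'f" where r: "r \<in> Cc M TM" "\<forall>y\<in>\<Union>(K ` S). r y = 1"
      by (rule compact_unit)
    have "smul r s = s" if "s \<in> S" for s using K r that by auto
    then show "\<exists>r\<in>carrier RM. \<forall>a\<in>S. r \<odot>\<^bsub>Sec\<^esub> a = a"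
      using r(1) by (intro bexI[of _ r]) simp_all
  qed
qed

end

subsection \<open>Linear maps out of the module of sections\<close>

text \<open>The additive closure of a graph prescribed on generators. It stays a relation until
  single-valuedness is known; then it is the graph of the map sought.\<close>

inductive_set lin_graph :: "('a, 'x) ring_scheme => ('b, 'y) ring_scheme => ('a \<times> 'b) set => ('a \<times> 'b) set"
  for A B X where
  zero: "(\<zero>\<^bsub>A\<^esub>, \<zero>\<^bsub>B\<^esub>) \<in> lin_graph A B X"
| add: "(a, b) \<in> X ==> (s, d) \<in> lin_graph A B X ==> (a \<oplus>\<^bsub>A\<^esub> s, b \<oplus>\<^bsub>B\<^esub> d) \<in> lin_graph A B X"

text \<open>Additivity is built into the relation, and homogeneity comes from the stability of
  \<open>X\<close> under scalars. Spanning makes the relation total, so only single-valuedness is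
  left as a genuine condition.\<close>

lemma linear_extension:
  assumes A: "rmod R A" and B: "rmod R B"
    and X: "\<And>a b. (a, b) \<in> X ==> a \<in> carrier A \<and> b \<in> carrier B"
    and Xs: "\<And>r a b. r \<in> carrier R ==> (a, b) \<in> X ==> (r \<odot>\<^bsub>A\<^esub> a, r \<odot>\<^bsub>B\<^esub> b) \<in> X"
    and span: "carrier A \<subseteq> addspan A (fst ` X)"
    and single: "\<And>s d d'. (s, d) \<in> lin_graph A B X ==> (s, d') \<in> lin_graph A B X ==> d = d'"
  obtains F where "rlinear R A B F" "\<And>a b. (a, b) \<in> X ==> F a = b"
    "\<And>s. s \<in> carrier A ==> (s, F s) \<in> lin_graph A B X"
proof -
  interpret A: rmod R A by (rule A)
  interpret B: rmod R B by (rule B)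
  let ?G = "lin_graph A B X"
  have c: "s \<in> carrier A \<and> d \<in> carrier B" if "(s, d) \<in> ?G" for s d
    using that by (induction rule: lin_graph.induct) (use X in auto)
  have plus: "(s \<oplus>\<^bsub>A\<^esub> t, d \<oplus>\<^bsub>B\<^esub> u) \<in> ?G" if s: "(s, d) \<in> ?G" and t: "(t, u) \<in> ?G" for s d t u
    using s
  proof (induction rule: lin_graph.induct)
    case zero
    then show ?case using t c[OF t] by simp
  next
    case (add a b s d)
    have "(a \<oplus>\<^bsub>A\<^esub> (s \<oplus>\<^bsub>A\<^esub> t), b \<oplus>\<^bsub>B\<^esub> (d \<oplus>\<^bsub>B\<^esub> u)) \<in> ?G"
      by (rule lin_graph.add[OF add.hyps(1) add.IH])
    then show ?case using X[OF add.hyps(1)] c[OF add.hyps(2)] c[OF t] by (simp add: A.a_assoc B.a_assoc)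
  qed
  have sm: "(r \<odot>\<^bsub>A\<^esub> s, r \<odot>\<^bsub>B\<^esub> d) \<in> ?G" if r: "r \<in> carrier R" and s: "(s, d) \<in> ?G" for r s d
    using s
  proof (induction rule: lin_graph.induct)
    case zero
    show ?case using lin_graph.zero[of A B X] r by simp
  next
    case (add a b s d)
    have "(r \<odot>\<^bsub>A\<^esub> a \<oplus>\<^bsub>A\<^esub> r \<odot>\<^bsub>A\<^esub> s, r \<odot>\<^bsub>B\<^esub> b \<oplus>\<^bsub>B\<^esub> r \<odot>\<^bsub>B\<^esub> d) \<in> ?G"
      by (rule lin_graph.add[OF Xs[OF r add.hyps(1)] add.IH])
    then show ?case using r X[OF add.hyps(1)] c[OF add.hyps(2)] by (simp add: A.smult_r_distr B.smult_r_distr)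
  qed
  have tot: "\<exists>d. (s, d) \<in> ?G" if "s \<in> carrier A" for s
  proof -
    have "s \<in> addspan A (fst ` X)" using span that by blast
    then show ?thesis
    proof (induction rule: addspan.induct)
      case zero
      show ?case using lin_graph.zero[of A B X] by blast
    next
      case (add a s)
      obtain b where "(a, b) \<in> X" using add.hyps(1) by auto
      moreover obtain d where "(s, d) \<in> ?G" using add.IH by blast
      ultimately show ?case using lin_graph.add[of a b X s d A B] by blast
    qed
  qed
  define F where "F s = (SOME d. (s, d) \<in> ?G)" for s
  have F: "(s, F s) \<in> ?G" if "s \<in> carrier A" for s
    unfolding F_def using someI_ex[OF tot[OF that]] .
  have Feq: "F s = d" if "(s, d) \<in> ?G" for s d
    using single[OF F that] c[OF that] by simp
  show ?thesis
  proof (rule that)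
    show "rlinear R A B F"
      unfolding rlinear_def
    proof (intro conjI ballI funcsetI)
      show "F s \<in> carrier B" if "s \<in> carrier A" for s using c[OF F[OF that]] by simp
      show "F (s \<oplus>\<^bsub>A\<^esub> t) = F s \<oplus>\<^bsub>B\<^esub> F t" if "s \<in> carrier A" "t \<in> carrier A" for s t
        by (rule Feq[OF plus[OF F[OF that(1)] F[OF that(2)]]])
      show "F (r \<odot>\<^bsub>A\<^esub> s) = r \<odot>\<^bsub>B\<^esub> F s" if "r \<in> carrier R" "s \<in> carrier A" for r s
        by (rule Feq[OF sm[OF that(1) F[OF that(2)]]])
    qed
    show "F a = b" if "(a, b) \<in> X" for a b
    proof (rule Feq)
      have "(a \<oplus>\<^bsub>A\<^esub> \<zero>\<^bsub>A\<^esub>, b \<oplus>\<^bsub>B\<^esub> \<zero>\<^bsub>B\<^esub>) \<in> ?G" by (rule lin_graph.add[OF that lin_graph.zero])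
      then show "(a, b) \<in> ?G" using X[OF that] by simp
    qed
  qed (rule F)
qed

text \<open>A linear map prescribed on each member of an elementary cover. Compatibility at a common
  point \<open>e\<close> concerns only functions supported near \<open>\<pi> e\<close>, since
  \<open>U i\<close> and \<open>U j\<close> may separate over the rest of the intersection of their
  images. The comultiplication, the counit, \<open>Psi\<close> and the identity of the module of
  sections all arise in this way.\<close>

locale sheaf_family = sheaf M E \<pi> + B: lmod M B
  for M :: "'m manifold" and E :: "'e manifold" and \<pi> :: "'e => 'm"
    and B :: "('m => 'f::real_normed_field, 'b, 'x) module_scheme" +
  fixes I :: "'i set" and U :: "'i => 'e set" and \<Phi> :: "'i => ('m => 'f) => 'b"
  assumes elU: "\<And>i. i \<in> I ==> elementary E \<pi> (U i)"
    and cover: "topspace (mtop E) \<subseteq> (\<Union>i\<in>I. U i)"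
    and \<Phi>_closed: "\<And>i f. i \<in> I ==> f \<in> Cc M (\<pi> ` U i) ==> \<Phi> i f \<in> carrier B"
    and \<Phi>_add: "\<And>i f g. i \<in> I ==> f \<in> Cc M (\<pi> ` U i) ==> g \<in> Cc M (\<pi> ` U i) ==>
      \<Phi> i (\<lambda>y. f y + g y) = \<Phi> i f \<oplus>\<^bsub>B\<^esub> \<Phi> i g"
    and \<Phi>_smult: "\<And>i f p. i \<in> I ==> f \<in> Cc M (\<pi> ` U i) ==> p \<in> Cc M (topspace (mtop M)) ==>
      \<Phi> i (\<lambda>y. p y * f y) = p \<odot>\<^bsub>B\<^esub> \<Phi> i f"
    and \<Phi>_compatible: "\<And>i j e. i \<in> I ==> j \<in> I ==> e \<in> U i ==> e \<in> U j ==>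
      \<exists>W. openin (mtop M) W \<and> \<pi> e \<in> W \<and> (\<forall>f. f \<in> Cc M W --> f \<in> Cc M (\<pi> ` U i) --> f \<in> Cc M (\<pi> ` U j)
        --> \<Phi> i f = \<Phi> j f)"
begin

lemma \<Phi>_zero: assumes i: "i \<in> I" shows "\<Phi> i (\<lambda>_. 0) = \<zero>\<^bsub>B\<^esub>"
proof -
  have z: "(\<lambda>_. 0) \<in> Cc M (\<pi> ` U i)" by (rule Cc_zero[OF el_image_open[OF elU[OF i]]])
  have "\<Phi> i (\<lambda>y. 0 * 0) = (\<lambda>_. 0) \<odot>\<^bsub>B\<^esub> \<Phi> i (\<lambda>_. 0)" by (rule \<Phi>_smult[OF i z B.zero_in_Cc])
  then show ?thesis using \<Phi>_closed[OF i z] by simp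
qed

lemma \<Phi>_germ:
  assumes i: "i \<in> I" and f: "f \<in> Cc M (\<pi> ` U i)" and g: "g \<in> Cc M (\<pi> ` U i)"
    and eq: "germ M x f = germ M x g" and x: "x \<in> TM"
  shows "B.geq x (\<Phi> i f) (\<Phi> i g)"
proof -
  obtain W where W: "openin (mtop M) W" "x \<in> W" "\<forall>y\<in>W. f y = g y"
    using eq unfolding germ_eq_iff[OF x] by blast
  obtain b :: "'m => 'f" where b: "b \<in> Cc M W" "germ M x b = germ1 M x" by (rule bump[OF W(1,2)])
  have bR: "b \<in> Cc M TM" by (rule Cc_in_ring[OF b(1)])
  have "(\<lambda>y. b y * f y) = (\<lambda>y. b y * g y)"
  proof
    fix y show "b y * f y = b y * g y" using W(3) Cc_outside[OF b(1), of y] by (cases "y \<in> W") simp_all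
  qed
  then have "b \<odot>\<^bsub>B\<^esub> \<Phi> i f = b \<odot>\<^bsub>B\<^esub> \<Phi> i g" by (simp only: \<Phi>_smult[OF i f bR, symmetric] \<Phi>_smult[OF i g bR, symmetric])
  then show ?thesis by (rule B.geqI[OF bR b(2)])
qed

lemma \<Phi>_germ_zero:
  assumes i: "i \<in> I" and f: "f \<in> Cc M (\<pi> ` U i)" and eq: "germ M x f = germ0 M x" and x: "x \<in> TM"
  shows "B.geq x (\<Phi> i f) \<zero>\<^bsub>B\<^esub>"
  using \<Phi>_germ[OF i f Cc_zero[OF el_image_open[OF elU[OF i]]] eq x] \<Phi>_zero[OF i] by simp

text \<open>A bump function cuts \<open>f\<close> down to a neighbourhood on which the compatibility
  condition applies. This changes neither side near \<open>\<pi> e\<close>, as \<Phi> sees only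
  germs by \<open>\<Phi>_germ\<close>.\<close>

lemma \<Phi>_change:
  assumes i: "i \<in> I" and j: "j \<in> I" and e: "e \<in> U i" "e \<in> U j"
    and f: "f \<in> Cc M (\<pi> ` U i)" and g: "g \<in> Cc M (\<pi> ` U j)" and eq: "germ M (\<pi> e) f = germ M (\<pi> e) g"
  shows "B.geq (\<pi> e) (\<Phi> i f) (\<Phi> j g)"
proof -
  have x: "\<pi> e \<in> TM" using proj_in el_sub[OF elU[OF i]] e by blast
  obtain W where W: "openin (mtop M) W" "\<pi> e \<in> W" "\<forall>f. f \<in> Cc M W --> f \<in> Cc M (\<pi> ` U i) --> f \<in> Cc M (\<pi> ` U j) --> \<Phi> i f = \<Phi> j f"
    using \<Phi>_compatible[OF i j e] by blast
  let ?P = "W \<inter> (\<pi> ` U i \<inter> \<pi> ` U j)"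
  have oi: "openin (mtop M) (\<pi> ` U i)" and oj: "openin (mtop M) (\<pi> ` U j)" using el_image_open elU i j by blast+
  have P: "openin (mtop M) ?P" using W(1) oi oj by blast
  have "\<pi> e \<in> ?P" using W e by blast
  then obtain b :: "'m => 'f" where b: "b \<in> Cc M ?P" "germ M (\<pi> e) b = germ1 M (\<pi> e)" by (rule bump[OF P])
  define h where "h = (\<lambda>y. b y * f y)"
  have h: "h \<in> Cc M ?P" unfolding h_def by (rule Cc_mult_right[OF b(1) f])
  have hW: "h \<in> Cc M W" by (rule Cc_mono[OF h W(1)]) blast
  have hi: "h \<in> Cc M (\<pi> ` U i)" by (rule Cc_mono[OF h oi]) blast
  have hj: "h \<in> Cc M (\<pi> ` U j)" by (rule Cc_mono[OF h oj]) blast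
  have hf: "germ M (\<pi> e) h = germ M (\<pi> e) f" unfolding h_def by (rule B.germ_one_mult[OF b(2)])
  have "B.geq (\<pi> e) (\<Phi> i f) (\<Phi> i h)" by (rule \<Phi>_germ[OF i f hi hf[symmetric] x])
  moreover have "B.geq (\<pi> e) (\<Phi> i h) (\<Phi> j g)"
    using \<Phi>_germ[OF j hj g _ x] hf eq W(3) hW hi hj by simp
  ultimately show ?thesis
    by (rule B.geq_trans) (use \<Phi>_closed i j f g hi in blast)+
qed

definition idx :: "'e => 'i" where "idx e = (SOME i. i \<in> I \<and> e \<in> U i)"

definition rep :: "'e => ('e => ('e => 'f) set) => 'm => 'f" where
  "rep e s = (SOME f. f \<in> Cc M (\<pi> ` U (idx e)) \<and> germ M (\<pi> e) f = loc e s)"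

definition fib :: "'m => 'e set" where "fib x = {e \<in> TE. \<pi> e = x}"

lemma idx: assumes "e \<in> TE" shows "idx e \<in> I" "e \<in> U (idx e)"
proof -
  have "\<exists>i. i \<in> I \<and> e \<in> U i" using cover assms by blast
  from someI_ex[OF this] show "idx e \<in> I" "e \<in> U (idx e)" by (simp_all add: idx_def)
qed

lemma rep:
  assumes e: "e \<in> TE" and s: "s \<in> CS"
  shows "rep e s \<in> Cc M (\<pi> ` U (idx e))" "germ M (\<pi> e) (rep e s) = loc e s"
proof -
  have "\<exists>f. f \<in> Cc M (\<pi> ` U (idx e)) \<and> germ M (\<pi> e) f = loc e s"
  proof (rule germ_ring_representative[OF loc_closed[OF e s]])
    show "\<pi> e \<in> \<pi> ` U (idx e)" using idx[OF e] by blast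
    show "openin (mtop M) (\<pi> ` U (idx e))" by (rule el_image_open[OF elU[OF idx(1)[OF e]]])
  qed auto
  from someI_ex[OF this] show "rep e s \<in> Cc M (\<pi> ` U (idx e))" "germ M (\<pi> e) (rep e s) = loc e s"
    by (simp_all add: rep_def)
qed

text \<open>The contribution of the germ of \<open>s\<close> at \<open>e\<close> to the value on
  \<open>s\<close>. By \<open>\<Phi>_change\<close> it does not depend, near \<open>\<pi> e\<close>,
  on the choices made in \<open>idx\<close> and \<open>rep\<close>.\<close>

abbreviation "term e s \<equiv> \<Phi> (idx e) (rep e s)"

lemma term_closed: "e \<in> TE ==> s \<in> CS ==> term e s \<in> carrier B"
  by (rule \<Phi>_closed[OF idx(1) rep(1)])

lemma fib_el_finite: assumes "i \<in> I" shows "finite (U i \<inter> fib x)"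
proof (cases "U i \<inter> fib x = {}")
  case False
  then obtain e where "e \<in> U i" "\<pi> e = x" by (auto simp: fib_def)
  then have "U i \<inter> fib x \<subseteq> {e}" using inj_onD[OF el_inj[OF elU[OF assms]]] by (auto simp: fib_def)
  then show ?thesis using finite_subset by blast
qed simp

text \<open>An elementary set meets the fibre over \<open>x\<close> in at most one point. The sum
  over \<open>T\<close> therefore reduces, near \<open>x\<close>, to the term at that point, or to 0
  if there is none.\<close>

lemma term_single:
  assumes i: "i \<in> I" and f: "f \<in> Cc M (\<pi> ` U i)" and x: "x \<in> TM"
    and T: "finite T" "T \<subseteq> fib x" "U i \<inter> fib x \<subseteq> T"
  shows "B.geq x (\<Phi> i f) (finsum B (\<lambda>e. term e (ez (U i) f)) T)"
proof -
  let ?s = "ez (U i) f"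
  have sc: "?s \<in> CS" by (rule ez_section[OF elU[OF i] f])
  have fib: "e \<in> TE" "\<pi> e = x" if "e \<in> fib x" for e using that by (auto simp: fib_def)
  have tc: "term e ?s \<in> carrier B" if "e \<in> T" for e using term_closed[OF fib(1) sc] that T(2) by blast
  have off: "B.geq x (term e ?s) \<zero>\<^bsub>B\<^esub>" if "e \<in> T - U i" for e
  proof -
    have e: "e \<in> TE" "\<pi> e = x" using fib that T(2) by blast+
    show ?thesis
      using \<Phi>_germ_zero[OF idx(1)[OF e(1)] rep(1)[OF e(1) sc], of x] rep(2)[OF e(1) sc] loc_ez[OF e(1) elU[OF i] f] that e(2) x
      by simp
  qed
  have red: "B.geq x (finsum B (\<lambda>e. term e ?s) T) (finsum B (\<lambda>e. term e ?s) (T \<inter> U i))"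
    by (rule B.geq_finsum_zero_off[OF T(1) Int_lower1]) (use tc off x in auto)
  have main: "B.geq x (\<Phi> i f) (finsum B (\<lambda>e. term e ?s) (T \<inter> U i))"
  proof (cases "T \<inter> U i = {}")
    case True
    have "x \<notin> \<pi> ` U i"
    proof
      assume "x \<in> \<pi> ` U i"
      then obtain e where "e \<in> U i" "\<pi> e = x" by blast
      then have "e \<in> U i \<inter> fib x" using el_sub[OF elU[OF i]] by (auto simp: fib_def)
      then show False using T(3) True by blast
    qed
    then show ?thesis using True \<Phi>_germ_zero[OF i f Cc_germ_zero[OF f x] x] by simp
  next
    case False
    then obtain e where e: "e \<in> T" "e \<in> U i" by blast
    have eT: "e \<in> TE" "\<pi> e = x" using fib e T(2) by blast+
    have "T \<inter> U i = {e}"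
    proof (intro equalityI subsetI)
      fix d assume "d \<in> T \<inter> U i"
      then have "d \<in> U i" "\<pi> d = \<pi> e" using fib T(2) eT by auto
      then show "d \<in> {e}" using inj_onD[OF el_inj[OF elU[OF i]] _ _ e(2)] by blast
    qed (use e in blast)
    then have "finsum B (\<lambda>e. term e ?s) (T \<inter> U i) = term e ?s" using tc[OF e(1)] by simp
    moreover have "B.geq (\<pi> e) (\<Phi> i f) (term e ?s)"
      using rep(2)[OF eT(1) sc] loc_ez[OF eT(1) elU[OF i] f] e(2)
      by (intro \<Phi>_change[OF i idx(1)[OF eT(1)] e(2) idx(2)[OF eT(1)] f rep(1)[OF eT(1) sc]]) simp
    ultimately show ?thesis using eT(2) by simp
  qed
  show ?thesis
    by (rule B.geq_trans[OF main B.geq_sym[OF red]])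
      (use \<Phi>_closed[OF i f] tc in \<open>auto intro!: B.finsum_closed\<close>)
qed

abbreviation "gens \<equiv> {(ez (U i) f, \<Phi> i f) |i f. i \<in> I \<and> f \<in> Cc M (\<pi> ` U i)}"

lemma graph_closed:
  assumes "(s, d) \<in> lin_graph Sec B gens" shows "s \<in> CS \<and> d \<in> carrier B"
  using assms
proof (induction rule: lin_graph.induct)
  case zero
  show ?case by (simp add: zero_section)
next
  case (add a b s d)
  then obtain i f where a: "i \<in> I" "f \<in> Cc M (\<pi> ` U i)" "a = ez (U i) f" "b = \<Phi> i f" by blast
  have "a \<in> CS" unfolding a(3) by (rule ez_section[OF elU[OF a(1)] a(2)])
  then show ?case using add.IH \<Phi>_closed[OF a(1,2)] a(4) by (simp add: Cc_sections.add)
qed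

lemma normal_form:
  assumes G: "(s, d) \<in> lin_graph Sec B gens" and x: "x \<in> TM"
  shows "\<exists>T0. finite T0 \<and> T0 \<subseteq> fib x \<and> (\<forall>e\<in>fib x - T0. loc e s = germ0 M x) \<and>
    (\<forall>T. finite T --> T0 \<subseteq> T --> T \<subseteq> fib x --> B.geq x d (finsum B (\<lambda>e. term e s) T))"
  using G
proof (induction rule: lin_graph.induct)
  case zero
  have z: "B.geq x (term e (\<lambda>e. germ0 E e)) \<zero>\<^bsub>B\<^esub>" if "e \<in> fib x" for e
    using that rep[OF _ zero_section, of e] loc_zero[of e] x
    by (intro \<Phi>_germ_zero idx(1)) (auto simp: fib_def)
  have "B.geq x \<zero>\<^bsub>B\<^esub> (finsum B (\<lambda>e. term e (\<lambda>e. germ0 E e)) T)" if "finite T" "T \<subseteq> fib x" for T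
  proof -
    have "B.geq x (finsum B (\<lambda>e. term e (\<lambda>e. germ0 E e)) T) (finsum B (\<lambda>e. \<zero>\<^bsub>B\<^esub>) T)"
    proof (intro B.geq_finsum x)
      fix e assume "e \<in> T"
      then have e: "e \<in> fib x" using that by blast
      show "B.geq x (term e (\<lambda>e. germ0 E e)) \<zero>\<^bsub>B\<^esub>" by (rule z[OF e])
      show "term e (\<lambda>e. germ0 E e) \<in> carrier B"
        by (rule term_closed[OF _ zero_section]) (use e in \<open>simp add: fib_def\<close>)
    qed simp
    then show ?thesis using B.geq_sym by simp
  qed
  then show ?case using loc_zero by (intro exI[of _ "{}"]) (auto simp: fib_def)
next
  case (add a b s d)
  obtain i f where a: "i \<in> I" "f \<in> Cc M (\<pi> ` U i)" "a = ez (U i) f" "b = \<Phi> i f" using add.hyps(1) by blast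
  obtain T0 where T0: "finite T0" "T0 \<subseteq> fib x" "\<forall>e\<in>fib x - T0. loc e s = germ0 M x"
    "\<forall>T. finite T --> T0 \<subseteq> T --> T \<subseteq> fib x --> B.geq x d (finsum B (\<lambda>e. term e s) T)"
    using add.IH by blast
  have sd: "s \<in> CS" "d \<in> carrier B" using graph_closed[OF add.hyps(2)] by auto
  have ac: "a \<in> CS" unfolding a(3) by (rule ez_section[OF elU[OF a(1)] a(2)])
  have bc: "b \<in> carrier B" unfolding a(4) by (rule \<Phi>_closed[OF a(1,2)])
  have asc: "sec_add E a s \<in> CS" by (rule Cc_sections.add[OF ac sd(1)])
  \<comment> \<open>The additional generator contributes at most one more point of the
    fibre.\<close>
  let ?T0 = "T0 \<union> (U i \<inter> fib x)"
  have fT: "finite ?T0" using T0(1) fib_el_finite[OF a(1)] by simp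
  have l: "loc e (sec_add E a s) = germ0 M x" if "e \<in> fib x - ?T0" for e
  proof -
    have e: "e \<in> TE" "\<pi> e = x" "e \<notin> U i" using that by (auto simp: fib_def)
    have "loc e a = germ0 M x" using loc_ez[OF e(1) elU[OF a(1)] a(2)] e by (simp add: a(3))
    moreover have "loc e s = germ0 M x" using T0(3) that by blast
    ultimately show ?thesis using loc_add[OF e(1) ac sd(1)] e(2) by simp
  qed
  have g: "B.geq x (b \<oplus>\<^bsub>B\<^esub> d) (finsum B (\<lambda>e. term e (sec_add E a s)) T)"
    if T: "finite T" "?T0 \<subseteq> T" "T \<subseteq> fib x" for T
  proof -
    have eT: "e \<in> TE" "\<pi> e = x" if "e \<in> T" for e using that T(3) by (auto simp: fib_def)
    have tc: "term e t \<in> carrier B" if "e \<in> T" "t \<in> CS" for e t using term_closed eT that by blast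
    have "B.geq x (b \<oplus>\<^bsub>B\<^esub> d) (finsum B (\<lambda>e. term e a) T \<oplus>\<^bsub>B\<^esub> finsum B (\<lambda>e. term e s) T)"
    proof (rule B.geq_add)
      show "B.geq x b (finsum B (\<lambda>e. term e a) T)"
        unfolding a(3,4) by (rule term_single[OF a(1,2) x T(1,3)]) (use T(2) in blast)
      show "B.geq x d (finsum B (\<lambda>e. term e s) T)" using T0(4) T by blast
    qed (use bc sd tc ac in \<open>auto intro!: B.finsum_closed\<close>)
    also have "finsum B (\<lambda>e. term e a) T \<oplus>\<^bsub>B\<^esub> finsum B (\<lambda>e. term e s) T = finsum B (\<lambda>e. term e a \<oplus>\<^bsub>B\<^esub> term e s) T"
      by (rule B.finsum_addf[symmetric]) (use tc ac sd in auto)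
    finally have 1: "B.geq x (b \<oplus>\<^bsub>B\<^esub> d) (finsum B (\<lambda>e. term e a \<oplus>\<^bsub>B\<^esub> term e s) T)" .
    have 2: "B.geq x (finsum B (\<lambda>e. term e a \<oplus>\<^bsub>B\<^esub> term e s) T) (finsum B (\<lambda>e. term e (sec_add E a s)) T)"
    proof (rule B.geq_finsum[OF _ _ _ x])
      fix e assume e: "e \<in> T"
      note i = idx(1)[OF eT(1)[OF e]] and r = rep[OF eT(1)[OF e]]
      have "term e a \<oplus>\<^bsub>B\<^esub> term e s = \<Phi> (idx e) (\<lambda>y. rep e a y + rep e s y)"
        by (rule \<Phi>_add[OF i r(1)[OF ac] r(1)[OF sd(1)], symmetric])
      moreover have "germ M (\<pi> e) (\<lambda>y. rep e a y + rep e s y) = germ M (\<pi> e) (rep e (sec_add E a s))"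
        unfolding germ_ring_simps(2)[symmetric] r(2)[OF ac] r(2)[OF sd(1)] r(2)[OF asc]
        by (rule loc_add[OF eT(1)[OF e] ac sd(1), symmetric])
      ultimately show "B.geq x (term e a \<oplus>\<^bsub>B\<^esub> term e s) (term e (sec_add E a s))"
        using \<Phi>_germ[OF i Cc_add[OF r(1)[OF ac] r(1)[OF sd(1)]] r(1)[OF asc], of x] eT(2)[OF e] x by simp
    qed (use tc ac sd asc in auto)
    show ?thesis
      by (rule B.geq_trans[OF 1 2]) (use bc sd tc ac asc in \<open>auto intro!: B.finsum_closed\<close>)
  qed
  show ?case
  proof (intro exI[of _ ?T0] conjI allI impI ballI)
    show "finite ?T0" by (rule fT)
    show "?T0 \<subseteq> fib x" using T0(2) by blast
    show "loc e (a \<oplus>\<^bsub>Sec\<^esub> s) = germ0 M x" if "e \<in> fib x - ?T0" for e using l[OF that] by simp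
    show "B.geq x (b \<oplus>\<^bsub>B\<^esub> d) (finsum B (\<lambda>e. term e (a \<oplus>\<^bsub>Sec\<^esub> s)) T)"
      if "finite T" "?T0 \<subseteq> T" "T \<subseteq> fib x" for T using g[OF that] by simp
  qed
qed

text \<open>Two values of the same section have, near every \<open>x\<close>, the same normal form
  over the union of the two finite sets; hence they agree near every point and are equal by
  \<open>geq_everywhere\<close>.\<close>

lemma family_extension:
  obtains F where "rlinear RM Sec B F" "\<And>i f. i \<in> I ==> f \<in> Cc M (\<pi> ` U i) ==> F (ez (U i) f) = \<Phi> i f"
    "\<And>s. s \<in> CS ==> (s, F s) \<in> lin_graph Sec B gens"
proof (rule linear_extension[where R = "Cc_ring M" and A = Sec and B = B and X = gens])
  show "rmod RM Sec" by (rule rmod.intro[OF Sec_rmodule])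
  show "rmod RM B" by (rule B.rmod_axioms)
  show "a \<in> carrier Sec \<and> b \<in> carrier B" if "(a, b) \<in> gens" for a b
    using that ez_section[OF elU] \<Phi>_closed by auto
  show "(r \<odot>\<^bsub>Sec\<^esub> a, r \<odot>\<^bsub>B\<^esub> b) \<in> gens" if r: "r \<in> carrier RM" and ab: "(a, b) \<in> gens" for r a b
  proof -
    obtain i f where a: "i \<in> I" "f \<in> Cc M (\<pi> ` U i)" "a = ez (U i) f" "b = \<Phi> i f" using ab by blast
    have "r \<odot>\<^bsub>Sec\<^esub> a = ez (U i) (\<lambda>y. r y * f y)" by (simp add: a(3) ez_smult)
    moreover have "r \<odot>\<^bsub>B\<^esub> b = \<Phi> i (\<lambda>y. r y * f y)" using \<Phi>_smult[OF a(1,2)] r by (simp add: a(4))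
    moreover have "(\<lambda>y. r y * f y) \<in> Cc M (\<pi> ` U i)" using Cc_mult[OF _ a(2)] r by simp
    ultimately show ?thesis using a(1) by blast
  qed
  have "fst ` gens = {ez (U i) f |i f. i \<in> I \<and> f \<in> Cc M (\<pi> ` U i)}" by force
  then show "carrier Sec \<subseteq> addspan Sec (fst ` gens)"
    using section_span[OF elU cover] by auto
  show "d = d'" if d: "(s, d) \<in> lin_graph Sec B gens" "(s, d') \<in> lin_graph Sec B gens" for s d d'
  proof (rule B.geq_everywhere)
    fix x assume x: "x \<in> TM"
    obtain T0 where T0: "finite T0" "T0 \<subseteq> fib x"
      "\<forall>T. finite T --> T0 \<subseteq> T --> T \<subseteq> fib x --> B.geq x d (finsum B (\<lambda>e. term e s) T)"
      using normal_form[OF d(1) x] by blast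
    obtain T1 where T1: "finite T1" "T1 \<subseteq> fib x"
      "\<forall>T. finite T --> T1 \<subseteq> T --> T \<subseteq> fib x --> B.geq x d' (finsum B (\<lambda>e. term e s) T)"
      using normal_form[OF d(2) x] by blast
    let ?S = "finsum B (\<lambda>e. term e s) (T0 \<union> T1)"
    have T: "finite (T0 \<union> T1)" "T0 \<union> T1 \<subseteq> fib x" using T0(1,2) T1(1,2) by auto
    have Sc: "?S \<in> carrier B"
    proof (rule B.finsum_closed, rule funcsetI)
      fix e assume "e \<in> T0 \<union> T1"
      then have "e \<in> TE" using T(2) by (auto simp: fib_def)
      then show "term e s \<in> carrier B" by (rule term_closed) (use graph_closed[OF d(1)] in simp)
    qed
    have 0: "B.geq x d ?S" by (rule T0(3)[rule_format, OF T(1) Un_upper1 T(2)])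
    have 1: "B.geq x d' ?S" by (rule T1(3)[rule_format, OF T(1) Un_upper2 T(2)])
    show "B.geq x d d'"
      by (rule B.geq_trans[OF 0 B.geq_sym[OF 1] _ Sc]) (use graph_closed[OF d(1)] graph_closed[OF d(2)] in simp_all)
  qed (use graph_closed[OF d(1)] graph_closed[OF d(2)] in simp_all)
next
  fix F assume F: "rlinear RM Sec B F" "\<And>a b. (a, b) \<in> gens ==> F a = b"
    "\<And>s. s \<in> carrier Sec ==> (s, F s) \<in> lin_graph Sec B gens"
  show thesis
  proof (rule that[OF F(1)])
    show "F (ez (U i) f) = \<Phi> i f" if "i \<in> I" "f \<in> Cc M (\<pi> ` U i)" for i f
      by (rule F(2)) (use that in blast)
    show "(s, F s) \<in> lin_graph Sec B gens" if "s \<in> CS" for s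
      using F(3) that by simp
  qed
qed

end

subsection \<open>Comultiplication and counit\<close>

context sheaf
begin

abbreviation "SecT \<equiv> tensor RM Sec Sec"
abbreviation "ts \<equiv> tens RM Sec Sec"

text \<open>Both sides equal f \<otimes> \<eta>\<eta>': a unit of \<open>f\<close> can be inserted
  in the first factor and moved to the second.\<close>

lemma ez_tens_swap:
  fixes f \<eta> \<eta>' :: "'m => 'f::real_normed_field"
  assumes U: "el U" and f: "f \<in> Cc M (\<pi> ` U)" and h: "\<eta> \<in> Cc M (\<pi> ` U)" "\<eta>' \<in> Cc M (\<pi> ` U)"
    and eq: "(\<lambda>y. \<eta> y * f y) = f" "(\<lambda>y. \<eta>' y * f y) = f"
  shows "ts (ez U f) (ez U \<eta>) = ts (ez U f) (ez U \<eta>')"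
proof -
  interpret S: lmod M "Sec :: ('m => 'f, 'e => ('e => 'f) set) module" by (rule Sec_lmod)
  note c = ez_section[OF U f] ez_section[OF U h(1)] ez_section[OF U h(2)]
  have b: "ts (ez U f) (ez U (\<lambda>y. p y * q y)) = ts (ez U (\<lambda>y. p y * f y)) (ez U q)"
    if p: "p \<in> Cc M (\<pi> ` U)" and q: "q \<in> Cc M (\<pi> ` U)" for p q :: "'m => 'f"
    using S.AA.tens_smult[of p "ez U f" "ez U q"] Cc_in_ring[OF p] c(1) ez_section[OF U q]
    by (simp add: ez_smult)
  have "ts (ez U f) (ez U \<eta>) = ts (ez U (\<lambda>y. \<eta>' y * f y)) (ez U \<eta>)" by (simp only: eq(2))
  also have "\<dots> = ts (ez U f) (ez U (\<lambda>y. \<eta>' y * \<eta> y))" by (rule b[OF h(2,1), symmetric])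
  also have "(\<lambda>y. \<eta>' y * \<eta> y) = (\<lambda>y. \<eta> y * \<eta>' y)" by (simp add: mult.commute)
  also have "ts (ez U f) (ez U (\<lambda>y. \<eta> y * \<eta>' y)) = ts (ez U (\<lambda>y. \<eta> y * f y)) (ez U \<eta>')" by (rule b[OF h])
  finally show ?thesis by (simp only: eq(1))
qed

lemma Cc_unit:
  fixes f :: "'m => 'f::real_normed_field"
  assumes "f \<in> Cc M W"
  obtains \<eta> :: "'m => 'f" where "\<eta> \<in> Cc M W" "(\<lambda>y. \<eta> y * f y) = f"
proof -
  obtain h :: "'m => 'f" where h: "h \<in> Cc M W" "\<And>x. f x \<noteq> 0 ==> h x = 1"
    by (rule Cc_support_bump[OF assms]) (rule that, assumption, simp)
  have "(\<lambda>y. h y * f y) = f"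
  proof
    fix y show "h y * f y = f y" using h(2)[of y] by (cases "f y = 0") simp_all
  qed
  then show ?thesis by (rule that[OF h(1)])
qed

text \<open>The prescription f \<mapsto> f \<otimes> \<eta> involves a unit that varies with
  \<open>f\<close>. By \<open>ez_tens_swap\<close> the unit may be exchanged, so additivity follows
  with a common unit and compatibility with a unit supported over the intersection.\<close>

lemma comult_exists:
  obtains D :: "('e => ('e => 'f::real_normed_field) set) => _" where
    "rlinear RM Sec SecT D"
    "\<forall>U f \<eta>. el U --> f \<in> Cc M (\<pi> ` U) --> \<eta> \<in> Cc M (\<pi> ` U) --> (\<lambda>y. \<eta> y * f y) = f -->
      D (ez U f) = ts (ez U f) (ez U \<eta>)"
proof -
  interpret S: lmod M "Sec :: ('m => 'f, 'e => ('e => 'f) set) module" by (rule Sec_lmod)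
  define \<eta> where "\<eta> U f = (SOME h. h \<in> Cc M (\<pi> ` U) \<and> (\<lambda>y. h y * f y) = f)" for U and f :: "'m => 'f"
  have \<eta>: "\<eta> U f \<in> Cc M (\<pi> ` U)" "(\<lambda>y. \<eta> U f y * f y) = f" if f: "f \<in> Cc M (\<pi> ` U)" for U f
  proof -
    have "\<exists>h. h \<in> Cc M (\<pi> ` U) \<and> (\<lambda>y. h y * f y) = f" by (rule Cc_unit[OF f]) blast
    from someI_ex[OF this] show "\<eta> U f \<in> Cc M (\<pi> ` U)" "(\<lambda>y. \<eta> U f y * f y) = f" by (simp_all add: \<eta>_def)
  qed
  define \<Phi> where "\<Phi> U f = ts (ez U f) (ez U (\<eta> U f))" for U f
  have \<Phi>: "\<Phi> U f = ts (ez U f) (ez U h)"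
    if "el U" "f \<in> Cc M (\<pi> ` U)" "h \<in> Cc M (\<pi> ` U)" "(\<lambda>y. h y * f y) = f" for U f h
    unfolding \<Phi>_def by (rule ez_tens_swap[OF that(1,2) \<eta>(1)[OF that(2)] that(3) \<eta>(2)[OF that(2)] that(4)])
  interpret F: sheaf_family M E \<pi> SecT "Collect el" "\<lambda>U. U" \<Phi>
  proof (intro sheaf_family.intro sheaf_axioms S.AxA_lmod sheaf_family_axioms.intro)
    show "el U" if "U \<in> Collect el" for U using that by simp
    show "TE \<subseteq> (\<Union>U\<in>Collect el. U)" using el_exists by blast
    show "\<Phi> U f \<in> carrier SecT" if "U \<in> Collect el" "f \<in> Cc M (\<pi> ` U)" for U f
      using that ez_section[OF _ that(2)] ez_section[OF _ \<eta>(1)[OF that(2)]] by (simp add: \<Phi>_def)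
    show "\<Phi> U (\<lambda>y. f y + g y) = \<Phi> U f \<oplus>\<^bsub>SecT\<^esub> \<Phi> U g"
      if U: "U \<in> Collect el" and f: "f \<in> Cc M (\<pi> ` U)" and g: "g \<in> Cc M (\<pi> ` U)" for U f g
    proof -
      \<comment> \<open>1 - h = (1 - \<eta>_f)(1 - \<eta>_g), so \<open>h\<close> is a unit for
        \<open>f\<close> and for \<open>g\<close>.\<close>
      define h where "h y = (\<eta> U f y + \<eta> U g y) - \<eta> U f y * \<eta> U g y" for y
      have h: "h \<in> Cc M (\<pi> ` U)"
        unfolding h_def by (rule Cc_diff[OF Cc_add[OF \<eta>(1)[OF f] \<eta>(1)[OF g]] Cc_mult[OF \<eta>(1)[OF f] \<eta>(1)[OF g]]])
      have ff: "\<eta> U f y * f y = f y" and gg: "\<eta> U g y * g y = g y" for y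
        using fun_cong[OF \<eta>(2)[OF f], of y] fun_cong[OF \<eta>(2)[OF g], of y] .
      have hf: "h y * f y = f y" for y
      proof -
        have "h y * f y = \<eta> U f y * f y + \<eta> U g y * f y - \<eta> U g y * (\<eta> U f y * f y)" by (simp add: h_def algebra_simps)
        then show ?thesis using ff[of y] by simp
      qed
      have hg: "h y * g y = g y" for y
      proof -
        have "h y * g y = \<eta> U f y * g y + \<eta> U g y * g y - \<eta> U f y * (\<eta> U g y * g y)" by (simp add: h_def algebra_simps)
        then show ?thesis using gg[of y] by simp
      qed
      have U': "el U" using U by simp
      have "\<Phi> U (\<lambda>y. f y + g y) = ts (ez U (\<lambda>y. f y + g y)) (ez U h)"
        by (rule \<Phi>[OF U' Cc_add[OF f g] h]) (simp add: distrib_left hf hg)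
      also have "\<dots> = ts (ez U f) (ez U h) \<oplus>\<^bsub>SecT\<^esub> ts (ez U g) (ez U h)"
        using S.AA.tens_add_left[of "ez U f" "ez U g" "ez U h"] ez_section[OF U' f] ez_section[OF U' g] ez_section[OF U' h]
        by (simp add: ez_add)
      also have "ts (ez U f) (ez U h) = \<Phi> U f" by (rule \<Phi>[OF U' f h, symmetric]) (simp add: hf)
      also have "ts (ez U g) (ez U h) = \<Phi> U g" by (rule \<Phi>[OF U' g h, symmetric]) (simp add: hg)
      finally show ?thesis .
    qed
    show "\<Phi> U (\<lambda>y. p y * f y) = p \<odot>\<^bsub>SecT\<^esub> \<Phi> U f"
      if U: "U \<in> Collect el" and f: "f \<in> Cc M (\<pi> ` U)" and p: "p \<in> Cc M TM" for U f p
    proof -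
      have U': "el U" using U by simp
      have e: "\<eta> U f y * f y = f y" for y using fun_cong[OF \<eta>(2)[OF f], of y] .
      have "\<Phi> U (\<lambda>y. p y * f y) = ts (ez U (\<lambda>y. p y * f y)) (ez U (\<eta> U f))"
        by (rule \<Phi>[OF U' Cc_mult[OF p f] \<eta>(1)[OF f]]) (simp only: mult.left_commute[of "\<eta> U f _" "p _"] e)
      also have "\<dots> = p \<odot>\<^bsub>SecT\<^esub> \<Phi> U f"
        using S.AxA_smult_tens[OF p, of "ez U f" "ez U (\<eta> U f)"] ez_section[OF U' f] ez_section[OF U' \<eta>(1)[OF f]]
        by (simp add: \<Phi>_def ez_smult)
      finally show ?thesis .
    qed
    show "\<exists>W. openin (mtop M) W \<and> \<pi> e \<in> W \<and> (\<forall>f. f \<in> Cc M W --> f \<in> Cc M (\<pi> ` U) --> f \<in> Cc M (\<pi> ` V) --> \<Phi> U f = \<Phi> V f)"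
      if U: "U \<in> Collect el" and V: "V \<in> Collect el" and e: "e \<in> U" "e \<in> V" for U V e
    \<comment> \<open>Over this set \<open>U\<close> and \<open>V\<close> have the same points above
      them that matter: generators with coefficients supported in it are the same for
      \<open>U\<close> and for \<open>V\<close>, and so are their units.\<close>
    proof (intro exI[of _ "\<pi> ` (U \<inter> V)"] conjI allI impI)
      have U': "el U" "el V" using U V by simp_all
      have UV: "openin (mtop E) (U \<inter> V)" using el_open U' by blast
      show "openin (mtop M) (\<pi> ` (U \<inter> V))" by (rule proj_open[OF UV])
      show "\<pi> e \<in> \<pi> ` (U \<inter> V)" using e by blast
      fix f :: "'m => 'f" assume f: "f \<in> Cc M (\<pi> ` (U \<inter> V))" "f \<in> Cc M (\<pi> ` U)" "f \<in> Cc M (\<pi> ` V)"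
      obtain h :: "'m => 'f" where h: "h \<in> Cc M (\<pi> ` (U \<inter> V))" "(\<lambda>y. h y * f y) = f" by (rule Cc_unit[OF f(1)])
      have hU: "h \<in> Cc M (\<pi> ` U)" by (rule Cc_mono[OF h(1) el_image_open[OF U'(1)]]) blast
      have hV: "h \<in> Cc M (\<pi> ` V)" by (rule Cc_mono[OF h(1) el_image_open[OF U'(2)]]) blast
      have m: "ez U k = ez V k" if "k \<in> Cc M (\<pi> ` (U \<inter> V))" for k :: "'m => 'f"
        using ez_mono[OF U'(1) UV Int_lower1 that] ez_mono[OF U'(2) UV Int_lower2 that] by simp
      show "\<Phi> U f = \<Phi> V f"
        unfolding \<Phi>[OF U'(1) f(2) hU h(2)] \<Phi>[OF U'(2) f(3) hV h(2)] m[OF f(1)] m[OF h(1)] ..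
    qed
  qed
  obtain D where D: "rlinear RM Sec SecT D"
    "\<And>U f. U \<in> Collect el ==> f \<in> Cc M (\<pi> ` U) ==> D (ez U f) = \<Phi> U f"
    by (rule F.family_extension) (rule that, assumption, simp)
  show ?thesis
  proof (rule that[OF D(1)], intro allI impI)
    fix U and f h :: "'m => 'f" assume a: "el U" "f \<in> Cc M (\<pi> ` U)" "h \<in> Cc M (\<pi> ` U)" "(\<lambda>y. h y * f y) = f"
    have "D (ez U f) = \<Phi> U f" using D(2)[of U f] a(1,2) by simp
    also have "\<dots> = ts (ez U f) (ez U h)" by (rule \<Phi>[OF a])
    finally show "D (ez U f) = ts (ez U f) (ez U h)" .
  qed
qed

lemma section_sum:
  fixes s :: "'e => ('e => 'f::real_normed_field) set"
  assumes "s \<in> CS"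
  obtains k :: nat and U and f :: "nat => 'm => 'f" where "\<forall>i<k. el (U i) \<and> f i \<in> Cc M (\<pi> ` U i)"
    "s = finsum Sec (\<lambda>i. ez (U i) (f i)) {..<k}"
proof -
  interpret S: lmod M "Sec :: ('m => 'f, 'e => ('e => 'f) set) module" by (rule Sec_lmod)
  let ?P = "\<lambda>y. el (fst y) \<and> snd y \<in> Cc M (\<pi> ` fst y)"
  let ?\<phi> = "\<lambda>y. ez (fst y) (snd y)"
  have "s \<in> addspan Sec {ez U f |U (f :: 'm => 'f). U \<in> Collect el \<and> f \<in> Cc M (\<pi> ` U)}"
    by (rule section_span[OF _ _ assms, of "Collect el" "\<lambda>U. U"]) (use el_exists in auto)
  also have "{ez U f |U (f :: 'm => 'f). U \<in> Collect el \<and> f \<in> Cc M (\<pi> ` U)} = {?\<phi> y |y. ?P y}" by auto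
  finally have "\<exists>(k::nat) y. (\<forall>i<k. ?P (y i)) \<and> s = finsum Sec (\<lambda>i. ?\<phi> (y i)) {..<k}"
    by (subst (asm) S.addspan_iff) (auto intro: ez_section)
  then obtain k :: nat and y where y: "\<forall>i<k. ?P (y i)" "s = finsum Sec (\<lambda>i. ?\<phi> (y i)) {..<k}" by blast
  show ?thesis by (rule that[of k "\<lambda>i. fst (y i)" "\<lambda>i. snd (y i)"]) (use y in auto)
qed

text \<open>Every presentation of \<open>s\<close> produces the value at \<open>s\<close> of the
  linear map from \<open>comult_exists\<close>, so the definite description denotes that
  value.\<close>

lemma sheaf_comult:
  fixes dummy :: "'f::real_normed_field itself"
  shows "rlinear RM Sec SecT (sheaf_comult M E \<pi> :: ('e => ('e => 'f) set) => _)"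
    and "\<And>U (f :: 'm => 'f) \<eta>. el U ==> f \<in> Cc M (\<pi> ` U) ==> \<eta> \<in> Cc M (\<pi> ` U) ==> (\<lambda>y. \<eta> y * f y) = f ==>
      sheaf_comult M E \<pi> (ez U f) = ts (ez U f) (ez U \<eta>)"
proof -
  interpret S: lmod M "Sec :: ('m => 'f, 'e => ('e => 'f) set) module" by (rule Sec_lmod)
  obtain D :: "('e => ('e => 'f) set) => _" where D0: "rlinear RM Sec SecT D"
    "\<forall>U f \<eta>. el U --> f \<in> Cc M (\<pi> ` U) --> \<eta> \<in> Cc M (\<pi> ` U) --> (\<lambda>y. \<eta> y * f y) = f -->
      D (ez U f) = ts (ez U f) (ez U \<eta>)"
    by (rule comult_exists)
  note D = D0(1) D0(2)[rule_format]
  have eq: "sheaf_comult M E \<pi> s = D s" if s: "s \<in> CS" for s :: "'e => ('e => 'f) set"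
    unfolding sheaf_comult_def Let_def ez_def[symmetric]
  proof (rule the_equality)
    have sum: "finsum SecT (\<lambda>i. ts (ez (U i) (f i)) (ez (U i) (\<eta> i))) {..<k} = D (finsum Sec (\<lambda>i. ez (U i) (f i)) {..<k})"
      if a: "\<forall>i<k. el (U i) \<and> f i \<in> Cc M (\<pi> ` U i) \<and> \<eta> i \<in> Cc M (\<pi> ` U i) \<and> \<eta> i \<otimes>\<^bsub>Cc_ring M\<^esub> f i = f i"
      for k :: nat and U and f \<eta> :: "nat => 'm => 'f"
    proof -
      have "finsum SecT (\<lambda>i. ts (ez (U i) (f i)) (ez (U i) (\<eta> i))) {..<k} = finsum SecT (\<lambda>i. D (ez (U i) (f i))) {..<k}"
      proof (rule abelian_monoid.finsum_cong'[OF abelian_group.axioms(1)[OF S.AA.tensor_abelian_group]])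
        show "(\<lambda>i. D (ez (U i) (f i))) \<in> {..<k} \<rightarrow> carrier SecT"
          using a by (simp add: Pi_iff rlinear_closed[OF D(1), simplified] ez_section)
        show "ts (ez (U i) (f i)) (ez (U i) (\<eta> i)) = D (ez (U i) (f i))" if "i \<in> {..<k}" for i
          using a that by (intro D(2)[symmetric]) auto
      qed simp
      also have "\<dots> = D (finsum Sec (\<lambda>i. ez (U i) (f i)) {..<k})"
        by (rule rlinear_finsum[OF Sec_abelian_group S.AA.tensor_abelian_group D(1), symmetric])
          (use a in \<open>simp add: ez_section\<close>)
      finally show ?thesis .
    qed
    obtain k :: nat and U and f :: "nat => 'm => 'f" where k: "\<forall>i<k. el (U i) \<and> f i \<in> Cc M (\<pi> ` U i)"
      "s = finsum Sec (\<lambda>i. ez (U i) (f i)) {..<k}" using section_sum[OF s] .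
    have "\<forall>i\<in>{..<k}. \<exists>h. h \<in> Cc M (\<pi> ` U i) \<and> (\<lambda>y. h y * f i y) = f i"
    proof
      fix i assume "i \<in> {..<k}"
      then have "f i \<in> Cc M (\<pi> ` U i)" using k by simp
      then show "\<exists>h. h \<in> Cc M (\<pi> ` U i) \<and> (\<lambda>y. h y * f i y) = f i" by (rule Cc_unit) blast
    qed
    from bchoice[OF this] obtain \<eta> where \<eta>: "\<forall>i\<in>{..<k}. \<eta> i \<in> Cc M (\<pi> ` U i) \<and> (\<lambda>y. \<eta> i y * f i y) = f i" by blast
    have a: "\<forall>i<k. el (U i) \<and> f i \<in> Cc M (\<pi> ` U i) \<and> \<eta> i \<in> Cc M (\<pi> ` U i) \<and> \<eta> i \<otimes>\<^bsub>Cc_ring M\<^esub> f i = f i"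
      using k \<eta> by simp
    show "\<exists>(k::nat) U f \<eta>. (\<forall>i<k. el (U i) \<and> f i \<in> Cc M (\<pi> ` U i) \<and> \<eta> i \<in> Cc M (\<pi> ` U i) \<and> \<eta> i \<otimes>\<^bsub>Cc_ring M\<^esub> f i = f i) \<and>
        s = finsum Sec (\<lambda>i. ez (U i) (f i)) {..<k} \<and>
        D s = finsum SecT (\<lambda>i. ts (ez (U i) (f i)) (ez (U i) (\<eta> i))) {..<k}"
      by (intro exI[of _ k] exI[of _ U] exI[of _ f] exI[of _ \<eta>] conjI a k(2)) (simp only: k(2) sum[OF a])
    fix T assume "\<exists>(k::nat) U f \<eta>. (\<forall>i<k. el (U i) \<and> f i \<in> Cc M (\<pi> ` U i) \<and> \<eta> i \<in> Cc M (\<pi> ` U i) \<and> \<eta> i \<otimes>\<^bsub>Cc_ring M\<^esub> f i = f i) \<and>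
        s = finsum Sec (\<lambda>i. ez (U i) (f i)) {..<k} \<and>
        T = finsum SecT (\<lambda>i. ts (ez (U i) (f i)) (ez (U i) (\<eta> i))) {..<k}"
    then show "T = D s"
    proof (elim exE conjE)
      fix k :: nat and U and f \<eta> :: "nat => 'm => 'f"
      assume a: "\<forall>i<k. el (U i) \<and> f i \<in> Cc M (\<pi> ` U i) \<and> \<eta> i \<in> Cc M (\<pi> ` U i) \<and> \<eta> i \<otimes>\<^bsub>Cc_ring M\<^esub> f i = f i"
        and s': "s = finsum Sec (\<lambda>i. ez (U i) (f i)) {..<k}"
        and T: "T = finsum SecT (\<lambda>i. ts (ez (U i) (f i)) (ez (U i) (\<eta> i))) {..<k}"
      show "T = D s" unfolding T s' by (rule sum[OF a])
    qed
  qed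
  show "rlinear RM Sec SecT (sheaf_comult M E \<pi> :: ('e => ('e => 'f) set) => _)"
    using D(1) eq unfolding rlinear_def
    by (simp add: Cc_sections.add S.smult_closed'[simplified Sec_simps] Pi_iff)
  show "\<And>U (f :: 'm => 'f) \<eta>. el U ==> f \<in> Cc M (\<pi> ` U) ==> \<eta> \<in> Cc M (\<pi> ` U) ==> (\<lambda>y. \<eta> y * f y) = f ==>
      sheaf_comult M E \<pi> (ez U f) = ts (ez U f) (ez U \<eta>)"
    by (simp only: eq[OF ez_section] D(2))
qed

text \<open>The family sends \<open>f\<close> to itself for every \<open>U\<close>; its
  compatibility is trivial and any neighbourhood of \<open>\<pi> e\<close> will do.\<close>

lemma counit_exists:
  obtains D :: "('e => ('e => 'f::real_normed_field) set) => 'm => 'f" where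
    "rlinear RM Sec Reg D" "\<And>U f. el U ==> f \<in> Cc M (\<pi> ` U) ==> D (ez U f) = f"
proof -
  interpret F: sheaf_family M E \<pi> "Reg :: ('m => 'f, 'm => 'f) module" "Collect el" "\<lambda>U. U" "\<lambda>U f. f"
  proof (intro sheaf_family.intro sheaf_axioms Reg_lmod sheaf_family_axioms.intro, goal_cases)
    case (6 U V e)
    then show ?case using proj_in el_sub by (intro exI[of _ TM]) auto
  qed (use el_exists Cc_in_ring in auto)
  show ?thesis by (rule F.family_extension) (use that in simp)
qed

lemma sheaf_counit:
  fixes dummy :: "'f::real_normed_field itself"
  shows "rlinear RM Sec Reg (sheaf_counit M E \<pi> :: ('e => ('e => 'f) set) => _)"
    and "\<And>U (f :: 'm => 'f). el U ==> f \<in> Cc M (\<pi> ` U) ==> sheaf_counit M E \<pi> (ez U f) = f"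
proof -
  interpret S: lmod M "Sec :: ('m => 'f, 'e => ('e => 'f) set) module" by (rule Sec_lmod)
  interpret R: lmod M "Reg :: ('m => 'f, 'm => 'f) module" by (rule Reg_lmod)
  obtain D :: "('e => ('e => 'f) set) => 'm => 'f" where D: "rlinear RM Sec Reg D"
    "\<And>U f. el U ==> f \<in> Cc M (\<pi> ` U) ==> D (ez U f) = f"
    by (rule counit_exists) (rule that, assumption, simp)
  \<comment> \<open>The definition sums in the ring, while linear maps have values in the ring
    regarded as a module; both have the same addition.\<close>
  have fin: "finsum RM f J = finsum Reg f J" for f :: "nat => 'm => 'f" and J
    by (simp add: finsum_def finprod_def regular_module_def)
  have eq: "sheaf_counit M E \<pi> s = D s" if s: "s \<in> CS" for s :: "'e => ('e => 'f) set"
    unfolding sheaf_counit_def ez_def[symmetric]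
  proof (rule the_equality)
    have sum: "finsum RM f {..<k} = D (finsum Sec (\<lambda>i. ez (U i) (f i)) {..<k})"
      if a: "\<forall>i<k. el (U i) \<and> f i \<in> Cc M (\<pi> ` U i)" for k :: nat and U and f :: "nat => 'm => 'f"
    proof -
      have "finsum RM f {..<k} = finsum Reg (\<lambda>i. D (ez (U i) (f i))) {..<k}"
        unfolding fin
        by (rule R.finsum_cong') (use a in \<open>auto simp: Pi_iff D(2) intro: Cc_in_ring\<close>)
      also have "\<dots> = D (finsum Sec (\<lambda>i. ez (U i) (f i)) {..<k})"
        by (rule rlinear_finsum[OF Sec_abelian_group R.abelian_group_axioms D(1), symmetric])
          (use a in \<open>simp add: ez_section\<close>)
      finally show ?thesis .
    qed
    obtain k :: nat and U and f :: "nat => 'm => 'f" where k: "\<forall>i<k. el (U i) \<and> f i \<in> Cc M (\<pi> ` U i)"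
      "s = finsum Sec (\<lambda>i. ez (U i) (f i)) {..<k}" using section_sum[OF s] .
    have a: "\<forall>i<k. el (U i) \<and> f i \<in> Cc M (\<pi> ` U i)" using k by simp
    show "\<exists>(k::nat) U f. (\<forall>i<k. el (U i) \<and> f i \<in> Cc M (\<pi> ` U i)) \<and>
        s = finsum Sec (\<lambda>i. ez (U i) (f i)) {..<k} \<and> D s = finsum RM f {..<k}"
      by (intro exI[of _ k] exI[of _ U] exI[of _ f] conjI a k(2)) (simp only: k(2) sum[OF a])
    fix T assume "\<exists>(k::nat) U f. (\<forall>i<k. el (U i) \<and> f i \<in> Cc M (\<pi> ` U i)) \<and>
        s = finsum Sec (\<lambda>i. ez (U i) (f i)) {..<k} \<and> T = finsum RM f {..<k}"
    then show "T = D s"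
    proof (elim exE conjE)
      fix k :: nat and U and f :: "nat => 'm => 'f"
      assume a: "\<forall>i<k. el (U i) \<and> f i \<in> Cc M (\<pi> ` U i)"
        and s': "s = finsum Sec (\<lambda>i. ez (U i) (f i)) {..<k}" and T: "T = finsum RM f {..<k}"
      show "T = D s" unfolding T s' by (rule sum[OF a])
    qed
  qed
  show "rlinear RM Sec Reg (sheaf_counit M E \<pi> :: ('e => ('e => 'f) set) => _)"
    using D(1) eq unfolding rlinear_def
    by (simp add: Cc_sections.add S.smult_closed'[simplified Sec_simps] Pi_iff)
  show "\<And>U (f :: 'm => 'f). el U ==> f \<in> Cc M (\<pi> ` U) ==> sheaf_counit M E \<pi> (ez U f) = f"
    by (simp only: eq[OF ez_section] D(2))
qed

lemma sheaf_coalgebra_simps: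
  "carrier (sheaf_coalgebra M E \<pi>) = carrier Sec"
  "add (sheaf_coalgebra M E \<pi>) = add Sec"
  "zero (sheaf_coalgebra M E \<pi>) = zero Sec"
  "module.smult (sheaf_coalgebra M E \<pi>) = module.smult Sec"
  "comult (sheaf_coalgebra M E \<pi>) = sheaf_comult M E \<pi>"
  "counit (sheaf_coalgebra M E \<pi>) = sheaf_counit M E \<pi>"
  by (simp_all add: sheaf_coalgebra_def module.extend_def coalgebra.fields_def)

end

section \<open>The spectral sheaf\<close>

context coalg
begin

text \<open>The pairs \<open>(c, W)\<close> that index the basic open sets of the spectral
  sheaf.\<close>

definition nd :: "'c => 'm set => bool" where
  "nd c W \<longleftrightarrow> c \<in> WG \<and> openin (mtop M) W \<and> normalized_on M C c W"

abbreviation "ss \<equiv> spectral_set M C"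
abbreviation "SP \<equiv> spectral_sheaf M C"
abbreviation "SS \<equiv> spectral_space M C"

lemma ndD: "nd c W ==> c \<in> WG" "nd c W ==> openin (mtop M) W" "nd c W ==> normalized_on M C c W"
  "nd c W ==> c \<in> carrier C" "nd c W ==> W \<subseteq> TM" "nd c W ==> x \<in> W ==> normalized_at M C c x"
  using openin_subset by (auto simp: nd_def WG_carrier normalized_on_def)

lemma nd_subset: "nd c W ==> openin (mtop M) V ==> V \<subseteq> W ==> nd c V"
  by (auto simp: nd_def normalized_on_def)

lemma mem_ss: "p \<in> ss c W \<longleftrightarrow> fst p \<in> W \<and> snd p = cls M C (fst p) c"
  by (cases p) (auto simp: spectral_set_def)

lemma fst_ss: "fst ` ss c W = W"
  by (force simp: spectral_set_def)

lemma comp_fst_image: "(\<phi> \<circ> fst) ` Q = \<phi> ` fst ` Q"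
  by (rule image_comp[symmetric])

lemma ss_inj: "inj_on fst (ss c W)"
  by (auto simp: inj_on_def mem_ss intro: prod_eqI)

lemma ss_sub: assumes "nd c W" shows "ss c W \<subseteq> SS"
proof
  fix p assume "p \<in> ss c W"
  then have p: "fst p \<in> W" "snd p = cls M C (fst p) c" by (simp_all add: mem_ss)
  have "cls M C (fst p) c \<in> stalk_grouplike M C (fst p)"
    by (rule WG_stalk_grouplike) (use ndD[OF assms] p in auto)
  then show "p \<in> SS" using p ndD(5)[OF assms] by (cases p) (auto simp: spectral_space_def)
qed

lemma basis_iff: "B \<in> spectral_basis M C \<longleftrightarrow> (\<exists>c W. nd c W \<and> B = ss c W)"
  by (auto simp: spectral_basis_def nd_def)

text \<open>A multiplier that equates \<open>c\<close> and \<open>d\<close> has germ 1 not only at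
  \<open>x\<close> but at all nearby points, and serves there as well.\<close>

lemma openin_germ_cls_eq:
  assumes c: "c \<in> carrier C" "d \<in> carrier C"
  shows "openin (mtop M) {y \<in> TM. cls M C y c = cls M C y d}"
proof (subst openin_subopen, intro ballI)
  fix x assume "x \<in> {y \<in> TM. cls M C y c = cls M C y d}"
  then have x: "x \<in> TM" "geq x c d" using cls_eq_iff c by auto
  from x(2) show "\<exists>T. openin (mtop M) T \<and> x \<in> T \<and> T \<subseteq> {y \<in> TM. cls M C y c = cls M C y d}"
  proof (rule geqE)
    fix g assume g: "g \<in> Cc M TM" "germ M x g = germ1 M x" "g \<odot> c = g \<odot> d"
    let ?T = "{y \<in> TM. germ M y g = germ1 M y}"
    have "?T \<subseteq> {y \<in> TM. cls M C y c = cls M C y d}"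
      using cls_eq_iff[OF _ c] geqI[OF g(1) _ g(3)] by blast
    then show ?thesis using openin_germ_eq x(1) g(2) by (intro exI[of _ ?T]) simp
  qed
qed

text \<open>The basic sets are closed under intersection, hence a basis of a topology: two sections
  of the form \<open>ss c W\<close> meet over an open set.\<close>

lemma ss_Int:
  assumes "nd c W" "nd d V"
  shows "ss c W \<inter> ss d V = ss c (W \<inter> V \<inter> {y \<in> TM. cls M C y c = cls M C y d})"
    "nd c (W \<inter> V \<inter> {y \<in> TM. cls M C y c = cls M C y d})"
proof -
  show "ss c W \<inter> ss d V = ss c (W \<inter> V \<inter> {y \<in> TM. cls M C y c = cls M C y d})"
    using ndD(5)[OF assms(1)] by (auto simp: mem_ss)
  show "nd c (W \<inter> V \<inter> {y \<in> TM. cls M C y c = cls M C y d})"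
    by (rule nd_subset[OF assms(1)])
      (use ndD(2)[OF assms(1)] ndD(2)[OF assms(2)] openin_germ_cls_eq[OF ndD(4)[OF assms(1)] ndD(4)[OF assms(2)]] in auto)
qed

lemma openin_SP: "openin (mtop SP) Q \<longleftrightarrow> Q \<subseteq> SS \<and> (\<forall>p\<in>Q. \<exists>c W. nd c W \<and> p \<in> ss c W \<and> ss c W \<subseteq> Q)"
proof -
  let ?o = "\<lambda>Q. Q \<subseteq> SS \<and> (\<forall>p \<in> Q. \<exists>B \<in> spectral_basis M C. p \<in> B \<and> B \<subseteq> Q)"
  have "istopology ?o"
  proof -
    have 1: "?o (Q \<inter> P)" if Q: "?o Q" and P: "?o P" for Q P
    proof (intro conjI ballI)
      show "Q \<inter> P \<subseteq> SS" using Q by blast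
      fix p assume p: "p \<in> Q \<inter> P"
      have "\<exists>B \<in> spectral_basis M C. p \<in> B \<and> B \<subseteq> Q" "\<exists>B \<in> spectral_basis M C. p \<in> B \<and> B \<subseteq> P"
        using Q P p by simp_all
      then obtain A B where AB: "A \<in> spectral_basis M C" "p \<in> A" "A \<subseteq> Q" "B \<in> spectral_basis M C" "p \<in> B" "B \<subseteq> P"
        by (elim bexE conjE)
      from AB(1) obtain c W where c: "nd c W" "A = ss c W" unfolding basis_iff by (elim exE conjE)
      from AB(4) obtain d V where d: "nd d V" "B = ss d V" unfolding basis_iff by (elim exE conjE)
      show "\<exists>B\<in>spectral_basis M C. p \<in> B \<and> B \<subseteq> Q \<inter> P"
      proof (intro bexI conjI)
        show "ss c W \<inter> ss d V \<in> spectral_basis M C" unfolding basis_iff using ss_Int[OF c(1) d(1)] by (intro exI conjI)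
        show "p \<in> ss c W \<inter> ss d V" "ss c W \<inter> ss d V \<subseteq> Q \<inter> P" using AB c(2) d(2) by blast+
      qed
    qed
    have 2: "?o (\<Union>K)" if K: "\<forall>Q\<in>K. ?o Q" for K
    proof (intro conjI ballI)
      show "\<Union>K \<subseteq> SS" using K by blast
      fix p assume "p \<in> \<Union>K"
      then obtain Q where "Q \<in> K" "p \<in> Q" by blast
      then show "\<exists>B\<in>spectral_basis M C. p \<in> B \<and> B \<subseteq> \<Union>K" using K by (meson Union_upper order_trans)
    qed
    show ?thesis unfolding istopology_def
    proof (rule conjI; intro allI impI)
      fix Q P assume "?o Q" "?o P" then show "?o (Q \<inter> P)" by (rule 1)
    next
      fix K assume "\<forall>Q\<in>K. ?o Q" then show "?o (\<Union>K)" by (rule 2)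
    qed
  qed
  then have "openin (topology ?o) = ?o" by (rule topology_inverse')
  then have "openin (mtop SP) Q \<longleftrightarrow> ?o Q" by (simp add: spectral_sheaf_def)
  then show ?thesis unfolding Bex_def basis_iff by blast
qed

lemma ss_open: "nd c W ==> openin (mtop SP) (ss c W)"
  unfolding openin_SP using ss_sub by blast

text \<open>By \<open>stalk_grouplike_WG\<close> every grouplike element of a stalk comes from a
  weakly grouplike \<open>c\<close>; for \<open>W\<close> one takes all points at which
  \<open>c\<close> is normalized.\<close>

lemma SS_cases:
  assumes "p \<in> SS"
  obtains c W where "nd c W" "p \<in> ss c W"
proof -
  have p: "fst p \<in> TM" "snd p \<in> stalk_grouplike M C (fst p)" using assms by (auto simp: spectral_space_def)
  obtain c where c: "c \<in> WG" "normalized_at M C c (fst p)" "snd p = cls M C (fst p) c"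
    by (rule stalk_grouplike_WG[OF p])
  show ?thesis
  proof (rule that)
    show "nd c {y \<in> TM. normalized_at M C c y}" using c openin_normalized by (simp add: nd_def normalized_on_def)
    show "p \<in> ss c {y \<in> TM. normalized_at M C c y}" using p c by (simp add: mem_ss)
  qed
qed

lemma topspace_SP [simp]: "topspace (mtop SP) = SS"
proof
  show "topspace (mtop SP) \<subseteq> SS" using openin_SP[of "topspace (mtop SP)"] by simp
  have "openin (mtop SP) SS"
    unfolding openin_SP
  proof (intro conjI subset_refl ballI)
    fix p assume "p \<in> SS"
    then obtain c W where "nd c W" "p \<in> ss c W" by (rule SS_cases)
    then show "\<exists>c W. nd c W \<and> p \<in> ss c W \<and> ss c W \<subseteq> SS" using ss_sub by blast
  qed
  then show "SS \<subseteq> topspace (mtop SP)" by (rule openin_subset)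
qed

lemma mdim_SP [simp]: "mdim SP = mdim M"
  by (simp add: spectral_sheaf_def)

lemma atlas_SP: "(P, \<theta>) \<in> atlas SP \<longleftrightarrow>
    (\<exists>c W V \<phi>. P = ss c W \<and> \<theta> = \<phi> \<circ> fst \<and> (V, \<phi>) \<in> atlas M \<and> W \<subseteq> V \<and> nd c W)"
  by (auto simp: spectral_sheaf_def nd_def)

lemma fst_open:
  assumes "openin (mtop SP) Q" shows "openin (mtop M) (fst ` Q)"
proof (subst openin_subopen, intro ballI)
  fix y assume "y \<in> fst ` Q"
  then obtain p where p: "p \<in> Q" "y = fst p" by blast
  then obtain c W where c: "nd c W" "p \<in> ss c W" "ss c W \<subseteq> Q" using assms unfolding openin_SP by blast
  have "W \<subseteq> fst ` Q" using c(3) fst_ss[of c W] by blast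
  then show "\<exists>T. openin (mtop M) T \<and> y \<in> T \<and> T \<subseteq> fst ` Q"
    using ndD(2)[OF c(1)] c(2) p(2) by (intro exI[of _ W]) (simp add: mem_ss)
qed

lemma fst_preimage_open:
  assumes "openin (mtop M) V" shows "openin (mtop SP) {p \<in> SS. fst p \<in> V}"
  unfolding openin_SP
proof (intro conjI ballI)
  fix p assume p: "p \<in> {p \<in> SS. fst p \<in> V}"
  then obtain c W where c: "nd c W" "p \<in> ss c W" using SS_cases by blast
  have n: "nd c (W \<inter> V)" by (rule nd_subset[OF c(1)]) (use ndD(2)[OF c(1)] assms in auto)
  have "ss c (W \<inter> V) \<subseteq> {p \<in> SS. fst p \<in> V}" using ss_sub[OF n] by (auto simp: mem_ss)
  moreover have "p \<in> ss c (W \<inter> V)" using c p by (simp add: mem_ss)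
  ultimately show "\<exists>c W. nd c W \<and> p \<in> ss c W \<and> ss c W \<subseteq> {p \<in> SS. fst p \<in> V}" using n by blast
qed blast

lemma fst_TM: "p \<in> SS ==> fst p \<in> TM"
  by (auto simp: spectral_space_def)

lemma fst_continuous: "continuous_map (mtop SP) (mtop M) fst"
  unfolding continuous_map_def using fst_preimage_open fst_TM by auto

lemma ss_image_Int:
  assumes "nd c W" "openin (mtop SP) Q"
  shows "{y \<in> W. (y, cls M C y c) \<in> Q} = fst ` (ss c W \<inter> Q)" "openin (mtop M) {y \<in> W. (y, cls M C y c) \<in> Q}"
proof -
  show e: "{y \<in> W. (y, cls M C y c) \<in> Q} = fst ` (ss c W \<inter> Q)"
    by (force simp: mem_ss image_iff)
  show "openin (mtop M) {y \<in> W. (y, cls M C y c) \<in> Q}"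
    unfolding e by (intro fst_open openin_Int ss_open assms)
qed

lemma inv_ss:
  assumes "y \<in> W" shows "inv_into (ss c W) fst y = (y, cls M C y c)"
  using inv_into_f_f[OF ss_inj, of "(y, cls M C y c)" c W] assms by (simp add: mem_ss)

section \<open>The manifold structure of the spectral sheaf\<close>

lemma SP_chart_inj:
  assumes "(V, \<phi>) \<in> atlas M" "W \<subseteq> V"
  shows "inj_on (\<phi> \<circ> fst) (ss c W)"
  by (rule comp_inj_on[OF ss_inj]) (simp add: fst_ss inj_on_subset[OF chart_inj[OF mfd assms(1)] assms(2)])

lemma inv_SP_chart:
  assumes "(V, \<phi>) \<in> atlas M" "W \<subseteq> V" "y \<in> W"
  shows "inv_into (ss c W) (\<phi> \<circ> fst) (\<phi> y) = (y, cls M C y c)"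
  using inv_into_f_f[OF SP_chart_inj[OF assms(1,2)], of "(y, cls M C y c)" c] assms by (simp add: mem_ss)

lemma SP_chart_homeo:
  assumes ch: "(V, \<phi>) \<in> atlas M" and WV: "W \<subseteq> V" and n: "nd c W"
  shows "homeomorphic_map (subtopology (mtop SP) (ss c W))
    (subtopology (Euclidean_space (mdim M)) ((\<phi> \<circ> fst) ` ss c W)) (\<phi> \<circ> fst)"
proof (rule bijective_open_imp_homeomorphic_map)
  let ?E = "Euclidean_space (mdim M)"
  have im: "(\<phi> \<circ> fst) ` ss c W = \<phi> ` W" by (simp only: comp_fst_image fst_ss)
  have oW: "openin ?E (\<phi> ` W)"
    using chart_open[OF mfd ch ndD(2)[OF n]] WV by (simp add: Int_absorb2)
  have top: "topspace (subtopology (mtop SP) (ss c W)) = ss c W" using ss_sub[OF n] by auto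
  show "continuous_map (subtopology (mtop SP) (ss c W)) (subtopology ?E ((\<phi> \<circ> fst) ` ss c W)) (\<phi> \<circ> fst)"
    unfolding continuous_map_in_subtopology
  proof
    show "continuous_map (subtopology (mtop SP) (ss c W)) ?E (\<phi> \<circ> fst)"
      unfolding continuous_map_def top
    proof (intro conjI allI impI)
      show "\<phi> \<circ> fst \<in> ss c W \<rightarrow> topspace ?E" using openin_subset[OF oW] by (auto simp: mem_ss)
      fix Q assume Q: "openin ?E Q"
      have "{p \<in> ss c W. (\<phi> \<circ> fst) p \<in> Q} = ss c (W \<inter> {y \<in> V. \<phi> y \<in> Q})" using WV by (auto simp: mem_ss)
      moreover have "nd c (W \<inter> {y \<in> V. \<phi> y \<in> Q})"
        by (rule nd_subset[OF n]) (use ndD(2)[OF n] chart_preimage_open[OF mfd ch Q] in auto)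
      ultimately show "openin (subtopology (mtop SP) (ss c W)) {p \<in> ss c W. (\<phi> \<circ> fst) p \<in> Q}"
        using ss_open by (auto simp: openin_open_subtopology[OF ss_open[OF n]] mem_ss)
    qed
  qed (auto simp: top)
  show "open_map (subtopology (mtop SP) (ss c W)) (subtopology ?E ((\<phi> \<circ> fst) ` ss c W)) (\<phi> \<circ> fst)"
    unfolding open_map_def
  proof (intro allI impI)
    fix Q assume "openin (subtopology (mtop SP) (ss c W)) Q"
    then have Q: "openin (mtop SP) Q" "Q \<subseteq> ss c W" by (simp_all add: openin_open_subtopology[OF ss_open[OF n]])
    have "fst ` Q \<subseteq> V" using Q(2) fst_ss[of c W] WV by blast
    then have "openin ?E (\<phi> ` fst ` Q)" using chart_open[OF mfd ch fst_open[OF Q(1)]] by (simp add: Int_absorb2)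
    moreover have "\<phi> ` fst ` Q \<subseteq> \<phi> ` W"
      by (rule image_mono) (use image_mono[OF Q(2), of fst] in \<open>simp only: fst_ss\<close>)
    ultimately show "openin (subtopology ?E ((\<phi> \<circ> fst) ` ss c W)) ((\<phi> \<circ> fst) ` Q)"
      unfolding comp_fst_image fst_ss openin_open_subtopology[OF oW] by (rule conjI)
  qed
  show "(\<phi> \<circ> fst) ` topspace (subtopology (mtop SP) (ss c W)) = topspace (subtopology ?E ((\<phi> \<circ> fst) ` ss c W))"
    unfolding top im using Int_absorb1[OF openin_subset[OF oW]] by (simp only: topspace_subtopology)
  show "inj_on (\<phi> \<circ> fst) (topspace (subtopology (mtop SP) (ss c W)))"
    unfolding top by (rule SP_chart_inj[OF ch WV])
qed

text \<open>The charts are charts of \<open>M\<close> composed with injective projections. The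
  transition maps are therefore those of \<open>M\<close>, restricted to the open projection
  \<open>Z\<close> of the intersection of the two domains.\<close>

lemma SP_manifold: "is_manifold SP"
  unfolding is_manifold_def
proof (intro conjI)
  show "\<forall>(P, \<theta>) \<in> atlas SP. openin (mtop SP) P \<and> openin (Euclidean_space (mdim SP)) (\<theta> ` P) \<and>
      homeomorphic_map (subtopology (mtop SP) P) (subtopology (Euclidean_space (mdim SP)) (\<theta> ` P)) \<theta>"
  proof (intro ballI, clarify)
    fix P \<theta> assume "(P, \<theta>) \<in> atlas SP"
    then obtain c W V \<phi> where P: "P = ss c W" "\<theta> = \<phi> \<circ> fst" "(V, \<phi>) \<in> atlas M" "W \<subseteq> V" "nd c W"
      unfolding atlas_SP by blast
    have "\<theta> ` P = \<phi> ` (W \<inter> V)" by (simp only: P(1,2) comp_fst_image fst_ss Int_absorb2[OF P(4)])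
    then show "openin (mtop SP) P \<and> openin (Euclidean_space (mdim SP)) (\<theta> ` P) \<and>
      homeomorphic_map (subtopology (mtop SP) P) (subtopology (Euclidean_space (mdim SP)) (\<theta> ` P)) \<theta>"
      using chart_open[OF mfd P(3) ndD(2)[OF P(5)]] ss_open[OF P(5)] SP_chart_homeo[OF P(3-5)] by (simp add: P(1,2))
  qed
  show "(\<Union>(P, \<theta>)\<in>atlas SP. P) = topspace (mtop SP)"
  proof (intro equalityI subsetI)
    fix p assume "p \<in> (\<Union>(P, \<theta>)\<in>atlas SP. P)"
    then obtain c W where "nd c W" "p \<in> ss c W" by (auto simp: atlas_SP)
    then show "p \<in> topspace (mtop SP)" using subsetD[OF ss_sub] by simp
  next
    fix p assume "p \<in> topspace (mtop SP)"
    then have p: "p \<in> SS" by simp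
    then obtain c W where c: "nd c W" "p \<in> ss c W" by (rule SS_cases)
    obtain V \<phi> where V: "(V, \<phi>) \<in> atlas M" "fst p \<in> V" using chart_cover[OF mfd fst_TM[OF p]] by blast
    have "nd c (W \<inter> V)" by (rule nd_subset[OF c(1)]) (use ndD(2)[OF c(1)] chart_openin[OF mfd V(1)] in auto)
    then have "(ss c (W \<inter> V), \<phi> \<circ> fst) \<in> atlas SP" unfolding atlas_SP using V(1) by blast
    moreover have "p \<in> ss c (W \<inter> V)" using c V by (simp add: mem_ss)
    ultimately show "p \<in> (\<Union>(P, \<theta>)\<in>atlas SP. P)" by blast
  qed
  show "\<forall>(P, \<theta>)\<in>atlas SP. \<forall>(P', \<theta>')\<in>atlas SP. \<forall>i<mdim SP.
      smooth_Rn (mdim SP) (\<theta> ` (P \<inter> P')) (\<lambda>z. \<theta>' (inv_into P \<theta> z) i)"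
  proof (intro ballI, clarify)
    fix P \<theta> P' \<theta>' i assume "(P, \<theta>) \<in> atlas SP" "(P', \<theta>') \<in> atlas SP" and i: "i < mdim SP"
    then obtain c W V \<phi> d W' V' \<psi> where P: "P = ss c W" "\<theta> = \<phi> \<circ> fst" "(V, \<phi>) \<in> atlas M" "W \<subseteq> V" "nd c W"
      and P': "P' = ss d W'" "\<theta>' = \<psi> \<circ> fst" "(V', \<psi>) \<in> atlas M" "W' \<subseteq> V'" "nd d W'"
      unfolding atlas_SP by blast
    define Z where "Z = fst ` (ss c W \<inter> ss d W')"
    have ZW: "Z \<subseteq> W" "Z \<subseteq> W'" unfolding Z_def by (auto simp: mem_ss)
    have oZ: "openin (mtop M) Z" unfolding Z_def by (intro fst_open openin_Int ss_open P(5) P'(5))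
    have dom: "\<theta> ` (P \<inter> P') = \<phi> ` (Z \<inter> V)"
      by (simp only: P(1,2) P'(1) comp_fst_image Z_def[symmetric] Int_absorb2[OF subset_trans[OF ZW(1) P(4)]])
    have "smooth_Rn (mdim M) (\<phi> ` (Z \<inter> V)) (\<lambda>z. \<psi> (inv_into V \<phi> z) i)"
      by (rule smooth_Rn_subset[OF chart_transition[OF mfd P(3) P'(3)] chart_open[OF mfd P(3) oZ]])
        (use i ZW P'(4) in auto)
    also have "smooth_Rn (mdim M) (\<phi> ` (Z \<inter> V)) (\<lambda>z. \<psi> (inv_into V \<phi> z) i) \<longleftrightarrow>
        smooth_Rn (mdim M) (\<phi> ` (Z \<inter> V)) (\<lambda>z. \<theta>' (inv_into P \<theta> z) i)"
    proof (rule smooth_Rn_cong)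
      fix z assume "z \<in> \<phi> ` (Z \<inter> V)"
      then obtain y where y: "y \<in> Z" "y \<in> V" "z = \<phi> y" by blast
      then show "\<psi> (inv_into V \<phi> z) i = \<theta>' (inv_into P \<theta> z) i"
        using inv_SP_chart[OF P(3,4), of y c] inv_into_f_f[OF chart_inj[OF mfd P(3)], of y] ZW(1)
        by (simp add: P(1,2) P'(2) subset_iff)
    qed
    finally show "smooth_Rn (mdim SP) (\<theta> ` (P \<inter> P')) (\<lambda>z. \<theta>' (inv_into P \<theta> z) i)" using dom by simp
  qed
qed

lemma SP_section_smooth:
  assumes n: "nd c W"
  shows "smooth_map_on M W SP (inv_into (ss c W) fst)"
proof -
  have top: "topspace (subtopology (mtop M) W) = W" using ndD(5)[OF n] by auto
  have cont: "continuous_map (subtopology (mtop M) W) (mtop SP) (inv_into (ss c W) fst)"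
    unfolding continuous_map_def top
  proof (intro conjI allI impI)
    show "inv_into (ss c W) fst \<in> W \<rightarrow> topspace (mtop SP)"
      using ss_sub[OF n] by (auto simp: inv_ss mem_ss subset_iff)
    fix Q assume Q: "openin (mtop SP) Q"
    have "{y \<in> W. inv_into (ss c W) fst y \<in> Q} = {y \<in> W. (y, cls M C y c) \<in> Q}" by (auto simp: inv_ss)
    then show "openin (subtopology (mtop M) W) {y \<in> W. inv_into (ss c W) fst y \<in> Q}"
      using ss_image_Int(2)[OF n Q] by (auto simp: openin_open_subtopology[OF ndD(2)[OF n]])
  qed
  have sm: "smooth_Rn (mdim M) (\<phi> ` (W \<inter> V \<inter> inv_into (ss c W) fst -` ss d W'))
      (\<lambda>z. (\<psi> \<circ> fst) (inv_into (ss c W) fst (inv_into V \<phi> z)) i)"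
    if a: "(V, \<phi>) \<in> atlas M" and P: "(V', \<psi>) \<in> atlas M" "W' \<subseteq> V'" "nd d W'" and i: "i < mdim M"
    for V \<phi> d W' V' \<psi> i
  proof -
    define Z where "Z = fst ` (ss c W \<inter> ss d W')"
    have ZW: "Z \<subseteq> W" "Z \<subseteq> W'" unfolding Z_def by (auto simp: mem_ss)
    have oZ: "openin (mtop M) Z" unfolding Z_def by (intro fst_open openin_Int ss_open n P(3))
    have "Z = {y \<in> W. inv_into (ss c W) fst y \<in> ss d W'}"
      unfolding Z_def ss_image_Int(1)[OF n ss_open[OF P(3)], symmetric] by (auto simp: inv_ss)
    then have dom: "\<phi> ` (W \<inter> V \<inter> inv_into (ss c W) fst -` ss d W') = \<phi> ` (Z \<inter> V)" by (intro arg_cong[of _ _ "(`) \<phi>"]) auto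
    have "smooth_Rn (mdim M) (\<phi> ` (Z \<inter> V)) (\<lambda>z. \<psi> (inv_into V \<phi> z) i)"
      by (rule smooth_Rn_subset[OF chart_transition[OF mfd a P(1)] chart_open[OF mfd a oZ]])
        (use i ZW P(2) in auto)
    also have "smooth_Rn (mdim M) (\<phi> ` (Z \<inter> V)) (\<lambda>z. \<psi> (inv_into V \<phi> z) i) \<longleftrightarrow>
        smooth_Rn (mdim M) (\<phi> ` (Z \<inter> V)) (\<lambda>z. (\<psi> \<circ> fst) (inv_into (ss c W) fst (inv_into V \<phi> z)) i)"
    proof (rule smooth_Rn_cong)
      fix z assume "z \<in> \<phi> ` (Z \<inter> V)"
      then obtain y where y: "y \<in> Z" "y \<in> V" "z = \<phi> y" by blast
      then show "\<psi> (inv_into V \<phi> z) i = (\<psi> \<circ> fst) (inv_into (ss c W) fst (inv_into V \<phi> z)) i"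
        using inv_into_f_f[OF chart_inj[OF mfd a], of y] ZW(1) by (simp add: inv_ss subset_iff)
    qed
    finally show ?thesis using dom by simp
  qed
  show ?thesis
    unfolding smooth_map_on_def
  proof (intro conjI ballI ndD(2)[OF n] cont, clarify)
    fix V \<phi> P \<theta> i assume a: "(V, \<phi>) \<in> atlas M" and b: "(P, \<theta>) \<in> atlas SP" and i: "i < mdim SP"
    obtain d W' V' \<psi> where P: "P = ss d W'" "\<theta> = \<psi> \<circ> fst" "(V', \<psi>) \<in> atlas M" "W' \<subseteq> V'" "nd d W'"
      using b unfolding atlas_SP by blast
    show "smooth_Rn (mdim M) (\<phi> ` (W \<inter> V \<inter> inv_into (ss c W) fst -` P)) (\<lambda>z. \<theta> (inv_into (ss c W) fst (inv_into V \<phi> z)) i)"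
      unfolding P(1,2) by (rule sm[OF a P(3-5)]) (use i in simp)
  qed
qed

lemma SP_sheaf: "is_sheaf M SP fst"
  unfolding is_sheaf_def local_diffeo_def
proof (intro conjI ballI SP_manifold)
  have sm: "smooth_Rn (mdim M) ((\<phi> \<circ> fst) ` (SS \<inter> ss c W \<inter> fst -` V')) (\<lambda>z. \<psi> (fst (inv_into (ss c W) (\<phi> \<circ> fst) z)) i)"
    if P: "(V, \<phi>) \<in> atlas M" "W \<subseteq> V" "nd c W" and a: "(V', \<psi>) \<in> atlas M" and i: "i < mdim M"
    for V \<phi> c W V' \<psi> i
  proof -
    have "SS \<inter> ss c W \<inter> fst -` V' = ss c (W \<inter> V')" using ss_sub[OF P(3)] by (auto simp: mem_ss)
    then have dom: "(\<phi> \<circ> fst) ` (SS \<inter> ss c W \<inter> fst -` V') = \<phi> ` (W \<inter> V' \<inter> V)"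
      using Int_absorb2[of "W \<inter> V'" V] P(2) by (simp only: comp_fst_image fst_ss le_infI1)
    have o: "openin (mtop M) (W \<inter> V')" using ndD(2)[OF P(3)] chart_openin[OF mfd a] by blast
    have "smooth_Rn (mdim M) (\<phi> ` (W \<inter> V' \<inter> V)) (\<lambda>z. \<psi> (inv_into V \<phi> z) i)"
      by (rule smooth_Rn_subset[OF chart_transition[OF mfd P(1) a i] chart_open[OF mfd P(1) o]]) auto
    also have "smooth_Rn (mdim M) (\<phi> ` (W \<inter> V' \<inter> V)) (\<lambda>z. \<psi> (inv_into V \<phi> z) i) \<longleftrightarrow>
        smooth_Rn (mdim M) (\<phi> ` (W \<inter> V' \<inter> V)) (\<lambda>z. \<psi> (fst (inv_into (ss c W) (\<phi> \<circ> fst) z)) i)"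
    proof (rule smooth_Rn_cong)
      fix z assume "z \<in> \<phi> ` (W \<inter> V' \<inter> V)"
      then obtain y where y: "y \<in> W" "y \<in> V" "z = \<phi> y" by blast
      then show "\<psi> (inv_into V \<phi> z) i = \<psi> (fst (inv_into (ss c W) (\<phi> \<circ> fst) z)) i"
        using inv_into_f_f[OF chart_inj[OF mfd P(1)], of y] inv_SP_chart[OF P(1,2), of y c] by simp
    qed
    finally show ?thesis using dom by simp
  qed
  show "smooth_map_on SP (topspace (mtop SP)) M fst"
    unfolding smooth_map_on_def
  proof (rule conjI[OF openin_topspace conjI], (simp only: subtopology_topspace fst_continuous; fail), intro ballI, clarify)
    fix P \<theta> V' \<psi> i assume b: "(P, \<theta>) \<in> atlas SP" and a: "(V', \<psi>) \<in> atlas M" and i: "i < mdim M"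
    obtain c W V \<phi> where P: "P = ss c W" "\<theta> = \<phi> \<circ> fst" "(V, \<phi>) \<in> atlas M" "W \<subseteq> V" "nd c W"
      using b unfolding atlas_SP by blast
    show "smooth_Rn (mdim SP) (\<theta> ` (topspace (mtop SP) \<inter> P \<inter> fst -` V')) (\<lambda>z. \<psi> (fst (inv_into P \<theta> z)) i)"
      unfolding P(1,2) topspace_SP mdim_SP by (rule sm[OF P(3-5) a i])
  qed
  fix p assume "p \<in> topspace (mtop SP)"
  then have "p \<in> SS" by simp
  then obtain c W where c: "nd c W" "p \<in> ss c W" by (rule SS_cases)
  show "\<exists>U. openin (mtop SP) U \<and> p \<in> U \<and> openin (mtop M) (fst ` U) \<and> inj_on fst U \<and>
      smooth_map_on M (fst ` U) SP (inv_into U fst)"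
    by (intro exI[of _ "ss c W"] conjI ss_open c ss_inj) (simp_all add: fst_ss ndD(2)[OF c(1)] SP_section_smooth[OF c(1)])
qed

end

section \<open>Isomorphisms of coalgebras\<close>

text \<open>The map induced by the inverse on tensors inverts the one induced by \<alpha>; applied
  to the equation saying that \<alpha> preserves the comultiplication, it shows that the inverse
  does so too.\<close>

lemma coalgebra_hom_iso:
  fixes C :: "('r, 'c, 'x) coalgebra_scheme" and D :: "('r, 'd, 'y) coalgebra_scheme"
  assumes C: "rmodule R C" and D: "rmodule R D"
    and cl: "\<And>c. c \<in> carrier C ==> comult C c \<in> carrier (tensor_group R C C)"
    and h: "coalgebra_hom R C D \<alpha>" and bij: "bij_betw \<alpha> (carrier C) (carrier D)"
  shows "coalgebra_iso R C D \<alpha>"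
proof -
  interpret C: rmod R C by unfold_locales (rule C)
  interpret D: rmod R D by unfold_locales (rule D)
  interpret CC: tensor_pair R C C ..
  interpret DD: tensor_pair R D D ..
  let ?b = "inv_into (carrier C) \<alpha>"
  have lin: "rlinear R C D \<alpha>" using h by (simp add: coalgebra_hom_def)
  have ba: "?b (\<alpha> c) = c" if "c \<in> carrier C" for c using bij that by (simp add: bij_betw_inv_into_left)
  have ab: "\<alpha> (?b d) = d" and b: "?b d \<in> carrier C" if "d \<in> carrier D" for d
    using bij that by (simp_all add: bij_betw_inv_into_right bij_betw_imp_surj_on inv_into_into)
  have a: "\<alpha> c \<in> carrier D" if "c \<in> carrier C" for c using rlinear_closed[OF lin that] .
  have linb: "rlinear R D C ?b"
    unfolding rlinear_def
  proof (intro conjI ballI funcsetI b)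
    fix d d' assume d: "d \<in> carrier D" "d' \<in> carrier D"
    show "?b (d \<oplus>\<^bsub>D\<^esub> d') = ?b d \<oplus>\<^bsub>C\<^esub> ?b d'"
      using ba[of "?b d \<oplus>\<^bsub>C\<^esub> ?b d'"] d by (simp add: rlinear_add[OF lin] ab b)
  next
    fix r d assume d: "r \<in> carrier R" "d \<in> carrier D"
    show "?b (r \<odot>\<^bsub>D\<^esub> d) = r \<odot>\<^bsub>C\<^esub> ?b d"
      using ba[of "r \<odot>\<^bsub>C\<^esub> ?b d"] d by (simp add: rlinear_smult[OF lin] ab b)
  qed
  let ?A = "tensor_lift (tensor_group R D D) (\<lambda>(a, b). tens R D D (\<alpha> a) (\<alpha> b))"
  let ?B = "tensor_lift (tensor_group R C C) (\<lambda>(a, b). tens R C C (?b a) (?b b))"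
  have balA: "balanced R C C (tensor_group R D D) (\<lambda>(a, b). tens R D D (\<alpha> a) (\<alpha> b))"
    unfolding balanced_def by (simp add: a rlinear_add[OF lin] rlinear_smult[OF lin] DD.tens_add_left DD.tens_add_right DD.tens_smult)
  have balB: "balanced R D D (tensor_group R C C) (\<lambda>(a, b). tens R C C (?b a) (?b b))"
    unfolding balanced_def by (simp add: b rlinear_add[OF linb] rlinear_smult[OF linb] CC.tens_add_left CC.tens_add_right CC.tens_smult)
  note A = CC.tensor_lift[OF DD.TAB_comm_group balA] and B = DD.tensor_lift[OF CC.TAB_comm_group balB]
  have BA: "?B (?A T) = T" if T: "T \<in> carrier (tensor_group R C C)" for T
  proof -
    have "(?B \<circ> ?A) T = (\<lambda>T. T) T"
    proof (rule CC.tensor_hom_eq[OF _ _ _ _ T])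
      show "?B \<circ> ?A \<in> hom (tensor_group R C C) (tensor_group R C C)" by (rule hom_compose[OF A(1) B(1)])
      show "(\<lambda>T. T) \<in> hom (tensor_group R C C) (tensor_group R C C)" by (simp add: hom_def)
      show "group (tensor_group R C C)" by (rule comm_group.axioms(2)[OF CC.TAB_comm_group])
      show "(?B \<circ> ?A) (tens R C C c c') = tens R C C c c'" if "c \<in> carrier C" "c' \<in> carrier C" for c c'
        using that by (simp add: A(2) B(2) a ba)
    qed
    then show ?thesis by simp
  qed
  have "coalgebra_hom R D C ?b"
    unfolding coalgebra_hom_def
  proof (intro conjI ballI linb)
    fix d assume d: "d \<in> carrier D"
    have "comult D (\<alpha> (?b d)) = ?A (comult C (?b d))" "counit D (\<alpha> (?b d)) = counit C (?b d)"
      using h b[OF d] by (simp_all add: coalgebra_hom_def)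
    then show "?B (comult D d) = comult C (?b d)" "counit C (?b d) = counit D d"
      using d by (simp_all add: ab BA[OF cl[OF b]])
  qed
  then show ?thesis unfolding coalgebra_iso_def using h ba ab by (intro conjI exI[of _ ?b]) simp_all
qed

lemma coalgebra_iso_sym:
  assumes "coalgebra_iso R C D \<alpha>"
  shows "coalgebra_isomorphic R D C"
  using assms unfolding coalgebra_isomorphic_def coalgebra_iso_def by blast

context sheaf
begin

lemma sheaf_coalgebra_rmodule:
  "rmodule RM (sheaf_coalgebra M E \<pi> :: ('m => 'f::real_normed_field, _) coalgebra)"
proof -
  have "rmodule RM A'"
    if r: "rmodule RM (A :: ('m => 'f, 'a) module)" and e: "carrier A' = carrier A" "add A' = add A"
      "zero A' = zero A" "module.smult A' = module.smult A" for A and A' :: "('m => 'f, 'a) coalgebra"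
  proof -
    interpret A: rmod "Cc_ring M" A by unfold_locales (rule r)
    have "abelian_group A'"
      by (rule abelian_groupI) (auto simp: e A.a_ac intro: A.a_inv_closed A.l_neg)
    then show ?thesis using r e by (simp add: rmodule_def)
  qed
  from this[OF Sec_rmodule] show ?thesis by (simp only: sheaf_coalgebra_simps)
qed

lemma sheaf_coalgebra_tensor:
  "tensor_group RM (sheaf_coalgebra M E \<pi>) (sheaf_coalgebra M E \<pi>) = tensor_group RM Sec Sec"
  "tens RM (sheaf_coalgebra M E \<pi>) (sheaf_coalgebra M E \<pi>) = tens RM Sec Sec"
  by (rule tensor_cong; simp only: sheaf_coalgebra_simps)+

lemma section_induct [consumes 3, case_names zero add]:
  fixes s :: "'e => ('e => 'f::real_normed_field) set"
  assumes s: "s \<in> CS" and U: "\<And>i. i \<in> I ==> el (U i)" and cover: "TE \<subseteq> (\<Union>i\<in>I. U i)"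
    and z: "P (\<lambda>e. germ0 E e)"
    and a: "\<And>i f s. i \<in> I ==> f \<in> Cc M (\<pi> ` U i) ==> s \<in> CS ==> P s ==> P (sec_add E (ez (U i) f) s)"
  shows "P s"
proof -
  interpret S: lmod M "Sec :: ('m => 'f, 'e => ('e => 'f) set) module" by (rule Sec_lmod)
  have "s \<in> addspan Sec {ez (U i) f |i f. i \<in> I \<and> f \<in> Cc M (\<pi> ` U i)}" by (rule section_span[OF U cover s])
  then have "s \<in> CS \<and> P s"
  proof induction
    case zero then show ?case using z zero_section by simp
  next
    case (add x s)
    then obtain i f where "x = ez (U i) f" "i \<in> I" "f \<in> Cc M (\<pi> ` U i)" by blast
    then show ?case using add.IH a[of i f s] Cc_sections.add[OF ez_section[OF U], of i f s] by simp
  qed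
  then show ?thesis by simp
qed

end

section \<open>The homomorphism from the sections of the spectral sheaf\<close>

sublocale coalg \<subseteq> SP: sheaf M SP fst
  by unfold_locales (rule SP_sheaf)

context coalg
begin

definition ndI :: "('c \<times> 'm set) set" where "ndI = {(c, W). nd c W}"
abbreviation "ndU \<equiv> (\<lambda>(c, W). ss c W)"
abbreviation "ndP \<equiv> (\<lambda>(c :: 'c, W :: 'm set) f. f \<odot> c)"

lemma ndI_iff [simp]: "(c, W) \<in> ndI \<longleftrightarrow> nd c W"
  by (simp add: ndI_def)

lemma SP_el: "nd c W ==> elementary SP fst (ss c W)"
  by (simp add: elementary_def ss_open ss_inj)

text \<open>If the sections of \<open>c\<close> and \<open>d\<close> share a point over
  \<open>x\<close>, some \<open>g\<close> with germ 1 at \<open>x\<close> satisfies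
  \<open>g \<odot> c = g \<odot> d\<close>. A function \<open>f\<close> supported where the germ of
  \<open>g\<close> is 1 satisfies \<open>f g = f\<close>, so
  \<open>f \<odot> c = f \<odot> d\<close>.\<close>

lemma spectral_family: "sheaf_family M SP fst C ndI ndU ndP"
proof (unfold_locales, goal_cases)
  case (1 i) then show ?case by (cases i) (simp add: SP_el)
next
  case 2
  show ?case
  proof
    fix p assume "p \<in> topspace (mtop SP)"
    then have "p \<in> SS" by simp
    then obtain c W where "nd c W" "p \<in> ss c W" by (rule SS_cases)
    then show "p \<in> (\<Union>i\<in>ndI. ndU i)" by (intro UN_I[of "(c, W)"]) simp_all
  qed
next
  case (3 i f) then show ?case by (cases i) (auto simp: fst_ss intro: ndD(4) Cc_in_ring)
next
  case (4 i f g) then show ?case by (cases i) (auto simp: fst_ss intro!: smult_add_left intro: ndD(4) Cc_in_ring)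
next
  case (5 i f p) then show ?case by (cases i) (simp add: fst_ss smult_smult ndD(4) Cc_in_ring)
next
  case (6 i j e)
  obtain c W d V where ij: "i = (c, W)" "j = (d, V)" by (cases i, cases j)
  with 6 have c: "nd c W" "nd d V" "e \<in> ss c W" "e \<in> ss d V" by simp_all
  have x: "fst e \<in> TM" using ndD(5)[OF c(1)] c(3) by (auto simp: mem_ss)
  have cd: "c \<in> carrier C" "d \<in> carrier C" using c ndD(4) by simp_all
  have "geq (fst e) c d" using c x cd by (simp add: mem_ss cls_eq_iff[symmetric])
  then obtain g where g: "g \<in> Cc M TM" "germ M (fst e) g = germ1 M (fst e)" "g \<odot> c = g \<odot> d" by (rule geqE)
  let ?W = "{y \<in> TM. germ M y g = germ1 M y}"
  have "f \<odot> c = f \<odot> d" if f: "f \<in> Cc M ?W" for f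
  proof -
    have "(\<lambda>y. f y * g y) = f"
    proof
      fix y show "f y * g y = f y"
        using Cc_outside[OF f, of y] germ_value[of y M g "\<lambda>_. 1"] by (cases "y \<in> ?W") auto
    qed
    then have "f \<odot> a = f \<odot> (g \<odot> a)" if "a \<in> carrier C" for a
      using smult_smult[OF Cc_in_ring[OF f] g(1) that] by simp
    then show ?thesis using cd g(3) by simp
  qed
  then show ?case using ij openin_germ_eq x g(2) by (intro exI[of _ ?W]) simp
qed

sublocale spf: sheaf_family M SP fst C ndI ndU ndP
  by (rule spectral_family)

end

context coalg
begin

lemma spectral_sum:
  "s \<in> addspan SP.Sec {SP.ez (ndU i) f |i f. i \<in> ndI \<and> f \<in> Cc M (fst ` ndU i)} \<longleftrightarrow>
    (\<exists>(k::nat) c W f. (\<forall>i<k. c i \<in> WG \<and> openin (mtop M) (W i) \<and> normalized_on M C (c i) (W i) \<and> f i \<in> Cc M (W i)) \<and>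
      s = finsum SP.Sec (\<lambda>i. SP.ez (ss (c i) (W i)) (f i)) {..<k})"
  (is "_ \<longleftrightarrow> ?R")
proof -
  let ?P = "\<lambda>(i, f). i \<in> ndI \<and> f \<in> Cc M (fst ` ndU i)"
  have e: "{SP.ez (ndU i) f |i f. i \<in> ndI \<and> f \<in> Cc M (fst ` ndU i)} = {(\<lambda>(i, f). SP.ez (ndU i) f) y |y. ?P y}" by auto
  have "s \<in> addspan SP.Sec {SP.ez (ndU i) f |i f. i \<in> ndI \<and> f \<in> Cc M (fst ` ndU i)} \<longleftrightarrow>
    (\<exists>(k::nat) y. (\<forall>i<k. ?P (y i)) \<and> s = finsum SP.Sec (\<lambda>i. (\<lambda>(i, f). SP.ez (ndU i) f) (y i)) {..<k})" (is "_ \<longleftrightarrow> ?L")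
    unfolding e by (rule abelian_group.addspan_iff[OF SP.Sec_abelian_group])
      (auto simp: fst_ss intro!: SP.ez_section SP_el)
  also have "?L \<longleftrightarrow> ?R"
  proof
    assume ?L
    then obtain k :: nat and y where y: "\<forall>i<k. ?P (y i)"
      and s: "s = finsum SP.Sec (\<lambda>i. (\<lambda>(i, f). SP.ez (ndU i) f) (y i)) {..<k}" by (elim exE conjE)
    show ?R
      by (rule exI[of _ k], rule exI[of _ "\<lambda>i. fst (fst (y i))"], rule exI[of _ "\<lambda>i. snd (fst (y i))"],
          rule exI[of _ "\<lambda>i. snd (y i)"], intro conjI)
        (use y s in \<open>auto simp: case_prod_beta fst_ss nd_def ndI_def\<close>)
  next
    assume ?R
    then obtain k :: nat and c W f where
      c: "\<forall>i<k. c i \<in> WG \<and> openin (mtop M) (W i) \<and> normalized_on M C (c i) (W i) \<and> f i \<in> Cc M (W i)"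
      and s: "s = finsum SP.Sec (\<lambda>i. SP.ez (ss (c i) (W i)) (f i)) {..<k}" by (elim exE conjE)
    show ?L
      by (rule exI[of _ k], rule exI[of _ "\<lambda>i. ((c i, W i), f i)"], intro conjI)
        (use c s in \<open>auto simp: fst_ss nd_def\<close>)
  qed
  finally show ?thesis .
qed

text \<open>The definite description in \<open>Psi\<close> denotes the value of the glued map
  \<open>F\<close>, because linearity gives this value for every presentation. Membership in the
  graph is kept for use with \<open>normal_form\<close>.\<close>

lemma Psi_linear: "rlinear RM SP.Sec C (Psi M C)"
  and Psi_ez: "nd c W ==> f \<in> Cc M W ==> Psi M C (SP.ez (ss c W) f) = f \<odot> c"
  and Psi_graph: "s \<in> Cc_sections SP ==> (s, Psi M C s) \<in> lin_graph SP.Sec C spf.gens"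
proof -
  obtain F where F: "rlinear RM SP.Sec C F"
    "\<And>i f. i \<in> ndI ==> f \<in> Cc M (fst ` ndU i) ==> F (SP.ez (ndU i) f) = ndP i f"
    "\<And>s. s \<in> Cc_sections SP ==> (s, F s) \<in> lin_graph SP.Sec C spf.gens"
    by (rule spf.family_extension) (rule that, assumption, simp, assumption)
  have Fez: "F (SP.ez (ss c W) f) = f \<odot> c" if "nd c W" "f \<in> Cc M W" for c W f
    using F(2)[of "(c, W)" f] that by (simp add: fst_ss)
  have ezS: "SP.ez (ss c W) f \<in> Cc_sections SP" if "nd c W" "f \<in> Cc M W" for c W and f :: "'m => 'f"
    by (rule SP.ez_section[OF SP_el]) (use that in \<open>simp_all add: fst_ss\<close>)
  have sum: "finsum C (\<lambda>i. f i \<odot> c i) {..<k} = F (finsum SP.Sec (\<lambda>i. SP.ez (ss (c i) (W i)) (f i)) {..<k})"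
    if a: "\<forall>i<k. c i \<in> WG \<and> openin (mtop M) (W i) \<and> normalized_on M C (c i) (W i) \<and> f i \<in> Cc M (W i)"
    for k :: nat and c W f
  proof -
    have n: "nd (c i) (W i)" "f i \<in> Cc M (W i)" if "i < k" for i using a that by (simp_all add: nd_def)
    have "finsum C (\<lambda>i. f i \<odot> c i) {..<k} = finsum C (\<lambda>i. F (SP.ez (ss (c i) (W i)) (f i))) {..<k}"
      by (rule finsum_cong') (use n in \<open>auto simp: Pi_iff Fez intro!: smult_closed ndD(4)[OF n(1)] Cc_in_ring[OF n(2)]\<close>)
    also have "\<dots> = F (finsum SP.Sec (\<lambda>i. SP.ez (ss (c i) (W i)) (f i)) {..<k})"
      by (rule rlinear_finsum[OF SP.Sec_abelian_group abelian_group_axioms F(1), symmetric])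
        (use n ezS in simp)
    finally show ?thesis .
  qed
  have eq: "Psi M C s = F s" if s: "s \<in> Cc_sections SP" for s
    unfolding Psi_def Let_def SP.ez_def[symmetric]
  proof (rule the_equality)
    have "s \<in> addspan SP.Sec {SP.ez (ndU i) f |i f. i \<in> ndI \<and> f \<in> Cc M (fst ` ndU i)}"
      by (rule SP.section_span[OF spf.elU spf.cover s])
    then obtain k :: nat and c W f where
      c: "\<forall>i<k. c i \<in> WG \<and> openin (mtop M) (W i) \<and> normalized_on M C (c i) (W i) \<and> f i \<in> Cc M (W i)"
      and k: "s = finsum SP.Sec (\<lambda>i. SP.ez (ss (c i) (W i)) (f i)) {..<k}"
      unfolding spectral_sum by (elim exE conjE)
    show "\<exists>(k::nat) c W f. (\<forall>i<k. c i \<in> WG \<and> openin (mtop M) (W i) \<and> normalized_on M C (c i) (W i) \<and> f i \<in> Cc M (W i)) \<and>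
        s = finsum SP.Sec (\<lambda>i. SP.ez (ss (c i) (W i)) (f i)) {..<k} \<and> F s = finsum C (\<lambda>i. f i \<odot> c i) {..<k}"
      by (intro exI[of _ k] exI[of _ c] exI[of _ W] exI[of _ f] conjI c k) (simp only: k sum[OF c])
    fix T assume "\<exists>(k::nat) c W f. (\<forall>i<k. c i \<in> WG \<and> openin (mtop M) (W i) \<and> normalized_on M C (c i) (W i) \<and> f i \<in> Cc M (W i)) \<and>
        s = finsum SP.Sec (\<lambda>i. SP.ez (ss (c i) (W i)) (f i)) {..<k} \<and> T = finsum C (\<lambda>i. f i \<odot> c i) {..<k}"
    then show "T = F s"
    proof (elim exE conjE)
      fix k :: nat and c W f
      assume a: "\<forall>i<k. c i \<in> WG \<and> openin (mtop M) (W i) \<and> normalized_on M C (c i) (W i) \<and> f i \<in> Cc M (W i)"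
        and s': "s = finsum SP.Sec (\<lambda>i. SP.ez (ss (c i) (W i)) (f i)) {..<k}" and T: "T = finsum C (\<lambda>i. f i \<odot> c i) {..<k}"
      show "T = F s" unfolding T s' by (rule sum[OF a])
    qed
  qed
  interpret S: lmod M "SP.Sec :: ('m => 'f, _) module" by (rule SP.Sec_lmod)
  show "rlinear RM SP.Sec C (Psi M C)"
    using F(1) eq unfolding rlinear_def
    by (simp add: Cc_sections.add S.smult_closed'[simplified SP.Sec_simps] Pi_iff)
  show "Psi M C (SP.ez (ss c W) f) = f \<odot> c" if "nd c W" "f \<in> Cc M W"
    using eq[OF ezS[OF that]] Fez[OF that] by simp
  show "(s, Psi M C s) \<in> lin_graph SP.Sec C spf.gens" if "s \<in> Cc_sections SP"
    using F(3)[OF that] eq[OF that] by simp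
qed

end

section \<open>Free generation\<close>

context rmod
begin

text \<open>Translates coefficients on a finite set \<open>F\<close> into the functions on
  \<open>B\<close> that occur in \<open>freely_generated\<close>: zero on \<open>B - F\<close> and
  undefined off \<open>B\<close>.\<close>

lemma finsum_restrict:
  assumes F: "finite F" "F \<subseteq> B" and B: "B \<subseteq> carrier A" and r: "r \<in> F \<rightarrow> carrier R"
    and z: "\<zero>\<^bsub>R\<^esub> \<in> carrier R"
  defines "q \<equiv> \<lambda>b\<in>B. if b \<in> F then r b else \<zero>\<^bsub>R\<^esub>"
  shows "q \<in> B \<rightarrow>\<^sub>E carrier R" "finite {b \<in> B. q b \<noteq> \<zero>\<^bsub>R\<^esub>}"
    and "(\<And>b. b \<in> B ==> \<zero>\<^bsub>R\<^esub> \<odot> b = \<zero>) ==> finsum A (\<lambda>b. q b \<odot> b) {b \<in> B. q b \<noteq> \<zero>\<^bsub>R\<^esub>} = finsum A (\<lambda>b. r b \<odot> b) F"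
proof -
  show "q \<in> B \<rightarrow>\<^sub>E carrier R" using r z by (auto simp: q_def)
  have sub: "{b \<in> B. q b \<noteq> \<zero>\<^bsub>R\<^esub>} \<subseteq> F" by (auto simp: q_def split: if_splits)
  then show "finite {b \<in> B. q b \<noteq> \<zero>\<^bsub>R\<^esub>}" using F finite_subset by blast
  assume zb: "\<And>b. b \<in> B ==> \<zero>\<^bsub>R\<^esub> \<odot> b = \<zero>"
  show "finsum A (\<lambda>b. q b \<odot> b) {b \<in> B. q b \<noteq> \<zero>\<^bsub>R\<^esub>} = finsum A (\<lambda>b. r b \<odot> b) F"
    by (rule add.finprod_mono_neutral_cong_left[OF F(1) sub])
      (use F B r zb in \<open>auto simp: q_def Pi_iff subset_iff\<close>)
qed

text \<open>A new summand either brings a new element \<open>b0\<close> or is merged into its old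
  coefficient, so that the elements of \<open>F\<close> remain distinct.\<close>

lemma addspan_finite_sum:
  assumes B: "B \<subseteq> carrier A" and add: "\<And>r s. r \<in> carrier R ==> s \<in> carrier R ==> r \<oplus>\<^bsub>R\<^esub> s \<in> carrier R"
    and a: "a \<in> addspan A {r \<odot> b |r b. r \<in> carrier R \<and> b \<in> B}"
  shows "\<exists>F r. finite F \<and> F \<subseteq> B \<and> r \<in> F \<rightarrow> carrier R \<and> a = finsum A (\<lambda>b. r b \<odot> b) F"
  using a
proof induction
  case zero
  show ?case by (rule exI[of _ "{}"]) simp
next
  case (add x s)
  then obtain r0 b0 where x: "x = r0 \<odot> b0" "r0 \<in> carrier R" "b0 \<in> B" by blast
  from add.IH obtain F r where F: "finite F" "F \<subseteq> B" "r \<in> F \<rightarrow> carrier R" "s = finsum A (\<lambda>b. r b \<odot> b) F"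
    by (elim exE conjE)
  have b0: "b0 \<in> carrier A" using x B by blast
  define r' where "r' = r(b0 := if b0 \<in> F then r0 \<oplus>\<^bsub>R\<^esub> r b0 else r0)"
  have r': "r' \<in> insert b0 F \<rightarrow> carrier R" using F(3) x(2) by (auto simp: r'_def Pi_iff intro: assms(2))
  have fin: "finite (F - {b0})" "b0 \<notin> F - {b0}" using F(1) by simp_all
  have P: "(\<lambda>b. r b \<odot> b) \<in> (F - {b0}) \<rightarrow> carrier A" "(\<lambda>b. r' b \<odot> b) \<in> (F - {b0}) \<rightarrow> carrier A"
    using F(2,3) B r' by (auto simp: Pi_iff subset_iff)
  have same: "finsum A (\<lambda>b. r' b \<odot> b) (F - {b0}) = finsum A (\<lambda>b. r b \<odot> b) (F - {b0})"
    by (rule finsum_cong') (use P in \<open>auto simp: r'_def\<close>)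
  have "insert b0 (F - {b0}) = insert b0 F" by blast
  then have i': "finsum A (\<lambda>b. r' b \<odot> b) (insert b0 F) = r' b0 \<odot> b0 \<oplus> finsum A (\<lambda>b. r b \<odot> b) (F - {b0})"
    using finsum_insert[OF fin P(2)] r' b0 same by simp
  have c: "finsum A (\<lambda>b. r b \<odot> b) (F - {b0}) \<in> carrier A" using P(1) by (rule finsum_closed)
  have "x \<oplus> s = finsum A (\<lambda>b. r' b \<odot> b) (insert b0 F)"
  proof (cases "b0 \<in> F")
    case True
    then have "F = insert b0 (F - {b0})" by blast
    then have "s = r b0 \<odot> b0 \<oplus> finsum A (\<lambda>b. r b \<odot> b) (F - {b0})"
      using finsum_insert[OF fin P(1)] F(3,4) b0 True by (simp add: Pi_iff)
    then show ?thesis using True F(3) x b0 c i' by (simp add: r'_def smult_l_distr a_assoc Pi_iff)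
  next
    case False
    then show ?thesis using F(4) x i' by (simp add: r'_def)
  qed
  then show ?case using F(1,2) x(3) r' by (intro exI[of _ "insert b0 F"] exI[of _ r']) simp
qed

text \<open>Existence of coefficients becomes a span condition, and their uniqueness is tested on
  finite sets: two coefficient functions are compared on the union of their supports.\<close>

lemma freely_generated_iff:
  assumes B: "B \<subseteq> carrier A" and add: "\<And>r s. r \<in> carrier R ==> s \<in> carrier R ==> r \<oplus>\<^bsub>R\<^esub> s \<in> carrier R"
    and z: "\<zero>\<^bsub>R\<^esub> \<in> carrier R" and zb: "\<And>b. b \<in> B ==> \<zero>\<^bsub>R\<^esub> \<odot> b = \<zero>"
  shows "freely_generated R A B \<longleftrightarrow>
    carrier A \<subseteq> addspan A {r \<odot> b |r b. r \<in> carrier R \<and> b \<in> B} \<and>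
    (\<forall>F r s. finite F --> F \<subseteq> B --> r \<in> F \<rightarrow> carrier R --> s \<in> F \<rightarrow> carrier R -->
      finsum A (\<lambda>b. r b \<odot> b) F = finsum A (\<lambda>b. s b \<odot> b) F --> (\<forall>b\<in>F. r b = s b))" (is "_ \<longleftrightarrow> ?S \<and> ?I")
proof
  let ?P = "\<lambda>a r. r \<in> B \<rightarrow>\<^sub>E carrier R \<and> finite {b \<in> B. r b \<noteq> \<zero>\<^bsub>R\<^esub>} \<and>
        a = finsum A (\<lambda>b. r b \<odot> b) {b \<in> B. r b \<noteq> \<zero>\<^bsub>R\<^esub>}"
  have gen: "{r \<odot> b |r b. r \<in> carrier R \<and> b \<in> B} \<subseteq> carrier A" using B by auto
  {
    assume L: "freely_generated R A B"
    have ex: "\<exists>!r. ?P a r" if "a \<in> carrier A" for a using L that by (simp add: freely_generated_def)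
    have ?S
    proof
      fix a assume "a \<in> carrier A"
      from ex[OF this] obtain r where r: "r \<in> B \<rightarrow>\<^sub>E carrier R" "finite {b \<in> B. r b \<noteq> \<zero>\<^bsub>R\<^esub>}"
        "a = finsum A (\<lambda>b. r b \<odot> b) {b \<in> B. r b \<noteq> \<zero>\<^bsub>R\<^esub>}" by (elim ex1E conjE)
      have "finsum A (\<lambda>b. r b \<odot> b) F \<in> addspan A {r \<odot> b |r b. r \<in> carrier R \<and> b \<in> B}"
        if "finite F" "F \<subseteq> B" for F using that
      proof (induction F)
        case empty show ?case by (simp add: addspan.zero)
      next
        case (insert b F)
        have "(\<lambda>b. r b \<odot> b) \<in> F \<rightarrow> carrier A" "r b \<odot> b \<in> carrier A" "r b \<in> carrier R" "b \<in> B"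
          using insert.prems B r(1) by (auto simp: Pi_iff PiE_iff)
        then show ?case using insert by (auto intro!: addspan.add)
      qed
      then show "a \<in> addspan A {r \<odot> b |r b. r \<in> carrier R \<and> b \<in> B}" using r(2,3) by simp
    qed
    moreover have ?I
    proof (intro allI impI ballI)
      fix F r s b assume F: "finite F" "F \<subseteq> B" and r: "r \<in> F \<rightarrow> carrier R" and s: "s \<in> F \<rightarrow> carrier R"
        and eq: "finsum A (\<lambda>b. r b \<odot> b) F = finsum A (\<lambda>b. s b \<odot> b) F" and b: "b \<in> F"
      let ?q = "\<lambda>r. \<lambda>b\<in>B. if b \<in> F then r b else \<zero>\<^bsub>R\<^esub>"
      note q = finsum_restrict[OF F B r z] and q' = finsum_restrict[OF F B s z]
      have "finsum A (\<lambda>b. r b \<odot> b) F \<in> carrier A" using r F B by (auto intro!: finsum_closed simp: Pi_iff subset_iff)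
      note u = ex[OF this]
      have "?P (finsum A (\<lambda>b. r b \<odot> b) F) (?q r)" using q(1,2) q(3)[OF zb] by simp
      moreover have "?P (finsum A (\<lambda>b. r b \<odot> b) F) (?q s)" using q'(1,2) q'(3)[OF zb] eq by simp
      ultimately have "?q r = ?q s" using u by (blast elim: ex1E)
      then have "?q r b = ?q s b" by simp
      then show "r b = s b" using b F by (simp add: subset_iff)
    qed
    ultimately show "?S \<and> ?I" by blast
  }
  assume R: "?S \<and> ?I"
  show "freely_generated R A B"
    unfolding freely_generated_def
  proof (intro conjI B ballI)
    fix a assume "a \<in> carrier A"
    then have "a \<in> addspan A {r \<odot> b |r b. r \<in> carrier R \<and> b \<in> B}" using R by blast
    then obtain F r where F: "finite F" "F \<subseteq> B" "r \<in> F \<rightarrow> carrier R" and a: "a = finsum A (\<lambda>b. r b \<odot> b) F"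
      using addspan_finite_sum[OF B add] by blast
    note q = finsum_restrict[OF F(1,2) B F(3) z]
    show "\<exists>!r. ?P a r"
    proof (rule ex_ex1I)
      show "\<exists>r. ?P a r" using q(1,2) q(3)[OF zb] a by (intro exI[of _ "\<lambda>b\<in>B. if b \<in> F then r b else \<zero>\<^bsub>R\<^esub>"]) simp
      fix r s assume r: "?P a r" and s: "?P a s"
      let ?F = "{b \<in> B. r b \<noteq> \<zero>\<^bsub>R\<^esub>} \<union> {b \<in> B. s b \<noteq> \<zero>\<^bsub>R\<^esub>}"
      have F: "finite ?F" "?F \<subseteq> B" using r s by auto
      have rF: "r \<in> ?F \<rightarrow> carrier R" "s \<in> ?F \<rightarrow> carrier R" using r s by auto
      have e: "finsum A (\<lambda>b. q b \<odot> b) {b \<in> B. q b \<noteq> \<zero>\<^bsub>R\<^esub>} = finsum A (\<lambda>b. q b \<odot> b) ?F"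
        if "q \<in> ?F \<rightarrow> carrier R" "{b \<in> B. q b \<noteq> \<zero>\<^bsub>R\<^esub>} \<subseteq> ?F" for q
        by (rule add.finprod_mono_neutral_cong_left[OF F(1) that(2)])
          (use F(2) B that(1) zb in \<open>auto simp: Pi_iff subset_iff\<close>)
      have "finsum A (\<lambda>b. r b \<odot> b) ?F = a" using r e[OF rF(1)] by simp
      moreover have "finsum A (\<lambda>b. s b \<odot> b) ?F = a" using s e[OF rF(2)] by simp
      ultimately have fs: "finsum A (\<lambda>b. r b \<odot> b) ?F = finsum A (\<lambda>b. s b \<odot> b) ?F" by (rule trans[OF _ sym])
      have "r b = s b" if "b \<in> ?F" for b by (rule conjunct2[OF R, rule_format, OF F rF fs that])
      then have "r b = s b" if "b \<in> B" for b using that by (cases "b \<in> ?F") auto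
      then show "r = s" using r s by (intro PiE_ext[of r B "\<lambda>_. carrier R"]) auto
    qed
  qed
qed

end

section \<open>Normal generation and independence\<close>

context coalg
begin

text \<open>A relation that holds only near \<open>x\<close> becomes a genuine relation after
  multiplication by some \<open>g\<close> with germ 1, and this does not affect the germs of the
  coefficients. Distinct classes exclude the second alternative in the definition of
  independence.\<close>

lemma normal_indep_finite:
  assumes ind: "normally_lin_indep M C WG" and x: "x \<in> TM" and T: "finite T"
    and c: "\<And>t. t \<in> T ==> c t \<in> WG" "\<And>t. t \<in> T ==> normalized_at M C (c t) x"
    and f: "\<And>t. t \<in> T ==> f t \<in> Cc M TM"
    and z: "geq x (finsum C (\<lambda>t. f t \<odot> c t) T) \<zero>"
    and dist: "\<And>s t. s \<in> T ==> t \<in> T ==> s \<noteq> t ==> \<not> geq x (c s) (c t)"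
    and t: "t \<in> T"
  shows "germ M x (f t) = germ0 M x"
proof -
  obtain g where g: "g \<in> Cc M TM" "germ M x g = germ1 M x" "g \<odot> finsum C (\<lambda>t. f t \<odot> c t) T = g \<odot> \<zero>"
    using z by (rule geqE)
  obtain h where h: "bij_betw h {..<card T} T"
    using ex_bij_betw_nat_finite[OF T] by (auto simp: lessThan_atLeast0)
  have hT: "h i \<in> T" if "i < card T" for i using bij_betwE[OF h] that by simp
  let ?f = "\<lambda>i y. g y * f (h i) y"
  have cC: "c t \<in> carrier C" if "t \<in> T" for t using c(1)[OF that] by (rule WG_carrier)
  have "finsum C (\<lambda>i. ?f i \<odot> c (h i)) {..<card T} = finsum C (\<lambda>i. g \<odot> (f (h i) \<odot> c (h i))) {..<card T}"
    by (rule finsum_cong') (auto simp: Pi_iff smult_smult g(1) f hT cC)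
  also have "\<dots> = finsum C (\<lambda>t. g \<odot> (f t \<odot> c t)) (h ` {..<card T})"
    by (rule finsum_reindex[symmetric]) (use h hT in \<open>auto simp: bij_betw_def g(1) f cC\<close>)
  also have "h ` {..<card T} = T" using h by (simp add: bij_betw_def)
  also have "finsum C (\<lambda>t. g \<odot> (f t \<odot> c t)) T = g \<odot> finsum C (\<lambda>t. f t \<odot> c t) T"
    by (rule smult_finsum[symmetric]) (simp_all add: g(1) f cC)
  also have "\<dots> = \<zero>" using g by simp
  finally have sum: "finsum C (\<lambda>i. ?f i \<odot> c (h i)) {..<card T} = \<zero>" .
  have pre: "\<forall>i<card T. c (h i) \<in> WG \<and> normalized_at M C (c (h i)) x \<and> ?f i \<in> carrier RM"
    using c hT by (simp add: Cc_mult[OF g(1) f])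
  note alt = mp[OF spec[OF spec[OF spec[OF bspec[OF ind[unfolded normally_lin_indep_def] x], of "card T"],
    of "\<lambda>i. c (h i)"], of ?f] conjI[OF pre sum]]
  have "\<not> (\<exists>i<card T. \<exists>j<card T. i \<noteq> j \<and> (\<exists>g \<in> carrier RM.
         germ M x g = germ1 M x \<and> g \<odot> c (h i) = g \<odot> c (h j)))"
  proof (intro notI, elim exE conjE bexE)
    fix i j g assume ij: "i < card T" "j < card T" "i \<noteq> j" and "g \<in> carrier RM"
      "germ M x g = germ1 M x" "g \<odot> c (h i) = g \<odot> c (h j)"
    then have "geq x (c (h i)) (c (h j))" by (intro geqI[of g]) simp_all
    moreover have "h i \<noteq> h j" using h ij by (auto simp: bij_betw_def inj_on_def)
    ultimately show False using dist ij hT by blast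
  qed
  with alt have a: "germ M x (?f i) = germ0 M x" if "i < card T" for i using that by blast
  obtain i where "i < card T" "t = h i" using t h by (auto simp: bij_betw_def)
  then show ?thesis using a[of i] germ_one_mult[OF g(2), of "f (h i)"] by simp
qed

text \<open>By \<open>normal_form\<close>, \<open>Psi\<close> of \<open>s\<close> is near
  \<open>x\<close> a sum over points of the fibre, whose coefficients have the coordinates of
  \<open>s\<close> as germs. Distinct points of the fibre are distinct classes of weakly grouplike
  elements, so independence makes each coordinate vanish.\<close>

lemma Psi_inj:
  assumes ind: "normally_lin_indep M C WG" and s: "s \<in> Cc_sections SP" and z: "Psi M C s = \<zero>"
  shows "s = (\<lambda>e. germ0 SP e)"
proof (rule SP.loc_inj[OF s])
  fix e assume e: "e \<in> topspace (mtop SP)"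
  define x where "x = fst e"
  have x: "x \<in> TM" using SP.proj_in[OF e] by (simp add: x_def)
  obtain T where T: "finite T" "T \<subseteq> spf.fib x" "\<forall>e\<in>spf.fib x - T. SP.loc e s = germ0 M x"
    and nf: "\<forall>T'. finite T' --> T \<subseteq> T' --> T' \<subseteq> spf.fib x -->
      geq x (Psi M C s) (finsum C (\<lambda>e. ndP (spf.idx e) (spf.rep e s)) T')"
    using spf.normal_form[OF Psi_graph[OF s] x] by (elim exE conjE)
  have ef: "e \<in> spf.fib x" using e by (simp add: spf.fib_def x_def)
  show "SP.loc e s = germ0 M (fst e)"
  proof (cases "e \<in> T")
    case False
    then show ?thesis using T(3) ef by (simp add: x_def)
  next
    case True
    \<comment> \<open>The cover is indexed by pairs \<open>(c, W)\<close>, and the term at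
      \<open>e\<close> is the coefficient \<open>?f e\<close> times the first component.\<close>
    let ?c = "\<lambda>e. fst (spf.idx e)" and ?f = "\<lambda>e. spf.rep e s"
    have t: "nd (?c t) (snd (spf.idx t))" "t \<in> ss (?c t) (snd (spf.idx t))" "?f t \<in> Cc M TM"
      "germ M x (?f t) = SP.loc t s" "fst t = x" if "t \<in> T" for t
    proof -
      have tE: "t \<in> topspace (mtop SP)" "fst t = x" using that T(2) by (auto simp: spf.fib_def)
      show "nd (?c t) (snd (spf.idx t))" "t \<in> ss (?c t) (snd (spf.idx t))"
        using spf.idx[OF tE(1)] by (simp_all add: ndI_def case_prod_beta)
      show "?f t \<in> Cc M TM" "germ M x (?f t) = SP.loc t s" "fst t = x"
        using spf.rep[OF tE(1) s] tE(2) Cc_in_ring by auto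
    qed
    have "germ M x (?f e) = germ0 M x"
    proof (rule normal_indep_finite[OF ind x T(1) _ _ _ _ _ True, where c = ?c])
      show "geq x (finsum C (\<lambda>t. ?f t \<odot> ?c t) T) \<zero>"
        using nf[rule_format, OF T(1) order_refl T(2)] z by (simp add: case_prod_beta geq_sym)
      fix t t' assume tt: "t \<in> T" "t' \<in> T" "t \<noteq> t'"
      note t1 = t[OF tt(1)] and t2 = t[OF tt(2)]
      have "snd t = cls M C x (?c t)" "snd t' = cls M C x (?c t')"
        using t1(2,5) t2(2,5) by (simp_all add: mem_ss)
      moreover have "snd t \<noteq> snd t'" using t1(5) t2(5) tt(3) by (auto simp: prod_eq_iff)
      ultimately show "\<not> geq x (?c t) (?c t')"
        using cls_eq_iff[OF x ndD(4)[OF t1(1)] ndD(4)[OF t2(1)]] by simp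
    next
      fix t assume tT: "t \<in> T"
      show "?c t \<in> WG" "?f t \<in> Cc M TM" using t[OF tT] ndD(1) by simp_all
      have "x \<in> snd (spf.idx t)" using t(2,5)[OF tT] by (simp add: mem_ss)
      then show "normalized_at M C (?c t) x" by (rule ndD(6)[OF t(1)[OF tT]])
    qed
    then show ?thesis using t(4)[OF True] by (simp add: x_def)
  qed
qed

text \<open>It suffices to consider a generator with coefficient \<open>f\<close> over
  \<open>ss c W\<close>: its comultiplication is sent to fc \<otimes> \<eta>c = \<eta>fc \<otimes> c
  = fc \<otimes> c, which is \<Delta>(fc) by \<open>WG_comult_smult\<close>.\<close>

lemma Psi_hom: "coalgebra_hom RM (sheaf_coalgebra M SP fst) C (Psi M C)"
proof -
  interpret S: lmod M "SP.Sec :: ('m => 'f, _) module" by (rule SP.Sec_lmod)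
  let ?h = "\<lambda>(a, b). tn (Psi M C a) (Psi M C b)"
  let ?L = "tensor_lift AA.TAB ?h"
  note lin = rlinear_closed[OF Psi_linear, simplified SP.Sec_simps] rlinear_add[OF Psi_linear, simplified SP.Sec_simps]
    rlinear_smult[OF Psi_linear, simplified SP.Sec_simps carrier_Cc_ring]
  have bal: "balanced RM SP.Sec SP.Sec AA.TAB ?h"
    unfolding balanced_def by (simp add: lin AA.tens_add_left AA.tens_add_right AA.tens_smult)
  note L = S.AA.tensor_lift[OF AA.TAB_comm_group bal]
  have L1: "?L \<one>\<^bsub>S.AA.TAB\<^esub> = \<one>\<^bsub>AA.TAB\<^esub>"
    by (rule hom_one[OF L(1)]) (rule comm_group.axioms(2)[OF S.AA.TAB_comm_group], rule comm_group.axioms(2)[OF AA.TAB_comm_group])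
  have cz: "sheaf_comult M SP fst (\<lambda>e. germ SP e (\<lambda>_. 0 :: 'f)) = \<one>\<^bsub>S.AA.TAB\<^esub>"
    using rlinear_zero[OF SP.Sec_abelian_group S.AA.tensor_abelian_group SP.sheaf_comult(1)] by simp
  have ez: "sheaf_counit M SP fst (\<lambda>e. germ SP e (\<lambda>_. 0 :: 'f)) = (\<lambda>_. 0)"
  proof -
    interpret R: lmod M "Reg :: ('m => 'f, 'm => 'f) module" by (rule Reg_lmod)
    show ?thesis using rlinear_zero[OF SP.Sec_abelian_group R.abelian_group_axioms SP.sheaf_counit(1)] by simp
  qed
  have Pz: "Psi M C (\<lambda>e. germ0 SP e) = \<zero>"
    using rlinear_zero[OF SP.Sec_abelian_group abelian_group_axioms Psi_linear] by simp
  have Cz: "comult C \<zero> = \<one>\<^bsub>AA.TAB\<^esub>" "counit C \<zero> = (\<lambda>_. 0)"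
    using comult_smult[of "\<lambda>_. 0" \<zero>] rlinear_zero[OF abelian_group_axioms AA.tensor_abelian_group comult_linear]
      counit_smult[of "\<lambda>_. 0" \<zero>] by simp_all
  have ma: "sheaf_comult M SP fst (sec_add SP s t) = sheaf_comult M SP fst s \<otimes>\<^bsub>S.AA.TAB\<^esub> sheaf_comult M SP fst t"
    "sheaf_counit M SP fst (sec_add SP s t) = (\<lambda>y. sheaf_counit M SP fst s y + sheaf_counit M SP fst t y)"
    "sheaf_comult M SP fst s \<in> carrier S.AA.TAB"
    if "s \<in> Cc_sections SP" "t \<in> Cc_sections SP" for s t :: "'m \<times> 'c set => ('m \<times> 'c set => 'f) set"
    using rlinear_add[OF SP.sheaf_comult(1), of s t] rlinear_add[OF SP.sheaf_counit(1), of s t]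
      rlinear_closed[OF SP.sheaf_comult(1), of s] that by simp_all
  have main: "?L (sheaf_comult M SP fst s) = comult C (Psi M C s) \<and> counit C (Psi M C s) = sheaf_counit M SP fst s"
    (is "?Q s") if "s \<in> Cc_sections SP" for s
  proof (rule SP.section_induct[where P = ?Q, OF that spf.elU spf.cover])
    show "?Q (\<lambda>e. germ0 SP e)" by (simp only: cz ez Pz Cz L1)
  next
    fix i :: "'c \<times> 'm set" and f :: "'m => 'f" and s
    assume add: "i \<in> ndI" "f \<in> Cc M (fst ` ndU i)" "s \<in> Cc_sections SP" "?Q s"
    obtain c W where i: "i = (c, W)" by (cases i)
    have n: "nd c W" and f: "f \<in> Cc M W" using add(1,2) i by (simp_all add: fst_ss)
    have cC: "c \<in> carrier C" using n by (rule ndD)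
    obtain \<eta> :: "'m => 'f" where h: "\<eta> \<in> Cc M W" "(\<lambda>y. \<eta> y * f y) = f" using SP.Cc_unit[OF f] .
    have S: "SP.ez (ss c W) f \<in> Cc_sections SP" "SP.ez (ss c W) \<eta> \<in> Cc_sections SP"
      by (rule SP.ez_section[OF SP_el[OF n]], simp add: fst_ss f h)+
    have "sheaf_comult M SP fst (SP.ez (ss c W) f) = SP.ts (SP.ez (ss c W) f) (SP.ez (ss c W) \<eta>)"
      by (rule SP.sheaf_comult(2)[OF SP_el[OF n]]) (simp_all add: fst_ss f h)
    then have "?L (sheaf_comult M SP fst (SP.ez (ss c W) f)) = tn (f \<odot> c) (\<eta> \<odot> c)"
      using S by (simp add: L(2) Psi_ez[OF n] f h)
    also have "\<dots> = tn (\<eta> \<odot> (f \<odot> c)) c"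
      using AA.tens_smult[of \<eta> "f \<odot> c" c] Cc_in_ring[OF f] Cc_in_ring[OF h(1)] cC by simp
    also have "\<eta> \<odot> (f \<odot> c) = f \<odot> c"
      using smult_smult[OF Cc_in_ring[OF h(1)] Cc_in_ring[OF f] cC] h(2) by simp
    also have "tn (f \<odot> c) c = comult C (f \<odot> c)"
      by (rule WG_comult_smult[OF ndD(1)[OF n] ndD(3)[OF n] f, symmetric])
    finally have g1: "?L (sheaf_comult M SP fst (SP.ez (ss c W) f)) = comult C (f \<odot> c)" .
    have g2: "counit C (f \<odot> c) = f"
      using counit_smult[OF Cc_in_ring[OF f] cC] normalized_mult[OF ndD(3)[OF n] f] by simp
    have g3: "sheaf_counit M SP fst (SP.ez (ss c W) f) = f"
      by (rule SP.sheaf_counit(2)[OF SP_el[OF n]]) (simp add: fst_ss f)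
    have fc: "f \<odot> c \<in> carrier C" using Cc_in_ring[OF f] cC by simp
    have P: "Psi M C (sec_add SP (SP.ez (ss c W) f) s) = f \<odot> c \<oplus> Psi M C s"
      using lin(2) S add(3) by (simp add: Psi_ez[OF n f])
    have m1: "?L (sheaf_comult M SP fst (sec_add SP (SP.ez (ss c W) f) s)) =
        comult C (f \<odot> c) \<otimes>\<^bsub>AA.TAB\<^esub> comult C (Psi M C s)"
      unfolding ma(1)[OF S(1) add(3)] hom_mult[OF L(1) ma(3)[OF S(1) S(1)] ma(3)[OF add(3) add(3)]]
      using g1 add(4) by simp
    have m2: "sheaf_counit M SP fst (sec_add SP (SP.ez (ss c W) f) s) = (\<lambda>y. counit C (f \<odot> c) y + counit C (Psi M C s) y)"
      unfolding ma(2)[OF S(1) add(3)] using g2 g3 add(4) by simp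
    have "?Q (sec_add SP (SP.ez (ss c W) f) s)"
      unfolding m1 m2 P comult_add[OF fc lin(1)[OF add(3)]] counit_add[OF fc lin(1)[OF add(3)]] by simp
    then show "?Q (sec_add SP (SP.ez (ndU i) f) s)" by (simp add: i)
  qed
  show ?thesis
    unfolding coalgebra_hom_def SP.sheaf_coalgebra_simps SP.sheaf_coalgebra_tensor
    using Psi_linear main by (simp add: rlinear_def SP.sheaf_coalgebra_simps)
qed

text \<open>Normal generation is exactly what surjectivity needs: a coefficient whose support lies
  where \<open>c i\<close> is normalized defines a generator of the module of sections.\<close>

lemma Psi_iso:
  assumes gen: "normally_generates M C WG" and ind: "normally_lin_indep M C WG"
  shows "coalgebra_iso RM (sheaf_coalgebra M SP fst) C (Psi M C)"
proof (rule coalgebra_hom_iso[OF SP.sheaf_coalgebra_rmodule rmodule _ Psi_hom])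
  interpret S: lmod M "SP.Sec :: ('m => 'f, _) module" by (rule SP.Sec_lmod)
  show "comult (sheaf_coalgebra M SP fst) s \<in> carrier (tensor_group RM (sheaf_coalgebra M SP fst) (sheaf_coalgebra M SP fst))"
    if "s \<in> carrier (sheaf_coalgebra M SP fst)" for s :: "'m \<times> 'c set => ('m \<times> 'c set => 'f) set"
    using rlinear_closed[OF SP.sheaf_comult(1), of s] that
    by (simp add: SP.sheaf_coalgebra_simps SP.sheaf_coalgebra_tensor)
  have inj: "s = t" if st: "s \<in> Cc_sections SP" "t \<in> Cc_sections SP" "Psi M C s = Psi M C t" for s t
  proof -
    have m: "\<ominus>\<^bsub>SP.Sec\<^esub> t \<in> Cc_sections SP" using S.a_inv_closed[of t] st by simp
    have "Psi M C (\<ominus>\<^bsub>SP.Sec\<^esub> t) \<oplus> Psi M C t = \<zero>"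
      using rlinear_add[OF Psi_linear, of "\<ominus>\<^bsub>SP.Sec\<^esub> t" t] S.l_neg[of t] m st
        rlinear_zero[OF SP.Sec_abelian_group abelian_group_axioms Psi_linear] by simp
    then have "Psi M C (s \<oplus>\<^bsub>SP.Sec\<^esub> \<ominus>\<^bsub>SP.Sec\<^esub> t) = \<zero>"
      using rlinear_add[OF Psi_linear, of s "\<ominus>\<^bsub>SP.Sec\<^esub> t"] m st a_comm
        rlinear_closed[OF Psi_linear, of t] rlinear_closed[OF Psi_linear, of "\<ominus>\<^bsub>SP.Sec\<^esub> t"] by simp
    moreover have "s \<oplus>\<^bsub>SP.Sec\<^esub> \<ominus>\<^bsub>SP.Sec\<^esub> t \<in> Cc_sections SP" using S.a_closed[of s "\<ominus>\<^bsub>SP.Sec\<^esub> t"] m st by simp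
    ultimately have "s \<oplus>\<^bsub>SP.Sec\<^esub> \<ominus>\<^bsub>SP.Sec\<^esub> t = \<zero>\<^bsub>SP.Sec\<^esub>" using Psi_inj[OF ind] by simp
    then show "s = t" using S.minus_equality[of s "\<ominus>\<^bsub>SP.Sec\<^esub> t"] S.minus_minus[of t] m st by simp
  qed
  have surj: "\<exists>s\<in>Cc_sections SP. Psi M C s = d" if d: "d \<in> carrier C" for d
  proof -
    obtain k :: nat and f c where fc: "\<forall>i<k. f i \<in> carrier RM \<and> c i \<in> WG \<and> normalized_on M C (c i) (supp M (f i))"
      and dd: "d = finsum C (\<lambda>i. f i \<odot> c i) {..<k}"
      using bspec[OF gen[unfolded normally_generates_def] d] by (elim exE conjE)
    \<comment> \<open>Normalization on the closed support holds on the open set \<open>W i\<close>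
      as well, which is required for a basic set of the spectral sheaf.\<close>
    define W where "W i = {y \<in> TM. normalized_at M C (c i) y}" for i
    have n: "nd (c i) (W i)" "f i \<in> Cc M (W i)" if "i < k" for i
    proof -
      have oW: "openin (mtop M) (W i)" unfolding W_def by (rule openin_normalized)
      then show "nd (c i) (W i)" using fc that by (simp add: nd_def) (simp add: W_def normalized_on_def)
      have sub: "supp M (f i) \<subseteq> W i"
      proof
        fix y assume y: "y \<in> supp M (f i)"
        have "y \<in> TM" using y closure_of_subset_topspace unfolding supp_def by (rule rev_subsetD)
        moreover have "normalized_on M C (c i) (supp M (f i))" using fc that by simp
        ultimately show "y \<in> W i" using y by (simp add: W_def normalized_on_def)
      qed
      have "f i \<in> Cc M TM" using fc that by simp
      then show "f i \<in> Cc M (W i)" by (rule supp_subset_Cc[OF _ oW sub])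
    qed
    have S: "SP.ez (ss (c i) (W i)) (f i) \<in> Cc_sections SP" if "i < k" for i
      by (rule SP.ez_section[OF SP_el[OF n(1)[OF that]]]) (simp add: fst_ss n that)
    have "d = finsum C (\<lambda>i. Psi M C (SP.ez (ss (c i) (W i)) (f i))) {..<k}"
      unfolding dd
    proof (rule finsum_cong'[OF refl])
      show "(\<lambda>i. Psi M C (SP.ez (ss (c i) (W i)) (f i))) \<in> {..<k} \<rightarrow> carrier C"
        by (intro Pi_I rlinear_closed[OF Psi_linear]) (simp add: S)
      show "f i \<odot> c i = Psi M C (SP.ez (ss (c i) (W i)) (f i))" if "i \<in> {..<k}" for i
        by (rule Psi_ez[OF n, symmetric]) (use that in simp_all)
    qed
    also have "\<dots> = Psi M C (finsum SP.Sec (\<lambda>i. SP.ez (ss (c i) (W i)) (f i)) {..<k})"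
      by (rule rlinear_finsum[OF SP.Sec_abelian_group abelian_group_axioms Psi_linear, symmetric]) (use S in simp)
    finally have "Psi M C (finsum SP.Sec (\<lambda>i. SP.ez (ss (c i) (W i)) (f i)) {..<k}) = d" by simp
    moreover have "finsum SP.Sec (\<lambda>i. SP.ez (ss (c i) (W i)) (f i)) {..<k} \<in> Cc_sections SP"
      using S.finsum_closed[of "\<lambda>i. SP.ez (ss (c i) (W i)) (f i)" "{..<k}"] S by (simp add: Pi_iff)
    ultimately show ?thesis by blast
  qed
  show "bij_betw (Psi M C) (carrier (sheaf_coalgebra M SP fst)) (carrier C)"
    unfolding bij_betw_def
  proof
    show "inj_on (Psi M C) (carrier (sheaf_coalgebra M SP fst))"
      using inj by (intro inj_onI) (simp add: SP.sheaf_coalgebra_simps)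
    show "Psi M C ` carrier (sheaf_coalgebra M SP fst) = carrier C"
    proof
      show "Psi M C ` carrier (sheaf_coalgebra M SP fst) \<subseteq> carrier C"
        using rlinear_closed[OF Psi_linear] by (auto simp: SP.sheaf_coalgebra_simps)
      show "carrier C \<subseteq> Psi M C ` carrier (sheaf_coalgebra M SP fst)"
      proof
        fix d assume "d \<in> carrier C"
        then obtain s where "s \<in> Cc_sections SP" "Psi M C s = d" using surj by blast
        then show "d \<in> Psi M C ` carrier (sheaf_coalgebra M SP fst)" by (auto simp: SP.sheaf_coalgebra_simps)
      qed
    qed
  qed
qed

end

section \<open>Finite sums in spans, supports, and idempotent germs\<close>

context abelian_group
begin

lemma addspan_finsum:
  assumes X: "X \<subseteq> carrier G" and "finite I" and f: "\<And>i. i \<in> I ==> f i \<in> addspan G X"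
  shows "finsum G f I \<in> addspan G X"
  using assms(2) f
proof (induction I)
  case empty show ?case by (simp add: addspan.zero)
next
  case (insert i I)
  have "f \<in> I \<rightarrow> carrier G" "f i \<in> carrier G" using insert.prems addspan_closed[OF X] by auto
  then show ?case using insert addspan_plus[OF X] by simp
qed

end

context Hausdorff_manifold
begin

lemma supp_Cc_subset:
  assumes f: "f \<in> Cc M U" shows "supp M f \<subseteq> U"
proof -
  obtain K where K: "compactin (mtop M) K" "K \<subseteq> U" "\<forall>x. x \<notin> K --> f x = 0"
    using f Cc_open_iff[OF Cc_imp_open[OF f]] by blast
  have "closedin (mtop M) K" by (rule compactin_imp_closedin[OF Hausd K(1)])
  then have "supp M f \<subseteq> K" unfolding supp_def by (rule closure_of_minimal[rotated]) (use K(3) in blast)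
  then show ?thesis using K(2) by blast
qed

lemma supp_mult_subset: "supp M (\<lambda>y. r y * f y) \<subseteq> supp M f"
  unfolding supp_def by (rule closure_of_mono) auto

lemma germ_ring_cases':
  assumes "\<gamma> \<in> carrier (germ_ring M x)" "x \<in> TM"
  obtains f where "f \<in> Cc M TM" "\<gamma> = germ M x f"
  using germ_ring_representative[OF assms(1) _ openin_topspace] assms(2) by blast

lemma germ_ring_abelian_group:
  assumes x: "x \<in> TM"
  shows "abelian_group (germ_ring M x :: ('m => 'f::real_normed_field) set ring)"
proof (rule abelian_groupI)
  let ?S = "germ_ring M x :: ('m => 'f) set ring"
  note cl = Cc_germ_in_ring[OF x]
  show "\<zero>\<^bsub>?S\<^esub> \<in> carrier ?S" using cl[OF Cc_zero[OF openin_topspace]] by simp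
  fix a assume "a \<in> carrier ?S"
  then obtain f where f: "f \<in> Cc M TM" "a = germ M x f" using x by (rule germ_ring_cases')
  show "\<zero>\<^bsub>?S\<^esub> \<oplus>\<^bsub>?S\<^esub> a = a" by (simp add: f)
  show "\<exists>y\<in>carrier ?S. y \<oplus>\<^bsub>?S\<^esub> a = \<zero>\<^bsub>?S\<^esub>"
    using cl[OF Cc_uminus[OF f(1)]] by (intro bexI[of _ "germ M x (\<lambda>y. - f y)"]) (simp_all add: f)
  fix b assume "b \<in> carrier ?S"
  then obtain g where g: "g \<in> Cc M TM" "b = germ M x g" using x by (rule germ_ring_cases')
  show "a \<oplus>\<^bsub>?S\<^esub> b \<in> carrier ?S" using cl[OF Cc_add[OF f(1) g(1)]] by (simp add: f g)
  show "a \<oplus>\<^bsub>?S\<^esub> b = b \<oplus>\<^bsub>?S\<^esub> a" by (simp add: f g add.commute)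
  fix c assume "c \<in> carrier ?S"
  then obtain h where h: "h \<in> Cc M TM" "c = germ M x h" using x by (rule germ_ring_cases')
  show "a \<oplus>\<^bsub>?S\<^esub> b \<oplus>\<^bsub>?S\<^esub> c = a \<oplus>\<^bsub>?S\<^esub> (b \<oplus>\<^bsub>?S\<^esub> c)" by (simp add: f g h add.assoc)
qed

text \<open>A field has no idempotents other than 0 and 1, and by continuity the value at
  \<open>x\<close> excludes the other one nearby.\<close>

lemma germ_idempotent:
  fixes f :: "'m => 'f::real_normed_field"
  assumes f: "f \<in> Cc M TM" and x: "x \<in> TM" and i: "germ M x (\<lambda>y. f y * f y) = germ M x f"
  shows "germ M x f = germ0 M x \<or> germ M x f = germ1 M x"
proof -
  obtain U where U: "openin (mtop M) U" "x \<in> U" "\<forall>y\<in>U. f y * f y = f y"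
    using iffD1[OF germ_eq_iff[OF x] i] by (elim exE conjE)
  have v: "f y = 0 \<or> f y = 1" if "y \<in> U" for y
  proof -
    have "f y * (f y - 1) = 0" using bspec[OF U(3) that] by (simp add: right_diff_distrib)
    then show ?thesis by simp
  qed
  have op: "openin (mtop M) {y \<in> TM. f y \<in> - {a}}" for a
    by (rule smooth_on_continuous_preimage[OF mfd Cc_smooth_on_top[OF f] open_Compl[OF closed_singleton]])
  \<comment> \<open>Here \<open>b\<close> is the value at \<open>x\<close> and \<open>a\<close> is
    the value to be excluded.\<close>
  have g: "germ M x f = germ M x (\<lambda>_. b)" if h: "f x = b" "a \<noteq> b" "\<And>y. y \<in> U ==> f y = a \<or> f y = b" for a b
  proof (rule germ_eqI)
    show "openin (mtop M) (U \<inter> {y \<in> TM. f y \<in> - {a}})" by (rule openin_Int[OF U(1) op])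
    show "x \<in> U \<inter> {y \<in> TM. f y \<in> - {a}}" using U(2) x h(1,2) by simp
    show "f y = b" if "y \<in> U \<inter> {y \<in> TM. f y \<in> - {a}}" for y using h(3)[of y] that by simp
  qed
  from v[OF U(2)] show ?thesis
  proof
    assume "f x = 0"
    then have "germ M x f = germ0 M x" by (rule g[of 0 1]) (simp, use v in blast)
    then show ?thesis ..
  next
    assume "f x = 1"
    then have "germ M x f = germ1 M x" by (rule g[of 1 0]) (simp, rule v)
    then show ?thesis ..
  qed
qed

end

section \<open>Freeness of the stalks\<close>

context coalg
begin

lemma stalk_zero_smult: "x \<in> TM ==> b \<in> carrier (Cx x) ==> \<zero>\<^bsub>germ_ring M x\<^esub> \<odot>\<^bsub>Cx x\<^esub> b = \<zero>\<^bsub>Cx x\<^esub>"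
  by (erule stalk_cases) (simp add: stalk_smult stalk_zero)

lemma stalk_free_iff:
  assumes x: "x \<in> TM"
  defines "G \<equiv> stalk_grouplike M C x"
  shows "freely_generated (germ_ring M x) (stalk_coalgebra M C x) G \<longleftrightarrow>
    carrier (Cx x) \<subseteq> addspan (Cx x) {r \<odot>\<^bsub>Cx x\<^esub> b |r b. r \<in> carrier (germ_ring M x) \<and> b \<in> G} \<and>
    (\<forall>F r s. finite F --> F \<subseteq> G --> r \<in> F \<rightarrow> carrier (germ_ring M x) --> s \<in> F \<rightarrow> carrier (germ_ring M x) -->
      finsum (Cx x) (\<lambda>b. r b \<odot>\<^bsub>Cx x\<^esub> b) F = finsum (Cx x) (\<lambda>b. s b \<odot>\<^bsub>Cx x\<^esub> b) F --> (\<forall>b\<in>F. r b = s b))"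
proof -
  interpret S: rmod "germ_ring M x" "Cx x" by unfold_locales (rule stalk_rmodule[OF x])
  interpret GR: abelian_group "germ_ring M x :: ('m => 'f) set ring" by (rule germ_ring_abelian_group[OF x])
  have "freely_generated (germ_ring M x) (stalk_coalgebra M C x) G = freely_generated (germ_ring M x) (Cx x) G"
    by (simp add: freely_generated_def finsum_def finprod_def stalk_coalgebra_simps[OF x])
  also have "\<dots> \<longleftrightarrow> carrier (Cx x) \<subseteq> addspan (Cx x) {r \<odot>\<^bsub>Cx x\<^esub> b |r b. r \<in> carrier (germ_ring M x) \<and> b \<in> G} \<and>
    (\<forall>F r s. finite F --> F \<subseteq> G --> r \<in> F \<rightarrow> carrier (germ_ring M x) --> s \<in> F \<rightarrow> carrier (germ_ring M x) -->
      finsum (Cx x) (\<lambda>b. r b \<odot>\<^bsub>Cx x\<^esub> b) F = finsum (Cx x) (\<lambda>b. s b \<odot>\<^bsub>Cx x\<^esub> b) F --> (\<forall>b\<in>F. r b = s b))"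
    unfolding G_def
    by (rule S.freely_generated_iff[OF stalk_grouplike_carrier[OF x] GR.a_closed GR.zero_closed])
      (use stalk_zero_smult[OF x] stalk_grouplike_carrier[OF x] in blast)+
  finally show ?thesis .
qed

text \<open>A summand whose coefficient has \<open>x\<close> in its support is a multiple of a
  grouplike class, as its weakly grouplike element is normalized at \<open>x\<close>; every other
  summand vanishes near \<open>x\<close>.\<close>

lemma normal_imp_span:
  assumes gen: "normally_generates M C WG" and x: "x \<in> TM"
  shows "carrier (Cx x) \<subseteq> addspan (Cx x) {r \<odot>\<^bsub>Cx x\<^esub> b |r b. r \<in> carrier (germ_ring M x) \<and> b \<in> stalk_grouplike M C x}"
    (is "_ \<subseteq> addspan _ ?X")
proof
  interpret S: rmod "germ_ring M x" "Cx x" by unfold_locales (rule stalk_rmodule[OF x])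
  have X: "?X \<subseteq> carrier (Cx x)" using stalk_grouplike_carrier[OF x] by auto
  fix a assume "a \<in> carrier (Cx x)"
  then obtain d where d: "d \<in> carrier C" "a = cls M C x d" by (rule stalk_cases)
  obtain k :: nat and f c where fc: "\<forall>i<k. f i \<in> carrier RM \<and> c i \<in> WG \<and> normalized_on M C (c i) (supp M (f i))"
    and dd: "d = finsum C (\<lambda>i. f i \<odot> c i) {..<k}"
    using bspec[OF gen[unfolded normally_generates_def] d(1)] by (elim exE conjE)
  have cC: "c i \<in> carrier C" "f i \<in> Cc M TM" if "i < k" for i using fc that WG_carrier by simp_all
  have "a = finsum (Cx x) (\<lambda>i. cls M C x (f i \<odot> c i)) {..<k}"
    unfolding d(2) dd by (rule cls_finsum[OF x, symmetric]) (simp add: cC)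
  also have "\<dots> \<in> addspan (Cx x) ?X"
  proof (rule S.addspan_finsum[OF X])
    fix i assume "i \<in> {..<k}"
    then have i: "i < k" by simp
    show "cls M C x (f i \<odot> c i) \<in> addspan (Cx x) ?X"
    proof (cases "x \<in> supp M (f i)")
      case True
      then have n: "normalized_at M C (c i) x" using fc i by (simp add: normalized_on_def)
      have "c i \<in> WG" using fc i by simp
      then have "cls M C x (c i) \<in> stalk_grouplike M C x" using n by (rule WG_stalk_grouplike[OF x])
      moreover have "germ M x (f i) \<in> carrier (germ_ring M x)" by (rule Cc_germ_in_ring[OF x cC(2)[OF i]])
      moreover have "cls M C x (f i \<odot> c i) = germ M x (f i) \<odot>\<^bsub>Cx x\<^esub> cls M C x (c i)"
        by (rule stalk_smult[OF x cC(2)[OF i] cC(1)[OF i], symmetric])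
      ultimately have "cls M C x (f i \<odot> c i) \<in> ?X" by blast
      then show ?thesis by (rule S.addspan_incl[OF X])
    next
      case False
      have "geq x (f i \<odot> c i) \<zero>"
        by (rule geq_germ_zero[OF germ_zero_off_supp[OF x False] cC(2)[OF i] cC(1)[OF i] x])
      then have "cls M C x (f i \<odot> c i) = \<zero>\<^bsub>Cx x\<^esub>" using cC[OF i] x by (simp add: stalk_zero cls_eq_iff)
      then show ?thesis by (simp add: addspan.zero)
    qed
  qed simp
  finally show "a \<in> addspan (Cx x) ?X" .
qed

text \<open>Coefficients and grouplike elements are lifted to the ring and to weakly grouplike
  elements of \<open>C\<close>; \<open>normal_indep_finite\<close> is then applied to the
  differences of the coefficients.\<close>

lemma normal_imp_unique:
  assumes ind: "normally_lin_indep M C WG" and x: "x \<in> TM" and F: "finite F" "F \<subseteq> stalk_grouplike M C x"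
    and r: "r \<in> F \<rightarrow> carrier (germ_ring M x)" and s: "s \<in> F \<rightarrow> carrier (germ_ring M x)"
    and eq: "finsum (Cx x) (\<lambda>b. r b \<odot>\<^bsub>Cx x\<^esub> b) F = finsum (Cx x) (\<lambda>b. s b \<odot>\<^bsub>Cx x\<^esub> b) F" and b: "b \<in> F"
  shows "r b = s b"
proof -
  interpret S: rmod "germ_ring M x" "Cx x" by unfold_locales (rule stalk_rmodule[OF x])
  have "\<forall>b\<in>F. \<exists>c. c \<in> WG \<and> normalized_at M C c x \<and> b = cls M C x c"
  proof
    fix b assume "b \<in> F"
    then have "b \<in> stalk_grouplike M C x" using F(2) by blast
    then obtain c where "c \<in> WG" "normalized_at M C c x" "b = cls M C x c" by (rule stalk_grouplike_WG[OF x])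
    then show "\<exists>c. c \<in> WG \<and> normalized_at M C c x \<and> b = cls M C x c" by (intro exI conjI)
  qed
  then obtain c where c: "\<forall>b\<in>F. c b \<in> WG \<and> normalized_at M C (c b) x \<and> b = cls M C x (c b)" by (rule bchoice[THEN exE])
  have rep: "\<exists>f. \<forall>b\<in>F. f b \<in> Cc M TM \<and> q b = germ M x (f b)" if "q \<in> F \<rightarrow> carrier (germ_ring M x)" for q :: "_ => ('m => 'f) set"
  proof (rule bchoice, intro ballI)
    fix b assume "b \<in> F"
    with that have "q b \<in> carrier (germ_ring M x)" by (rule funcset_mem)
    then obtain f where "f \<in> Cc M TM" "q b = germ M x f" using x by (rule germ_ring_cases)
    then show "\<exists>f. f \<in> Cc M TM \<and> q b = germ M x f" by (intro exI conjI)
  qed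
  obtain f where f: "\<forall>b\<in>F. f b \<in> Cc M TM \<and> r b = germ M x (f b)" using rep[OF r] by (rule exE)
  obtain h where h: "\<forall>b\<in>F. h b \<in> Cc M TM \<and> s b = germ M x (h b)" using rep[OF s] by (rule exE)
  have cC: "c b \<in> carrier C" if "b \<in> F" for b using c that WG_carrier by simp
  have sum: "finsum (Cx x) (\<lambda>b. q b \<odot>\<^bsub>Cx x\<^esub> b) F = cls M C x (finsum C (\<lambda>b. f b \<odot> c b) F)"
    if q: "\<forall>b\<in>F. f b \<in> Cc M TM \<and> q b = germ M x (f b)" for q and f
  proof -
    have "finsum (Cx x) (\<lambda>b. q b \<odot>\<^bsub>Cx x\<^esub> b) F = finsum (Cx x) (\<lambda>b. cls M C x (f b \<odot> c b)) F"
    proof (rule S.finsum_cong'[OF refl])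
      show "(\<lambda>b. cls M C x (f b \<odot> c b)) \<in> F \<rightarrow> carrier (Cx x)" using q cC by (simp add: Pi_iff)
      fix b assume b: "b \<in> F"
      then have "b = cls M C x (c b)" using c by simp
      then have "q b \<odot>\<^bsub>Cx x\<^esub> b = germ M x (f b) \<odot>\<^bsub>Cx x\<^esub> cls M C x (c b)" using q b by simp
      then show "q b \<odot>\<^bsub>Cx x\<^esub> b = cls M C x (f b \<odot> c b)" using stalk_smult[OF x _ cC[OF b], of "f b"] q b by simp
    qed
    also have "\<dots> = cls M C x (finsum C (\<lambda>b. f b \<odot> c b) F)" by (rule cls_finsum[OF x]) (simp add: q cC)
    finally show ?thesis .
  qed
  let ?D = "finsum C (\<lambda>b. (\<lambda>y. f b y - h b y) \<odot> c b) F"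
  let ?f = "finsum C (\<lambda>b. f b \<odot> c b) F" and ?h = "finsum C (\<lambda>b. h b \<odot> c b) F"
  have closed: "?f \<in> carrier C" "?h \<in> carrier C" "?D \<in> carrier C"
    using f h cC by (auto intro!: finsum_closed Cc_diff smult_closed)
  have "geq x ?f ?h" using eq sum[OF f] sum[OF h] cls_eq_iff[OF x closed(1,2)] by simp
  moreover have "?D \<oplus> ?h = ?f"
  proof -
    have "?D \<oplus> ?h = finsum C (\<lambda>b. (\<lambda>y. f b y - h b y) \<odot> c b \<oplus> h b \<odot> c b) F"
      by (rule finsum_addf[symmetric]) (use f h cC in \<open>auto intro!: Cc_diff smult_closed\<close>)
    also have "\<dots> = ?f"
    proof (rule finsum_cong'[OF refl])
      show "(\<lambda>b. f b \<odot> c b) \<in> F \<rightarrow> carrier C" using f cC by simp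
      fix b assume b: "b \<in> F"
      show "(\<lambda>y. f b y - h b y) \<odot> c b \<oplus> h b \<odot> c b = f b \<odot> c b"
        using smult_add_left[of "\<lambda>y. f b y - h b y" "h b" "c b"] f h b cC[OF b] by (simp add: Cc_diff)
    qed
    finally show ?thesis .
  qed
  ultimately have "geq x (?D \<oplus> ?h) ?h" by simp
  then obtain g where g: "g \<in> Cc M TM" "germ M x g = germ1 M x" "g \<odot> (?D \<oplus> ?h) = g \<odot> ?h"
    by (rule geqE)
  have "g \<odot> ?D \<oplus> g \<odot> ?h = g \<odot> ?h" using g closed smult_r_distr[of g ?D ?h] by simp
  then have "g \<odot> ?D = \<zero>" using add.r_cancel_one[of "g \<odot> ?h" "g \<odot> ?D"] g(1) closed by simp
  then have z: "geq x ?D \<zero>" using g by (intro geqI[of g]) simp_all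
  have "germ M x (\<lambda>y. f b y - h b y) = germ0 M x"
  proof (rule normal_indep_finite[OF ind x F(1) _ _ _ z _ b])
    fix t assume t: "t \<in> F"
    show "c t \<in> WG" "normalized_at M C (c t) x" using c t by simp_all
    show "(\<lambda>y. f t y - h t y) \<in> Cc M TM" using f h t by (simp add: Cc_diff)
  next
    fix t u assume "t \<in> F" "u \<in> F" "t \<noteq> u"
    then have "cls M C x (c t) \<noteq> cls M C x (c u)" using c by simp
    then show "\<not> geq x (c t) (c u)" using cls_eq_iff[OF x cC cC, of t u] \<open>t \<in> F\<close> \<open>u \<in> F\<close> by simp
  qed
  from germ_cong2[OF this refl, of "(+)" "h b"] show "r b = s b" using f h b by simp
qed

text \<open>The elements that are normally generated form a submodule \<open>S\<close>. By
  \<open>local_submodule\<close> it is enough to bring \<open>d\<close> into \<open>S\<close> near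
  each point, and there a presentation of its class by grouplike elements can be lifted.\<close>

lemma free_imp_generates:
  assumes span: "\<And>x. x \<in> TM ==> carrier (Cx x) \<subseteq>
    addspan (Cx x) {r \<odot>\<^bsub>Cx x\<^esub> b |r b. r \<in> carrier (germ_ring M x) \<and> b \<in> stalk_grouplike M C x}"
  shows "normally_generates M C WG"
proof -
  define P where "P p \<longleftrightarrow> fst p \<in> Cc M TM \<and> snd p \<in> WG \<and> normalized_on M C (snd p) (supp M (fst p))"
    for p :: "('m => 'f) \<times> 'c"
  define \<phi> where "\<phi> p = fst p \<odot> snd p" for p :: "('m => 'f) \<times> 'c"
  let ?X = "{\<phi> p |p. P p}"
  define S where "S = addspan C ?X"
  have Xc: "\<phi> p \<in> carrier C" if "P p" for p using that WG_carrier by (simp add: P_def \<phi>_def)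
  then have X: "?X \<subseteq> carrier C" by blast
  have Xs: "r \<odot> s \<in> ?X" if "r \<in> Cc M TM" "s \<in> ?X" for r s
  proof -
    from that(2) obtain p where p: "s = \<phi> p" "P p" by blast
    obtain f c where fc: "p = (f, c)" by (cases p)
    have s: "s = f \<odot> c" "f \<in> Cc M TM" "c \<in> WG" "normalized_on M C c (supp M f)" using p by (simp_all add: fc P_def \<phi>_def)
    then have "r \<odot> s = \<phi> ((\<lambda>y. r y * f y), c)" using that(1) WG_carrier smult_smult by (simp add: \<phi>_def)
    moreover have "P ((\<lambda>y. r y * f y), c)"
      using s(2-4) Cc_mult[OF that(1) s(2)] supp_mult_subset[of r f] by (auto simp: normalized_on_def P_def)
    ultimately show ?thesis by blast
  qed
  have Ssm: "r \<odot> s \<in> S" if r: "r \<in> Cc M TM" and s: "s \<in> S" for r s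
    using s unfolding S_def
  proof induction
    case zero show ?case using r by (simp add: addspan.zero)
  next
    case (add u t)
    have "t \<in> carrier C" "u \<in> carrier C" using addspan_closed[OF X add.hyps(2)] X add.hyps(1) by auto
    then have "r \<odot> (u \<oplus> t) = r \<odot> u \<oplus> r \<odot> t" using r by (simp add: smult_r_distr)
    then show ?case using addspan.add[OF Xs[OF r add.hyps(1)] add.IH] by simp
  qed
  have zS: "\<zero> \<in> S" unfolding S_def by (rule addspan.zero)
  have aS: "s \<oplus> t \<in> S" if "s \<in> S" "t \<in> S" for s t using addspan_plus[OF X] that unfolding S_def by blast
  have SC: "S \<subseteq> carrier C" unfolding S_def using addspan_closed[OF X] by blast
  have local: "\<exists>g\<in>Cc M TM. germ M x g = germ1 M x \<and> g \<odot> d \<in> S" if x: "x \<in> TM" and d: "d \<in> carrier C" for x d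
  proof -
    interpret Sx: rmod "germ_ring M x" "Cx x" by unfold_locales (rule stalk_rmodule[OF x])
    let ?Y = "{r \<odot>\<^bsub>Cx x\<^esub> b |r b. r \<in> carrier (germ_ring M x) \<and> b \<in> stalk_grouplike M C x}"
    have Y: "?Y \<subseteq> carrier (Cx x)" using stalk_grouplike_carrier[OF x] by auto
    have "cls M C x d \<in> addspan (Cx x) ?Y" using span[OF x] d by auto
    \<comment> \<open>The claim is made for all elements with the given class, since the induction
      runs over classes and a class does not determine its element.\<close>
    then have "\<forall>d\<in>carrier C. cls M C x d = a --> (\<exists>g\<in>Cc M TM. germ M x g = germ1 M x \<and> g \<odot> d \<in> S)"
      if "a = cls M C x d" for a using that
    proof (induction "cls M C x d" arbitrary: a d)
      case zero
      show ?case
      proof (intro ballI impI)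
        fix e assume e: "e \<in> carrier C" "cls M C x e = a"
        then have "cls M C x e = cls M C x \<zero>" using zero stalk_zero[OF x] by simp
        then have "geq x e \<zero>" by (rule iffD1[OF cls_eq_iff[OF x e(1) zero_closed]])
        then obtain g where "g \<in> Cc M TM" "germ M x g = germ1 M x" "g \<odot> e = g \<odot> \<zero>" by (rule geqE)
        then show "\<exists>g\<in>Cc M TM. germ M x g = germ1 M x \<and> g \<odot> e \<in> S" using zS by (intro bexI[of _ g]) simp_all
      qed
    next
      case (add y t)
      obtain \<gamma> b where y: "y = \<gamma> \<odot>\<^bsub>Cx x\<^esub> b" "\<gamma> \<in> carrier (germ_ring M x)" "b \<in> stalk_grouplike M C x"
        using add.hyps(1) by blast
      obtain f where f: "f \<in> Cc M TM" "\<gamma> = germ M x f" using y(2) x by (rule germ_ring_cases)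
      obtain c where c: "c \<in> WG" "normalized_at M C c x" "b = cls M C x c" by (rule stalk_grouplike_WG[OF x y(3)])
      have cC: "c \<in> carrier C" using c(1) by (rule WG_carrier)
      have "t \<in> carrier (Cx x)" by (rule Sx.addspan_closed[OF Y add.hyps(2)])
      then obtain d' where d': "d' \<in> carrier C" "t = cls M C x d'" by (rule stalk_cases)
      obtain g2 where g2: "g2 \<in> Cc M TM" "germ M x g2 = germ1 M x" "g2 \<odot> d' \<in> S"
        using add.hyps(3)[OF d'(2) refl] d' by blast
      let ?W = "{y \<in> TM. normalized_at M C c y}"
      obtain g3 :: "'m => 'f" where g3: "g3 \<in> Cc M ?W" "germ M x g3 = germ1 M x"
        by (rule bump[OF openin_normalized, of x c]) (use x c(2) in auto)
      show ?case
      proof (intro ballI impI)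
        fix e assume e: "e \<in> carrier C" "cls M C x e = a"
        have "cls M C x e = cls M C x (f \<odot> c \<oplus> d')"
          using e(2) add.prems add.hyps(4) y(1) d'(2) f c(3) cC d'(1) x by (simp add: stalk_smult stalk_add)
        then have "geq x e (f \<odot> c \<oplus> d')" using e(1) f(1) cC d'(1) cls_eq_iff[OF x] by simp
        then obtain g1 where g1: "g1 \<in> Cc M TM" "germ M x g1 = germ1 M x" "g1 \<odot> e = g1 \<odot> (f \<odot> c \<oplus> d')"
          by (rule geqE)
        note g3' = Cc_in_ring[OF g3(1)]
        \<comment> \<open>Three multipliers with germ 1 are combined: \<open>g1\<close> replaces
          \<open>e\<close> by the lifted sum, \<open>g2\<close> brings \<open>d'\<close> into
          \<open>S\<close>, and \<open>g3\<close> confines the support to the points at which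
          \<open>c\<close> is normalized.\<close>
        define g where "g = (\<lambda>y. g3 y * g2 y)"
        have g: "g \<in> Cc M ?W" "g \<in> Cc M TM" unfolding g_def using Cc_mult_right[OF g3(1) g2(1)] Cc_in_ring by blast+
        have gg: "germ M x g = germ1 M x"
          unfolding g_def using germ_one_mult[OF g3(2), of g2] g2(2) by simp
        have gW: "(\<lambda>y. g1 y * g y) \<in> Cc M ?W" by (rule Cc_mult[OF g1(1) g(1)])
        have "(\<lambda>y. g1 y * g y) \<odot> e = g \<odot> (g1 \<odot> e)"
          using smult_smult[OF g1(1) g(2) e(1)] smult_commute[OF g1(1) g(2) e(1)] by simp
        also have "\<dots> = g \<odot> (g1 \<odot> (f \<odot> c)) \<oplus> g \<odot> (g1 \<odot> d')"
          using g1 g f cC d' by (simp add: smult_r_distr)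
        also have "g \<odot> (g1 \<odot> (f \<odot> c)) = (\<lambda>y. f y * (g1 y * g y)) \<odot> c"
          using f g1 g cC
          by (simp add: smult_smult Cc_mult smult_commute[of g g1] smult_commute[of g f] smult_commute[of g1 f])
        also have "g \<odot> (g1 \<odot> d') = g1 \<odot> (g3 \<odot> (g2 \<odot> d'))"
          unfolding g_def using g1 g2 g3' d'(1) Cc_mult[OF g3' g2(1)] by (simp add: smult_smult smult_commute[of g2 g1] smult_commute[of g3 g1])
        finally have e2: "(\<lambda>y. g1 y * g y) \<odot> e = (\<lambda>y. f y * (g1 y * g y)) \<odot> c \<oplus> g1 \<odot> (g3 \<odot> (g2 \<odot> d'))" .
        have fW: "(\<lambda>y. f y * (g1 y * g y)) \<in> Cc M ?W" by (rule Cc_mult[OF f(1) gW])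
        have "P ((\<lambda>y. f y * (g1 y * g y)), c)"
          using Cc_in_ring[OF fW] c(1) supp_Cc_subset[OF fW] by (auto simp: normalized_on_def P_def)
        then have "\<phi> ((\<lambda>y. f y * (g1 y * g y)), c) \<in> ?X" by blast
        then have "\<phi> ((\<lambda>y. f y * (g1 y * g y)), c) \<in> S" unfolding S_def by (rule addspan_incl[OF X])
        then have "(\<lambda>y. f y * (g1 y * g y)) \<odot> c \<in> S" by (simp add: \<phi>_def)
        then have "(\<lambda>y. g1 y * g y) \<odot> e \<in> S" unfolding e2 using Ssm[OF g1(1) Ssm[OF g3' g2(3)]] by (rule aS)
        moreover have "germ M x (\<lambda>y. g1 y * g y) = germ1 M x" using germ_one_mult[OF g1(2), of g] gg by simp
        ultimately show "\<exists>g\<in>Cc M TM. germ M x g = germ1 M x \<and> g \<odot> e \<in> S" using Cc_in_ring[OF gW] by blast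
      qed
    qed
    then show ?thesis using d by blast
  qed
  show ?thesis
    unfolding normally_generates_def
  proof
    fix d assume d: "d \<in> carrier C"
    have "d \<in> S" by (rule local_submodule[OF zS aS SC Ssm d]) (assumption+, rule local[OF _ d])
    then have dS: "d \<in> addspan C ?X" unfolding S_def .
    have "d \<in> addspan C ?X \<longleftrightarrow> (\<exists>(k::nat) p. (\<forall>i<k. P (p i)) \<and> d = finsum C (\<lambda>i. \<phi> (p i)) {..<k})"
      by (rule addspan_iff) (rule Xc)
    from iffD1[OF this dS]
    have "\<exists>(k::nat) p. (\<forall>i<k. P (p i)) \<and> d = finsum C (\<lambda>i. \<phi> (p i)) {..<k}" .
    then obtain k :: nat and p where p: "\<forall>i<k. P (p i)" and dd: "d = finsum C (\<lambda>i. \<phi> (p i)) {..<k}"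
      by (elim exE conjE)
    show "\<exists>(k::nat) f c. (\<forall>i<k. f i \<in> carrier RM \<and> c i \<in> WG \<and> normalized_on M C (c i) (supp M (f i))) \<and>
        d = finsum C (\<lambda>i. f i \<odot> c i) {..<k}"
      by (rule exI[of _ k], rule exI[of _ "\<lambda>i. fst (p i)"], rule exI[of _ "\<lambda>i. snd (p i)"])
        (use p dd in \<open>simp add: P_def \<phi>_def\<close>)
  qed
qed

text \<open>Unless two of the \<open>c i\<close> agree near \<open>x\<close>, their classes are
  distinct grouplike elements. The relation then expresses 0 through them, and uniqueness compares
  its coefficients with zero coefficients.\<close>

lemma free_imp_indep:
  assumes unique: "\<And>x F r s. x \<in> TM ==> finite F ==> F \<subseteq> stalk_grouplike M C x ==> r \<in> F \<rightarrow> carrier (germ_ring M x) ==>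
      s \<in> F \<rightarrow> carrier (germ_ring M x) ==>
      finsum (Cx x) (\<lambda>b. r b \<odot>\<^bsub>Cx x\<^esub> b) F = finsum (Cx x) (\<lambda>b. s b \<odot>\<^bsub>Cx x\<^esub> b) F ==> \<forall>b\<in>F. r b = s b"
  shows "normally_lin_indep M C WG"
  unfolding normally_lin_indep_def
proof (intro ballI allI impI, elim conjE)
  fix x and k :: nat and c f
  assume x: "x \<in> TM" and cf: "\<forall>i<k. c i \<in> WG \<and> normalized_at M C (c i) x \<and> f i \<in> carrier RM"
    and z: "finsum C (\<lambda>i. f i \<odot> c i) {..<k} = \<zero>"
  interpret S: rmod "germ_ring M x" "Cx x" by unfold_locales (rule stalk_rmodule[OF x])
  interpret GR: abelian_group "germ_ring M x :: ('m => 'f) set ring" by (rule germ_ring_abelian_group[OF x])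
  have cC: "c i \<in> carrier C" "f i \<in> Cc M TM" if "i < k" for i using cf that WG_carrier by simp_all
  show "(\<forall>i<k. germ M x (f i) = germ0 M x) \<or>
      (\<exists>i<k. \<exists>j<k. i \<noteq> j \<and> (\<exists>g \<in> carrier RM. germ M x g = germ1 M x \<and> g \<odot> c i = g \<odot> c j))"
    (is "?A \<or> ?B")
  proof (rule disjCI)
    assume nB: "\<not> ?B"
    let ?b = "\<lambda>i. cls M C x (c i)"
    have inj: "inj_on ?b {..<k}"
    proof (rule inj_onI, rule ccontr)
      fix i j assume ij: "i \<in> {..<k}" "j \<in> {..<k}" "?b i = ?b j" "i \<noteq> j"
      then have "geq x (c i) (c j)" using cls_eq_iff[OF x cC(1) cC(1), of i j] by simp
      then obtain g where "g \<in> Cc M TM" "germ M x g = germ1 M x" "g \<odot> c i = g \<odot> c j" by (rule geqE)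
      then have "\<exists>g \<in> carrier RM. germ M x g = germ1 M x \<and> g \<odot> c i = g \<odot> c j"
        by (intro bexI[of _ g] conjI) simp_all
      then have ?B using ij(1,2,4) by (intro exI[of _ i] exI[of _ j] conjI) simp_all
      then show False using nB by simp
    qed
    \<comment> \<open>The coefficients are indexed by positions, but uniqueness speaks of
      coefficients indexed by elements; injectivity of the classes permits the change.\<close>
    define r where "r b = germ M x (f (the_inv_into {..<k} ?b b))" for b
    have rb: "r (?b i) = germ M x (f i)" if "i < k" for i
      unfolding r_def using the_inv_into_f_f[OF inj, of i] that by simp
    let ?F = "?b ` {..<k}"
    have F: "finite ?F" "?F \<subseteq> stalk_grouplike M C x" using WG_stalk_grouplike[OF x] cf by auto
    have rF: "r \<in> ?F \<rightarrow> carrier (germ_ring M x)" using rb Cc_germ_in_ring[OF x cC(2)] by auto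
    have zF: "(\<lambda>_. \<zero>\<^bsub>germ_ring M x\<^esub>) \<in> ?F \<rightarrow> carrier (germ_ring M x :: ('m => 'f) set ring)" using GR.zero_closed by (intro Pi_I)
    have "finsum (Cx x) (\<lambda>b. r b \<odot>\<^bsub>Cx x\<^esub> b) ?F = finsum (Cx x) (\<lambda>i. r (?b i) \<odot>\<^bsub>Cx x\<^esub> ?b i) {..<k}"
      by (rule S.finsum_reindex[OF _ inj]) (use rF F(2) stalk_grouplike_carrier[OF x] in \<open>auto intro!: S.smult_closed simp: Pi_iff cC\<close>)
    also have "\<dots> = finsum (Cx x) (\<lambda>i. cls M C x (f i \<odot> c i)) {..<k}"
    proof (rule S.finsum_cong'[OF refl])
      show "(\<lambda>i. cls M C x (f i \<odot> c i)) \<in> {..<k} \<rightarrow> carrier (Cx x)" by (simp add: Pi_iff cC)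
      fix i assume "i \<in> {..<k}"
      then show "r (?b i) \<odot>\<^bsub>Cx x\<^esub> ?b i = cls M C x (f i \<odot> c i)" using rb stalk_smult[OF x cC(2) cC(1)] by simp
    qed
    also have "\<dots> = cls M C x (finsum C (\<lambda>i. f i \<odot> c i) {..<k})" by (rule cls_finsum[OF x]) (simp add: cC)
    also have "\<dots> = \<zero>\<^bsub>Cx x\<^esub>" using z x by (simp add: stalk_zero)
    also have "\<dots> = finsum (Cx x) (\<lambda>b. \<zero>\<^bsub>germ_ring M x\<^esub> \<odot>\<^bsub>Cx x\<^esub> b) ?F"
    proof (rule sym)
      have "finsum (Cx x) (\<lambda>b. \<zero>\<^bsub>germ_ring M x\<^esub> \<odot>\<^bsub>Cx x\<^esub> b) ?F = finsum (Cx x) (\<lambda>b. \<zero>\<^bsub>Cx x\<^esub>) ?F"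
        by (rule S.finsum_cong'[OF refl]) (use stalk_zero_smult[OF x] cC in auto)
      then show "finsum (Cx x) (\<lambda>b. \<zero>\<^bsub>germ_ring M x\<^esub> \<odot>\<^bsub>Cx x\<^esub> b) ?F = \<zero>\<^bsub>Cx x\<^esub>" by simp
    qed
    finally have "\<forall>b\<in>?F. r b = \<zero>\<^bsub>germ_ring M x\<^esub>" by (rule unique[OF x F rF zF])
    then show ?A using rb by auto
  qed
qed

lemma normal_iff_free:
  "normally_generates M C WG \<and> normally_lin_indep M C WG \<longleftrightarrow>
    (\<forall>x\<in>TM. freely_generated (germ_ring M x) (stalk_coalgebra M C x) (stalk_grouplike M C x))"
proof
  assume n: "normally_generates M C WG \<and> normally_lin_indep M C WG"
  show "\<forall>x\<in>TM. freely_generated (germ_ring M x) (stalk_coalgebra M C x) (stalk_grouplike M C x)"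
  proof
    fix x assume x: "x \<in> TM"
    show "freely_generated (germ_ring M x) (stalk_coalgebra M C x) (stalk_grouplike M C x)"
      unfolding stalk_free_iff[OF x]
    proof (intro conjI allI impI ballI)
      show "carrier (Cx x) \<subseteq> addspan (Cx x) {r \<odot>\<^bsub>Cx x\<^esub> b |r b. r \<in> carrier (germ_ring M x) \<and> b \<in> stalk_grouplike M C x}"
        by (rule normal_imp_span[OF conjunct1[OF n] x])
    qed (rule normal_imp_unique[OF conjunct2[OF n] x])
  qed
next
  assume f: "\<forall>x\<in>TM. freely_generated (germ_ring M x) (stalk_coalgebra M C x) (stalk_grouplike M C x)"
  have fr: "carrier (Cx x) \<subseteq> addspan (Cx x) {r \<odot>\<^bsub>Cx x\<^esub> b |r b. r \<in> carrier (germ_ring M x) \<and> b \<in> stalk_grouplike M C x} \<and>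
    (\<forall>F r s. finite F --> F \<subseteq> stalk_grouplike M C x --> r \<in> F \<rightarrow> carrier (germ_ring M x) --> s \<in> F \<rightarrow> carrier (germ_ring M x) -->
      finsum (Cx x) (\<lambda>b. r b \<odot>\<^bsub>Cx x\<^esub> b) F = finsum (Cx x) (\<lambda>b. s b \<odot>\<^bsub>Cx x\<^esub> b) F --> (\<forall>b\<in>F. r b = s b))"
    if "x \<in> TM" for x using bspec[OF f that] unfolding stalk_free_iff[OF that] .
  show "normally_generates M C WG \<and> normally_lin_indep M C WG"
  proof
    show "normally_generates M C WG" by (rule free_imp_generates) (rule conjunct1[OF fr])
    show "normally_lin_indep M C WG"
    proof (rule free_imp_indep, intro ballI)
      fix x F r s b
      assume h: "x \<in> TM" "finite F" "F \<subseteq> stalk_grouplike M C x" "r \<in> F \<rightarrow> carrier (germ_ring M x)"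
        "s \<in> F \<rightarrow> carrier (germ_ring M x)"
        "finsum (Cx x) (\<lambda>b. r b \<odot>\<^bsub>Cx x\<^esub> b) F = finsum (Cx x) (\<lambda>b. s b \<odot>\<^bsub>Cx x\<^esub> b) F" "b \<in> F"
      show "r b = s b" by (rule conjunct2[OF fr[OF h(1)], rule_format, OF h(2-7)])
    qed
  qed
qed

end

section \<open>Recovering a sheaf from its coalgebra\<close>

context lmod
begin

text \<open>The same multiplier works for the images, so linear maps act on stalks.\<close>

lemma rlinear_geq:
  assumes h: "rlinear RM A B h" and g: "geq x a b" and a: "a \<in> carrier A" "b \<in> carrier A" and B: "lmod M B"
  shows "lmod.geq M B x (h a) (h b)"
proof -
  interpret B: lmod M B by (rule B)
  obtain g where g: "g \<in> Cc M TM" "germ M x g = germ1 M x" "g \<odot> a = g \<odot> b" using g by (rule geqE)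
  have gr: "g \<in> carrier RM" using g(1) by simp
  have "g \<odot>\<^bsub>B\<^esub> h a = g \<odot>\<^bsub>B\<^esub> h b"
    using g(3) rlinear_smult[OF h gr a(1)] rlinear_smult[OF h gr a(2)] by simp
  then show ?thesis by (rule B.geqI[OF g(1,2)])
qed

end

text \<open>On a set \<open>N\<close> as in the last hypothesis the map is determined by the
  projections: there \<open>g\<close> is \<pi> followed by the inverse of \<rho> on the elementary
  set that is the image of \<open>N\<close>. Continuity and smoothness of \<open>g\<close> are
  inherited from these two maps.\<close>

lemma (in Hausdorff_manifold) sheaf_map_smooth:
  assumes E: "is_sheaf M E \<pi>" and D: "is_sheaf M D \<rho>"
    and over: "\<And>e. e \<in> topspace (mtop E) ==> g e \<in> topspace (mtop D) \<and> \<rho> (g e) = \<pi> e"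
    and loc: "\<And>e. e \<in> topspace (mtop E) ==>
      \<exists>N. openin (mtop E) N \<and> e \<in> N \<and> openin (mtop D) (g ` N) \<and> inj_on \<rho> (g ` N)"
  shows "smooth_map_on E (topspace (mtop E)) D g"
proof -
  interpret E: sheaf M E \<pi> by unfold_locales (rule E)
  interpret D: sheaf M D \<rho> by unfold_locales (rule D)
  let ?TE = "topspace (mtop E)"
  have Nsub: "N \<subseteq> ?TE" if "openin (mtop E) N" for N using that by (rule openin_subset)
  have gN: "inv_into (g ` N) \<rho> (\<pi> e) = g e" if N: "openin (mtop E) N" "inj_on \<rho> (g ` N)" "e \<in> N" for N e
  proof -
    have "\<rho> (g e) = \<pi> e" using over Nsub[OF N(1)] N(3) by blast
    moreover have "inv_into (g ` N) \<rho> (\<rho> (g e)) = g e" by (rule inv_into_f_f[OF N(2) imageI[OF N(3)]])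
    ultimately show ?thesis by simp
  qed
  have cont: "openin (mtop E) {e \<in> ?TE. g e \<in> Q}" if Q: "openin (mtop D) Q" for Q
  proof (subst openin_subopen, intro ballI)
    fix e assume e: "e \<in> {e \<in> ?TE. g e \<in> Q}"
    then have eE: "e \<in> ?TE" by simp
    obtain N where N: "openin (mtop E) N" "e \<in> N" "openin (mtop D) (g ` N)" "inj_on \<rho> (g ` N)"
      using loc[OF eE] by (elim exE conjE)
    \<comment> \<open>A point of \<open>N\<close> lying over the projection of a point of the image
      in \<open>Q\<close> must be sent to that point, as \<rho> is injective on the image of
      \<open>N\<close>.\<close>
    let ?T = "N \<inter> {e' \<in> ?TE. \<pi> e' \<in> \<rho> ` (g ` N \<inter> Q)}"
    have "openin (mtop E) ?T"
      by (intro openin_Int N(1) E.proj_preimage_open D.proj_open N(3) Q)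
    moreover have "\<pi> e \<in> \<rho> ` (g ` N \<inter> Q)"
    proof (rule image_eqI)
      show "\<pi> e = \<rho> (g e)" using over e by simp
      show "g e \<in> g ` N \<inter> Q" using N(2) e by simp
    qed
    moreover have "?T \<subseteq> {e \<in> ?TE. g e \<in> Q}"
    proof
      fix e' assume e': "e' \<in> ?T"
      then obtain d where d: "d \<in> g ` N" "d \<in> Q" "\<pi> e' = \<rho> d" by blast
      have "\<rho> (g e') = \<rho> d" using over[of e'] e' d(3) by simp
      then have "g e' = d" using inj_onD[OF N(4)] e' d(1) by blast
      then show "e' \<in> {e \<in> ?TE. g e \<in> Q}" using e' d(2) by simp
    qed
    ultimately show "\<exists>T. openin (mtop E) T \<and> e \<in> T \<and> T \<subseteq> {e \<in> ?TE. g e \<in> Q}"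
      using N(2) e by (intro exI[of _ ?T]) simp
  qed
  have k: "smooth_on D W (\<lambda>d. \<psi> d i)" if W: "(W, \<psi>) \<in> atlas D" and i: "i < mdim D" for W \<psi> i
    unfolding smooth_on_def
  proof (intro conjI chart_openin[OF D.E_mfd W] ballI, clarify)
    fix V' \<phi>' assume "(V', \<phi>') \<in> atlas D"
    from chart_transition[OF D.E_mfd this W i]
    show "smooth_Rn (mdim D) (\<phi>' ` (W \<inter> V')) (\<lambda>z. \<psi> (inv_into V' \<phi>' z) i)" by (simp add: Int_commute)
  qed
  have sm: "smooth_Rn (mdim E) (\<phi> ` (?TE \<inter> V \<inter> g -` W)) (\<lambda>z. \<psi> (g (inv_into V \<phi> z)) i)"
    if V: "(V, \<phi>) \<in> atlas E" and W: "(W, \<psi>) \<in> atlas D" and i: "i < mdim D" for V \<phi> W \<psi> i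
  proof (rule smooth_Rn_local)
    fix z assume "z \<in> \<phi> ` (?TE \<inter> V \<inter> g -` W)"
    then obtain e where e: "e \<in> ?TE" "e \<in> V" "g e \<in> W" "z = \<phi> e" by blast
    obtain N where N: "openin (mtop E) N" "e \<in> N" "openin (mtop D) (g ` N)" "inj_on \<rho> (g ` N)"
      using loc[OF e(1)] by (elim exE conjE)
    have elN: "elementary D \<rho> (g ` N)" using N by (simp add: elementary_def)
    let ?s = "inv_into (g ` N) \<rho>"
    let ?Y = "{y \<in> \<rho> ` g ` N. ?s y \<in> W}"
    let ?Z = "N \<inter> {e \<in> ?TE. \<pi> e \<in> ?Y}"
    note p1 = smooth_on_pullback[OF mfd D.E_mfd D.el_inv_smooth[OF elN] k[OF W i]]
    note p2 = smooth_on_pullback[OF E.E_mfd mfd E.proj_smooth p1]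
    have oZ: "openin (mtop E) ?Z"
      by (intro openin_Int N(1)) (use p2 in \<open>simp only: smooth_on_def\<close>)
    have "smooth_on E ?Z (\<lambda>e. \<psi> (?s (\<pi> e)) i)" by (rule smooth_on_subset[OF E.E_mfd p2 oZ Int_lower2])
    then have s: "smooth_Rn (mdim E) (\<phi> ` (?Z \<inter> V)) (\<lambda>z. \<psi> (?s (\<pi> (inv_into V \<phi> z))) i)"
      using V unfolding smooth_on_def by fast
    have Zg: "?s (\<pi> e') = g e'" "g e' \<in> W" "e' \<in> ?TE" if "e' \<in> ?Z" for e'
    proof -
      show 1: "?s (\<pi> e') = g e'" using gN[OF N(1,4)] that by simp
      then show "g e' \<in> W" "e' \<in> ?TE" using that by simp_all
    qed
    have eZ: "e \<in> ?Z"
    proof -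
      have "\<pi> e = \<rho> (g e)" using over[OF e(1)] by simp
      then have "\<pi> e \<in> \<rho> ` g ` N" using N(2) by simp
      then show ?thesis using gN[OF N(1,4,2)] e N(2) by simp
    qed
    show "\<exists>A. z \<in> A \<and> A \<subseteq> \<phi> ` (?TE \<inter> V \<inter> g -` W) \<and> smooth_Rn (mdim E) A (\<lambda>z. \<psi> (g (inv_into V \<phi> z)) i)"
    proof (intro exI conjI)
      show "z \<in> \<phi> ` (?Z \<inter> V)" using eZ e(2,4) by blast
      show "\<phi> ` (?Z \<inter> V) \<subseteq> \<phi> ` (?TE \<inter> V \<inter> g -` W)" by (rule image_mono) (use Zg in blast)
      have "smooth_Rn (mdim E) (\<phi> ` (?Z \<inter> V)) (\<lambda>z. \<psi> (?s (\<pi> (inv_into V \<phi> z))) i) \<longleftrightarrow>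
          smooth_Rn (mdim E) (\<phi> ` (?Z \<inter> V)) (\<lambda>z. \<psi> (g (inv_into V \<phi> z)) i)"
      proof (rule smooth_Rn_cong)
        fix z assume "z \<in> \<phi> ` (?Z \<inter> V)"
        then obtain e' where e': "e' \<in> ?Z" "e' \<in> V" "z = \<phi> e'" by blast
        then have "inv_into V \<phi> z = e'" using inv_into_f_f[OF chart_inj[OF E.E_mfd V]] by simp
        then show "\<psi> (?s (\<pi> (inv_into V \<phi> z))) i = \<psi> (g (inv_into V \<phi> z)) i" using Zg(1)[OF e'(1)] by simp
      qed
      then show "smooth_Rn (mdim E) (\<phi> ` (?Z \<inter> V)) (\<lambda>z. \<psi> (g (inv_into V \<phi> z)) i)" using s by simp
    qed
  qed
  have "continuous_map (mtop E) (mtop D) g"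
    unfolding continuous_map_def using over cont by (simp add: Pi_iff)
  then show ?thesis
    unfolding smooth_map_on_def subtopology_topspace
    by (intro conjI openin_topspace, assumption) (use sm in fast)
qed

section \<open>Sections near a point and their coordinates on the fibre\<close>

context sheaf
begin

lemma loc_rep:
  fixes s :: "'e => ('e => 'f::real_normed_field) set"
  assumes "e \<in> TE" "s \<in> CS"
  obtains p where "p \<in> Cc M TM" "loc e s = germ M (\<pi> e) p"
  using germ_ring_cases'[OF loc_closed[OF assms] proj_in[OF assms(1)]] .

text \<open>\<open>normal_form\<close> is applied to the family that glues to the identity. It
  expands both sections near \<open>x\<close> as sums of terms that depend only on their coordinates
  over \<open>x\<close>.\<close>

lemma loc_determines:
  fixes s t :: "'e => ('e => 'f::real_normed_field) set"
  assumes x: "x \<in> TM" and s: "s \<in> CS" and t: "t \<in> CS"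
    and eq: "\<And>e. e \<in> TE ==> \<pi> e = x ==> loc e s = loc e t"
  shows "lmod.geq M Sec x s t"
proof -
  interpret S: lmod M "Sec :: ('m => 'f, 'e => ('e => 'f) set) module" by (rule Sec_lmod)
  have cover: "TE \<subseteq> (\<Union>U\<in>{U. el U}. U)"
  proof
    fix e assume "e \<in> TE"
    then obtain U where "el U" "e \<in> U" using el_exists by blast
    then show "e \<in> (\<Union>U\<in>{U. el U}. U)" by blast
  qed
  interpret fam: sheaf_family M E \<pi> "Sec :: ('m => 'f, 'e => ('e => 'f) set) module" "{U. el U}" "\<lambda>U. U" "\<lambda>U f. ez U f"
  proof (unfold_locales, goal_cases)
    case (1 i) then show ?case by simp
  next
    case 2 show ?case by (rule cover)
  next
    case (3 i f) then show ?case by (simp add: ez_section)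
  next
    case (4 i f g) show ?case by (simp add: ez_add)
  next
    case (5 i f p) show ?case by (simp add: ez_smult)
  next
    case (6 i j e)
    then have e: "el i" "el j" "e \<in> i" "e \<in> j" by simp_all
    have o: "openin (mtop E) (i \<inter> j)" by (intro openin_Int el_open e)
    have "ez i f = ez j f" if f: "f \<in> Cc M (\<pi> ` (i \<inter> j))" for f :: "'m => 'f"
      using ez_mono[OF e(1) o Int_lower1 f] ez_mono[OF e(2) o Int_lower2 f] by simp
    moreover have "\<pi> e \<in> \<pi> ` (i \<inter> j)" using e by simp
    ultimately show ?case using proj_open[OF o] by (intro exI[of _ "\<pi> ` (i \<inter> j)"]) simp
  qed
  \<comment> \<open>The graph generated by this family contains the diagonal, so a section is itself
    a value to which \<open>normal_form\<close> applies.\<close>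
  have gr: "(u, u) \<in> lin_graph Sec Sec fam.gens" if u: "u \<in> CS" for u
  proof (rule section_induct[where P = "\<lambda>u. (u, u) \<in> lin_graph Sec Sec fam.gens" and I = "{U. el U}" and U = "\<lambda>U. U", OF u _ cover])
    show "el i" if "i \<in> {U. el U}" for i using that by simp
    show "((\<lambda>e. germ0 E e), (\<lambda>e. germ0 E e)) \<in> lin_graph Sec Sec fam.gens"
      using lin_graph.zero[of Sec Sec fam.gens] by simp
    show "(sec_add E (ez i f) s, sec_add E (ez i f) s) \<in> lin_graph Sec Sec fam.gens"
      if h: "i \<in> {U. el U}" "f \<in> Cc M (\<pi> ` i)" "s \<in> CS" "(s, s) \<in> lin_graph Sec Sec fam.gens"
      for i f and s :: "'e => ('e => 'f) set"
    proof -
      have "(ez i f, ez i f) \<in> fam.gens" using h(1,2) by blast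
      from lin_graph.add[OF this h(4)] show ?thesis by simp
    qed
  qed
  obtain T1 where T1: "finite T1" "T1 \<subseteq> fam.fib x"
    "\<forall>T. finite T --> T1 \<subseteq> T --> T \<subseteq> fam.fib x --> S.geq x s (finsum Sec (\<lambda>e. ez (fam.idx e) (fam.rep e s)) T)"
    using fam.normal_form[OF gr[OF s] x] by (elim exE conjE)
  obtain T2 where T2: "finite T2" "T2 \<subseteq> fam.fib x"
    "\<forall>T. finite T --> T2 \<subseteq> T --> T \<subseteq> fam.fib x --> S.geq x t (finsum Sec (\<lambda>e. ez (fam.idx e) (fam.rep e t)) T)"
    using fam.normal_form[OF gr[OF t] x] by (elim exE conjE)
  let ?T = "T1 \<union> T2"
  have T: "finite ?T" "?T \<subseteq> fam.fib x" using T1 T2 by simp_all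
  have fib: "e \<in> TE" "\<pi> e = x" if "e \<in> ?T" for e using T(2) that by (auto simp: fam.fib_def)
  have a: "S.geq x s (finsum Sec (\<lambda>e. ez (fam.idx e) (fam.rep e s)) ?T)"
    using T1(3)[rule_format, OF T(1) Un_upper1 T(2)] .
  have b: "S.geq x t (finsum Sec (\<lambda>e. ez (fam.idx e) (fam.rep e t)) ?T)"
    using T2(3)[rule_format, OF T(1) Un_upper2 T(2)] .
  have cl: "ez (fam.idx e) (fam.rep e u) \<in> carrier Sec" if "e \<in> ?T" "u \<in> CS" for e u
    by (rule fam.term_closed[OF fib(1)[OF that(1)] that(2)])
  have same: "finsum Sec (\<lambda>e. ez (fam.idx e) (fam.rep e s)) ?T = finsum Sec (\<lambda>e. ez (fam.idx e) (fam.rep e t)) ?T"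
  proof (rule S.finsum_cong'[OF refl])
    show "(\<lambda>e. ez (fam.idx e) (fam.rep e t)) \<in> ?T \<rightarrow> carrier Sec" using cl[OF _ t] by (rule Pi_I)
    fix e assume "e \<in> ?T"
    \<comment> \<open>The choice in \<open>rep\<close> refers to the section only through its
      coordinate, so equal coordinates give literally the same function.\<close>
    then have "fam.rep e s = fam.rep e t" unfolding fam.rep_def using eq[OF fib] by simp
    then show "ez (fam.idx e) (fam.rep e s) = ez (fam.idx e) (fam.rep e t)" by simp
  qed
  have c: "finsum Sec (\<lambda>e. ez (fam.idx e) (fam.rep e t)) ?T \<in> carrier Sec"
    by (rule S.finsum_closed) (rule Pi_I, rule cl[OF _ t])
  show ?thesis
    by (rule S.geq_trans[OF a[unfolded same] S.geq_sym[OF b] _ c]) (simp_all add: s t)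
qed

lemma geq_loc:
  fixes s t :: "'e => ('e => 'f::real_normed_field) set"
  assumes g: "lmod.geq M Sec (\<pi> e) s t" and e: "e \<in> TE" and s: "s \<in> CS" and t: "t \<in> CS"
  shows "loc e s = loc e t"
proof -
  interpret S: lmod M "Sec :: ('m => 'f, 'e => ('e => 'f) set) module" by (rule Sec_lmod)
  obtain g where g: "g \<in> Cc M TM" "germ M (\<pi> e) g = germ1 M (\<pi> e)" "g \<odot>\<^bsub>Sec\<^esub> s = g \<odot>\<^bsub>Sec\<^esub> t"
    using g by (rule S.geqE)
  have "loc e (smul g u) = loc e u" if u: "u \<in> CS" for u :: "'e => ('e => 'f) set"
  proof -
    obtain p where p: "loc e u = germ M (\<pi> e) p" using loc_rep[OF e u] .
    show ?thesis unfolding loc_smul[OF e u] p by (simp add: S.germ_one_mult[OF g(2)])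
  qed
  from this[OF s] this[OF t] g(3) show ?thesis by simp
qed

text \<open>The product of the coordinates at \<open>e\<close> and \<open>e'\<close> is a balanced
  map and can be evaluated on the comultiplication. For a generator over \<open>U\<close> both
  coordinates are nonzero only if \<open>e\<close> and \<open>e'\<close> lie in \<open>U\<close>,
  and then they coincide because \<pi> is injective there.\<close>

lemma comult_loc:
  fixes s t u :: "'e => ('e => 'f::real_normed_field) set"
  assumes e: "e \<in> TE" and e': "e' \<in> TE" and ee: "\<pi> e' = \<pi> e"
    and s: "s \<in> CS" and t: "t \<in> CS" and u: "u \<in> CS"
    and cm: "sheaf_comult M E \<pi> u = ts s t"
  shows "loc e s \<otimes>\<^bsub>germ_ring M (\<pi> e)\<^esub> loc e' t = (if e = e' then loc e u else germ0 M (\<pi> e))"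
proof -
  interpret S: lmod M "Sec :: ('m => 'f, 'e => ('e => 'f) set) module" by (rule Sec_lmod)
  let ?x = "\<pi> e"
  let ?G = "germ_ring M ?x :: ('m => 'f) set ring"
  have x: "?x \<in> TM" by (rule proj_in[OF e])
  interpret GR: abelian_group ?G by (rule germ_ring_abelian_group[OF x])
  let ?h = "\<lambda>(a, b). loc e a \<otimes>\<^bsub>?G\<^esub> loc e' b"
  have add': "loc e' (sec_add E a b) = loc e' a \<oplus>\<^bsub>?G\<^esub> loc e' b" if "a \<in> CS" "b \<in> CS" for a b
    using loc_add[OF e' that] ee by simp
  have smul': "loc e' (smul p a) = germ M ?x p \<otimes>\<^bsub>?G\<^esub> loc e' a" if "a \<in> CS" for p a
    using loc_smul[OF e' that] ee by simp
  have ex: "\<exists>p. p \<in> Cc M TM \<and> loc e a = germ M ?x p" "\<exists>p. p \<in> Cc M TM \<and> loc e' a = germ M ?x p"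
    if a: "a \<in> CS" for a :: "'e => ('e => 'f) set"
  proof -
    obtain p where "p \<in> Cc M TM" "loc e a = germ M (\<pi> e) p" by (rule loc_rep[OF e a])
    then show "\<exists>p. p \<in> Cc M TM \<and> loc e a = germ M ?x p" by (intro exI conjI)
    obtain q where "q \<in> Cc M TM" "loc e' a = germ M (\<pi> e') q" by (rule loc_rep[OF e' a])
    then show "\<exists>p. p \<in> Cc M TM \<and> loc e' a = germ M ?x p" unfolding ee by (intro exI conjI)
  qed
  have hc: "loc e a \<otimes>\<^bsub>?G\<^esub> loc e' b \<in> carrier ?G" if ab: "a \<in> CS" "b \<in> CS" for a b
  proof -
    obtain p q where p: "p \<in> Cc M TM" "loc e a = germ M ?x p" and q: "q \<in> Cc M TM" "loc e' b = germ M ?x q"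
      using ex(1)[OF ab(1)] ex(2)[OF ab(2)] by (elim exE conjE)
    show ?thesis using Cc_germ_in_ring[OF x Cc_mult[OF p(1) q(1)]] by (simp add: p(2) q(2))
  qed
  have a1: "loc e (sec_add E a a') \<otimes>\<^bsub>?G\<^esub> loc e' b = (loc e a \<otimes>\<^bsub>?G\<^esub> loc e' b) \<oplus>\<^bsub>?G\<^esub> (loc e a' \<otimes>\<^bsub>?G\<^esub> loc e' b)"
    if ab: "a \<in> CS" "a' \<in> CS" "b \<in> CS" for a a' b
  proof -
    obtain p p' q where p: "loc e a = germ M ?x p" "loc e a' = germ M ?x p'" "loc e' b = germ M ?x q"
      using ex(1)[OF ab(1)] ex(1)[OF ab(2)] ex(2)[OF ab(3)] by (elim exE conjE)
    show ?thesis by (simp add: loc_add[OF e ab(1,2)] p distrib_right)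
  qed
  have a2: "loc e a \<otimes>\<^bsub>?G\<^esub> loc e' (sec_add E b b') = (loc e a \<otimes>\<^bsub>?G\<^esub> loc e' b) \<oplus>\<^bsub>?G\<^esub> (loc e a \<otimes>\<^bsub>?G\<^esub> loc e' b')"
    if ab: "a \<in> CS" "b \<in> CS" "b' \<in> CS" for a b b'
  proof -
    obtain p q q' where p: "loc e a = germ M ?x p" "loc e' b = germ M ?x q" "loc e' b' = germ M ?x q'"
      using ex(1)[OF ab(1)] ex(2)[OF ab(2)] ex(2)[OF ab(3)] by (elim exE conjE)
    show ?thesis by (simp add: add'[OF ab(2,3)] p distrib_left)
  qed
  have sm: "loc e (smul r a) \<otimes>\<^bsub>?G\<^esub> loc e' b = loc e a \<otimes>\<^bsub>?G\<^esub> loc e' (smul r b)"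
    if ab: "a \<in> CS" "b \<in> CS" for r a b
  proof -
    obtain p q where p: "loc e a = germ M ?x p" "loc e' b = germ M ?x q"
      using ex(1)[OF ab(1)] ex(2)[OF ab(2)] by (elim exE conjE)
    show ?thesis by (simp add: loc_smul[OF e ab(1)] smul'[OF ab(2)] p mult.assoc mult.left_commute)
  qed
  have bal: "balanced RM Sec Sec (add_monoid ?G) ?h"
    unfolding balanced_def using hc a1 a2 sm by simp
  note L = S.AA.tensor_lift[OF GR.a_comm_group bal]
  let ?L = "tensor_lift (add_monoid ?G) ?h"
  have L1: "?L \<one>\<^bsub>S.AA.TAB\<^esub> = germ0 M ?x"
    using hom_one[OF L(1) comm_group.axioms(2)[OF S.AA.TAB_comm_group] comm_group.axioms(2)[OF GR.a_comm_group]] by simp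
  have cz: "sheaf_comult M E \<pi> (\<lambda>e. germ E e (\<lambda>_. 0 :: 'f)) = \<one>\<^bsub>S.AA.TAB\<^esub>"
    using rlinear_zero[OF Sec_abelian_group S.AA.tensor_abelian_group sheaf_comult(1)] by simp
  have ma: "sheaf_comult M E \<pi> (sec_add E a b) = sheaf_comult M E \<pi> a \<otimes>\<^bsub>S.AA.TAB\<^esub> sheaf_comult M E \<pi> b"
    "sheaf_comult M E \<pi> a \<in> carrier S.AA.TAB"
    if "a \<in> CS" "b \<in> CS" for a b :: "'e => ('e => 'f) set"
    using rlinear_add[OF sheaf_comult(1), of a b] rlinear_closed[OF sheaf_comult(1), of a] that by simp_all
  have cover: "TE \<subseteq> (\<Union>U\<in>{U. el U}. U)"
  proof
    fix e assume "e \<in> TE"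
    then obtain U where "el U" "e \<in> U" using el_exists by blast
    then show "e \<in> (\<Union>U\<in>{U. el U}. U)" by blast
  qed
  let ?Q = "\<lambda>v. ?L (sheaf_comult M E \<pi> v) = (if e = e' then loc e v else germ0 M ?x)"
  have "?Q u"
  proof (rule section_induct[where P = ?Q and I = "{U. el U}" and U = "\<lambda>U. U", OF u _ cover])
    show "el i" if "i \<in> {U. el U}" for i using that by simp
    show "?Q (\<lambda>e. germ0 E e)" unfolding cz L1 loc_zero[OF e] by simp
    fix U :: "'e set" and f :: "'m => 'f" and v
    assume U': "U \<in> {U. el U}" and f: "f \<in> Cc M (\<pi> ` U)" and v: "v \<in> CS" and IH: "?Q v"
    have U: "el U" using U' by simp
    obtain \<eta> :: "'m => 'f" where h: "\<eta> \<in> Cc M (\<pi> ` U)" "(\<lambda>y. \<eta> y * f y) = f" using Cc_unit[OF f] .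
    have sec: "ez U f \<in> CS" "ez U \<eta> \<in> CS" by (rule ez_section[OF U f], rule ez_section[OF U h(1)])
    have fh: "(\<lambda>y. f y * \<eta> y) = f" using h(2) by (simp add: mult.commute)
    have "?L (sheaf_comult M E \<pi> (ez U f)) = loc e (ez U f) \<otimes>\<^bsub>?G\<^esub> loc e' (ez U \<eta>)"
      using L(2)[of "ez U f" "ez U \<eta>"] sec sheaf_comult(2)[OF U f h] by simp
    also have "\<dots> = (if e = e' then loc e (ez U f) else germ0 M ?x)"
    proof (cases "e = e'")
      case True
      then show ?thesis using loc_ez[OF e U f] loc_ez[OF e U h(1)] fh by simp
    next
      case False
      then have "e \<notin> U \<or> e' \<notin> U" using inj_onD[OF el_inj[OF U], of e e'] ee by auto
      then show ?thesis using loc_ez[OF e U f] loc_ez[OF e' U h(1)] ee False by auto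
    qed
    finally have g: "?L (sheaf_comult M E \<pi> (ez U f)) = (if e = e' then loc e (ez U f) else germ0 M ?x)" .
    have "?L (sheaf_comult M E \<pi> (sec_add E (ez U f) v)) =
        ?L (sheaf_comult M E \<pi> (ez U f)) \<oplus>\<^bsub>?G\<^esub> ?L (sheaf_comult M E \<pi> v)"
      unfolding ma(1)[OF sec(1) v] using hom_mult[OF L(1) ma(2)[OF sec(1) v] ma(2)[OF v v]] by simp
    then show "?Q (sec_add E (ez U f) v)" unfolding g IH loc_add[OF e sec(1) v] by (cases "e = e'") simp_all
  qed
  then show ?thesis unfolding cm using L(2)[of s t] s t by simp
qed

section \<open>Sections attached to the points of a sheaf, and the sections that are grouplike near
  a point\<close>

definition bmp :: "'e => 'm => 'f::real_normed_field" where
  "bmp e = (SOME b. b \<in> Cc M (\<pi> ` el_of e) \<and> germ M (\<pi> e) b = germ1 M (\<pi> e))"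

text \<open>Over \<open>\<pi> e\<close> this section has coordinate 1 at \<open>e\<close> and 0 at
  all other points of the fibre; it represents the grouplike element that belongs to the point
  \<open>e\<close>.\<close>

definition usec :: "'e => 'e => ('e => 'f::real_normed_field) set" where
  "usec e = ez (el_of e) (bmp e)"

lemma el_of_el: assumes "e \<in> TE" shows "el (el_of e)" "e \<in> el_of e"
  using someI_ex[OF el_exists[OF assms]] by (simp_all add: el_of_def)

lemma bmp:
  assumes e: "e \<in> TE"
  shows "(bmp e :: 'm => 'f::real_normed_field) \<in> Cc M (\<pi> ` el_of e)"
    "germ M (\<pi> e) (bmp e :: 'm => 'f) = germ1 M (\<pi> e)"
proof -
  obtain b :: "'m => 'f" where "b \<in> Cc M (\<pi> ` el_of e)" "germ M (\<pi> e) b = germ1 M (\<pi> e)"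
    by (rule bump[OF el_image_open[OF el_of_el(1)[OF e]] imageI[OF el_of_el(2)[OF e]]])
  then have "b \<in> Cc M (\<pi> ` el_of e) \<and> germ M (\<pi> e) b = germ1 M (\<pi> e)" by simp
  from someI[where P = "\<lambda>b. b \<in> Cc M (\<pi> ` el_of e) \<and> germ M (\<pi> e) b = germ1 M (\<pi> e)", OF this]
  show "(bmp e :: 'm => 'f) \<in> Cc M (\<pi> ` el_of e)" "germ M (\<pi> e) (bmp e :: 'm => 'f) = germ1 M (\<pi> e)"
    by (simp_all add: bmp_def)
qed

lemma usec_section: "e \<in> TE ==> usec e \<in> CS"
  unfolding usec_def by (rule ez_section[OF el_of_el(1) bmp(1)])

text \<open>The section attached to \<open>e0\<close> also does the service of the one attached to a
  nearby point \<open>e\<close>. This is what later makes the map to the spectral sheaf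
  open.\<close>

lemma loc_usec_near:
  assumes e0: "e0 \<in> TE" and e: "e \<in> el_of e0"
    and b: "germ M (\<pi> e) (bmp e0 :: 'm => 'f::real_normed_field) = germ1 M (\<pi> e)"
    and e': "e' \<in> TE" "\<pi> e' = \<pi> e"
  shows "loc e' (usec e0 :: 'e => ('e => 'f) set) = (if e' = e then germ1 M (\<pi> e) else germ0 M (\<pi> e))"
proof (cases "e' \<in> el_of e0")
  case True
  then have "e' = e" using inj_onD[OF el_inj[OF el_of_el(1)[OF e0]] e'(2)] e by simp
  then show ?thesis unfolding usec_def loc_ez[OF e'(1) el_of_el(1)[OF e0] bmp(1)[OF e0]] using True b by simp
next
  case False
  then show ?thesis unfolding usec_def loc_ez[OF e'(1) el_of_el(1)[OF e0] bmp(1)[OF e0]] using e e'(2) by auto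
qed

lemmas loc_usec = loc_usec_near[OF _ el_of_el(2) bmp(2)]

text \<open>
  The coordinates of a section \<open>s\<close> with \<open>\<Delta>(s) = s \<otimes> s\<close> near \<open>x\<close> are orthogonal idempotent germs, so that
  at most one of them is nonzero, and that one is \<open>1\<close>.
\<close>

lemma comult_delta:
  fixes s s' :: "'e => ('e => 'f::real_normed_field) set"
  assumes x: "x \<in> TM" and s: "s \<in> CS" and s': "s' \<in> CS"
    and cm: "sheaf_comult M E \<pi> s = ts s s'" and ss': "lmod.geq M Sec x s s'"
    and nz: "\<not> lmod.geq M Sec x s (\<lambda>e. germ0 E e)"
  obtains e where "e \<in> TE" "\<pi> e = x" "lmod.geq M Sec x s (usec e)"
proof -
  have "\<exists>e. e \<in> TE \<and> \<pi> e = x \<and> loc e s \<noteq> germ0 M x"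
  proof (rule ccontr)
    assume no: "\<not> (\<exists>e. e \<in> TE \<and> \<pi> e = x \<and> loc e s \<noteq> germ0 M x)"
    have "lmod.geq M Sec x s (\<lambda>e. germ0 E e)"
    proof (rule loc_determines[OF x s zero_section])
      fix e assume e: "e \<in> TE" "\<pi> e = x"
      then show "loc e s = loc e (\<lambda>e. germ0 E e)" unfolding loc_zero[OF e(1)] using no by auto
    qed
    then show False using nz by simp
  qed
  then obtain e where e: "e \<in> TE" "\<pi> e = x" and ne: "loc e s \<noteq> germ0 M x" by (elim exE conjE)
  have orth: "loc e s \<otimes>\<^bsub>germ_ring M x\<^esub> loc e' s = (if e = e' then loc e s else germ0 M x)"
    if e': "e' \<in> TE" "\<pi> e' = x" for e'
  proof -
    have "loc e' s = loc e' s'" by (rule geq_loc) (use ss' e' s s' in simp_all)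
    then show ?thesis using comult_loc[OF e(1) e'(1) _ s s' s cm] e(2) e'(2) by simp
  qed
  obtain p where p: "p \<in> Cc M TM" "loc e s = germ M (\<pi> e) p" using loc_rep[OF e(1) s] .
  have "germ M x (\<lambda>y. p y * p y) = germ M x p" using orth[OF e] p(2) e(2) by simp
  then have one: "loc e s = germ1 M x" using germ_idempotent[OF p(1) x] ne p(2) e(2) by auto
  have zero: "loc e' s = germ0 M x" if e': "e' \<in> TE" "\<pi> e' = x" "e' \<noteq> e" for e'
  proof -
    obtain q where q: "loc e' s = germ M (\<pi> e') q" using loc_rep[OF e'(1) s] .
    then show ?thesis using orth[OF e'(1,2)] one e' by simp
  qed
  have "lmod.geq M Sec x s (usec e)"
  proof (rule loc_determines[OF x s usec_section[OF e(1)]])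
    fix e' assume e': "e' \<in> TE" "\<pi> e' = x"
    have "loc e' (usec e :: 'e => ('e => 'f) set) = (if e' = e then germ1 M (\<pi> e) else germ0 M (\<pi> e))"
      by (rule loc_usec[OF e(1) e(1) e(1) e'(1)]) (simp add: e(2) e'(2))
    then show "loc e' s = loc e' (usec e)" using one zero[OF e'] e(2) by auto
  qed
  then show ?thesis by (rule that[OF e])
qed

end

section \<open>Coalgebras isomorphic to a sheaf coalgebra\<close>

locale presented = sheaf M E \<pi> + coalg M C
  for M :: "'m manifold" and E :: "'e manifold" and \<pi> :: "'e => 'm"
    and C :: "('m => 'f::real_normed_field, 'c) coalgebra" (structure) +
  fixes \<alpha> :: "'c => 'e => ('e => 'f) set" and \<beta> :: "('e => ('e => 'f) set) => 'c"
  assumes hom_\<alpha>: "coalgebra_hom RM C (sheaf_coalgebra M E \<pi>) \<alpha>"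
    and hom_\<beta>: "coalgebra_hom RM (sheaf_coalgebra M E \<pi>) C \<beta>"
    and \<beta>\<alpha>: "c \<in> carrier C ==> \<beta> (\<alpha> c) = c"
    and \<alpha>\<beta>: "s \<in> CS ==> \<alpha> (\<beta> s) = s"
begin

interpretation S: lmod M "Sec :: ('m => 'f, 'e => ('e => 'f) set) module"
  by (rule Sec_lmod)

lemma \<alpha>_linear: "rlinear RM C Sec \<alpha>"
  using hom_\<alpha> by (simp add: coalgebra_hom_def rlinear_def sheaf_coalgebra_simps)

lemma \<beta>_linear: "rlinear RM Sec C \<beta>"
  using hom_\<beta> by (simp add: coalgebra_hom_def rlinear_def sheaf_coalgebra_simps)

lemma \<alpha>_closed: "c \<in> carrier C ==> \<alpha> c \<in> CS"
  using rlinear_closed[OF \<alpha>_linear] by simp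

lemma \<beta>_closed: "s \<in> CS ==> \<beta> s \<in> carrier C"
  using rlinear_closed[OF \<beta>_linear, of s] by simp

lemma \<beta>_geq: "S.geq x s t ==> s \<in> CS ==> t \<in> CS ==> geq x (\<beta> s) (\<beta> t)"
  by (rule S.rlinear_geq[OF \<beta>_linear _ _ _ lmod_axioms]) simp_all

lemma \<alpha>_geq: "geq x c d ==> c \<in> carrier C ==> d \<in> carrier C ==> S.geq x (\<alpha> c) (\<alpha> d)"
  by (rule rlinear_geq[OF \<alpha>_linear _ _ _ S.lmod_axioms])

lemma \<alpha>_comult:
  assumes c: "c \<in> carrier C" "c' \<in> carrier C" "d \<in> carrier C" and cm: "comult C d = tn c c'"
  shows "sheaf_comult M E \<pi> (\<alpha> d) = ts (\<alpha> c) (\<alpha> c')"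
proof -
  have bal: "balanced RM C C S.AA.TAB (\<lambda>(a, b). ts (\<alpha> a) (\<alpha> b))"
    unfolding balanced_def
    by (simp add: rlinear_closed[OF \<alpha>_linear] rlinear_add[OF \<alpha>_linear] rlinear_smult[OF \<alpha>_linear]
        S.AA.tens_add_left S.AA.tens_add_right S.AA.tens_smult del: Sec_simps)
  have "tensor_lift S.AA.TAB (\<lambda>(a, b). ts (\<alpha> a) (\<alpha> b)) (comult C d) = sheaf_comult M E \<pi> (\<alpha> d)"
    using hom_\<alpha> c(3) by (simp add: coalgebra_hom_def sheaf_coalgebra_simps sheaf_coalgebra_tensor)
  then show ?thesis using AA.tensor_lift(2)[OF S.AA.TAB_comm_group bal c(1,2)] cm by simp
qed

text \<open>The comultiplication of a generator is a pure tensor whose first factor is the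
  generator, and \<beta> preserves this as well as the counit.\<close>

lemma \<beta>_ez:
  assumes U: "el U" and f: "f \<in> Cc M (\<pi> ` U)"
  shows "\<beta> (ez U f) \<in> WG" "counit C (\<beta> (ez U f)) = f"
proof -
  note lin = rlinear_closed[OF \<beta>_linear, simplified Sec_simps] rlinear_add[OF \<beta>_linear, simplified Sec_simps]
    rlinear_smult[OF \<beta>_linear, simplified Sec_simps carrier_Cc_ring]
  have bal: "balanced RM Sec Sec AA.TAB (\<lambda>(a, b). tn (\<beta> a) (\<beta> b))"
    unfolding balanced_def by (simp add: lin AA.tens_add_left AA.tens_add_right AA.tens_smult)
  obtain \<eta> :: "'m => 'f" where h: "\<eta> \<in> Cc M (\<pi> ` U)" "(\<lambda>y. \<eta> y * f y) = f" using Cc_unit[OF f] .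
  have s: "ez U f \<in> CS" "ez U \<eta> \<in> CS" by (rule ez_section[OF U f], rule ez_section[OF U h(1)])
  have "tensor_lift AA.TAB (\<lambda>(a, b). tn (\<beta> a) (\<beta> b)) (sheaf_comult M E \<pi> (ez U f)) = comult C (\<beta> (ez U f))"
    and "counit C (\<beta> (ez U f)) = sheaf_counit M E \<pi> (ez U f)"
    using hom_\<beta> s(1) by (simp_all add: coalgebra_hom_def sheaf_coalgebra_simps)
  then have "comult C (\<beta> (ez U f)) = tn (\<beta> (ez U f)) (\<beta> (ez U \<eta>))" and e: "counit C (\<beta> (ez U f)) = f"
    using S.AA.tensor_lift(2)[OF AA.TAB_comm_group bal, of "ez U f" "ez U \<eta>"] s sheaf_comult(2)[OF U f h] sheaf_counit(2)[OF U f]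
    by simp_all
  then show "\<beta> (ez U f) \<in> WG" unfolding weakly_grouplike_def using \<beta>_closed[OF s(1)] \<beta>_closed[OF s(2)] by blast
  show "counit C (\<beta> (ez U f)) = f" by (rule e)
qed

definition w :: "'e => 'c" where "w e = \<beta> (usec e)"

lemma w:
  assumes e: "e \<in> TE"
  shows "w e \<in> WG" "counit C (w e) = bmp e" "normalized_at M C (w e) (\<pi> e)" "w e \<in> carrier C"
proof -
  show 1: "w e \<in> WG" "counit C (w e) = bmp e"
    unfolding w_def usec_def by (rule \<beta>_ez[OF el_of_el(1)[OF e] bmp(1)[OF e]])+
  show "normalized_at M C (w e) (\<pi> e)" unfolding normalized_at_def 1(2) by (rule bmp(2)[OF e])
  show "w e \<in> carrier C" using 1(1) by (rule WG_carrier)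
qed

text \<open>The section \<open>\<alpha> c\<close> satisfies the hypotheses of
  \<open>comult_delta\<close>: its second tensor factor agrees with it near \<open>x\<close>, where
  \<open>c\<close> is normalized, and it is not zero near \<open>x\<close>, because the counit of
  \<open>c\<close> takes the value 1 there.\<close>

lemma w_cover:
  assumes c: "c \<in> WG" "normalized_at M C c x" and x: "x \<in> TM"
  obtains e where "e \<in> TE" "\<pi> e = x" "geq x c (w e)"
proof -
  have cC: "c \<in> carrier C" using c(1) by (rule WG_carrier)
  obtain c' where c': "c' \<in> carrier C" "comult C c = tn c c'" "geq x c c'" by (rule WG_germ[OF c x])
  have nz: "\<not> S.geq x (\<alpha> c) (\<lambda>e. germ0 E e)"
  proof
    assume g: "S.geq x (\<alpha> c) (\<lambda>e. germ0 E e)"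
    have "\<beta> (\<lambda>e. germ0 E e) = \<zero>" using rlinear_zero[OF Sec_abelian_group abelian_group_axioms \<beta>_linear] by simp
    then have "geq x c \<zero>" using \<beta>_geq[OF g \<alpha>_closed[OF cC] zero_section] \<beta>\<alpha>[OF cC] by simp
    then obtain g where g: "g \<in> Cc M TM" "germ M x g = germ1 M x" "g \<odot> c = g \<odot> \<zero>" by (rule geqE)
    have "counit C (g \<odot> c) = counit C ((\<lambda>_. 0) \<odot> c)" using g cC by simp
    then have "g x * counit C c x = 0" using counit_smult[OF g(1) cC] counit_smult[OF zero_in_Cc cC] by (metis mult_zero_left)
    moreover have "g x = 1" by (rule germ_value[OF x g(2)])
    moreover have "counit C c x = 1" by (rule germ_value[OF x c(2)[unfolded normalized_at_def]])
    ultimately show False by simp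
  qed
  obtain e where e: "e \<in> TE" "\<pi> e = x" "S.geq x (\<alpha> c) (usec e)"
    by (rule comult_delta[OF x \<alpha>_closed[OF cC] \<alpha>_closed[OF c'(1)] \<alpha>_comult[OF cC c'(1) cC c'(2)] \<alpha>_geq[OF c'(3) cC c'(1)] nz])
  have "geq x c (w e)" using \<beta>_geq[OF e(3) \<alpha>_closed[OF cC] usec_section[OF e(1)]] \<beta>\<alpha>[OF cC] by (simp add: w_def)
  then show ?thesis by (rule that[OF e(1,2)])
qed

lemma loc_w:
  assumes c: "c \<in> carrier C" and e: "e \<in> TE" "e' \<in> TE" "\<pi> e' = \<pi> e" and g: "geq (\<pi> e) c (w e)"
  shows "loc e' (\<alpha> c) = (if e' = e then germ1 M (\<pi> e) else germ0 M (\<pi> e))"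
proof -
  have "S.geq (\<pi> e') (\<alpha> c) (usec e)"
    using \<alpha>_geq[OF g c w(4)[OF e(1)]] \<alpha>\<beta>[OF usec_section[OF e(1)]] e(3) by (simp add: w_def)
  then have "loc e' (\<alpha> c) = loc e' (usec e)" by (rule geq_loc[OF _ e(2) \<alpha>_closed[OF c] usec_section[OF e(1)]])
  then show ?thesis unfolding loc_usec[OF e(1) e(1) e(1) e(2,3)] .
qed

lemma germ_one_neq_zero: "x \<in> TM ==> germ M x (\<lambda>_. 1 :: 'f) \<noteq> germ0 M x"
  using germ_value[of x M "\<lambda>_. 1 :: 'f" "\<lambda>_. 0"] by auto

text \<open>The coordinate of \<open>\<alpha> (w e')\<close> at \<open>e'\<close> is 1, whereas for
  \<open>e'\<close> different from \<open>e\<close> the assumption would make it 0.\<close>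

lemma w_inj:
  assumes e: "e \<in> TE" "e' \<in> TE" "\<pi> e' = \<pi> e" and g: "geq (\<pi> e) (w e') (w e)"
  shows "e' = e"
proof (rule ccontr)
  assume ne: "e' \<noteq> e"
  have "loc e' (\<alpha> (w e')) = germ0 M (\<pi> e)" using loc_w[OF w(4)[OF e(2)] e g] ne by simp
  moreover have "loc e' (\<alpha> (w e')) = germ1 M (\<pi> e')"
    using loc_w[OF w(4)[OF e(2)] e(2) e(2) refl geq_refl[OF proj_in[OF e(2)]]] by simp
  ultimately show False using germ_one_neq_zero[OF proj_in[OF e(1)]] e(3) by simp
qed

text \<open>A generator with coefficient \<open>f\<close> is \<open>f\<close> times the generator
  with a coefficient \<open>h\<close> that is 1 near the support of \<open>f\<close>. Under \<beta>
  the latter becomes a weakly grouplike element with counit \<open>h\<close>, so it is normalized on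
  that support.\<close>

lemma generates: "normally_generates M C WG"
  unfolding normally_generates_def
proof
  fix d assume d: "d \<in> carrier C"
  obtain k :: nat and U and f :: "nat => 'm => 'f" where k: "\<forall>i<k. el (U i) \<and> f i \<in> Cc M (\<pi> ` U i)"
    and s: "\<alpha> d = finsum Sec (\<lambda>i. ez (U i) (f i)) {..<k}" using section_sum[OF \<alpha>_closed[OF d]] .
  have "\<forall>i\<in>{..<k}. \<exists>\<eta>. \<eta> \<in> Cc M (\<pi> ` U i) \<and> (\<forall>x\<in>supp M (f i). germ M x \<eta> = germ1 M x) \<and> (\<lambda>y. f i y * \<eta> y) = f i"
  proof
    fix i assume "i \<in> {..<k}"
    then have "f i \<in> Cc M (\<pi> ` U i)" using k by simp
    then obtain h :: "'m => 'f" where h: "h \<in> Cc M (\<pi> ` U i)"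
      "\<And>x. x \<in> supp M (f i) ==> germ M x h = germ1 M x" "\<And>x. f i x \<noteq> 0 ==> h x = 1"
      by (rule Cc_support_bump) (rule that, assumption, simp, simp)
    have "(\<lambda>y. f i y * h y) = f i"
    proof
      fix y show "f i y * h y = f i y" using h(3)[of y] by (cases "f i y = 0") simp_all
    qed
    then show "\<exists>\<eta>. \<eta> \<in> Cc M (\<pi> ` U i) \<and> (\<forall>x\<in>supp M (f i). germ M x \<eta> = germ1 M x) \<and> (\<lambda>y. f i y * \<eta> y) = f i"
      using h(1,2) by (intro exI[of _ h]) simp
  qed
  then obtain h where h: "\<forall>i\<in>{..<k}. h i \<in> Cc M (\<pi> ` U i) \<and> (\<forall>x\<in>supp M (f i). germ M x (h i) = germ1 M x) \<and> (\<lambda>y. f i y * h i y) = f i"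
    by (rule bchoice[THEN exE])
  let ?c = "\<lambda>i. \<beta> (ez (U i) (h i))"
  have i: "el (U i)" "f i \<in> Cc M (\<pi> ` U i)" "h i \<in> Cc M (\<pi> ` U i)" "(\<lambda>y. f i y * h i y) = f i"
    "ez (U i) (f i) \<in> CS" "ez (U i) (h i) \<in> CS" "f i \<in> Cc M TM" "?c i \<in> WG" if "i < k" for i
  proof -
    show 1: "el (U i)" "f i \<in> Cc M (\<pi> ` U i)" "h i \<in> Cc M (\<pi> ` U i)" "(\<lambda>y. f i y * h i y) = f i"
      using k h that by simp_all
    show "ez (U i) (f i) \<in> CS" by (rule ez_section[OF 1(1,2)])
    show "ez (U i) (h i) \<in> CS" by (rule ez_section[OF 1(1,3)])
    show "f i \<in> Cc M TM" by (rule Cc_in_ring[OF 1(2)])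
    show "?c i \<in> WG" by (rule \<beta>_ez(1)[OF 1(1,3)])
  qed
  have gen: "\<beta> (ez (U i) (f i)) = f i \<odot> ?c i" if "i < k" for i
  proof -
    have "ez (U i) (f i) = f i \<odot>\<^bsub>Sec\<^esub> ez (U i) (h i)" using i(4)[OF that] by (simp add: ez_smult)
    then show ?thesis using rlinear_smult[OF \<beta>_linear, of "f i" "ez (U i) (h i)"] i[OF that] by simp
  qed
  have "d = \<beta> (finsum Sec (\<lambda>i. ez (U i) (f i)) {..<k})" using \<beta>\<alpha>[OF d] s by simp
  also have "\<dots> = finsum C (\<lambda>i. \<beta> (ez (U i) (f i))) {..<k}"
    by (rule rlinear_finsum[OF Sec_abelian_group abelian_group_axioms \<beta>_linear]) (simp add: i(5))
  also have "\<dots> = finsum C (\<lambda>i. f i \<odot> ?c i) {..<k}"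
  proof (rule finsum_cong'[OF refl])
    show "(\<lambda>i. f i \<odot> ?c i) \<in> {..<k} \<rightarrow> carrier C" using i(7) WG_carrier[OF i(8)] by (simp add: Pi_iff)
    show "\<beta> (ez (U i) (f i)) = f i \<odot> ?c i" if "i \<in> {..<k}" for i using gen that by simp
  qed
  finally have dd: "d = finsum C (\<lambda>i. f i \<odot> ?c i) {..<k}" .
  show "\<exists>(k::nat) f c. (\<forall>i<k. f i \<in> carrier RM \<and> c i \<in> WG \<and> normalized_on M C (c i) (supp M (f i))) \<and>
      d = finsum C (\<lambda>i. f i \<odot> c i) {..<k}"
  proof (rule exI[of _ k], rule exI[of _ f], rule exI[of _ ?c], intro conjI allI impI)
    fix j assume j: "j < k"
    show "f j \<in> carrier RM" "?c j \<in> WG" using i(7,8)[OF j] by simp_all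
    have "counit C (?c j) = h j" by (rule \<beta>_ez(2)[OF i(1)[OF j] i(3)[OF j]])
    then show "normalized_on M C (?c j) (supp M (f j))"
      unfolding normalized_on_def normalized_at_def using h j by simp
  qed (rule dd)
qed

lemma loc_finsum_zero:
  assumes e: "e \<in> TE" and "finite J" and "\<And>i. i \<in> J ==> a i \<in> carrier C"
    and "\<And>i. i \<in> J ==> loc e (\<alpha> (a i)) = germ0 M (\<pi> e)"
  shows "loc e (\<alpha> (finsum C a J)) = germ0 M (\<pi> e)"
  using assms(2-)
proof (induction J)
  case empty
  have "\<alpha> \<zero> = (\<lambda>e. germ0 E e)" using rlinear_zero[OF abelian_group_axioms Sec_abelian_group \<alpha>_linear] by simp
  then show ?case by (simp add: loc_zero[OF e])
next
  case (insert i J)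
  have c: "a i \<in> carrier C" "a \<in> J \<rightarrow> carrier C" "finsum C a J \<in> carrier C" using insert.prems(1) by auto
  have "\<alpha> (finsum C a (insert i J)) = sec_add E (\<alpha> (a i)) (\<alpha> (finsum C a J))"
    using rlinear_add[OF \<alpha>_linear c(1,3)] insert.hyps c by simp
  then show ?case using loc_add[OF e \<alpha>_closed[OF c(1)] \<alpha>_closed[OF c(3)]] insert by simp
qed

text \<open>Near \<open>x\<close> each \<open>c i\<close> agrees with \<open>w (e i)\<close> for
  some point of the fibre. If two of these points coincide, the second alternative holds. Otherwise
  the coordinate at \<open>e j\<close> of the relation retains only the germ of
  \<open>f j\<close>.\<close>

lemma independent: "normally_lin_indep M C WG"
  unfolding normally_lin_indep_def
proof (intro ballI allI impI, elim conjE)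
  fix x and k :: nat and c f
  assume x: "x \<in> TM" and cf: "\<forall>i<k. c i \<in> WG \<and> normalized_at M C (c i) x \<and> f i \<in> carrier RM"
    and z: "finsum C (\<lambda>i. f i \<odot> c i) {..<k} = \<zero>"
  have cC: "c i \<in> carrier C" "f i \<in> Cc M TM" if "i < k" for i using cf that WG_carrier by simp_all
  have "\<forall>i\<in>{..<k}. \<exists>e. e \<in> TE \<and> \<pi> e = x \<and> geq x (c i) (w e)"
  proof
    fix i assume "i \<in> {..<k}"
    then have ci: "c i \<in> WG" "normalized_at M C (c i) x" using cf by simp_all
    obtain e where "e \<in> TE" "\<pi> e = x" "geq x (c i) (w e)" by (rule w_cover[OF ci x])
    then show "\<exists>e. e \<in> TE \<and> \<pi> e = x \<and> geq x (c i) (w e)" by (intro exI conjI)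
  qed
  then obtain e where "\<forall>i\<in>{..<k}. e i \<in> TE \<and> \<pi> (e i) = x \<and> geq x (c i) (w (e i))" by (rule bchoice[THEN exE])
  then have e: "e i \<in> TE" "\<pi> (e i) = x" "geq x (c i) (w (e i))" if "i < k" for i using that by simp_all
  show "(\<forall>i<k. germ M x (f i) = germ0 M x) \<or>
      (\<exists>i<k. \<exists>j<k. i \<noteq> j \<and> (\<exists>g \<in> carrier RM. germ M x g = germ1 M x \<and> g \<odot> c i = g \<odot> c j))"
    (is "?A \<or> ?B")
  proof (cases "\<exists>i<k. \<exists>j<k. i \<noteq> j \<and> e i = e j")
    case True
    then obtain i j where ij: "i < k" "j < k" "i \<noteq> j" "e i = e j" by (elim exE conjE)
    have gj: "geq x (w (e i)) (c j)" using geq_sym[OF e(3)[OF ij(2)]] ij(4) by simp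
    have "geq x (c i) (c j)"
      by (rule geq_trans[OF e(3)[OF ij(1)] gj cC(1)[OF ij(1)] w(4)[OF e(1)[OF ij(1)]] cC(1)[OF ij(2)]])
    then obtain g where "g \<in> Cc M TM" "germ M x g = germ1 M x" "g \<odot> c i = g \<odot> c j" by (rule geqE)
    then have "\<exists>g \<in> carrier RM. germ M x g = germ1 M x \<and> g \<odot> c i = g \<odot> c j"
      by (intro bexI[of _ g] conjI) simp_all
    then have ?B using ij(1-3) by (intro exI[of _ i] exI[of _ j] conjI)
    then show ?thesis ..
  next
    case False
    have "germ M x (f j) = germ0 M x" if j: "j < k" for j
    proof -
      have locs: "loc (e j) (\<alpha> (f i \<odot> c i)) = (if i = j then germ M x (f j) else germ0 M x)" if i: "i < k" for i
      proof -
        have g: "geq (\<pi> (e i)) (c i) (w (e i))" using e(2,3)[OF i] by simp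
        have pe: "\<pi> (e j) = \<pi> (e i)" using e(2)[OF i] e(2)[OF j] by simp
        have 1: "loc (e j) (\<alpha> (c i)) = (if e j = e i then germ1 M x else germ0 M x)"
          using loc_w[OF cC(1)[OF i] e(1)[OF i] e(1)[OF j] pe g] e(2)[OF i] by simp
        have "\<alpha> (f i \<odot> c i) = smul (f i) (\<alpha> (c i))"
          using rlinear_smult[OF \<alpha>_linear, of "f i" "c i"] cC[OF i] by simp
        then have "loc (e j) (\<alpha> (f i \<odot> c i)) = germ M x (f i) \<otimes>\<^bsub>germ_ring M x\<^esub> loc (e j) (\<alpha> (c i))"
          using loc_smul[OF e(1)[OF j] \<alpha>_closed[OF cC(1)[OF i]]] e(2)[OF j] by simp
        moreover have "e j = e i \<longleftrightarrow> i = j" using False i j by metis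
        ultimately show ?thesis using 1 by simp
      qed
      let ?J = "{..<k} - {j}"
      have cl: "f i \<odot> c i \<in> carrier C" if "i < k" for i using cC[OF that] by simp
      have clJ: "(\<lambda>i. f i \<odot> c i) \<in> ?J \<rightarrow> carrier C" using cl by auto
      have r: "loc (e j) (\<alpha> (finsum C (\<lambda>i. f i \<odot> c i) ?J)) = germ0 M (\<pi> (e j))"
        by (rule loc_finsum_zero[OF e(1)[OF j]]) (use cl locs e(2)[OF j] in auto)
      have "insert j ?J = {..<k}" using j by auto
      then have "finsum C (\<lambda>i. f i \<odot> c i) {..<k} = f j \<odot> c j \<oplus> finsum C (\<lambda>i. f i \<odot> c i) ?J"
        using finsum_insert[of ?J j "\<lambda>i. f i \<odot> c i"] clJ cl[OF j] by simp
      then have "\<alpha> \<zero> = sec_add E (\<alpha> (f j \<odot> c j)) (\<alpha> (finsum C (\<lambda>i. f i \<odot> c i) ?J))"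
        using rlinear_add[OF \<alpha>_linear cl[OF j] finsum_closed[OF clJ]] z by simp
      moreover have "\<alpha> \<zero> = (\<lambda>e. germ0 E e)"
        using rlinear_zero[OF abelian_group_axioms Sec_abelian_group \<alpha>_linear] by simp
      ultimately have z': "sec_add E (\<alpha> (f j \<odot> c j)) (\<alpha> (finsum C (\<lambda>i. f i \<odot> c i) ?J)) = (\<lambda>e. germ0 E e)"
        by (rule trans[OF sym])
      have "germ0 M x = loc (e j) (sec_add E (\<alpha> (f j \<odot> c j)) (\<alpha> (finsum C (\<lambda>i. f i \<odot> c i) ?J)))"
        unfolding z' by (simp add: loc_zero[OF e(1)[OF j]] e(2)[OF j])
      also have "\<dots> = germ M x (f j)"
        using loc_add[OF e(1)[OF j] \<alpha>_closed[OF cl[OF j]] \<alpha>_closed[OF finsum_closed[OF clJ]]] r locs[OF j] e(2)[OF j] by simp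
      finally show ?thesis ..
    qed
    then show ?thesis by blast
  qed
qed

section \<open>The isomorphism onto the spectral sheaf\<close>

definition emb :: "'e => 'm \<times> 'c set" where "emb e = (\<pi> e, cls M C (\<pi> e) (w e))"

lemma emb_SS: "e \<in> TE ==> emb e \<in> SS"
  using WG_stalk_grouplike[OF proj_in w(1) w(3)] proj_in by (simp add: emb_def spectral_space_def)

lemma emb_inj: "inj_on emb TE"
proof (rule inj_onI)
  fix e e' assume e: "e \<in> TE" "e' \<in> TE" "emb e = emb e'"
  have a: "\<pi> e = \<pi> e' \<and> cls M C (\<pi> e) (w e) = cls M C (\<pi> e') (w e')"
    using e(3) unfolding emb_def prod.inject .
  have p1: "\<pi> e' = \<pi> e" using a by simp
  have p: "\<pi> e' = \<pi> e" "cls M C (\<pi> e) (w e) = cls M C (\<pi> e) (w e')"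
    using conjunct2[OF a] p1 unfolding p1 by simp_all
  then have "geq (\<pi> e) (w e') (w e)"
    using cls_eq_iff[OF proj_in[OF e(1)] w(4)[OF e(2)] w(4)[OF e(1)]] by simp
  then show "e = e'" using w_inj[OF e(1,2) p(1)] by simp
qed

lemma emb_surj: "emb ` TE = SS"
proof
  show "emb ` TE \<subseteq> SS" using emb_SS by blast
  show "SS \<subseteq> emb ` TE"
  proof
    fix p assume p: "p \<in> SS"
    then obtain c W where c: "nd c W" "p \<in> ss c W" by (rule SS_cases)
    have x: "fst p \<in> TM" by (rule fst_TM[OF p])
    have m: "fst p \<in> W" "snd p = cls M C (fst p) c" using c(2) by (simp_all add: mem_ss)
    obtain e where e: "e \<in> TE" "\<pi> e = fst p" "geq (fst p) c (w e)"
      by (rule w_cover[OF ndD(1)[OF c(1)] ndD(6)[OF c(1) m(1)] x])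
    have "cls M C (fst p) c = cls M C (fst p) (w e)"
      by (rule iffD2[OF cls_eq_iff[OF x ndD(4)[OF c(1)] w(4)[OF e(1)]] e(3)])
    then have "p = emb e" using m(2) e(2) by (simp add: emb_def prod_eq_iff)
    then show "p \<in> emb ` TE" using e(1) by blast
  qed
qed

text \<open>For \<open>e\<close> near \<open>e0\<close> the sections attached to \<open>e\<close>
  and to \<open>e0\<close> have the same coordinates over \<open>\<pi> e\<close>, so
  \<open>w e0\<close> may replace \<open>w e\<close>. Hence the image of \<open>N\<close> is a basic
  open set, the one belonging to \<open>w e0\<close>.\<close>

lemma emb_local:
  assumes e0: "e0 \<in> TE"
  obtains N where "openin (mtop E) N" "e0 \<in> N" "el N" "openin (mtop SP) (emb ` N)" "inj_on fst (emb ` N)"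
proof -
  let ?Y = "{y \<in> TM. germ M y (bmp e0 :: 'm => 'f) = germ1 M y}"
  let ?N = "el_of e0 \<inter> {e \<in> TE. \<pi> e \<in> ?Y}"
  have oP: "openin (mtop E) {e \<in> TE. \<pi> e \<in> ?Y}" by (rule proj_preimage_open[OF openin_germ_eq])
  have elN: "el ?N" by (rule el_Int[OF el_of_el(1)[OF e0] oP])
  have e0N: "e0 \<in> ?N" using el_of_el(2)[OF e0] proj_in[OF e0] e0 by (simp add: bmp(2)[OF e0])
  have near: "emb e = (\<pi> e, cls M C (\<pi> e) (w e0))" if e: "e \<in> ?N" for e
  proof -
    have e': "e \<in> TE" "e \<in> el_of e0" "germ M (\<pi> e) (bmp e0 :: 'm => 'f) = germ1 M (\<pi> e)" using e by simp_all
    have x: "\<pi> e \<in> TM" by (rule proj_in[OF e'(1)])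
    have "S.geq (\<pi> e) (usec e) (usec e0)"
    proof (rule loc_determines[OF x usec_section[OF e'(1)] usec_section[OF e0]])
      fix d assume d: "d \<in> TE" "\<pi> d = \<pi> e"
      show "loc d (usec e :: 'e => ('e => 'f) set) = loc d (usec e0)"
        unfolding loc_usec_near[OF e0 e'(2,3) d] by (rule loc_usec[OF e'(1) e'(1) e'(1) d])
    qed
    then have "geq (\<pi> e) (w e) (w e0)" unfolding w_def by (rule \<beta>_geq[OF _ usec_section[OF e'(1)] usec_section[OF e0]])
    then show ?thesis using cls_eq_iff[OF x w(4)[OF e'(1)] w(4)[OF e0]] by (simp add: emb_def)
  qed
  have n: "nd (w e0) (\<pi> ` ?N)"
    unfolding nd_def
  proof (intro conjI w(1)[OF e0] el_image_open[OF elN])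
    show "normalized_on M C (w e0) (\<pi> ` ?N)" by (auto simp: normalized_on_def normalized_at_def w(2)[OF e0])
  qed
  have "emb ` ?N = ss (w e0) (\<pi> ` ?N)"
    unfolding spectral_set_def image_image by (rule image_cong[OF refl near])
  then have "openin (mtop SP) (emb ` ?N)" "inj_on fst (emb ` ?N)" using ss_open[OF n] ss_inj by simp_all
  then show ?thesis by (rule that[OF el_open[OF elN] e0N elN])
qed

text \<open>A bijection over \<open>M\<close> is smooth in both directions by
  \<open>sheaf_map_smooth\<close>: the sets from \<open>emb_local\<close> serve for
  \<open>emb\<close>, and their images serve for the inverse.\<close>

lemma sheaf_iso: "sheaf_isomorphic E \<pi> SP fst"
proof -
  let ?h = "inv_into TE emb"
  have he: "?h (emb e) = e" if "e \<in> TE" for e by (rule inv_into_f_f[OF emb_inj that])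
  have eh: "emb (?h p) = p" "?h p \<in> TE" if "p \<in> SS" for p
    using that emb_surj f_inv_into_f[of p emb TE] inv_into_into[of p emb TE] by simp_all
  have \<pi>h: "\<pi> (?h p) = fst p" if "p \<in> SS" for p
    using arg_cong[OF eh(1)[OF that], of fst] by (simp add: emb_def)
  have g: "smooth_map_on E TE SP emb"
  proof (rule sheaf_map_smooth[OF sheaf SP_sheaf])
    fix e assume e: "e \<in> TE"
    show "emb e \<in> topspace (mtop SP) \<and> fst (emb e) = \<pi> e" using emb_SS[OF e] by (simp add: emb_def)
    obtain N where "openin (mtop E) N" "e \<in> N" "el N" "openin (mtop SP) (emb ` N)" "inj_on fst (emb ` N)"
      by (rule emb_local[OF e])
    then show "\<exists>N. openin (mtop E) N \<and> e \<in> N \<and> openin (mtop SP) (emb ` N) \<and> inj_on fst (emb ` N)"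
      by (intro exI conjI)
  qed
  have h: "smooth_map_on SP (topspace (mtop SP)) E ?h"
  proof (rule sheaf_map_smooth[OF SP_sheaf sheaf])
    fix p assume "p \<in> topspace (mtop SP)"
    then have p: "p \<in> SS" by simp
    show "?h p \<in> TE \<and> \<pi> (?h p) = fst p" using eh(2)[OF p] \<pi>h[OF p] by simp
    obtain N where N: "openin (mtop E) N" "?h p \<in> N" "el N" "openin (mtop SP) (emb ` N)" "inj_on fst (emb ` N)"
      by (rule emb_local[OF eh(2)[OF p]])
    have "?h ` emb ` N = (\<lambda>e. e) ` N"
      unfolding image_image by (rule image_cong[OF refl he]) (use openin_subset[OF N(1)] in blast)
    then have hN: "?h ` emb ` N = N" by simp
    have "p \<in> emb ` N" using N(2) eh(1)[OF p] by (rule image_eqI[OF sym, rotated])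
    then show "\<exists>P. openin (mtop SP) P \<and> p \<in> P \<and> openin (mtop E) (?h ` P) \<and> inj_on \<pi> (?h ` P)"
      using N(1,4) el_inj[OF N(3)] hN by (intro exI[of _ "emb ` N"]) simp
  qed
  show ?thesis
    unfolding sheaf_isomorphic_def sheaf_morphism_def
    by (rule exI[of _ emb], rule exI[of _ ?h], intro conjI ballI g h) (simp_all add: emb_def[THEN arg_cong[of _ _ fst]] \<pi>h he eh)
qed

end

lemma (in coalg) sheaf_coalgebra_normal:
  assumes E: "is_sheaf M E \<pi>" and iso: "coalgebra_isomorphic RM C (sheaf_coalgebra M E \<pi>)"
  shows "normally_generates M C WG" "normally_lin_indep M C WG" "sheaf_isomorphic E \<pi> SP fst"
proof -
  interpret E: sheaf M E \<pi> by unfold_locales (rule E)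
  obtain \<alpha> where a: "coalgebra_iso RM C (sheaf_coalgebra M E \<pi>) \<alpha>"
    using iso unfolding coalgebra_isomorphic_def by (rule exE)
  then obtain \<beta> where h: "coalgebra_hom RM C (sheaf_coalgebra M E \<pi>) \<alpha>"
    "coalgebra_hom RM (sheaf_coalgebra M E \<pi>) C \<beta>"
    "\<forall>c \<in> carrier C. \<beta> (\<alpha> c) = c" "\<forall>s \<in> carrier (sheaf_coalgebra M E \<pi>). \<alpha> (\<beta> s) = s"
    unfolding coalgebra_iso_def by (elim conjE exE)
  interpret P: presented M E \<pi> C \<alpha> \<beta>
    by unfold_locales (use h in \<open>simp_all add: E.sheaf_coalgebra_simps\<close>)
  show "normally_generates M C WG" "normally_lin_indep M C WG" "sheaf_isomorphic E \<pi> SP fst"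
    by (rule P.generates, rule P.independent, rule P.sheaf_iso)
qed

text \<open>In \<open>cond_i\<close> the sheaf ranges over the type of points of the spectral sheaf,
  which provides a witness there. The last clause admits sheaves on any type and deduces
  \<open>cond_i\<close> from them, so this choice of type loses nothing.\<close>

theorem theorem2p10:
  fixes M :: "'m manifold"
    and C :: "('m \<Rightarrow> 'f::real_normed_field, 'c) coalgebra"
  assumes "is_manifold M" and "Hausdorff_space (mtop M)"
    and "is_coalgebra (Cc_ring M) C"
  defines "cond_i \<equiv> \<exists>(E :: ('m \<times> 'c set) manifold) \<pi>. is_sheaf M E \<pi> \<and>
             coalgebra_isomorphic (Cc_ring M) C (sheaf_coalgebra M E \<pi>)"
    and "cond_ii \<equiv> coalgebra_iso (Cc_ring M)
             (sheaf_coalgebra M (spectral_sheaf M C) fst) C (Psi M C)"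
    and "cond_iii \<equiv> normally_generates M C (weakly_grouplike (Cc_ring M) C) \<and>
             normally_lin_indep M C (weakly_grouplike (Cc_ring M) C)"
    and "cond_iv \<equiv> \<forall>x \<in> topspace (mtop M).
             freely_generated (germ_ring M x) (stalk_coalgebra M C x) (stalk_grouplike M C x)"
  shows "(cond_i \<longleftrightarrow> cond_ii) \<and> (cond_ii \<longleftrightarrow> cond_iii) \<and> (cond_iii \<longleftrightarrow> cond_iv) \<and>
    (\<forall>(E :: 'e manifold) \<pi>. is_sheaf M E \<pi> \<and>
        coalgebra_isomorphic (Cc_ring M) C (sheaf_coalgebra M E \<pi>) \<longrightarrow>
        cond_i \<and> sheaf_isomorphic E \<pi> (spectral_sheaf M C) fst)"
proof -
  interpret coalg M C
    by unfold_locales (use assms(1-3) in simp_all)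
  have iii_ii: "cond_iii ==> cond_ii"
    unfolding cond_iii_def cond_ii_def by (erule conjE) (rule Psi_iso)
  have ii_i: "cond_ii ==> cond_i"
    unfolding cond_i_def cond_ii_def
    by (rule exI[of _ SP], rule exI[of _ fst]) (intro conjI SP_sheaf coalgebra_iso_sym)
  have i_iii: "cond_i ==> cond_iii"
    unfolding cond_i_def cond_iii_def
  proof (elim exE conjE, rule conjI)
    fix E :: "('m \<times> 'c set) manifold" and \<pi>
    assume E: "is_sheaf M E \<pi>" "coalgebra_isomorphic (Cc_ring M) C (sheaf_coalgebra M E \<pi>)"
    show "normally_generates M C WG" "normally_lin_indep M C WG"
      by (rule sheaf_coalgebra_normal[OF E])+
  qed
  have iii_iv: "cond_iii \<longleftrightarrow> cond_iv"
    unfolding cond_iii_def cond_iv_def by (rule normal_iff_free)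
  have "cond_i \<and> sheaf_isomorphic E \<pi> (spectral_sheaf M C) fst"
    if E: "is_sheaf M E \<pi>" "coalgebra_isomorphic (Cc_ring M) C (sheaf_coalgebra M E \<pi>)"
    for E :: "'e manifold" and \<pi>
  proof
    \<comment> \<open>As \<open>E\<close> may live on another type, it is not itself a witness for
      \<open>cond_i\<close>; the way leads through (iii) and (ii) to the spectral sheaf.\<close>
    have cond_iii unfolding cond_iii_def by (intro conjI sheaf_coalgebra_normal[OF E])
    then show cond_i by (intro ii_i iii_ii)
    show "sheaf_isomorphic E \<pi> (spectral_sheaf M C) fst" by (rule sheaf_coalgebra_normal(3)[OF E])
  qed
  then show ?thesis using iii_ii ii_i i_iii iii_iv by (intro conjI allI impI) (blast | elim conjE, assumption)+
qed

end
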